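(* Let $E$ be a $\bar v$-trimmable graph with distinguished loop $\bar e$ at $\bar v$. Let $E'$ be the subgraph of $E$ obtained by removing the unique outgoing edge (loop) $\bar e$ of $\bar v$, and let $E''$ be the subgraph of $E'$ obtained by removing the vertex $\bar v$ and all edges ending in $\bar v$. Consider the $U(1)$-equivariant *-homomorphisms $\pi_1\colon C^*(E)\to C^*(E'')$, $f\colon C^*(E)\to C^*(E')\otimes C(S^1)$, $\delta\colon C^*(E'')\to C^*(E'')\otimes C(S^1)$ and $\pi_2\otimes\mathrm{id}\colon C^*(E')\otimes C(S^1)\to C^*(E'')\otimes C(S^1)$ defined in the context. Then the square $$C^*(E'')\xleftarrow{\ \pi_1\ }C^*(E)\xrightarrow{\ f\ }C^*(E')\otimes C(S^1),\qquad C^*(E'')\xrightarrow{\ \delta\ }C^*(E'')\otimes C(S^1)\xleftarrow{\ \pi_2\otimes\mathrm{id}\ }C^*(E')\otimes C(S^1)$$ is a pullback diagram of $U(1)$-C*-algebras. That is, $\delta\circ\pi_1=(\pi_2\otimes\mathrm{id})\circ f$, and $x\mapsto(\pi_1(x),f(x))$ is a $U(1)$-equivariant *-isomorphism from $C^*(E)$ onto $\{(a,b)\in C^*(E'')\oplus (C^*(E')\otimes C(S^1)) : \delta(a)=(\pi_2\otimes\mathrm{id})(b)\}$. Here $C^*(E)$ and $C^*(E'')$ carry the gauge action, and the tensor products carry the standard $U(1)$-action on the factor $C(S^1)$.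
   Context: Graph conventions: a directed graph $E$ has vertex set $E_0$, edge set $E_1$, and source and range maps $s,r\colon E_1\to E_0$. A sink is a vertex $v$ with $s^{-1}(v)=\emptyset$. For a finite graph $E$, $C^*(E)$ is the universal C*-algebra generated by mutually orthogonal projections $P_v$ ($v\in E_0$) and partial isometries $S_e$ ($e\in E_1$) subject to $S_e^*S_e=P_{r(e)}$ for all $e\in E_1$, and $\sum_{e:\,s(e)=v}S_eS_e^*=P_v$ for every $v\in E_0$ that is not a sink. The generators of the algebras of different subgraphs are denoted by the same symbols. The gauge action $\alpha$ of $U(1)$ on $C^*(E)$ is $\alpha_\lambda(P_v)=P_v$, $\alpha_\lambda(S_e)=\lambda S_e$. Trimmable graph: let $E$ be a finite graph with a distinguished vertex $\bar v$ emitting a loop $\bar e$. $E$ is $\bar v$-trimmable iff (T1) $s^{-1}(\bar v)=\{\bar e\}$ and $r^{-1}(\bar v)\setminus\{\bar e\}\ne\emptyset$; (T2) for every $v\in s(r^{-1}(\bar v)\setminus\{\bar e\})$ one has $s^{-1}(v)\setminus r^{-1}(\bar v)\neq\emptyset$. Maps: let $u$ be the standard unitary generator of $C(S^1)$, on which $\lambda\in U(1)$ acts by $u\mapsto\lambda u$. - $\pi_1\colon C^*(E)\to C^*(E'')$ and $\pi_2\colon C^*(E')\to C^*(E'')$ are the quotient maps by the closed ideals generated by $P_{\bar v}$: they send $P_{\bar v}$ and all $S_e$ with $r(e)=\bar v$ to $0$, and all other generators to the generators of the same name. - $\delta\colon C^*(E'')\to C^*(E'')\otimes C(S^1)$ is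 the gauge coaction: $\delta(S_e)=S_e\otimes u$, $\delta(P_v)=P_v\otimes 1$. - $f\colon C^*(E)\to C^*(E')\otimes C(S^1)$ is given by $f(P_v)=P_v\otimes1$ for $v\in E_0$, $f(S_{\bar e})=P_{\bar v}\otimes u$, and $f(S_e)=S_e\otimes u$ for $e\in E'_1$. *)

theory Defs
  imports
    "HOL-Analysis.Analysis"
    "HOL-Library.Poly_Mapping"
    "Graph_Theory.Digraph"
begin

section \<open>C*-algebras with explicit carriers\<close>

record 'a cstar_alg =
  elems :: "'a set"
  czero :: 'a
  cadd :: "'a \<Rightarrow> 'a \<Rightarrow> 'a"
  cscale :: "complex \<Rightarrow> 'a \<Rightarrow> 'a"
  cmult :: "'a \<Rightarrow> 'a \<Rightarrow> 'a"
  cstar :: "'a \<Rightarrow> 'a"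
  cnorm :: "'a \<Rightarrow> real"

definition cdist :: "('a, 'm) cstar_alg_scheme \<Rightarrow> 'a \<Rightarrow> 'a \<Rightarrow> real" where
  "cdist A a b = cnorm A (cadd A a (cscale A (- 1) b))"

locale cstar_algebra =
  fixes A :: "('a, 'm) cstar_alg_scheme"
  assumes zero_closed: "czero A \<in> elems A"
    and add_closed: "\<lbrakk>a \<in> elems A; b \<in> elems A\<rbrakk> \<Longrightarrow> cadd A a b \<in> elems A"
    and scale_closed: "a \<in> elems A \<Longrightarrow> cscale A c a \<in> elems A"
    and mult_closed: "\<lbrakk>a \<in> elems A; b \<in> elems A\<rbrakk> \<Longrightarrow> cmult A a b \<in> elems A"
    and star_closed: "a \<in> elems A \<Longrightarrow> cstar A a \<in> elems A"
    and add_assoc: "\<lbrakk>a \<in> elems A; b \<in> elems A; d \<in> elems A\<rbrakk>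
      \<Longrightarrow> cadd A (cadd A a b) d = cadd A a (cadd A b d)"
    and add_commute: "\<lbrakk>a \<in> elems A; b \<in> elems A\<rbrakk> \<Longrightarrow> cadd A a b = cadd A b a"
    and add_zero: "a \<in> elems A \<Longrightarrow> cadd A a (czero A) = a"
    and add_minus: "a \<in> elems A \<Longrightarrow> cadd A a (cscale A (- 1) a) = czero A"
    and scale_add_right: "\<lbrakk>a \<in> elems A; b \<in> elems A\<rbrakk>
      \<Longrightarrow> cscale A c (cadd A a b) = cadd A (cscale A c a) (cscale A c b)"
    and scale_add_left: "a \<in> elems A \<Longrightarrow> cscale A (c + k) a = cadd A (cscale A c a) (cscale A k a)"
    and scale_scale: "a \<in> elems A \<Longrightarrow> cscale A c (cscale A k a) = cscale A (c * k) a"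
    and scale_one: "a \<in> elems A \<Longrightarrow> cscale A 1 a = a"
    and mult_assoc: "\<lbrakk>a \<in> elems A; b \<in> elems A; d \<in> elems A\<rbrakk>
      \<Longrightarrow> cmult A (cmult A a b) d = cmult A a (cmult A b d)"
    and mult_add_right: "\<lbrakk>a \<in> elems A; b \<in> elems A; d \<in> elems A\<rbrakk>
      \<Longrightarrow> cmult A a (cadd A b d) = cadd A (cmult A a b) (cmult A a d)"
    and mult_add_left: "\<lbrakk>a \<in> elems A; b \<in> elems A; d \<in> elems A\<rbrakk>
      \<Longrightarrow> cmult A (cadd A a b) d = cadd A (cmult A a d) (cmult A b d)"
    and mult_scale_left: "\<lbrakk>a \<in> elems A; b \<in> elems A\<rbrakk>
      \<Longrightarrow> cmult A (cscale A c a) b = cscale A c (cmult A a b)"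
    and mult_scale_right: "\<lbrakk>a \<in> elems A; b \<in> elems A\<rbrakk>
      \<Longrightarrow> cmult A a (cscale A c b) = cscale A c (cmult A a b)"
    and star_star: "a \<in> elems A \<Longrightarrow> cstar A (cstar A a) = a"
    and star_add: "\<lbrakk>a \<in> elems A; b \<in> elems A\<rbrakk>
      \<Longrightarrow> cstar A (cadd A a b) = cadd A (cstar A a) (cstar A b)"
    and star_scale: "a \<in> elems A \<Longrightarrow> cstar A (cscale A c a) = cscale A (cnj c) (cstar A a)"
    and star_mult: "\<lbrakk>a \<in> elems A; b \<in> elems A\<rbrakk>
      \<Longrightarrow> cstar A (cmult A a b) = cmult A (cstar A b) (cstar A a)"
    and norm_nonneg: "a \<in> elems A \<Longrightarrow> 0 \<le> cnorm A a"
    and norm_eq_zero: "a \<in> elems A \<Longrightarrow> cnorm A a = 0 \<longleftrightarrow> a = czero A"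
    and norm_triangle: "\<lbrakk>a \<in> elems A; b \<in> elems A\<rbrakk>
      \<Longrightarrow> cnorm A (cadd A a b) \<le> cnorm A a + cnorm A b"
    and norm_scale: "a \<in> elems A \<Longrightarrow> cnorm A (cscale A c a) = cmod c * cnorm A a"
    and norm_mult: "\<lbrakk>a \<in> elems A; b \<in> elems A\<rbrakk>
      \<Longrightarrow> cnorm A (cmult A a b) \<le> cnorm A a * cnorm A b"
    and cstar_identity: "a \<in> elems A \<Longrightarrow> cnorm A (cmult A (cstar A a) a) = (cnorm A a)\<^sup>2"
    and complete: "\<lbrakk>\<And>n. X n \<in> elems A;
        \<forall>\<epsilon>>0. \<exists>M. \<forall>m\<ge>M. \<forall>n\<ge>M. cdist A (X m) (X n) < \<epsilon>\<rbrakk>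
      \<Longrightarrow> \<exists>a\<in>elems A. (\<lambda>n. cdist A (X n) a) \<longlonglongrightarrow> 0"

text \<open>Boundedness is not part of the definition: a *-homomorphism of C*-algebras is
  automatically contractive.\<close>

definition star_hom :: "('a, 'm) cstar_alg_scheme \<Rightarrow> ('b, 'n) cstar_alg_scheme \<Rightarrow> ('a \<Rightarrow> 'b) \<Rightarrow> bool"
  where "star_hom A B \<phi> \<longleftrightarrow>
    (\<forall>a\<in>elems A. \<phi> a \<in> elems B) \<and>
    (\<forall>a\<in>elems A. \<forall>b\<in>elems A. \<phi> (cadd A a b) = cadd B (\<phi> a) (\<phi> b)) \<and>
    (\<forall>c. \<forall>a\<in>elems A. \<phi> (cscale A c a) = cscale B c (\<phi> a)) \<and>
    (\<forall>a\<in>elems A. \<forall>b\<in>elems A. \<phi> (cmult A a b) = cmult B (\<phi> a) (\<phi> b)) \<and>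
    (\<forall>a\<in>elems A. \<phi> (cstar A a) = cstar B (\<phi> a))"

definition star_iso :: "('a, 'm) cstar_alg_scheme \<Rightarrow> ('b, 'n) cstar_alg_scheme \<Rightarrow> ('a \<Rightarrow> 'b) \<Rightarrow> bool"
  where "star_iso A B \<phi> \<longleftrightarrow> star_hom A B \<phi> \<and> bij_betw \<phi> (elems A) (elems B)"

text \<open>The fibre product of \<open>g : A \<rightarrow> D\<close> and \<open>h : B \<rightarrow> D\<close>, as a subalgebra of the direct sum.\<close>

definition cstar_pullback ::
    "('a, 'm) cstar_alg_scheme \<Rightarrow> ('b, 'n) cstar_alg_scheme \<Rightarrow> ('a \<Rightarrow> 'd) \<Rightarrow> ('b \<Rightarrow> 'd)
      \<Rightarrow> ('a \<times> 'b) cstar_alg" where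
  "cstar_pullback A B g h =
    \<lparr> elems = {(a, b). a \<in> elems A \<and> b \<in> elems B \<and> g a = h b},
      czero = (czero A, czero B),
      cadd = (\<lambda>(a, b) (a', b'). (cadd A a a', cadd B b b')),
      cscale = (\<lambda>c (a, b). (cscale A c a, cscale B c b)),
      cmult = (\<lambda>(a, b) (a', b'). (cmult A a a', cmult B b b')),
      cstar = (\<lambda>(a, b). (cstar A a, cstar B b)),
      cnorm = (\<lambda>(a, b). max (cnorm A a) (cnorm B b)) \<rparr>"


section \<open>\<open>U(1)\<close>-C*-algebras\<close>

abbreviation circle :: "complex set" where
  "circle \<equiv> sphere 0 1"

definition U1_cstar_algebra :: "('a, 'm) cstar_alg_scheme \<Rightarrow> (complex \<Rightarrow> 'a \<Rightarrow> 'a) \<Rightarrow> bool" where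
  "U1_cstar_algebra A \<alpha> \<longleftrightarrow>
    cstar_algebra A \<and>
    (\<forall>\<mu>\<in>circle. star_hom A A (\<alpha> \<mu>)) \<and>
    (\<forall>a\<in>elems A. \<alpha> 1 a = a) \<and>
    (\<forall>\<mu>\<in>circle. \<forall>\<nu>\<in>circle. \<forall>a\<in>elems A. \<alpha> (\<mu> * \<nu>) a = \<alpha> \<mu> (\<alpha> \<nu> a)) \<and>
    (\<forall>a\<in>elems A. \<forall>\<mu>\<in>circle. ((\<lambda>\<nu>. cdist A (\<alpha> \<nu> a) (\<alpha> \<mu> a)) \<longlongrightarrow> 0) (at \<mu> within circle))"

definition U1_equivariant ::
    "('a, 'm) cstar_alg_scheme \<Rightarrow> (complex \<Rightarrow> 'a \<Rightarrow> 'a) \<Rightarrow> (complex \<Rightarrow> 'b \<Rightarrow> 'b) \<Rightarrow> ('a \<Rightarrow> 'b) \<Rightarrow> bool"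
  where "U1_equivariant A \<alpha> \<beta> \<phi> \<longleftrightarrow> (\<forall>\<mu>\<in>circle. \<forall>a\<in>elems A. \<phi> (\<alpha> \<mu> a) = \<beta> \<mu> (\<phi> a))"

definition diag_action ::
    "(complex \<Rightarrow> 'a \<Rightarrow> 'a) \<Rightarrow> (complex \<Rightarrow> 'b \<Rightarrow> 'b) \<Rightarrow> complex \<Rightarrow> 'a \<times> 'b \<Rightarrow> 'a \<times> 'b" where
  "diag_action \<alpha> \<beta> \<mu> = (\<lambda>(a, b). (\<alpha> \<mu> a, \<beta> \<mu> b))"


section \<open>Tensor products with \<open>C(S\<^sup>1)\<close>\<close>

text \<open>
  The algebraic tensor product of \<open>A\<close> and \<open>C(S\<^sup>1)\<close> is identified with the span of the functions
  \<open>a \<otimes> g = (z \<mapsto> g(z) a)\<close> from \<open>S\<^sup>1\<close> to \<open>A\<close>. Letting \<open>C(S\<^sup>1)\<close> act on \<open>\<ell>\<^sup>2(S\<^sup>1)\<close> by multiplication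
  operators, its spatial C*-norm is the supremum norm; as \<open>C(S\<^sup>1)\<close> is commutative, hence nuclear,
  this is the only C*-norm. The C*-tensor product is the closure of that span.
  All functions are extensional, i.e. undefined off the circle.
\<close>

definition elem_tensor :: "('a, 'm) cstar_alg_scheme \<Rightarrow> 'a \<Rightarrow> (complex \<Rightarrow> complex) \<Rightarrow> complex \<Rightarrow> 'a" where
  "elem_tensor A a g = (\<lambda>z\<in>circle. cscale A (g z) a)"

inductive_set alg_tensor_C :: "('a, 'm) cstar_alg_scheme \<Rightarrow> (complex \<Rightarrow> 'a) set"
  for A :: "('a, 'm) cstar_alg_scheme" where
  zero: "(\<lambda>z\<in>circle. czero A) \<in> alg_tensor_C A"
| add: "\<lbrakk>F \<in> alg_tensor_C A; a \<in> elems A; continuous_on circle g\<rbrakk>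
    \<Longrightarrow> (\<lambda>z\<in>circle. cadd A (F z) (elem_tensor A a g z)) \<in> alg_tensor_C A"

definition tensor_C :: "('a, 'm) cstar_alg_scheme \<Rightarrow> (complex \<Rightarrow> 'a) cstar_alg" where
  "tensor_C A =
    \<lparr> elems = {F \<in> circle \<rightarrow>\<^sub>E elems A.
        \<forall>\<epsilon>>0. \<exists>G\<in>alg_tensor_C A. \<forall>z\<in>circle. cdist A (F z) (G z) < \<epsilon>},
      czero = (\<lambda>z\<in>circle. czero A),
      cadd = (\<lambda>F G. \<lambda>z\<in>circle. cadd A (F z) (G z)),
      cscale = (\<lambda>c F. \<lambda>z\<in>circle. cscale A c (F z)),
      cmult = (\<lambda>F G. \<lambda>z\<in>circle. cmult A (F z) (G z)),
      cstar = (\<lambda>F. \<lambda>z\<in>circle. cstar A (F z)),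
      cnorm = (\<lambda>F. SUP z\<in>circle. cnorm A (F z)) \<rparr>"

text \<open>\<open>\<phi> \<otimes> id\<close>, which maps \<open>a \<otimes> g\<close> to \<open>\<phi>(a) \<otimes> g\<close>.\<close>

definition map_tensor_C :: "('a \<Rightarrow> 'b) \<Rightarrow> (complex \<Rightarrow> 'a) \<Rightarrow> (complex \<Rightarrow> 'b)" where
  "map_tensor_C \<phi> F = (\<lambda>z\<in>circle. \<phi> (F z))"

text \<open>The action on the factor \<open>C(S\<^sup>1)\<close>: it maps \<open>a \<otimes> g\<close> to \<open>a \<otimes> g(\<mu> \<cdot>)\<close>, so \<open>a \<otimes> u\<close> to
  \<open>a \<otimes> \<mu>u\<close>, where \<open>u\<close> is the inclusion of the circle into the complex plane.\<close>

definition rotation :: "complex \<Rightarrow> (complex \<Rightarrow> 'a) \<Rightarrow> (complex \<Rightarrow> 'a)" where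
  "rotation \<mu> F = (\<lambda>z\<in>circle. F (\<mu> * z))"


section \<open>Universal C*-algebras\<close>

text \<open>
  Words in the generators and their adjoints; the letter \<open>(g, True)\<close> is the adjoint of \<open>g\<close>.
  Polynomials with these words as monomials form the free unital *-algebra; the library's
  convolution product of finitely supported functions is its multiplication.
\<close>

datatype 'g star_word = Word (letters: "('g \<times> bool) list")

instantiation star_word :: (type) monoid_add
begin

definition zero_star_word :: "'a star_word" where
  "0 = Word []"

definition plus_star_word :: "'a star_word \<Rightarrow> 'a star_word \<Rightarrow> 'a star_word" where
  "v + w = Word (letters v @ letters w)"

instance
  by standard (simp_all add: zero_star_word_def plus_star_word_def)

end

type_synonym 'g star_poly = "'g star_word \<Rightarrow>\<^sub>0 complex"

definition gen :: "'g \<Rightarrow> 'g star_poly" where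
  "gen g = Poly_Mapping.single (Word [(g, False)]) 1"

definition scale_poly :: "complex \<Rightarrow> 'g star_poly \<Rightarrow> 'g star_poly" where
  "scale_poly c x = Poly_Mapping.map ((*) c) x"

definition star_of_word :: "'g star_word \<Rightarrow> 'g star_word" where
  "star_of_word w = Word (rev (map (\<lambda>(g, b). (g, \<not> b)) (letters w)))"

definition star_poly :: "'g star_poly \<Rightarrow> 'g star_poly" where
  "star_poly x = (\<Sum>w\<in>Poly_Mapping.keys x.
     Poly_Mapping.single (star_of_word w) (cnj (Poly_Mapping.lookup x w)))"

text \<open>The free (non-unital) *-algebra on \<open>G\<close>: no constant term, and only letters from \<open>G\<close>.\<close>

definition free_star_alg :: "'g set \<Rightarrow> 'g star_poly set" where
  "free_star_alg G =
    {x. \<forall>w\<in>Poly_Mapping.keys x. w \<noteq> 0 \<and> fst ` set (letters w) \<subseteq> G}"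

definition cstar_seminorm :: "'g set \<Rightarrow> ('g star_poly \<Rightarrow> real) \<Rightarrow> bool" where
  "cstar_seminorm G p \<longleftrightarrow>
    (\<forall>x\<in>free_star_alg G. 0 \<le> p x) \<and>
    (\<forall>x\<in>free_star_alg G. \<forall>y\<in>free_star_alg G. p (x + y) \<le> p x + p y) \<and>
    (\<forall>c. \<forall>x\<in>free_star_alg G. p (scale_poly c x) = cmod c * p x) \<and>
    (\<forall>x\<in>free_star_alg G. \<forall>y\<in>free_star_alg G. p (x * y) \<le> p x * p y) \<and>
    (\<forall>x\<in>free_star_alg G. p (star_poly x * x) = (p x)\<^sup>2)"

text \<open>
  The universal C*-algebra on generators \<open>G\<close> and relations \<open>x = 0\<close>, \<open>x \<in> R\<close>, is the Hausdorff
  completion of the free *-algebra on \<open>G\<close> in the largest C*-seminorm annihilating \<open>R\<close>. The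
  supremum below is meaningful only if it is finite for every \<open>x\<close>; this is so for the relations
  of a graph, since they bound every C*-seminorm by 1 on the generators.
\<close>

definition univ_norm :: "'g set \<Rightarrow> 'g star_poly set \<Rightarrow> 'g star_poly \<Rightarrow> real" where
  "univ_norm G R x = Sup {p x |p. cstar_seminorm G p \<and> (\<forall>r\<in>R. p r = 0)}"

definition cauchy_seqs :: "'g set \<Rightarrow> 'g star_poly set \<Rightarrow> (nat \<Rightarrow> 'g star_poly) set" where
  "cauchy_seqs G R = {X. (\<forall>n. X n \<in> free_star_alg G) \<and>
     (\<forall>\<epsilon>>0. \<exists>M. \<forall>m\<ge>M. \<forall>n\<ge>M. univ_norm G R (X m - X n) < \<epsilon>)}"

definition cauchy_rel ::
    "'g set \<Rightarrow> 'g star_poly set \<Rightarrow> ((nat \<Rightarrow> 'g star_poly) \<times> (nat \<Rightarrow> 'g star_poly)) set" where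
  "cauchy_rel G R = {(X, Y). X \<in> cauchy_seqs G R \<and> Y \<in> cauchy_seqs G R \<and>
     (\<lambda>n. univ_norm G R (X n - Y n)) \<longlonglongrightarrow> 0}"

type_synonym 'g univ_elem = "(nat \<Rightarrow> 'g star_poly) set"

definition univ_class :: "'g set \<Rightarrow> 'g star_poly set \<Rightarrow> (nat \<Rightarrow> 'g star_poly) \<Rightarrow> 'g univ_elem" where
  "univ_class G R X = cauchy_rel G R `` {X}"

definition univ_cstar :: "'g set \<Rightarrow> 'g star_poly set \<Rightarrow> 'g univ_elem cstar_alg" where
  "univ_cstar G R =
    \<lparr> elems = cauchy_seqs G R // cauchy_rel G R,
      czero = univ_class G R (\<lambda>n. 0),
      cadd = (\<lambda>a b. \<Union>X\<in>a. \<Union>Y\<in>b. univ_class G R (\<lambda>n. X n + Y n)),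
      cscale = (\<lambda>c a. \<Union>X\<in>a. univ_class G R (\<lambda>n. scale_poly c (X n))),
      cmult = (\<lambda>a b. \<Union>X\<in>a. \<Union>Y\<in>b. univ_class G R (\<lambda>n. X n * Y n)),
      cstar = (\<lambda>a. \<Union>X\<in>a. univ_class G R (\<lambda>n. star_poly (X n))),
      cnorm = (\<lambda>a. the_elem ((\<lambda>X. lim (\<lambda>n. univ_norm G R (X n))) ` a)) \<rparr>"

definition univ_gen :: "'g set \<Rightarrow> 'g star_poly set \<Rightarrow> 'g \<Rightarrow> 'g univ_elem" where
  "univ_gen G R g = univ_class G R (\<lambda>n. gen g)"


section \<open>Graph C*-algebras\<close>

text \<open>Sources and ranges of edges are \<^const>\<open>tail\<close> and \<^const>\<open>head\<close>; loops and multiple edges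
  are allowed.\<close>

datatype ('v, 'e) graph_gen = Vx 'v | Ed 'e

definition graph_gens :: "('v, 'e) pre_digraph \<Rightarrow> ('v, 'e) graph_gen set" where
  "graph_gens E = Vx ` verts E \<union> Ed ` arcs E"

definition graph_rels :: "('v, 'e) pre_digraph \<Rightarrow> ('v, 'e) graph_gen star_poly set" where
  "graph_rels E =
     {gen (Vx v) * gen (Vx v) - gen (Vx v) |v. v \<in> verts E} \<union>
     {star_poly (gen (Vx v)) - gen (Vx v) |v. v \<in> verts E} \<union>
     {gen (Vx v) * gen (Vx w) |v w. v \<in> verts E \<and> w \<in> verts E \<and> v \<noteq> w} \<union>
     {gen (Ed e) * star_poly (gen (Ed e)) * gen (Ed e) - gen (Ed e) |e. e \<in> arcs E} \<union>
     {star_poly (gen (Ed e)) * gen (Ed e) - gen (Vx (head E e)) |e. e \<in> arcs E} \<union>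
     {(\<Sum>e\<in>out_arcs E v. gen (Ed e) * star_poly (gen (Ed e))) - gen (Vx v) |v.
        v \<in> verts E \<and> out_arcs E v \<noteq> {}}"

type_synonym ('v, 'e) graph_elem = "('v, 'e) graph_gen univ_elem"

definition graph_cstar :: "('v, 'e) pre_digraph \<Rightarrow> ('v, 'e) graph_elem cstar_alg" where
  "graph_cstar E = univ_cstar (graph_gens E) (graph_rels E)"

definition vproj :: "('v, 'e) pre_digraph \<Rightarrow> 'v \<Rightarrow> ('v, 'e) graph_elem" where
  "vproj E v = univ_gen (graph_gens E) (graph_rels E) (Vx v)"

definition eiso :: "('v, 'e) pre_digraph \<Rightarrow> 'e \<Rightarrow> ('v, 'e) graph_elem" where
  "eiso E e = univ_gen (graph_gens E) (graph_rels E) (Ed e)"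

text \<open>The *-homomorphism \<open>C\<^sup>*(E) \<rightarrow> B\<close> determined by \<open>P\<^sub>v \<mapsto> p v\<close> and \<open>S\<^sub>e \<mapsto> s e\<close>.\<close>

definition graph_hom ::
    "('v, 'e) pre_digraph \<Rightarrow> ('b, 'm) cstar_alg_scheme \<Rightarrow> ('v \<Rightarrow> 'b) \<Rightarrow> ('e \<Rightarrow> 'b)
      \<Rightarrow> ('v, 'e) graph_elem \<Rightarrow> 'b" where
  "graph_hom E B p s = (THE \<phi>. \<phi> \<in> extensional (elems (graph_cstar E)) \<and>
     star_hom (graph_cstar E) B \<phi> \<and>
     (\<forall>v\<in>verts E. \<phi> (vproj E v) = p v) \<and> (\<forall>e\<in>arcs E. \<phi> (eiso E e) = s e))"

definition gauge_action :: "('v, 'e) pre_digraph \<Rightarrow> complex \<Rightarrow> ('v, 'e) graph_elem \<Rightarrow> ('v, 'e) graph_elem" where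
  "gauge_action E \<mu> = graph_hom E (graph_cstar E) (vproj E) (\<lambda>e. cscale (graph_cstar E) \<mu> (eiso E e))"


section \<open>Trimmable graphs and the maps of the square\<close>

definition trimmable :: "('v, 'e) pre_digraph \<Rightarrow> 'v \<Rightarrow> 'e \<Rightarrow> bool" where
  "trimmable E vb eb \<longleftrightarrow>
    fin_digraph E \<and> vb \<in> verts E \<and> eb \<in> arcs E \<and> tail E eb = vb \<and> head E eb = vb \<and>
    out_arcs E vb = {eb} \<and> in_arcs E vb - {eb} \<noteq> {} \<and>
    (\<forall>v \<in> tail E ` (in_arcs E vb - {eb}). out_arcs E v - in_arcs E vb \<noteq> {})"

text \<open>The quotient map from \<open>C\<^sup>*(F)\<close> to \<open>C\<^sup>*(E'')\<close> by the ideal generated by \<open>P\<close> at \<open>vb\<close>, used for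
  \<open>F = E\<close> and \<open>F = E'\<close>.\<close>

definition kill_vertex ::
    "('v, 'e) pre_digraph \<Rightarrow> ('v, 'e) pre_digraph \<Rightarrow> 'v \<Rightarrow> ('v, 'e) graph_elem \<Rightarrow> ('v, 'e) graph_elem"
  where "kill_vertex F E'' vb = graph_hom F (graph_cstar E'')
     (\<lambda>v. if v = vb then czero (graph_cstar E'') else vproj E'' v)
     (\<lambda>e. if head F e = vb then czero (graph_cstar E'') else eiso E'' e)"

definition gauge_coaction ::
    "('v, 'e) pre_digraph \<Rightarrow> ('v, 'e) graph_elem \<Rightarrow> complex \<Rightarrow> ('v, 'e) graph_elem" where
  "gauge_coaction E = graph_hom E (tensor_C (graph_cstar E))
     (\<lambda>v. elem_tensor (graph_cstar E) (vproj E v) (\<lambda>z. 1))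
     (\<lambda>e. elem_tensor (graph_cstar E) (eiso E e) (\<lambda>z. z))"

definition trim_map ::
    "('v, 'e) pre_digraph \<Rightarrow> ('v, 'e) pre_digraph \<Rightarrow> 'v \<Rightarrow> 'e
      \<Rightarrow> ('v, 'e) graph_elem \<Rightarrow> complex \<Rightarrow> ('v, 'e) graph_elem" where
  "trim_map E E' vb eb = graph_hom E (tensor_C (graph_cstar E'))
     (\<lambda>v. elem_tensor (graph_cstar E') (vproj E' v) (\<lambda>z. 1))
     (\<lambda>e. if e = eb then elem_tensor (graph_cstar E') (vproj E' vb) (\<lambda>z. z)
          else elem_tensor (graph_cstar E') (eiso E' e) (\<lambda>z. z))"

end

theory Submission
  imports Defs
begin

text \<open>All three graph algebras are completions of free *-algebras under universal C*-seminorms, so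
  everything can be decided on *-polynomials \<open>x\<close>. Write \<open>P\<close> for the projection at \<open>vb\<close>, \<open>U\<close> for
  \<open>S\<^bsub>eb\<^esub>\<close>, and \<open>\<rho> x = sup\<^sub>z \<parallel>f\<^sub>z x\<parallel>\<close> for the norm of \<open>f x\<close>. The sums \<open>p\<^sub>n = \<Sum> S\<^sub>\<mu> S\<^sub>\<mu>\<^sup>*\<close> over the paths
  \<open>\<mu>\<close> of length at most \<open>n\<close> that first reach \<open>vb\<close> at their end are an approximate unit of the ideal
  \<open>I\<close> of \<open>P\<close>, and \<open>C\<^sup>*(E)/I = C\<^sup>*(E'')\<close> because condition (T2) keeps the Cuntz-Krieger relations
  intact.

  Injectivity of \<open>f\<close>: the corner \<open>P C\<^sup>*(E) P\<close> consists of Laurent polynomials in \<open>U\<close>, on which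
  \<open>\<parallel>x\<parallel> \<le> \<rho> x\<close> up to a factor polynomial in the degree. Since \<open>\<parallel>x\<parallel>\<close> is determined by the growth of
  \<open>\<parallel>(x\<^sup>* x)\<^sup>n\<parallel>\<close>, the factor can be dropped, and the matrix units carry the estimate from the corner to
  \<open>I\<close>. Modulo \<open>I\<close> the norm is that of \<open>C\<^sup>*(E'')\<close>, which \<open>\<rho>\<close> dominates; together \<open>\<parallel>x\<parallel> \<le> 2 \<rho> x\<close>, and
  by the growth argument \<open>\<parallel>x\<parallel> \<le> \<rho> x\<close>.

  Surjectivity onto the pullback: the range of \<open>f\<close> contains the ideal of \<open>P \<otimes> 1\<close> in
  \<open>C\<^sup>*(E') \<otimes> C(S\<^sup>1)\<close>, since \<open>f U = P \<otimes> u\<close> and \<open>S\<^sub>e \<otimes> u\<^sup>k\<close> for \<open>e\<close> ending at \<open>vb\<close> is \<open>f (S\<^sub>e U\<^sup>k\<^sup>-\<^sup>1)\<close>. If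
  \<open>(a, b)\<close> lies in the pullback and \<open>x\<close> lifts \<open>a\<close>, then \<open>b - f x\<close> vanishes in \<open>C\<^sup>*(E'') \<otimes> C(S\<^sup>1)\<close>, so
  it lies in that ideal.\<close>

section \<open>The free *-algebra\<close>

text \<open>A C*-seminorm is given only on polynomials without constant term, where
  \<open>1 - q\<close> does not exist. Each one is therefore extended to all polynomials, and an
  identity modulo null elements then takes the place of an equation in a C*-algebra. Positivity,
  spectra and functional calculus do not appear; the C*-identity does their work. Growth of powers
  replaces uniqueness of the C*-norm, extreme points of a corner replace the fact that positive
  elements with sum zero vanish, and a fixed-point iteration replaces the square root behind
  contractivity of *-homomorphisms. The extreme point argument matters because the relations say
  only that the range projections of the edges leaving a vertex add up to its projection; their
  orthogonality and \<open>P_v S_e = S_e\<close> have to be derived. A homomorphism into an algebra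
  tensored with C(S^1) is handled as a family of substitutions, one for each z on the circle.
  Injectivity is then a supremum over z; surjectivity needs one index of the approximate unit that
  serves all z, which compactness of the circle provides.\<close>

definition cst :: "complex \<Rightarrow> 'g star_poly" where
  "cst c = Poly_Mapping.single 0 c"

definition letter :: "'g \<times> bool \<Rightarrow> 'g star_poly" where
  "letter l = Poly_Mapping.single (Word [l]) 1"

lemma scale_poly_cst: "scale_poly c x = cst c * x"
  by (simp add: scale_poly_def cst_def mult_map_scale_conv_mult)

lemma cst_0 [simp]: "cst 0 = 0" and cst_1 [simp]: "cst 1 = 1"
  by (simp_all add: cst_def)

lemma cst_add: "cst (a + b) = cst a + cst b"
  and cst_diff: "cst (a - b) = cst a - cst b"
  and cst_minus: "cst (- a) = - cst a"
  and cst_mult: "cst (a * b) = cst a * cst b"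
  by (simp_all add: cst_def single_add single_diff single_uminus mult_single)

lemma single_split: "Poly_Mapping.single w c = cst c * Poly_Mapping.single w 1"
  by (simp add: cst_def mult_single)

lemma poly_sum_single:
  "x = (\<Sum>w\<in>Poly_Mapping.keys x. Poly_Mapping.single w (Poly_Mapping.lookup x w))"
proof (rule poly_mapping_eqI)
  fix k
  have "Poly_Mapping.lookup (\<Sum>w\<in>Poly_Mapping.keys x. Poly_Mapping.single w (Poly_Mapping.lookup x w)) k
      = (\<Sum>w\<in>Poly_Mapping.keys x. if w = k then Poly_Mapping.lookup x k else 0)"
    unfolding lookup_sum by (intro sum.cong) (auto simp: lookup_single when_def)
  also have "\<dots> = Poly_Mapping.lookup x k"
    by (simp add: sum.delta in_keys_iff)
  finally show "Poly_Mapping.lookup x k = Poly_Mapping.lookup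
      (\<Sum>w\<in>Poly_Mapping.keys x. Poly_Mapping.single w (Poly_Mapping.lookup x w)) k" ..
qed

lemma Word_Cons: "Poly_Mapping.single (Word (l # ls)) 1 = letter l * Poly_Mapping.single (Word ls) (1::complex)"
  by (simp add: letter_def mult_single plus_star_word_def)

lemma single_Nil [simp]: "Poly_Mapping.single (Word []) (1::complex) = 1"
  by (metis single_one zero_star_word_def)

lemma star_poly_induct [case_names zero single add]:
  assumes "P 0" "\<And>w c. P (Poly_Mapping.single w c)" "\<And>x y. P x \<Longrightarrow> P y \<Longrightarrow> P (x + y)"
  shows "P (x :: 'g star_poly)"
proof -
  have "P (\<Sum>w\<in>A. Poly_Mapping.single w (Poly_Mapping.lookup x w))" if "finite A" for A
    using that by induction (auto intro: assms)
  from this[OF finite_keys] show ?thesis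
    using poly_sum_single[of x] by metis
qed

lemma cst_comm: "x * cst c = cst c * (x :: 'g star_poly)"
  by (induction x rule: star_poly_induct) (simp_all add: algebra_simps cst_def mult_single)

lemma cst_left_comm: "x * (cst c * y) = cst c * (x * (y :: 'g star_poly))"
  by (metis cst_comm mult.assoc)

text \<open>Cancellation can make the support of \<open>x + y\<close> smaller than the union of the
  supports. As the summand vanishes at coefficient 0, all sums may be taken over that union; this is
  how \<open>star_poly\<close> and \<open>subst\<close> are seen to be additive.\<close>

lemma linear_extension_add:
  fixes f :: "'g star_word \<Rightarrow> complex \<Rightarrow> 'b::comm_monoid_add"
  assumes "\<And>w. f w 0 = 0" "\<And>w a b. f w (a + b) = f w a + f w b"
  shows "(\<Sum>w\<in>Poly_Mapping.keys (x + y). f w (Poly_Mapping.lookup (x + y) w)) =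
    (\<Sum>w\<in>Poly_Mapping.keys x. f w (Poly_Mapping.lookup x w)) +
    (\<Sum>w\<in>Poly_Mapping.keys y. f w (Poly_Mapping.lookup y w))"
  by (rule setsum_keys_plus_distrib) (use assms in auto)

lemma star_poly_single: "star_poly (Poly_Mapping.single w c) = Poly_Mapping.single (star_of_word w) (cnj c)"
  by (cases "c = 0") (simp_all add: star_poly_def)

lemma star_poly_0 [simp]: "star_poly 0 = 0"
  by (simp add: star_poly_def)

lemma star_poly_add: "star_poly (x + y) = star_poly x + star_poly y"
  unfolding star_poly_def by (rule linear_extension_add) (auto simp: single_add)

lemma star_poly_cst [simp]: "star_poly (cst c) = cst (cnj c)"
  by (simp add: cst_def star_poly_single star_of_word_def zero_star_word_def)

lemma star_poly_1 [simp]: "star_poly 1 = 1"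
  using star_poly_cst[of 1] by (simp del: star_poly_cst)

lemma star_of_word_plus: "star_of_word (v + w) = star_of_word w + star_of_word v"
  by (simp add: star_of_word_def plus_star_word_def)

lemma star_of_word_idem [simp]: "star_of_word (star_of_word w) = w"
proof -
  have "map ((\<lambda>(g, b). (g, \<not> b)) \<circ> (\<lambda>(g, b). (g, \<not> b))) l = l" for l :: "('g \<times> bool) list"
    by (induction l) auto
  then show ?thesis by (cases w) (simp add: star_of_word_def rev_map)
qed

lemma star_poly_cst_mult: "star_poly (cst c * x) = cst (cnj c) * star_poly x"
  by (induction x rule: star_poly_induct)
    (simp_all add: star_poly_add algebra_simps cst_def mult_single star_poly_single)

lemma star_poly_minus: "star_poly (- x) = - star_poly x"
  using star_poly_cst_mult[of "- 1" x] by (simp add: cst_minus)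

lemma star_poly_diff: "star_poly (x - y) = star_poly x - star_poly y"
  using star_poly_add[of x "- y"] by (simp add: star_poly_minus)

lemma star_poly_sum: "star_poly (sum f A) = (\<Sum>a\<in>A. star_poly (f a))"
  by (induction A rule: infinite_finite_induct) (simp_all add: star_poly_add)

lemma star_poly_mult: "star_poly (x * y) = star_poly y * star_poly x"
proof (induction x rule: star_poly_induct)
  case (single v c)
  show ?case
    by (induction y rule: star_poly_induct)
      (simp_all add: algebra_simps star_poly_add mult_single star_poly_single star_of_word_plus)
qed (simp_all add: algebra_simps star_poly_add)

lemma star_poly_star_poly [simp]: "star_poly (star_poly x) = x"
  by (induction x rule: star_poly_induct) (simp_all add: star_poly_add star_poly_single)

lemma letter_eq: "letter (g, b) = (if b then star_poly (gen g) else gen g)"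
  by (simp add: letter_def gen_def star_poly_single star_of_word_def)

text \<open>Peels one letter off the left of each word. It serves properties whose behaviour is
  known only under multiplication by a single letter, where no rule for a product of two arbitrary
  factors is at hand.\<close>

lemma star_poly_word_induct [case_names zero one letter scale add]:
  assumes "P 0" "P 1" "\<And>l x. P x \<Longrightarrow> P (letter l * x)" "\<And>c x. P x \<Longrightarrow> P (cst c * x)"
    and "\<And>x y. P x \<Longrightarrow> P y \<Longrightarrow> P (x + y)"
  shows "P (x :: 'g star_poly)"
proof (induction x rule: star_poly_induct)
  case (single w c)
  have "P (Poly_Mapping.single (Word ls) 1)" for ls
    by (induction ls) (auto simp: Word_Cons assms(2,3))
  then show ?case
    using assms(4) single_split star_word.collapse by metis
qed (use assms in auto)

lemma star_poly_gen_induct [case_names const gen add mult star]: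
  assumes "\<And>c. P (cst c)" "\<And>g. P (gen g)" "\<And>x y. P x \<Longrightarrow> P y \<Longrightarrow> P (x + y)"
    and "\<And>x y. P x \<Longrightarrow> P y \<Longrightarrow> P (x * y)" "\<And>x. P x \<Longrightarrow> P (star_poly x)"
  shows "P (x :: 'g star_poly)"
proof (induction x rule: star_poly_word_induct)
  case (letter l x)
  then show ?case by (cases l) (simp add: letter_eq assms)
qed (use assms(1)[of 0] assms(1)[of 1] assms in auto)

subsection \<open>Substitution homomorphisms\<close>

fun letter_val :: "('g \<Rightarrow> 'h star_poly) \<Rightarrow> 'g \<times> bool \<Rightarrow> 'h star_poly" where
  "letter_val t (g, b) = (if b then star_poly (t g) else t g)"

definition word_val :: "('g \<Rightarrow> 'h star_poly) \<Rightarrow> 'g star_word \<Rightarrow> 'h star_poly" where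
  "word_val t w = prod_list (map (letter_val t) (letters w))"

definition subst :: "('g \<Rightarrow> 'h star_poly) \<Rightarrow> 'g star_poly \<Rightarrow> 'h star_poly" where
  "subst t x = (\<Sum>w\<in>Poly_Mapping.keys x. cst (Poly_Mapping.lookup x w) * word_val t w)"

lemma word_val_plus: "word_val t (v + w) = word_val t v * word_val t w"
  by (simp add: word_val_def plus_star_word_def)

lemma word_val_star: "word_val t (star_of_word w) = star_poly (word_val t w)"
proof -
  have "prod_list (map (letter_val t \<circ> (\<lambda>(g, b). (g, \<not> b))) (rev l)) =
      star_poly (prod_list (map (letter_val t) l))" for l
    by (induction l) (auto simp: star_poly_mult)
  then show ?thesis by (simp add: word_val_def star_of_word_def rev_map)
qed

lemma subst_single: "subst t (Poly_Mapping.single w c) = cst c * word_val t w"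
  by (cases "c = 0") (simp_all add: subst_def)

lemma subst_0 [simp]: "subst t 0 = 0"
  by (simp add: subst_def)

lemma subst_add: "subst t (x + y) = subst t x + subst t y"
  unfolding subst_def by (rule linear_extension_add) (auto simp: cst_add algebra_simps)

lemma subst_cst [simp]: "subst t (cst c) = cst c"
proof -
  have "word_val t 0 = 1"
    unfolding word_val_def zero_star_word_def by simp
  then show ?thesis
    using subst_single[of t 0 c] by (simp add: cst_def)
qed

lemma subst_1 [simp]: "subst t 1 = 1"
  using subst_cst[of t 1] by (simp del: subst_cst)

lemma subst_gen [simp]: "subst t (gen g) = t g"
  by (simp add: gen_def subst_single word_val_def)

lemma subst_mult: "subst t (x * y) = subst t x * subst t y"
proof (induction x rule: star_poly_induct)
  case (single v c)
  show ?case
  proof (induction y rule: star_poly_induct)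
    case (single w d)
    show ?case
      by (simp add: mult_single subst_single word_val_plus cst_mult mult.assoc)
        (simp add: cst_left_comm[of "word_val t v"])
  qed (simp_all add: algebra_simps subst_add)
qed (simp_all add: algebra_simps subst_add)

lemma subst_star: "subst t (star_poly x) = star_poly (subst t x)"
  by (induction x rule: star_poly_induct)
    (simp_all add: subst_add star_poly_add star_poly_single subst_single word_val_star star_poly_cst_mult)

lemma subst_minus: "subst t (- x) = - subst t x"
  using subst_mult[of t "cst (- 1)" x] subst_cst[of t "- 1"]
  by (simp add: cst_minus del: subst_cst)

lemma subst_diff: "subst t (x - y) = subst t x - subst t y"
  using subst_add[of t x "- y"] by (simp add: subst_minus)

lemma subst_sum: "subst t (sum f A) = (\<Sum>a\<in>A. subst t (f a))"
  by (induction A rule: infinite_finite_induct) (simp_all add: subst_add)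

lemma subst_subst: "subst t (subst s x) = subst (\<lambda>g. subst t (s g)) x"
  by (induction x rule: star_poly_gen_induct) (simp_all add: subst_add subst_mult subst_star)

lemmas subst_simps = subst_add subst_mult subst_star subst_minus subst_diff subst_sum
lemmas star_poly_simps = star_poly_add star_poly_mult star_poly_minus star_poly_diff star_poly_sum

subsection \<open>The non-unital free *-algebra on a set of generators\<close>

definition words_over :: "'g set \<Rightarrow> 'g star_word set" where
  "words_over G = {w. fst ` set (letters w) \<subseteq> G}"

text \<open>Constants are allowed here. \<open>cut\<close> takes values in this set, whose elements
  act as left multipliers on \<open>free_star_alg\<close>.\<close>

definition unital_free :: "'g set \<Rightarrow> 'g star_poly set" where
  "unital_free G = {x. Poly_Mapping.keys x \<subseteq> words_over G}"

lemma free_star_alg_eq: "free_star_alg G = {x. Poly_Mapping.keys x \<subseteq> words_over G - {0}}"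
  by (auto simp: free_star_alg_def words_over_def)

lemma free_0 [simp, intro]: "0 \<in> free_star_alg G"
  by (simp add: free_star_alg_def)

lemma free_gen: "g \<in> G \<Longrightarrow> gen g \<in> free_star_alg G"
  by (simp add: free_star_alg_def gen_def zero_star_word_def)

lemma free_add: "x \<in> free_star_alg G \<Longrightarrow> y \<in> free_star_alg G \<Longrightarrow> x + y \<in> free_star_alg G"
  unfolding free_star_alg_eq using keys_add[of x y] by blast

lemma keys_sum_subset: "Poly_Mapping.keys (sum f A) \<subseteq> (\<Union>a\<in>A. Poly_Mapping.keys (f a))"
proof (induction A rule: infinite_finite_induct)
  case (insert a A)
  then show ?case using keys_add[of "f a" "sum f A"] by auto
qed auto

lemma words_over_plus: "v \<in> words_over G \<Longrightarrow> w \<in> words_over G \<Longrightarrow> v + w \<in> words_over G"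
  by (auto simp: words_over_def plus_star_word_def)

lemma word_plus_eq_0: "v + w = (0 :: 'g star_word) \<longleftrightarrow> v = 0 \<and> w = 0"
  by (cases v; cases w) (auto simp: plus_star_word_def zero_star_word_def)

lemma keys_mult_subset:
  "(\<And>v w. v \<in> Poly_Mapping.keys x \<Longrightarrow> w \<in> Poly_Mapping.keys y \<Longrightarrow> v + w \<in> A) \<Longrightarrow>
    Poly_Mapping.keys (x * y) \<subseteq> A"
  using keys_mult[of x y] by auto

lemma unital_free_mult_free:
  assumes "x \<in> unital_free G" "y \<in> free_star_alg G"
  shows "x * y \<in> free_star_alg G"
  using assms unfolding free_star_alg_eq unital_free_def mem_Collect_eq
  by (intro keys_mult_subset) (auto simp: word_plus_eq_0 words_over_plus subset_iff)

lemma free_unital_free: "x \<in> free_star_alg G \<Longrightarrow> x \<in> unital_free G"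
  by (auto simp: free_star_alg_eq unital_free_def)

lemma free_mult: "x \<in> free_star_alg G \<Longrightarrow> y \<in> free_star_alg G \<Longrightarrow> x * y \<in> free_star_alg G"
  by (simp add: unital_free_mult_free free_unital_free)

lemma cst_unital_free [simp]: "cst c \<in> unital_free G"
  by (auto simp: unital_free_def cst_def words_over_def zero_star_word_def split: if_splits)

lemma unital_free_add: "x \<in> unital_free G \<Longrightarrow> y \<in> unital_free G \<Longrightarrow> x + y \<in> unital_free G"
  unfolding unital_free_def using keys_add[of x y] by blast

lemma unital_free_mult: "x \<in> unital_free G \<Longrightarrow> y \<in> unital_free G \<Longrightarrow> x * y \<in> unital_free G"
  unfolding unital_free_def mem_Collect_eq
  by (intro keys_mult_subset) (auto simp: words_over_plus subset_iff)

lemma free_cst_mult: "x \<in> free_star_alg G \<Longrightarrow> cst c * x \<in> free_star_alg G"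
  by (simp add: unital_free_mult_free)

lemma free_minus: "x \<in> free_star_alg G \<Longrightarrow> - x \<in> free_star_alg G"
  using free_cst_mult[of x G "- 1"] by (simp add: cst_minus)

lemma free_diff: "x \<in> free_star_alg G \<Longrightarrow> y \<in> free_star_alg G \<Longrightarrow> x - y \<in> free_star_alg G"
  using free_add[of x G "- y"] by (simp add: free_minus)

lemma free_sum: "(\<And>a. a \<in> A \<Longrightarrow> f a \<in> free_star_alg G) \<Longrightarrow> sum f A \<in> free_star_alg G"
  by (induction A rule: infinite_finite_induct) (auto simp: free_add)

lemma keys_star_poly:
  assumes "\<And>w. w \<in> Poly_Mapping.keys x \<Longrightarrow> star_of_word w \<in> A"
  shows "Poly_Mapping.keys (star_poly x) \<subseteq> A"
  unfolding star_poly_def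
  by (rule subset_trans[OF keys_sum_subset]) (use assms in \<open>auto split: if_splits\<close>)

lemma words_over_star: "w \<in> words_over G \<Longrightarrow> star_of_word w \<in> words_over G"
  by (force simp: words_over_def star_of_word_def)

lemma free_star:
  assumes "x \<in> free_star_alg G"
  shows "star_poly x \<in> free_star_alg G"
proof -
  have "star_of_word w \<in> words_over G - {0}" if "w \<in> Poly_Mapping.keys x" for w
    using that assms words_over_star[of w G]
    by (cases w) (auto simp: free_star_alg_eq star_of_word_def zero_star_word_def)
  then show ?thesis
    unfolding free_star_alg_eq mem_Collect_eq by (rule keys_star_poly)
qed

lemma unital_free_star: "x \<in> unital_free G \<Longrightarrow> star_poly x \<in> unital_free G"
  unfolding unital_free_def mem_Collect_eq
  by (intro keys_star_poly) (auto simp: words_over_star)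

lemmas free_closed = free_gen free_add free_mult free_minus free_diff free_star free_cst_mult

lemma free_mono: "G \<subseteq> H \<Longrightarrow> free_star_alg G \<subseteq> free_star_alg H"
  by (auto simp: free_star_alg_def)

lemma letter_free: "fst l \<in> G \<Longrightarrow> letter l \<in> free_star_alg G"
  by (cases l) (simp add: letter_eq free_closed)

lemma word_free: "w \<in> words_over G - {0} \<Longrightarrow> Poly_Mapping.single w c \<in> free_star_alg G"
  by (auto simp: free_star_alg_eq)

lemma free_induct [consumes 1, case_names zero gen add mult scale star]:
  assumes x: "x \<in> free_star_alg G"
    and zero: "P 0" and gen: "\<And>g. g \<in> G \<Longrightarrow> P (gen g)"
    and add: "\<And>x y. \<lbrakk>x \<in> free_star_alg G; y \<in> free_star_alg G; P x; P y\<rbrakk> \<Longrightarrow> P (x + y)"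
    and mult: "\<And>x y. \<lbrakk>x \<in> free_star_alg G; y \<in> free_star_alg G; P x; P y\<rbrakk> \<Longrightarrow> P (x * y)"
    and scale: "\<And>c x. \<lbrakk>x \<in> free_star_alg G; P x\<rbrakk> \<Longrightarrow> P (cst c * x)"
    and star: "\<And>x. \<lbrakk>x \<in> free_star_alg G; P x\<rbrakk> \<Longrightarrow> P (star_poly x)"
  shows "P x"
proof -
  have lett: "P (letter l)" if "fst l \<in> G" for l
    using that by (cases l) (auto simp: letter_eq gen star free_gen)
  have word: "P (Poly_Mapping.single (Word (l # ls)) 1)"
    if "Word (l # ls) \<in> words_over G" for l ls
    using that
  proof (induction ls arbitrary: l)
    case Nil
    then show ?case using lett[of l] by (simp add: Word_Cons words_over_def)
  next
    case (Cons k ls)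
    have "Word (k # ls) \<in> words_over G" "fst l \<in> G"
      using Cons.prems by (auto simp: words_over_def)
    then show ?case
      unfolding Word_Cons[of l] using Cons.IH lett
      by (intro mult letter_free word_free) (auto simp: zero_star_word_def)
  qed
  have single: "P (Poly_Mapping.single w c)" if w: "w \<in> words_over G - {0}" for w c
  proof -
    obtain l ls where "w = Word (l # ls)"
      using w by (cases w; cases "letters w") (auto simp: zero_star_word_def)
    then show ?thesis
      unfolding single_split[of w c] using w by (auto intro!: scale word word_free)
  qed
  have "P (\<Sum>w\<in>A. Poly_Mapping.single w (Poly_Mapping.lookup x w))"
    if "finite A" "A \<subseteq> words_over G - {0}" for A
    using that
  proof (induction A rule: finite_induct)
    case (insert w A)
    then show ?case
      by (auto intro!: add word_free free_sum single)
  qed (simp add: zero)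
  from this[OF finite_keys, of x] show ?thesis
    using poly_sum_single[of x] x by (metis (no_types, lifting) free_star_alg_eq mem_Collect_eq)
qed

lemma subst_free:
  assumes "x \<in> free_star_alg G" "\<And>g. g \<in> G \<Longrightarrow> t g \<in> free_star_alg H"
  shows "subst t x \<in> free_star_alg H"
  using assms(1)
  by (induction x rule: free_induct) (auto simp: subst_simps free_closed assms(2))

lemma subst_cong_free:
  assumes "x \<in> free_star_alg G" "\<And>g. g \<in> G \<Longrightarrow> t g = s g"
  shows "subst t x = subst s x"
  using assms(1) by (induction x rule: free_induct) (auto simp: subst_simps assms(2))

lemma subst_gen_id [simp]: "subst gen x = x"
  by (induction x rule: star_poly_gen_induct) (simp_all add: subst_simps)

text \<open>A retraction of the polynomials in all letters of the type onto those over
  \<open>G\<close>, deleting every word with a foreign letter. It lets a seminorm known over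
  \<open>G\<close> be read on all polynomials.\<close>

definition cut :: "'g set \<Rightarrow> 'g star_poly \<Rightarrow> 'g star_poly" where
  "cut G = subst (\<lambda>g. if g \<in> G then gen g else 0)"

lemma cut_unital_free: "cut G x \<in> unital_free G"
  unfolding cut_def
  by (induction x rule: star_poly_gen_induct)
    (auto simp: subst_simps free_gen free_unital_free unital_free_add unital_free_mult unital_free_star)

lemma cut_free: "x \<in> free_star_alg G \<Longrightarrow> cut G x = x"
  unfolding cut_def using subst_cong_free[of x G _ gen] by simp

lemma cut_simps [simp]:
  "cut G 0 = 0" "cut G 1 = 1" "cut G (cst c) = cst c" "cut G (x + y) = cut G x + cut G y"
  "cut G (x * y) = cut G x * cut G y" "cut G (star_poly x) = star_poly (cut G x)"
  "cut G (gen g) = (if g \<in> G then gen g else 0)"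
  by (simp_all add: cut_def subst_simps)

section \<open>C*-seminorms on the whole free *-algebra\<close>

text \<open>Defined on every polynomial, constants included, so that membership conditions disappear
  and \<open>1 - q\<close> is available for a projection \<open>q\<close>. The zero seminorm is
  allowed, hence \<open>p 1\<close> is only bounded by 1.\<close>

locale total_seminorm =
  fixes p :: "'g star_poly \<Rightarrow> real"
  assumes nonneg: "0 \<le> p x"
    and triangle: "p (x + y) \<le> p x + p y"
    and scale: "p (cst c * x) = cmod c * p x"
    and mult: "p (x * y) \<le> p x * p y"
    and cstar: "p (star_poly x * x) = (p x)\<^sup>2"
begin

lemma p_0 [simp]: "p 0 = 0"
  using scale[of 0 0] by simp

lemma p_minus [simp]: "p (- x) = p x"
  using scale[of "- 1" x] by (simp add: cst_minus)

lemma triangle_diff: "p (x - y) \<le> p x + p y"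
  using triangle[of x "- y"] by simp

lemma p_diff_comm: "p (x - y) = p (y - x)"
  using p_minus[of "x - y"] by simp

lemma p_sum: "p (sum f A) \<le> (\<Sum>a\<in>A. p (f a))"
proof (induction A rule: infinite_finite_induct)
  case (insert a A)
  then show ?case using triangle[of "f a" "sum f A"] by simp
qed auto

lemma p_mult_le: "p x \<le> a \<Longrightarrow> p y \<le> b \<Longrightarrow> p (x * y) \<le> a * b"
  by (rule order_trans[OF mult]) (meson mult_mono nonneg order_trans)

lemma p_mult_le_1: "p x \<le> 1 \<Longrightarrow> p y \<le> 1 \<Longrightarrow> p (x * y) \<le> 1"
  using p_mult_le[of x 1 y 1] by simp

lemma p_mult_right: "p y \<le> 1 \<Longrightarrow> p (x * y) \<le> p x"
  using p_mult_le[of x "p x" y 1] by simp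

lemma p_mult_left: "p y \<le> 1 \<Longrightarrow> p (y * x) \<le> p x"
  using p_mult_le[of y 1 x "p x"] by simp

lemma p_star [simp]: "p (star_poly x) = p x"
proof -
  have "p x \<le> p (star_poly x)" for x
  proof (cases "p x = 0")
    case False
    have "p x * p x \<le> p (star_poly x) * p x"
      using mult[of "star_poly x" x] cstar[of x] by (simp add: power2_eq_square)
    then show ?thesis using False nonneg[of x] by (simp add: mult_le_cancel_right)
  qed (simp add: nonneg)
  from this[of x] this[of "star_poly x"] show ?thesis by simp
qed

lemma cstar': "p (x * star_poly x) = (p x)\<^sup>2"
  using cstar[of "star_poly x"] by simp

text \<open>Equality in the quotient by the null space of \<open>p\<close>. Computations in the
  C*-algebra become chains of this congruence between polynomials, without passing to the
  completion.\<close>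

definition eqv :: "'g star_poly \<Rightarrow> 'g star_poly \<Rightarrow> bool" (infix \<open>\<simeq>\<close> 50) where
  "x \<simeq> y \<longleftrightarrow> p (x - y) = 0"

lemma eqv_refl [simp, intro]: "x \<simeq> x"
  by (simp add: eqv_def)

lemma eqv_sym: "x \<simeq> y \<Longrightarrow> y \<simeq> x"
  by (simp add: eqv_def p_diff_comm)

lemma eqv_trans [trans]: "x \<simeq> y \<Longrightarrow> y \<simeq> z \<Longrightarrow> x \<simeq> z"
  using triangle[of "x - y" "y - z"] nonneg[of "x - z"] by (simp add: eqv_def)

lemma eqv_0: "x \<simeq> 0 \<longleftrightarrow> p x = 0"
  by (simp add: eqv_def)

lemma eqv_add: "x \<simeq> x' \<Longrightarrow> y \<simeq> y' \<Longrightarrow> x + y \<simeq> x' + y'"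
  using triangle[of "x - x'" "y - y'"] nonneg[of "x + y - (x' + y')"]
  by (simp add: eqv_def algebra_simps)

lemma eqv_minus: "x \<simeq> x' \<Longrightarrow> - x \<simeq> - x'"
  by (metis eqv_def p_minus minus_diff_minus)

lemma eqv_diff: "x \<simeq> x' \<Longrightarrow> y \<simeq> y' \<Longrightarrow> x - y \<simeq> x' - y'"
  using eqv_add[of x x' "- y" "- y'"] eqv_minus[of y y'] by simp

lemma eqv_mult: "x \<simeq> x' \<Longrightarrow> y \<simeq> y' \<Longrightarrow> x * y \<simeq> x' * y'"
proof -
  assume a: "x \<simeq> x'" "y \<simeq> y'"
  have "p ((x - x') * y) = 0" "p (x' * (y - y')) = 0"
    using a mult[of "x - x'" y] nonneg[of "(x - x') * y"]
      mult[of x' "y - y'"] nonneg[of "x' * (y - y')"] by (auto simp: eqv_def)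
  then show ?thesis
    using triangle[of "(x - x') * y" "x' * (y - y')"] nonneg[of "x * y - x' * y'"]
    by (simp add: eqv_def algebra_simps)
qed

lemma eqv_multL: "x \<simeq> x' \<Longrightarrow> x * y \<simeq> x' * y"
  and eqv_multR: "x \<simeq> x' \<Longrightarrow> y * x \<simeq> y * x'"
  by (simp_all add: eqv_mult)

lemma eqv_star: "x \<simeq> y \<Longrightarrow> star_poly x \<simeq> star_poly y"
  by (metis eqv_def p_star star_poly_diff)

lemma eqv_sum: "(\<And>a. a \<in> A \<Longrightarrow> f a \<simeq> g a) \<Longrightarrow> sum f A \<simeq> sum g A"
  by (induction A rule: infinite_finite_induct) (auto intro: eqv_add)

lemma p_cong: "x \<simeq> y \<Longrightarrow> p x = p y"
  using triangle[of "x - y" y] triangle[of "y - x" x] p_diff_comm[of x y] by (simp add: eqv_def)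

lemma eqv_0_mult: "x \<simeq> 0 \<Longrightarrow> x * y \<simeq> 0" "x \<simeq> 0 \<Longrightarrow> y * x \<simeq> 0"
  using eqv_mult[of x 0 y y] eqv_mult[of y y x 0] by auto

section \<open>Projections and the extreme point argument\<close>

definition is_proj :: "'g star_poly \<Rightarrow> bool" where
  "is_proj q \<longleftrightarrow> star_poly q \<simeq> q \<and> q * q \<simeq> q"

lemma projD: "is_proj q \<Longrightarrow> star_poly q \<simeq> q" "is_proj q \<Longrightarrow> q * q \<simeq> q"
  by (simp_all add: is_proj_def)

lemma proj_le_1: "is_proj q \<Longrightarrow> p q \<le> 1"
proof -
  assume q: "is_proj q"
  have "star_poly q * q \<simeq> q"
    using eqv_trans[OF eqv_multL[OF projD(1)[OF q]] projD(2)[OF q]] .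
  then have "(p q)\<^sup>2 = p q" using cstar[of q] p_cong by metis
  then show ?thesis by (auto simp: power2_eq_square)
qed

lemma proj_1 [simp]: "is_proj 1"
  by (simp add: is_proj_def)

lemma p_1: "p 1 \<le> 1"
  by (simp add: proj_le_1)

lemma proj_compl: "is_proj q \<Longrightarrow> is_proj (1 - q)"
proof -
  assume q: "is_proj q"
  have "1 - q - (q - q * q) \<simeq> 1 - q - (q - q)"
    by (intro eqv_diff eqv_refl projD q)
  then show ?thesis
    using q unfolding is_proj_def
    by (auto simp: star_poly_diff algebra_simps intro: eqv_diff)
qed

text \<open>In a C*-algebra the unit \<open>b\<close> of a corner is an extreme point of the unit ball, in the sense
  that \<open>\<parallel>b \<plusminus> h\<parallel> \<le> 1\<close> forces \<open>h = 0\<close>. By the C*-identity such \<open>h\<close> may be replaced by \<open>3h/2\<close>, since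
  \<open>1 + 3h/2\<close> is the convex combination
  \<open>3/8 (1 + h)\<^sup>3 + 3/8 (1 + h)\<^sup>2 (1 - h) + 1/8 (1 + ih)\<^sup>3 + 1/8 (1 - ih)\<^sup>3\<close>.\<close>

definition corner_contr :: "'g star_poly \<Rightarrow> 'g star_poly \<Rightarrow> bool" where
  "corner_contr b x \<longleftrightarrow> p (b * x) \<le> 1 \<and> b * x \<simeq> x * b"

lemma corner_contr_mult:
  assumes b: "is_proj b" and x: "corner_contr b x" and y: "corner_contr b y"
  shows "corner_contr b (x * y)"
proof -
  have xb: "b * x \<simeq> x * b" and yb: "b * y \<simeq> y * b"
    using x y by (auto simp: corner_contr_def)
  have "b * (x * y) \<simeq> (b * b) * (x * y)"
    by (intro eqv_multL eqv_sym[OF projD(2)] b)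
  also have "\<dots> = b * ((b * x) * y)" by (simp add: mult.assoc)
  also have "\<dots> \<simeq> b * ((x * b) * y)" by (intro eqv_multR eqv_multL xb)
  also have "\<dots> = (b * x) * (b * y)" by (simp add: mult.assoc)
  finally have "p (b * (x * y)) = p ((b * x) * (b * y))" by (rule p_cong)
  moreover have "p ((b * x) * (b * y)) \<le> 1"
    using x y p_mult_le_1[of "b * x" "b * y"] by (auto simp: corner_contr_def)
  moreover have "b * (x * y) \<simeq> (x * y) * b"
  proof -
    have "b * (x * y) = (b * x) * y" by (simp add: mult.assoc)
    also have "\<dots> \<simeq> (x * b) * y" by (intro eqv_multL xb)
    also have "\<dots> = x * (b * y)" by (simp add: mult.assoc)
    also have "\<dots> \<simeq> x * (y * b)" by (intro eqv_multR yb)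
    finally show ?thesis by (simp add: mult.assoc)
  qed
  ultimately show ?thesis by (simp add: corner_contr_def)
qed

lemma eqv_cst: "x \<simeq> y \<Longrightarrow> cst c * x \<simeq> cst c * y"
  by (rule eqv_multR)

lemma corner_contr_convex:
  assumes "corner_contr b x" "corner_contr b y" "0 \<le> s" "s \<le> 1"
  shows "corner_contr b (cst (of_real s) * x + cst (of_real (1 - s)) * y)"
proof -
  have "p (b * (cst (of_real s) * x + cst (of_real (1 - s)) * y))
      = p (cst (of_real s) * (b * x) + cst (of_real (1 - s)) * (b * y))"
    by (simp only: distrib_left cst_left_comm[of b])
  also have "\<dots> \<le> s * p (b * x) + (1 - s) * p (b * y)"
    using triangle[of "cst (of_real s) * (b * x)" "cst (of_real (1 - s)) * (b * y)"] assms
    by (simp only: scale norm_of_real)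
  also have "\<dots> \<le> s * 1 + (1 - s) * 1"
    using assms by (intro add_mono mult_left_mono) (auto simp: corner_contr_def)
  finally have 1: "p (b * (cst (of_real s) * x + cst (of_real (1 - s)) * y)) \<le> 1" by simp
  have "b * (cst (of_real s) * x + cst (of_real (1 - s)) * y)
      = cst (of_real s) * (b * x) + cst (of_real (1 - s)) * (b * y)"
    by (simp only: distrib_left cst_left_comm[of b])
  also have "\<dots> \<simeq> cst (of_real s) * (x * b) + cst (of_real (1 - s)) * (y * b)"
    using assms by (intro eqv_add eqv_cst) (auto simp: corner_contr_def)
  finally show ?thesis using 1 by (simp add: corner_contr_def distrib_right mult.assoc)
qed

text \<open>As \<open>h\<close> is self-adjoint, the adjoint of \<open>1 + ih\<close> times
  \<open>1 + ih\<close> is \<open>1 + h * h\<close>, the mean of the squares of \<open>1 + h\<close>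
  and \<open>1 - h\<close>. Both squares are contractive on the corner, and the C*-identity turns
  this into a bound for \<open>1 + ih\<close>.\<close>

lemma corner_contr_i:
  assumes b: "is_proj b" and h: "star_poly h \<simeq> h" "b * h \<simeq> h * b"
    and K: "corner_contr b (1 + h)" "corner_contr b (1 - h)" and c: "c\<^sup>2 = -1"
  shows "corner_contr b (1 + cst c * h)"
proof -
  define v where "v = cst c * h"
  have cn: "cnj c = - c"
  proof -
    have "c = \<i> \<or> c = - \<i>" using c by (metis i_squared power2_eq_square square_eq_iff)
    then show ?thesis by auto
  qed
  have vv: "v * v = - (h * h)"
  proof -
    have "v * v = cst (c * c) * (h * h)"
      by (simp add: v_def cst_mult mult.assoc cst_left_comm[of h])
    then show ?thesis using c by (simp add: power2_eq_square cst_minus)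
  qed
  have vs: "star_poly v \<simeq> - v"
    using eqv_cst[OF h(1), of "- c"] by (simp add: v_def star_poly_cst_mult cn cst_minus)
  have bv: "b * v \<simeq> v * b"
    using eqv_cst[OF h(2), of c] by (simp add: v_def cst_left_comm[of b] mult.assoc)
  have b1: "b * (1 + v) \<simeq> (1 + v) * b"
    using eqv_add[OF eqv_refl[of b] bv] by (simp add: algebra_simps)
  have b2: "(1 - v) * b \<simeq> b * (1 - v)"
    using eqv_diff[OF eqv_refl[of b] eqv_sym[OF bv]] by (simp add: algebra_simps)
  have "star_poly (b * (1 + v)) \<simeq> (1 - v) * b"
    using eqv_mult[OF eqv_add[OF eqv_refl[of 1] vs] projD(1)[OF b]]
    by (simp add: star_poly_simps)
  then have "star_poly (b * (1 + v)) * (b * (1 + v)) \<simeq> ((1 - v) * b) * (b * (1 + v))"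
    by (rule eqv_multL)
  also have "\<dots> = (1 - v) * (b * b) * (1 + v)" by (simp add: mult.assoc)
  also have "\<dots> \<simeq> (1 - v) * b * (1 + v)" by (intro eqv_multL eqv_multR projD b)
  also have "\<dots> \<simeq> b * (1 - v) * (1 + v)" by (intro eqv_multL b2)
  also have "\<dots> = b * (1 + h * h)"
    using vv by (simp add: algebra_simps)
  also have "1 + h * h = cst (of_real (1/2)) * ((1 + h) * (1 + h)) + cst (of_real (1 - 1/2)) * ((1 - h) * (1 - h))"
  proof -
    have "cst (1/2) * ((1 + h) * (1 + h)) + cst (1/2) * ((1 - h) * (1 - h))
        = cst (1/2 + 1/2) * (1 + h * h)"
      by (simp only: cst_add) (simp add: algebra_simps)
    then show ?thesis by simp
  qed
  finally have "(p (b * (1 + v)))\<^sup>2 = p (b * (cst (of_real (1/2)) * ((1 + h) * (1 + h)) +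
      cst (of_real (1 - 1/2)) * ((1 - h) * (1 - h))))"
    using cstar p_cong by metis
  also have "\<dots> \<le> 1"
    using corner_contr_convex[of b "(1 + h) * (1 + h)" "(1 - h) * (1 - h)" "1/2"]
      corner_contr_mult[OF b K(1) K(1)] corner_contr_mult[OF b K(2) K(2)]
    by (simp add: corner_contr_def)
  finally have "p (b * (1 + v)) \<le> 1"
    using power2_le_imp_le[of "p (b * (1 + v))" 1] by simp
  then show ?thesis using b1 by (simp add: corner_contr_def v_def)
qed

lemma corner_contr_step:
  assumes b: "is_proj b" and h: "star_poly h \<simeq> h" "b * h \<simeq> h * b"
    and K: "corner_contr b (1 + h)" "corner_contr b (1 - h)"
  shows "corner_contr b (1 + cst (3/2) * h)"
proof -
  define v where "v = cst \<i> * h"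
  have vv: "v * v = - (h * h)"
  proof -
    have "v * v = cst \<i> * (cst \<i> * (h * h))"
      by (simp add: v_def mult.assoc cst_left_comm[of h])
    also have "\<dots> = cst (\<i> * \<i>) * (h * h)"
      by (simp only: cst_mult mult.assoc)
    finally show ?thesis by (simp add: cst_minus)
  qed
  have K3: "corner_contr b (1 + v)" "corner_contr b (1 - v)"
    using corner_contr_i[OF b h K, of \<i>] corner_contr_i[OF b h K, of "- \<i>"]
    by (simp_all add: v_def cst_minus)
  define A where "A = (1 + h) * ((1 + h) * (1 + h))"
  define B where "B = (1 + h) * ((1 + h) * (1 - h))"
  define C where "C = (1 + v) * ((1 + v) * (1 + v))"
  define D where "D = (1 - v) * ((1 - v) * (1 - v))"
  have KA: "corner_contr b A" "corner_contr b B" "corner_contr b C" "corner_contr b D"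
    unfolding A_def B_def C_def D_def by (intro corner_contr_mult b K K3)+
  have six: "6 * x = x + x + x + x + x + x" and four: "4 * x = x + x + x + x"
    for x :: "'g star_poly"
    using distrib_right[of 3 3 x] distrib_right[of 2 1 x] distrib_right[of 2 2 x]
    by (simp_all add: mult_2 add.assoc)
  have "C + D - 1 - 1 = v * v + v * v + v * v + v * v + v * v + v * v"
    by (simp add: C_def D_def algebra_simps)
  then have "C + D = 2 + 6 * (v * v)"
    by (simp add: six diff_eq_eq)
  then have CD: "C + D = 2 - 6 * (h * h)"
    by (simp add: vv)
  have "A + B - 1 - 1 = h + h + h + h + (h * h + h * h)"
    by (simp add: A_def B_def algebra_simps)
  then have "A + B = 2 + 4 * h + 2 * (h * h)"
    by (simp add: four mult_2 diff_eq_eq)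
  then have AB: "3 * (A + B) + (C + D) = 8 + 12 * h"
    unfolding CD by (simp add: algebra_simps)
  have num: "numeral k = cst (numeral k)" for k
    by (simp add: cst_def)
  have "cst (1/8) * (3 * (A + B) + (C + D)) = 1 + cst (3/2) * h"
  proof -
    have "cst (1/8) * (8 + 12 * h) = cst (1/8) * cst 8 + (cst (1/8) * cst 12) * h"
      by (simp only: num distrib_left mult.assoc)
    also have "\<dots> = 1 + cst (3/2) * h" by (simp flip: cst_mult)
    finally show ?thesis using AB by simp
  qed
  \<comment> \<open>The weights 3/8, 3/8, 1/8, 1/8 arise from nested two-point convex combinations:
    the mean of \<open>A\<close> and \<open>B\<close> and the mean of \<open>C\<close> and
    \<open>D\<close>, mixed with weight 3/4.\<close>
  moreover have "cst (1/8) * (3 * (A + B) + (C + D)) =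
     cst (of_real (3/4)) * (cst (of_real (1/2)) * A + cst (of_real (1 - 1/2)) * B)
     + cst (of_real (1 - 3/4)) * (cst (of_real (1/2)) * C + cst (of_real (1 - 1/2)) * D)"
    by (simp add: num distrib_left flip: mult.assoc cst_mult)
  ultimately show ?thesis
    using corner_contr_convex[OF corner_contr_convex[OF KA(1,2), of "1/2"]
        corner_contr_convex[OF KA(3,4), of "1/2"], of "3/4"] by simp
qed

text \<open>Iterating the replacement admits the multiples \<open>(3/2)^n\<close> of
  \<open>h\<close> for every n, whereas two elements of the unit ball differ by at most 2.
  Boundedness of \<open>(3/2)^n * p h\<close> leaves only \<open>p h = 0\<close>.\<close>

lemma corner_extreme:
  assumes b: "is_proj b" and h: "star_poly h \<simeq> h" "b * h \<simeq> h" "h * b \<simeq> h"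
    and le: "p (b + h) \<le> 1" "p (b - h) \<le> 1"
  shows "p h = 0"
proof -
  have bh: "b * h \<simeq> h * b" using h eqv_trans eqv_sym by blast
  have "corner_contr b (1 + h)"
  proof -
    have "b * (1 + h) \<simeq> b + h" using eqv_add[OF eqv_refl h(2)] by (simp add: algebra_simps)
    moreover have "b * (1 + h) \<simeq> (1 + h) * b"
      using eqv_add[OF eqv_refl[of b] bh] by (simp add: algebra_simps)
    ultimately show ?thesis using le p_cong by (auto simp: corner_contr_def)
  qed
  moreover have "corner_contr b (1 - h)"
  proof -
    have "b * (1 - h) \<simeq> b - h" using eqv_diff[OF eqv_refl h(2)] by (simp add: algebra_simps)
    moreover have "b * (1 - h) \<simeq> (1 - h) * b"
      using eqv_diff[OF eqv_refl[of b] bh] by (simp add: algebra_simps)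
    ultimately show ?thesis using le p_cong by (auto simp: corner_contr_def)
  qed
  ultimately have *: "corner_contr b (1 + cst ((3/2) ^ n) * h) \<and> corner_contr b (1 - cst ((3/2) ^ n) * h)" for n
  proof (induction n)
    case (Suc n)
    let ?k = "cst ((3/2) ^ n) * h"
    have k: "star_poly ?k \<simeq> ?k" "b * ?k \<simeq> ?k * b"
      using eqv_cst[OF h(1)] eqv_cst[OF bh]
      by (simp_all add: star_poly_cst_mult cst_left_comm[of b] mult.assoc)
    then have k': "star_poly (- ?k) \<simeq> - ?k" "b * (- ?k) \<simeq> - ?k * b"
      using eqv_minus by (fastforce simp: star_poly_minus)+
    have "cst (3/2) * ?k = cst ((3/2) ^ Suc n) * h"
      by (simp only: power_Suc cst_mult mult.assoc)
    then show ?case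
      using corner_contr_step[OF b k] corner_contr_step[OF b k'] Suc by simp
  qed simp
  have "(3/2) ^ n * p h \<le> 2" for n :: nat
  proof -
    let ?k = "cst ((3/2) ^ n) * h"
    have "p (b * (1 + ?k) - b) \<le> 1 + 1"
      using triangle_diff[of "b * (1 + ?k)" b] proj_le_1[OF b] *[of n]
      by (simp add: corner_contr_def)
    moreover have "b * (1 + ?k) - b \<simeq> ?k"
      using eqv_cst[OF h(2)] by (simp add: algebra_simps cst_left_comm[of b])
    ultimately show ?thesis
      using p_cong by (simp add: scale norm_power norm_divide)
  qed
  show ?thesis
  proof (rule ccontr)
    assume "p h \<noteq> 0"
    then have "0 < p h" using nonneg[of h] by simp
    then obtain n where "2 / p h < (3/2) ^ n"
      using real_arch_pow[of "3/2" "2 / p h"] by auto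
    then show False
      using \<open>(3/2) ^ n * p h \<le> 2\<close> \<open>0 < p h\<close> by (simp add: field_simps)
  qed
qed

text \<open>With \<open>h = b * q j0 * b\<close> and n summands, \<open>b - h/n\<close> and
  \<open>b + h/n\<close> are averages of elements of seminorm at most 1, the second because the zero
  sum lets \<open>h\<close> be traded for minus the other compressions. Extremality of
  \<open>b\<close> gives \<open>h = 0\<close>, and the C*-identity then gives
  \<open>q j0 * b = 0\<close>.\<close>

lemma sum_compression_zero:
  assumes J: "finite J" "j0 \<in> J" and q: "\<And>j. j \<in> J \<Longrightarrow> is_proj (q j)" and b: "is_proj b"
    and sum: "(\<Sum>j\<in>J. b * q j * b) \<simeq> 0"
  shows "q j0 * b \<simeq> 0"
proof -
  define h where "h = b * q j0 * b"
  define n where "n = card J"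
  have n: "0 < n" using J by (auto simp: n_def card_gt_0_iff)
  define k where "k = cst (of_real (1 / n)) * h"
  have le: "p (b - b * q j * b) \<le> 1" if "j \<in> J" for j
  proof -
    have "b - b * q j * b \<simeq> b * b - b * q j * b"
      by (intro eqv_diff eqv_refl eqv_sym[OF projD(2)] b)
    also have "\<dots> = b * ((1 - q j) * b)" by (simp add: algebra_simps)
    finally show ?thesis
      using p_mult_le_1[OF proj_le_1[OF b] p_mult_le_1[OF proj_le_1 proj_le_1]]
      by (metis p_cong proj_compl that b q)
  qed
  have h: "star_poly h \<simeq> h" "b * h \<simeq> h" "h * b \<simeq> h"
  proof -
    show "star_poly h \<simeq> h"
      unfolding h_def star_poly_mult
      by (simp only: mult.assoc) (intro eqv_mult projD b q J)
    show "b * h \<simeq> h" "h * b \<simeq> h"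
      using eqv_multL[OF projD(2)[OF b], of "q j0 * b"] eqv_multR[OF projD(2)[OF b], of "b * q j0"]
      by (simp_all add: h_def mult.assoc)
  qed
  have k: "star_poly k \<simeq> k" "b * k \<simeq> k" "k * b \<simeq> k"
    using h[THEN eqv_cst, of "of_real (1/n)"]
    by (simp_all add: k_def star_poly_cst_mult cst_left_comm[of b] mult.assoc)
  have "p (b - k) \<le> 1"
  proof -
    have "b - k = cst (of_real (1 - 1/n)) * b + cst (of_real (1/n)) * (b - h)"
      by (simp add: k_def algebra_simps cst_diff)
    also have "p \<dots> \<le> cmod (of_real (1 - 1/n)) * p b + cmod (of_real (1/n)) * p (b - h)"
      using triangle scale by metis
    also have "\<dots> = (1 - 1/n) * p b + 1/n * p (b - h)"
      using n by (simp only: norm_of_real) simp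
    also have "\<dots> \<le> (1 - 1/n) * 1 + 1/n * 1"
      using n le[OF J(2)] proj_le_1[OF b] by (intro add_mono mult_left_mono) (auto simp: h_def)
    finally show ?thesis by simp
  qed
  moreover have "p (b + k) \<le> 1"
  proof -
    have "b + k = cst (of_real (1/n)) * (of_nat n * b + h)"
    proof -
      have "(of_nat n :: 'g star_poly) = cst (of_nat n)" by (simp add: cst_def)
      then show ?thesis using n by (simp add: k_def algebra_simps flip: mult.assoc cst_mult)
    qed
    also have "p \<dots> = 1/n * p (of_nat n * b + h)"
      using n by (simp only: scale norm_of_real) simp
    also have "\<dots> = 1/n * p (b + (\<Sum>j\<in>J - {j0}. b - b * q j * b))"
    proof -
      have nn: "of_nat n = (1 + of_nat (card (J - {j0})) :: 'g star_poly)"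
        using J n by (simp add: n_def flip: of_nat_Suc)
      have "of_nat n * b + h \<simeq> of_nat n * b + h - (\<Sum>j\<in>J. b * q j * b)"
        using eqv_diff[OF eqv_refl sum, of "of_nat n * b + h"] eqv_sym by simp
      also have "(\<Sum>j\<in>J. b * q j * b) = h + (\<Sum>j\<in>J - {j0}. b * q j * b)"
        unfolding h_def using J by (rule sum.remove)
      also have "of_nat n * b + h - (h + (\<Sum>j\<in>J - {j0}. b * q j * b))
          = b + (\<Sum>j\<in>J - {j0}. b - b * q j * b)"
        unfolding nn by (simp add: sum_subtractf algebra_simps)
      finally show ?thesis using p_cong by simp
    qed
    also have "\<dots> \<le> 1/n * (p b + (\<Sum>j\<in>J - {j0}. p (b - b * q j * b)))"
      using order_trans[OF triangle add_left_mono[OF p_sum]] n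
      by (intro mult_left_mono) auto
    also have "\<dots> \<le> 1/n * (1 + (\<Sum>j\<in>J - {j0}. 1))"
      using le proj_le_1[OF b] n by (intro mult_left_mono add_mono sum_mono) auto
    also have "\<dots> = 1"
      using J n by (auto simp: n_def of_nat_diff)
    finally show ?thesis .
  qed
  ultimately have "p k = 0" using corner_extreme[OF b k] by simp
  then have "p h = 0" using n by (simp add: k_def scale norm_divide)
  moreover have "star_poly (q j0 * b) * (q j0 * b) \<simeq> h"
  proof -
    have "star_poly (q j0 * b) * (q j0 * b) \<simeq> (b * q j0) * (q j0 * b)"
      unfolding star_poly_mult by (intro eqv_mult eqv_refl projD b q J)
    also have "\<dots> = b * (q j0 * q j0) * b" by (simp add: mult.assoc)
    also have "\<dots> \<simeq> b * q j0 * b" by (intro eqv_mult eqv_refl projD q J)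
    finally show ?thesis by (simp add: h_def)
  qed
  ultimately have "(p (q j0 * b))\<^sup>2 = 0" using cstar p_cong by metis
  then show ?thesis by (simp add: eqv_0)
qed

text \<open>Compressed to the complement \<open>1 - P\<close> the sum is zero, so every summand
  vanishes there. For the edges leaving a vertex this yields \<open>P_v S_e = S_e\<close> from the
  Cuntz-Krieger relation.\<close>

lemma proj_sum_absorb:
  assumes J: "finite J" and q: "\<And>j. j \<in> J \<Longrightarrow> is_proj (q j)"
    and P: "is_proj P" "(\<Sum>j\<in>J. q j) \<simeq> P" and j: "j \<in> J"
  shows "P * q j \<simeq> q j"
proof -
  have "(\<Sum>j\<in>J. (1 - P) * q j * (1 - P)) = (1 - P) * (\<Sum>j\<in>J. q j) * (1 - P)"
    by (simp add: sum_distrib_left sum_distrib_right)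
  also have "\<dots> \<simeq> (1 - P) * P * (1 - P)" by (intro eqv_mult eqv_refl P)
  also have "\<dots> = (P - P * P) * (1 - P)" by (simp add: algebra_simps)
  also have "\<dots> \<simeq> (P - P) * (1 - P)" by (intro eqv_multL eqv_diff projD P eqv_refl)
  finally have "q j * (1 - P) \<simeq> 0"
    using sum_compression_zero[OF J j q proj_compl[OF P(1)]] by simp
  then have "q j \<simeq> q j * P" by (simp add: algebra_simps eqv_def)
  then have "star_poly (q j) \<simeq> star_poly P * star_poly (q j)"
    using eqv_star by (metis star_poly_mult)
  then show ?thesis
    using projD(1)[OF q[OF j]] projD(1)[OF P(1)] eqv_mult eqv_sym eqv_trans by meson
qed

text \<open>Compress to \<open>q i\<close>: since \<open>P\<close> absorbs \<open>q i\<close>, the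
  remaining summands add up to \<open>q i * (P - q i) * q i = 0\<close>. For the edges leaving a
  vertex this makes their ranges orthogonal.\<close>

lemma proj_sum_orthogonal:
  assumes J: "finite J" and q: "\<And>j. j \<in> J \<Longrightarrow> is_proj (q j)"
    and P: "is_proj P" "(\<Sum>j\<in>J. q j) \<simeq> P" and ij: "i \<in> J" "j \<in> J" "i \<noteq> j"
  shows "q i * q j \<simeq> 0"
proof -
  have "(\<Sum>j\<in>J - {i}. q i * q j * q i) = q i * ((\<Sum>j\<in>J. q j) - q i) * q i"
    using J ij by (simp add: sum_distrib_left sum_distrib_right sum.remove[of J i])
  also have "\<dots> \<simeq> q i * (P - q i) * q i"
    by (intro eqv_mult eqv_diff eqv_refl P)
  also have "\<dots> = q i * (P * q i) - q i * (q i * q i)" by (simp add: algebra_simps)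
  also have "\<dots> \<simeq> q i * q i - q i * q i"
    by (intro eqv_diff eqv_multR projD q ij proj_sum_absorb[OF J q P]) auto
  finally have "(\<Sum>j\<in>J - {i}. q i * q j * q i) \<simeq> 0" by simp
  then have "q j * q i \<simeq> 0"
    using sum_compression_zero[of "J - {i}" j q "q i"] J ij q by auto
  then have "star_poly (q i) * star_poly (q j) \<simeq> 0"
    using eqv_star[of "q j * q i" 0] by (simp add: star_poly_mult)
  then show ?thesis
    using projD(1)[OF q[OF ij(1)]] projD(1)[OF q[OF ij(2)]] eqv_mult eqv_sym eqv_trans by meson
qed

end

section \<open>Domination of C*-seminorms by growth of powers\<close>

primrec sq_iter :: "nat \<Rightarrow> 'g star_poly \<Rightarrow> 'g star_poly" where
  "sq_iter 0 x = star_poly x * x"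
| "sq_iter (Suc k) x = sq_iter k x * sq_iter k x"

lemma star_sq_iter [simp]: "star_poly (sq_iter k x) = sq_iter k x"
  by (induction k) (simp_all add: star_poly_mult)

text \<open>\<open>sq_iter k x\<close> is the power of \<open>star_poly x * x\<close> with exponent
  \<open>2^k\<close>. It is self-adjoint, so each squaring is exact for every C*-seminorm, while the
  degree of a polynomial merely doubles.\<close>

lemma (in total_seminorm) p_sq_iter: "p (sq_iter k x) = p x ^ 2 ^ Suc k"
proof (induction k)
  case 0
  show ?case using cstar[of x] by simp
next
  case (Suc k)
  have "p (sq_iter (Suc k) x) = (p (sq_iter k x))\<^sup>2"
    using cstar[of "sq_iter k x"] by simp
  then show ?case by (simp add: Suc.IH flip: power_mult)
qed

text \<open>If \<open>P > Q\<close>, put \<open>d = P/Q - 1\<close>. Bernoulli bounds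
  \<open>(P/Q)^(2^k)\<close> below by \<open>2^k * d\<close>; the square of this is of order
  \<open>4^k\<close> and outgrows the factor \<open>\<alpha> * 2^k + \<beta>\<close>.\<close>

lemma le_of_linear_growth:
  fixes P Q :: real
  assumes "0 \<le> Q" "0 \<le> \<alpha>" "0 \<le> \<beta>"
    and le: "\<And>k. P ^ 2 ^ Suc k \<le> (\<alpha> * 2 ^ k + \<beta>) * Q ^ 2 ^ Suc k"
  shows "P \<le> Q"
proof (rule ccontr)
  assume "\<not> P \<le> Q"
  then have PQ: "Q < P" by simp
  \<comment> \<open>The case k = 0 rules out \<open>Q = 0\<close>, so that the quotient
    \<open>P / Q\<close> makes sense.\<close>
  have Q: "0 < Q"
  proof (rule ccontr)
    assume "\<not> 0 < Q"
    then have "P ^ 2 ^ Suc 0 \<le> 0" using le[of 0] assms(1) by simp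
    then show False using PQ assms(1) by simp
  qed
  define d where "d = P / Q - 1"
  have d: "0 < d" using PQ Q by (simp add: d_def field_simps)
  have "2 ^ k * d\<^sup>2 \<le> \<alpha> + \<beta>" for k :: nat
  proof -
    have "1 + 2 ^ k * d \<le> (1 + d) ^ 2 ^ k"
      using Bernoulli_inequality[of d "2 ^ k"] d by simp
    then have "2 ^ k * d \<le> (P / Q) ^ 2 ^ k" by (simp add: d_def)
    then have "(2 ^ k * d)\<^sup>2 \<le> ((P / Q) ^ 2 ^ k)\<^sup>2"
      using d by (intro power_mono) auto
    also have "\<dots> = P ^ 2 ^ Suc k / Q ^ 2 ^ Suc k"
      by (simp add: power_divide mult.commute flip: power_mult)
    also have "\<dots> \<le> \<alpha> * 2 ^ k + \<beta>"
      using le[of k] Q by (simp add: divide_le_eq)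
    also have "\<dots> \<le> (\<alpha> + \<beta>) * 2 ^ k"
      using assms(3) mult_left_mono[of 1 "2 ^ k" \<beta>] by (simp add: distrib_right)
    finally show ?thesis by (simp add: power2_eq_square mult.assoc mult.left_commute)
  qed
  moreover obtain k :: nat where "(\<alpha> + \<beta>) / d\<^sup>2 < 2 ^ k"
    using real_arch_pow[of 2] by auto
  ultimately show False
    using d by (simp add: divide_less_eq not_less[symmetric])
qed

text \<open>The C*-identity makes a C*-seminorm depend only on the growth of \<open>\<parallel>(x\<^sup>* x)\<^sup>n\<parallel>\<close>, so that
  domination up to subexponential factors is domination.\<close>

lemma seminorm_le_of_growth:
  assumes "total_seminorm p" "total_seminorm q" "0 \<le> \<alpha>" "0 \<le> \<beta>"
    and "\<And>k. p (sq_iter k x) \<le> (\<alpha> * 2 ^ k + \<beta>) * q (sq_iter k x)"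
  shows "p x \<le> q x"
proof -
  interpret p: total_seminorm p by fact
  interpret q: total_seminorm q by fact
  show ?thesis
  proof (rule le_of_linear_growth[OF q.nonneg assms(3,4)])
    fix k
    show "p x ^ 2 ^ Suc k \<le> (\<alpha> * 2 ^ k + \<beta>) * q x ^ 2 ^ Suc k"
      using assms(5)[of k] by (simp only: p.p_sq_iter q.p_sq_iter)
  qed
qed

text \<open>A set closed under adjoints and products contains all \<open>sq_iter k x\<close>, so a
  constant factor valid on the whole set disappears. It absorbs the constants left by crude triangle
  inequalities.\<close>

lemma seminorm_le_of_bound:
  assumes pq: "total_seminorm p" "total_seminorm q" "0 \<le> C"
    and star: "\<And>x. x \<in> S \<Longrightarrow> star_poly x \<in> S" and mult: "\<And>x y. x \<in> S \<Longrightarrow> y \<in> S \<Longrightarrow> x * y \<in> S"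
    and le: "\<And>x. x \<in> S \<Longrightarrow> p x \<le> C * q x" and x: "x \<in> S"
  shows "p x \<le> q x"
proof (rule seminorm_le_of_growth[OF pq(1,2) order_refl pq(3)])
  fix k
  have "sq_iter k x \<in> S" using x by (induction k) (auto intro: star mult)
  then show "p (sq_iter k x) \<le> (0 * 2 ^ k + C) * q (sq_iter k x)" using le by simp
qed

lemma total_seminorm_subst:
  assumes "total_seminorm p"
  shows "total_seminorm (\<lambda>x. p (subst t x))"
proof -
  interpret total_seminorm p by fact
  show ?thesis
    by unfold_locales (auto simp: subst_simps nonneg triangle scale mult cstar)
qed

text \<open>Suprema preserve inequalities only. Equality for scaling comes from applying the
  inequality to the inverse scalar, and the C*-identity from squaring on one side and taking square
  roots on the other.\<close>

lemma total_seminorm_SUP: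
  assumes I: "I \<noteq> {}" and p: "\<And>i. i \<in> I \<Longrightarrow> total_seminorm (p i)"
    and bdd: "\<And>x. bdd_above ((\<lambda>i. p i x) ` I)"
  shows "total_seminorm (\<lambda>x. SUP i\<in>I. p i x)"
proof
  let ?N = "\<lambda>x. SUP i\<in>I. p i x"
  note upper = cSUP_upper[OF _ bdd]
  note least = cSUP_least[OF I]
  fix x y :: "'b star_poly" and c
  show nn: "0 \<le> ?N x" for x
    using I upper[of _ x] total_seminorm.nonneg[OF p] by (meson ex_in_conv order_trans)
  show "?N (x + y) \<le> ?N x + ?N y"
    by (rule least, rule order_trans[OF total_seminorm.triangle[OF p]])
      (auto intro!: add_mono upper)
  have sc: "?N (cst c * x) \<le> cmod c * ?N x" for c x
    by (rule least) (metis mult_left_mono norm_ge_zero p total_seminorm.scale upper)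
  show "?N (cst c * x) = cmod c * ?N x"
  proof (cases "c = 0")
    case True
    then show ?thesis using sc[of 0 x] nn[of 0] by simp
  next
    case False
    have "?N x \<le> cmod (inverse c) * ?N (cst c * x)"
      using sc[of "inverse c" "cst c * x"] False by (simp flip: mult.assoc cst_mult)
    then have "cmod c * ?N x \<le> ?N (cst c * x)"
      using False by (simp add: norm_inverse norm_divide field_simps)
    then show ?thesis using sc[of c x] by simp
  qed
  show "?N (x * y) \<le> ?N x * ?N y"
    by (rule least, rule total_seminorm.p_mult_le[OF p]) (auto intro!: upper)
  have "?N (star_poly x * x) \<le> (?N x)\<^sup>2"
  proof (rule least)
    fix i assume i: "i \<in> I"
    then interpret i: total_seminorm "p i" by (rule p)
    show "p i (star_poly x * x) \<le> (?N x)\<^sup>2"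
      using upper[OF i, of x] by (simp add: i.cstar i.nonneg power_mono)
  qed
  moreover have "?N x \<le> sqrt (?N (star_poly x * x))"
  proof (rule least)
    fix i assume i: "i \<in> I"
    then interpret i: total_seminorm "p i" by (rule p)
    show "p i x \<le> sqrt (?N (star_poly x * x))"
      using upper[OF i, of "star_poly x * x"] by (simp add: i.cstar real_le_rsqrt)
  qed
  ultimately show "?N (star_poly x * x) = (?N x)\<^sup>2"
    by (metis antisym nn power_mono real_sqrt_pow2)
qed

subsection \<open>Extending a C*-seminorm to the whole free *-algebra\<close>

locale free_seminorm =
  fixes G :: "'g set" and s :: "'g star_poly \<Rightarrow> real"
  assumes s: "cstar_seminorm G s"
begin

lemma s_nonneg: "x \<in> free_star_alg G \<Longrightarrow> 0 \<le> s x"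
  and s_triangle: "x \<in> free_star_alg G \<Longrightarrow> y \<in> free_star_alg G \<Longrightarrow> s (x + y) \<le> s x + s y"
  and s_scale: "x \<in> free_star_alg G \<Longrightarrow> s (cst c * x) = cmod c * s x"
  and s_mult: "x \<in> free_star_alg G \<Longrightarrow> y \<in> free_star_alg G \<Longrightarrow> s (x * y) \<le> s x * s y"
  and s_cstar: "x \<in> free_star_alg G \<Longrightarrow> s (star_poly x * x) = (s x)\<^sup>2"
  using s by (auto simp: cstar_seminorm_def scale_poly_cst)

lemma s_0: "s 0 = 0"
  using s_scale[of 0 0] by simp

lemma s_star: "x \<in> free_star_alg G \<Longrightarrow> s (star_poly x) = s x"
proof -
  have "s x \<le> s (star_poly x)" if x: "x \<in> free_star_alg G" for x
  proof (cases "s x = 0")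
    case False
    have "s x * s x \<le> s (star_poly x) * s x"
      using s_mult[OF free_star[OF x] x] s_cstar[OF x] by (simp add: power2_eq_square)
    then show ?thesis using False s_nonneg[OF x] by (simp add: mult_le_cancel_right)
  qed (simp add: s_nonneg free_star x)
  from this[of x] this[of "star_poly x"] show "x \<in> free_star_alg G \<Longrightarrow> ?thesis"
    by (simp add: free_star)
qed

lemma cut_mult_free [simp]: "c \<in> free_star_alg G \<Longrightarrow> cut G x * c \<in> free_star_alg G"
  by (rule unital_free_mult_free[OF cut_unital_free])

text \<open>Constants lie outside \<open>free_star_alg G\<close>, so \<open>s\<close> itself does
  not bound them as multipliers. The bound is built up letter by letter and makes the supremum in
  \<open>op_norm\<close> finite.\<close>

lemma mult_op_bounded: "\<exists>B\<ge>0. \<forall>c\<in>free_star_alg G. s (cut G x * c) \<le> B * s c"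
proof (induction x rule: star_poly_word_induct)
  case zero
  show ?case by (auto simp: s_0 intro!: exI[of _ 0])
next
  case one
  show ?case by (auto simp: intro!: exI[of _ 1])
next
  case (letter l x)
  then obtain B where B: "B \<ge> 0" "\<And>c. c \<in> free_star_alg G \<Longrightarrow> s (cut G x * c) \<le> B * s c" by blast
  show ?case
  proof (cases "fst l \<in> G")
    case True
    then have l: "letter l \<in> free_star_alg G" by (rule letter_free)
    have "s (cut G (letter l * x) * c) \<le> s (letter l) * B * s c" if c: "c \<in> free_star_alg G" for c
    proof -
      have "cut G (letter l * x) * c = letter l * (cut G x * c)"
        using cut_free[OF l] by (simp add: mult.assoc)
      then have "s (cut G (letter l * x) * c) \<le> s (letter l) * s (cut G x * c)"
        using s_mult[OF l] c by simp
      also have "\<dots> \<le> s (letter l) * (B * s c)"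
        using B c s_nonneg[OF l] by (intro mult_left_mono) auto
      finally show ?thesis by (simp add: mult.assoc)
    qed
    then show ?thesis using B(1) s_nonneg[OF l] by (intro exI[of _ "s (letter l) * B"]) auto
  next
    case False
    then have "cut G (letter l * x) = 0"
      by (cases l) (simp add: letter_eq)
    then show ?thesis by (auto simp: s_0 intro!: exI[of _ 0])
  qed
next
  case (scale c x)
  then obtain B where B: "B \<ge> 0" "\<And>c. c \<in> free_star_alg G \<Longrightarrow> s (cut G x * c) \<le> B * s c" by blast
  have "s (cut G (cst c * x) * d) \<le> (cmod c * B) * s d" if d: "d \<in> free_star_alg G" for d
    using mult_left_mono[OF B(2)[OF d], of "cmod c"] s_scale[of "cut G x * d" c] d
    by (simp add: mult.assoc)
  then show ?case using B(1) by (intro exI[of _ "cmod c * B"]) auto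
next
  case (add x y)
  then obtain B C where B: "B \<ge> 0" "\<And>c. c \<in> free_star_alg G \<Longrightarrow> s (cut G x * c) \<le> B * s c"
    and C: "C \<ge> 0" "\<And>c. c \<in> free_star_alg G \<Longrightarrow> s (cut G y * c) \<le> C * s c" by blast
  have "s (cut G (x + y) * c) \<le> (B + C) * s c" if c: "c \<in> free_star_alg G" for c
    using s_triangle[of "cut G x * c" "cut G y * c"] B(2)[OF c] C(2)[OF c] c
    by (simp add: distrib_right)
  then show ?case using B(1) C(1) by (intro exI[of _ "B + C"]) auto
qed

text \<open>The standard C*-seminorm on a unitization: the operator norm of left multiplication on
  the algebra without unit. Through \<open>cut\<close>, letters outside \<open>G\<close> act as
  zero.\<close>

definition op_norm :: "'g star_poly \<Rightarrow> real" where
  "op_norm x = (SUP c\<in>{c \<in> free_star_alg G. s c \<le> 1}. s (cut G x * c))"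

lemma op_norm_le:
  assumes "0 \<le> B" "\<And>c. c \<in> free_star_alg G \<Longrightarrow> s (cut G x * c) \<le> B * s c"
  shows "op_norm x \<le> B"
  unfolding op_norm_def
proof (rule cSUP_least)
  show "{c \<in> free_star_alg G. s c \<le> 1} \<noteq> {}" using s_0 by auto
  fix c assume "c \<in> {c \<in> free_star_alg G. s c \<le> 1}"
  then show "s (cut G x * c) \<le> B"
    using assms(2)[of c] mult_left_mono[of "s c" 1 B] assms(1) by simp
qed

lemma op_norm_upper:
  assumes c: "c \<in> free_star_alg G"
  shows "s (cut G x * c) \<le> op_norm x * s c"
proof -
  obtain B where B: "B \<ge> 0" "\<And>c. c \<in> free_star_alg G \<Longrightarrow> s (cut G x * c) \<le> B * s c"
    using mult_op_bounded by blast
  have upper: "s (cut G x * c) \<le> op_norm x" if "c \<in> free_star_alg G" "s c \<le> 1" for c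
    unfolding op_norm_def
  proof (rule cSUP_upper)
    show "bdd_above ((\<lambda>c. s (cut G x * c)) ` {c \<in> free_star_alg G. s c \<le> 1})"
    proof (rule bdd_aboveI2)
      fix c assume "c \<in> {c \<in> free_star_alg G. s c \<le> 1}"
      then show "s (cut G x * c) \<le> B"
        using B(2)[of c] mult_left_mono[of "s c" 1 B] B(1) by simp
    qed
  qed (use that in simp)
  show ?thesis
  \<comment> \<open>Null elements cannot be normalised; the crude bound \<open>B\<close> shows that
    their product with \<open>x\<close> is null as well.\<close>
  proof (cases "s c = 0")
    case True
    then show ?thesis using B(2)[OF c] by simp
  next
    case False
    then have pos: "0 < s c" using s_nonneg[OF c] by simp
    let ?d = "cst (of_real (1 / s c)) * c"
    have d: "?d \<in> free_star_alg G" "s ?d \<le> 1"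
      using c pos by (simp_all add: free_cst_mult s_scale norm_divide)
    have "s (cut G x * ?d) = 1 / s c * s (cut G x * c)"
      using pos c s_scale[of "cut G x * c"] by (simp add: cst_left_comm[of "cut G x"] norm_divide)
    then have "1 / s c * s (cut G x * c) \<le> op_norm x" using upper[OF d] by simp
    then show ?thesis using pos by (simp add: divide_le_eq mult.commute)
  qed
qed

lemma op_norm_nonneg: "0 \<le> op_norm x"
proof (cases "\<exists>c\<in>free_star_alg G. s c \<noteq> 0")
  case True
  then obtain c where c: "c \<in> free_star_alg G" "s c > 0" using s_nonneg by (metis less_eq_real_def)
  have "0 \<le> op_norm x * s c"
    using order_trans[OF s_nonneg op_norm_upper[OF c(1)]] c by simp
  then show ?thesis using c by (simp add: zero_le_mult_iff)
next
  case False
  then have "(\<lambda>c. s (cut G x * c)) ` {c \<in> free_star_alg G. s c \<le> 1} = {0}"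
    using s_0 by (auto intro!: image_eqI[of _ _ 0])
  then show ?thesis by (simp add: op_norm_def)
qed

lemma total_seminorm_op_norm: "total_seminorm op_norm"
proof
  fix x y :: "'g star_poly" and k
  show "0 \<le> op_norm x" by (rule op_norm_nonneg)
  show "op_norm (x + y) \<le> op_norm x + op_norm y"
  proof (rule op_norm_le)
    fix c assume c: "c \<in> free_star_alg G"
    show "s (cut G (x + y) * c) \<le> (op_norm x + op_norm y) * s c"
      using s_triangle[of "cut G x * c" "cut G y * c"] op_norm_upper[OF c, of x] op_norm_upper[OF c, of y] c
      by (simp add: distrib_right)
  qed (simp add: op_norm_nonneg)
  have sc: "op_norm (cst k * x) \<le> cmod k * op_norm x" for k x
  proof (rule op_norm_le)
    fix c assume c: "c \<in> free_star_alg G"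
    show "s (cut G (cst k * x) * c) \<le> (cmod k * op_norm x) * s c"
      using mult_left_mono[OF op_norm_upper[OF c], of "cmod k" x] s_scale[of "cut G x * c" k] c
      by (simp add: mult.assoc)
  qed (simp add: op_norm_nonneg)
  show "op_norm (cst k * x) = cmod k * op_norm x"
  proof (cases "k = 0")
    case True
    then show ?thesis using sc[of 0 x] op_norm_nonneg[of 0] by simp
  next
    case False
    have "op_norm x \<le> cmod (inverse k) * op_norm (cst k * x)"
      using sc[of "inverse k" "cst k * x"] False by (simp flip: mult.assoc cst_mult)
    then have "cmod k * op_norm x \<le> op_norm (cst k * x)"
      using False by (simp add: norm_inverse norm_divide field_simps)
    then show ?thesis using sc[of k x] by simp
  qed
  have mu: "op_norm (x * y) \<le> op_norm x * op_norm y" for x y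
  proof (rule op_norm_le)
    fix c assume c: "c \<in> free_star_alg G"
    have "s (cut G (x * y) * c) \<le> op_norm x * s (cut G y * c)"
      using op_norm_upper[of "cut G y * c" x] c by (simp add: mult.assoc)
    also have "\<dots> \<le> op_norm x * (op_norm y * s c)"
      by (intro mult_left_mono op_norm_upper c op_norm_nonneg)
    finally show "s (cut G (x * y) * c) \<le> (op_norm x * op_norm y) * s c" by (simp add: mult.assoc)
  qed (simp add: op_norm_nonneg)
  show "op_norm (x * y) \<le> op_norm x * op_norm y" by (rule mu)
  have sq: "(op_norm x)\<^sup>2 \<le> op_norm (star_poly x * x)" for x
  proof -
    have "op_norm x \<le> sqrt (op_norm (star_poly x * x))"
    proof (rule op_norm_le)
      fix c assume c: "c \<in> free_star_alg G"
      \<comment> \<open>The C*-identity of \<open>s\<close> at \<open>x * c\<close> brings in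
        \<open>star_poly x * x\<close> as a multiplier. This gives the half of the C*-identity for
        \<open>op_norm\<close> that does not come from submultiplicativity.\<close>
      have "(s (cut G x * c))\<^sup>2 = s (star_poly c * (cut G (star_poly x * x) * c))"
        using s_cstar[OF cut_mult_free[OF c], symmetric]
        by (simp add: star_poly_mult mult.assoc)
      also have "\<dots> \<le> s c * (op_norm (star_poly x * x) * s c)"
        using order_trans[OF s_mult[OF free_star[OF c] cut_mult_free[OF c]]
            mult_left_mono[OF op_norm_upper[OF c] s_nonneg[OF free_star[OF c]]]]
        by (simp only: s_star[OF c])
      also have "\<dots> = (sqrt (op_norm (star_poly x * x)) * s c)\<^sup>2"
        by (simp add: power_mult_distrib op_norm_nonneg power2_eq_square[of "s c"])
      finally show "s (cut G x * c) \<le> sqrt (op_norm (star_poly x * x)) * s c"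
        by (rule power2_le_imp_le) (simp add: s_nonneg[OF c] op_norm_nonneg)
    qed (simp add: op_norm_nonneg)
    then show ?thesis
      by (metis op_norm_nonneg real_sqrt_le_iff real_sqrt_pow2 power_mono)
  qed
  have st: "op_norm x \<le> op_norm (star_poly x)" for x
  proof (cases "op_norm x = 0")
    case False
    have "op_norm x * op_norm x \<le> op_norm (star_poly x) * op_norm x"
      using order_trans[OF sq mu] by (simp add: power2_eq_square)
    then show ?thesis using False op_norm_nonneg[of x] by (simp add: mult_le_cancel_right)
  qed (simp add: op_norm_nonneg)
  have "op_norm (star_poly x * x) \<le> op_norm x * op_norm x"
    using mu[of "star_poly x" x] mult_right_mono[OF st[of "star_poly x"] op_norm_nonneg[of x]] by simp
  then show "op_norm (star_poly x * x) = (op_norm x)\<^sup>2"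
    using sq[of x] by (simp add: power2_eq_square)
qed

text \<open>The adjoint of \<open>x\<close> is the test element: multiplied by \<open>x\<close> it
  has seminorm \<open>(s x)^2\<close>, so the operator norm cannot be smaller than
  \<open>s x\<close>.\<close>

lemma op_norm_eq:
  assumes x: "x \<in> free_star_alg G"
  shows "op_norm x = s x"
proof (rule antisym)
  show "op_norm x \<le> s x"
    using s_mult[OF x] by (intro op_norm_le s_nonneg x) (simp add: cut_free[OF x])
  have "s x * s x \<le> op_norm x * s x"
    using op_norm_upper[OF free_star[OF x], of x] s_cstar[OF free_star[OF x]] s_star[OF x]
    by (simp add: cut_free[OF x] power2_eq_square)
  then show "s x \<le> op_norm x"
    using s_nonneg[OF x] op_norm_nonneg[of x] by (cases "s x = 0") (simp_all add: mult_le_cancel_right)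
qed

lemma op_norm_outside: "g \<notin> G \<Longrightarrow> op_norm (gen g) = 0"
  using op_norm_le[of 0 "gen g"] op_norm_nonneg[of "gen g"] by (simp add: s_0)

end

subsection \<open>The universal seminorm\<close>

definition admissible :: "'g set \<Rightarrow> 'g star_poly set \<Rightarrow> ('g star_poly \<Rightarrow> real) set" where
  "admissible G R =
    {p. total_seminorm p \<and> (\<forall>g. g \<notin> G \<longrightarrow> p (gen g) = 0) \<and> (\<forall>r\<in>R. p r = 0)}"

definition total_norm :: "'g set \<Rightarrow> 'g star_poly set \<Rightarrow> 'g star_poly \<Rightarrow> real" where
  "total_norm G R x = (SUP p\<in>admissible G R. p x)"

text \<open>An admissible seminorm is a C*-seminorm over \<open>G\<close> annihilating
  \<open>R\<close>, and \<open>op_norm\<close> extends every such seminorm to an admissible one.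
  Both suprema therefore run over the same set of values at \<open>x\<close>.\<close>

lemma univ_norm_eq_total_norm:
  assumes R: "R \<subseteq> free_star_alg G" and x: "x \<in> free_star_alg G"
  shows "univ_norm G R x = total_norm G R x"
proof -
  have "{p x |p. cstar_seminorm G p \<and> (\<forall>r\<in>R. p r = 0)} = (\<lambda>p. p x) ` admissible G R"
  proof (intro equalityI subsetI)
    fix a assume "a \<in> {p x |p. cstar_seminorm G p \<and> (\<forall>r\<in>R. p r = 0)}"
    then obtain q where q: "cstar_seminorm G q" "\<forall>r\<in>R. q r = 0" "a = q x" by blast
    interpret free_seminorm G q by unfold_locales fact
    have "op_norm r = 0" if "r \<in> R" for r
      using that q R op_norm_eq[of r] by auto
    then have "op_norm \<in> admissible G R"
      using total_seminorm_op_norm op_norm_outside by (auto simp: admissible_def)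
    then show "a \<in> (\<lambda>p. p x) ` admissible G R"
      using op_norm_eq[OF x] q by (intro image_eqI[of _ _ op_norm]) simp_all
  next
    fix a assume "a \<in> (\<lambda>p. p x) ` admissible G R"
    then obtain p where p: "p \<in> admissible G R" "a = p x" by blast
    then interpret total_seminorm p by (simp add: admissible_def)
    have "cstar_seminorm G p"
      by (simp add: cstar_seminorm_def scale_poly_cst nonneg triangle scale mult cstar)
    then show "a \<in> {p x |p. cstar_seminorm G p \<and> (\<forall>r\<in>R. p r = 0)}"
      using p by (auto simp: admissible_def)
  qed
  then show ?thesis by (simp add: univ_norm_def total_norm_def)
qed

text \<open>The condition under which the universal C*-algebra exists: a common bound for each
  generator propagates to every polynomial, so the defining supremum is finite.\<close>

locale bounded_relations =
  fixes G :: "'g set" and R :: "'g star_poly set"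
  assumes R_free: "R \<subseteq> free_star_alg G"
    and gen_bounded: "\<And>g. \<exists>B. \<forall>p\<in>admissible G R. p (gen g) \<le> B"
begin

abbreviation N :: "'g star_poly \<Rightarrow> real" where "N \<equiv> total_norm G R"

lemma zero_admissible: "(\<lambda>x. 0) \<in> admissible G R"
  by (simp add: admissible_def total_seminorm_def)

lemma admissible_bounded: "\<exists>B. \<forall>p\<in>admissible G R. p x \<le> B"
proof (induction x rule: star_poly_gen_induct)
  case (const c)
  have "p (cst c) \<le> cmod c" if "p \<in> admissible G R" for p
  proof -
    interpret total_seminorm p using that by (simp add: admissible_def)
    show ?thesis using scale[of c 1] mult_left_mono[OF p_1, of "cmod c"] by simp
  qed
  then show ?case by blast
next
  case (gen g)
  show ?case by (rule gen_bounded)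
next
  case (add x y)
  then obtain B C where B: "\<And>p. p \<in> admissible G R \<Longrightarrow> p x \<le> B" "\<And>p. p \<in> admissible G R \<Longrightarrow> p y \<le> C"
    by blast
  have "p (x + y) \<le> B + C" if "p \<in> admissible G R" for p
  proof -
    interpret total_seminorm p using that by (simp add: admissible_def)
    show ?thesis using triangle[of x y] B[OF that] by simp
  qed
  then show ?case by blast
next
  case (mult x y)
  then obtain B C where B: "\<And>p. p \<in> admissible G R \<Longrightarrow> p x \<le> B" "\<And>p. p \<in> admissible G R \<Longrightarrow> p y \<le> C"
    by blast
  have "p (x * y) \<le> B * C" if "p \<in> admissible G R" for p
  proof -
    interpret total_seminorm p using that by (simp add: admissible_def)
    show ?thesis by (intro p_mult_le B that)
  qed
  then show ?case by blast
next
  case (star x)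
  have "p (star_poly x) = p x" if "p \<in> admissible G R" for p
  proof -
    interpret total_seminorm p using that by (simp add: admissible_def)
    show ?thesis by simp
  qed
  then show ?case using star by metis
qed

lemma N_upper: "p \<in> admissible G R \<Longrightarrow> p x \<le> N x"
  unfolding total_norm_def using admissible_bounded[of x]
  by (intro cSUP_upper) (auto intro: bdd_aboveI)

lemma N_least: "(\<And>p. p \<in> admissible G R \<Longrightarrow> p x \<le> B) \<Longrightarrow> N x \<le> B"
  unfolding total_norm_def using zero_admissible by (intro cSUP_least) auto

lemma admissibleD: "p \<in> admissible G R \<Longrightarrow> total_seminorm p"
  by (simp add: admissible_def)

sublocale total_seminorm N
  unfolding total_norm_def
proof (rule total_seminorm_SUP)
  show "bdd_above ((\<lambda>p. p x) ` admissible G R)" for x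
    using admissible_bounded[of x] by (auto intro: bdd_aboveI)
qed (use zero_admissible admissibleD in auto)

text \<open>The supremum is itself one of the seminorms over which it is taken, so whatever follows
  from the relations for all admissible seminorms holds for \<open>N\<close>.\<close>

lemma N_admissible: "N \<in> admissible G R"
proof -
  have "N (gen g) = 0" if "g \<notin> G" for g
    using N_least[of "gen g" 0] that nonneg[of "gen g"] by (auto simp: admissible_def)
  moreover have "N r = 0" if "r \<in> R" for r
    using N_least[of r 0] that nonneg[of r] by (auto simp: admissible_def)
  ultimately show ?thesis by (simp add: admissible_def total_seminorm_axioms)
qed

lemma univ_norm_eq: "x \<in> free_star_alg G \<Longrightarrow> univ_norm G R x = N x"
  by (rule univ_norm_eq_total_norm[OF R_free])

end

subsection \<open>The universal C*-algebra\<close>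

context bounded_relations begin

abbreviation CS :: "(nat \<Rightarrow> 'g star_poly) set" where "CS \<equiv> cauchy_seqs G R"
abbreviation cls :: "(nat \<Rightarrow> 'g star_poly) \<Rightarrow> 'g univ_elem" where "cls \<equiv> univ_class G R"
abbreviation U :: "'g univ_elem cstar_alg" where "U \<equiv> univ_cstar G R"

lemma CS_free: "X \<in> CS \<Longrightarrow> X n \<in> free_star_alg G"
  by (simp add: cauchy_seqs_def)

lemma CS_iff: "X \<in> CS \<longleftrightarrow> (\<forall>n. X n \<in> free_star_alg G) \<and>
    (\<forall>\<epsilon>>0. \<exists>M. \<forall>m\<ge>M. \<forall>n\<ge>M. N (X m - X n) < \<epsilon>)"
proof -
  have "univ_norm G R (X m - X n) = N (X m - X n)" if "\<forall>n. X n \<in> free_star_alg G" for m n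
    using that by (simp add: univ_norm_eq free_diff)
  then show ?thesis unfolding cauchy_seqs_def by auto
qed

lemma CS_D:
  assumes "X \<in> CS" "0 < \<epsilon>"
  obtains M where "\<And>m n. m \<ge> M \<Longrightarrow> n \<ge> M \<Longrightarrow> N (X m - X n) < \<epsilon>"
  using assms unfolding CS_iff by meson

lemma CS_I:
  assumes "\<And>n. X n \<in> free_star_alg G"
    and "\<And>\<epsilon>. \<epsilon> > 0 \<Longrightarrow> \<exists>M. \<forall>m\<ge>M. \<forall>n\<ge>M. N (X m - X n) < \<epsilon>"
  shows "X \<in> CS"
  using assms unfolding CS_iff by blast

lemma N_diff_abs: "\<bar>N x - N y\<bar> \<le> N (x - y)"
  using triangle[of "x - y" y] triangle[of "y - x" x] p_diff_comm[of x y] by simp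

lemma CS_convergent:
  assumes "X \<in> CS"
  shows "convergent (\<lambda>n. N (X n))"
proof (rule Cauchy_convergent, rule CauchyI)
  fix e :: real assume "0 < e"
  then obtain M where M: "\<And>m n. m \<ge> M \<Longrightarrow> n \<ge> M \<Longrightarrow> N (X m - X n) < e"
    using CS_D[OF assms] by blast
  then show "\<exists>M. \<forall>m\<ge>M. \<forall>n\<ge>M. norm (N (X m) - N (X n)) < e"
    using N_diff_abs by (metis le_less_trans real_norm_def)
qed

lemma CS_bounded:
  assumes "X \<in> CS"
  obtains B where "0 < B" "\<And>n. N (X n) \<le> B"
proof -
  have "Bseq (\<lambda>n. N (X n))" using CS_convergent[OF assms] by (rule convergent_imp_Bseq)
  then obtain B where "B > 0" "\<And>n. norm (N (X n)) \<le> B" by (auto elim: BseqE)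
  then show ?thesis using that[of B] nonneg by simp
qed

lemma CS_tendsto: "X \<in> CS \<Longrightarrow> (\<lambda>n. N (X n)) \<longlonglongrightarrow> lim (\<lambda>n. N (X n))"
  using CS_convergent convergent_LIMSEQ_iff by blast

lemma CS_const: "x \<in> free_star_alg G \<Longrightarrow> (\<lambda>n. x) \<in> CS"
  by (rule CS_I) auto

lemma CS_add:
  assumes X: "X \<in> CS" and Y: "Y \<in> CS"
  shows "(\<lambda>n. X n + Y n) \<in> CS"
proof (rule CS_I)
  fix e :: real assume e: "0 < e"
  obtain M where M: "\<And>m n. m \<ge> M \<Longrightarrow> n \<ge> M \<Longrightarrow> N (X m - X n) < e/2"
    using CS_D[OF X, of "e/2"] e by auto
  obtain L where L: "\<And>m n. m \<ge> L \<Longrightarrow> n \<ge> L \<Longrightarrow> N (Y m - Y n) < e/2"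
    using CS_D[OF Y, of "e/2"] e by auto
  have "N (X m + Y m - (X n + Y n)) < e" if "m \<ge> max M L" "n \<ge> max M L" for m n
    using triangle[of "X m - X n" "Y m - Y n"] M[of m n] L[of m n] that by (simp add: algebra_simps)
  then show "\<exists>M. \<forall>m\<ge>M. \<forall>n\<ge>M. N (X m + Y m - (X n + Y n)) < e" by blast
qed (intro free_add CS_free X Y)

lemma CS_mult:
  assumes X: "X \<in> CS" and Y: "Y \<in> CS"
  shows "(\<lambda>n. X n * Y n) \<in> CS"
proof (rule CS_I)
  fix e :: real assume e: "0 < e"
  obtain B where B: "0 < B" "\<And>n. N (X n) \<le> B" using CS_bounded[OF X] by blast
  obtain C where C: "0 < C" "\<And>n. N (Y n) \<le> C" using CS_bounded[OF Y] by blast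
  obtain M where M: "\<And>m n. m \<ge> M \<Longrightarrow> n \<ge> M \<Longrightarrow> N (X m - X n) < e/(2*C)"
    using CS_D[OF X, of "e/(2*C)"] e C by auto
  obtain L where L: "\<And>m n. m \<ge> L \<Longrightarrow> n \<ge> L \<Longrightarrow> N (Y m - Y n) < e/(2*B)"
    using CS_D[OF Y, of "e/(2*B)"] e B by auto
  have "N (X m * Y m - X n * Y n) < e" if mn: "m \<ge> max M L" "n \<ge> max M L" for m n
  proof -
    have "N (X m * Y m - X n * Y n) \<le> N ((X m - X n) * Y m) + N (X n * (Y m - Y n))"
      using triangle[of "(X m - X n) * Y m" "X n * (Y m - Y n)"] by (simp add: algebra_simps)
    also have "\<dots> \<le> N (X m - X n) * C + B * N (Y m - Y n)"
      by (intro add_mono p_mult_le B C order_refl)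
    also have "\<dots> < e/(2*C) * C + B * (e/(2*B))"
      using M[of m n] L[of m n] mn B C by (intro add_strict_mono mult_strict_right_mono mult_strict_left_mono) auto
    also have "\<dots> = e" using B C by simp
    finally show ?thesis .
  qed
  then show "\<exists>M. \<forall>m\<ge>M. \<forall>n\<ge>M. N (X m * Y m - X n * Y n) < e" by blast
qed (intro free_mult CS_free X Y)

lemma CS_scale:
  assumes X: "X \<in> CS"
  shows "(\<lambda>n. cst c * X n) \<in> CS"
proof (rule CS_I)
  fix e :: real assume e: "0 < e"
  then have e': "0 < e / (cmod c + 1)" by (simp add: add_nonneg_pos)
  obtain M where M: "\<And>m n. m \<ge> M \<Longrightarrow> n \<ge> M \<Longrightarrow> N (X m - X n) < e/(cmod c + 1)"
    using CS_D[OF X e'] by auto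
  have "N (cst c * X m - cst c * X n) < e" if "m \<ge> M" "n \<ge> M" for m n
  proof -
    have "N (cst c * X m - cst c * X n) = cmod c * N (X m - X n)"
      by (simp add: scale flip: right_diff_distrib)
    also have "\<dots> \<le> (cmod c + 1) * N (X m - X n)" by (simp add: nonneg mult_right_mono)
    also have "\<dots> < e"
      using M[OF that] by (simp add: pos_less_divide_eq add_nonneg_pos mult.commute)
    finally show ?thesis .
  qed
  then show "\<exists>M. \<forall>m\<ge>M. \<forall>n\<ge>M. N (cst c * X m - cst c * X n) < e" by blast
qed (intro free_cst_mult CS_free X)

lemma CS_star: "X \<in> CS \<Longrightarrow> (\<lambda>n. star_poly (X n)) \<in> CS"
  unfolding CS_iff by (simp add: free_star flip: star_poly_diff)

lemma CS_minus: "X \<in> CS \<Longrightarrow> (\<lambda>n. - X n) \<in> CS"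
  using CS_scale[of X "- 1"] by (simp add: cst_minus)

lemma CS_diff: "X \<in> CS \<Longrightarrow> Y \<in> CS \<Longrightarrow> (\<lambda>n. X n - Y n) \<in> CS"
  using CS_add[of X "\<lambda>n. - Y n"] CS_minus[of Y] by simp

lemma rel_iff: "(X, Y) \<in> cauchy_rel G R \<longleftrightarrow> X \<in> CS \<and> Y \<in> CS \<and> (\<lambda>n. N (X n - Y n)) \<longlonglongrightarrow> 0"
proof -
  have "univ_norm G R (X n - Y n) = N (X n - Y n)" if "X \<in> CS" "Y \<in> CS" for n
    using that by (simp add: univ_norm_eq free_diff CS_free)
  then show ?thesis unfolding cauchy_rel_def by auto
qed

lemma equiv_rel: "equiv CS (cauchy_rel G R)"
proof (rule equivI)
  show "cauchy_rel G R \<subseteq> CS \<times> CS" by (auto simp: rel_iff)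
  show "refl_on CS (cauchy_rel G R)"
    by (auto simp: refl_on_def rel_iff)
  show "sym (cauchy_rel G R)"
    by (auto simp: sym_def rel_iff p_diff_comm)
  show "trans (cauchy_rel G R)"
  proof (rule transI)
    fix X Y Z assume "(X, Y) \<in> cauchy_rel G R" "(Y, Z) \<in> cauchy_rel G R"
    then have *: "X \<in> CS" "Z \<in> CS" "(\<lambda>n. N (X n - Y n)) \<longlonglongrightarrow> 0" "(\<lambda>n. N (Y n - Z n)) \<longlonglongrightarrow> 0"
      by (auto simp: rel_iff)
    have "(\<lambda>n. N (X n - Z n)) \<longlonglongrightarrow> 0"
    proof (rule tendsto_sandwich[OF _ _ tendsto_const])
      show "(\<lambda>n. N (X n - Y n) + N (Y n - Z n)) \<longlonglongrightarrow> 0"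
        using tendsto_add[OF *(3,4)] by simp
      show "\<forall>\<^sub>F n in sequentially. N (X n - Z n) \<le> N (X n - Y n) + N (Y n - Z n)"
        using triangle[of "X n - Y n" "Y n - Z n" for n] by simp
    qed (simp add: nonneg)
    then show "(X, Z) \<in> cauchy_rel G R" using * by (simp add: rel_iff)
  qed
qed

lemma elems_U: "elems U = CS // cauchy_rel G R"
  by (simp add: univ_cstar_def)

lemma cls_elems [simp]: "X \<in> CS \<Longrightarrow> cls X \<in> elems U"
  by (simp add: elems_U univ_class_def quotientI)

lemma elems_E:
  assumes "a \<in> elems U"
  obtains X where "X \<in> CS" "a = cls X"
  using assms by (auto simp: elems_U univ_class_def elim: quotientE)

lemma cls_eq_iff: "X \<in> CS \<Longrightarrow> Y \<in> CS \<Longrightarrow> cls X = cls Y \<longleftrightarrow> (\<lambda>n. N (X n - Y n)) \<longlonglongrightarrow> 0"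
  unfolding univ_class_def by (simp add: eq_equiv_class_iff[OF equiv_rel] rel_iff)

lemma cls_self: "X \<in> CS \<Longrightarrow> X \<in> cls X"
  by (simp add: univ_class_def rel_iff)

lemma cls_member:
  assumes "X' \<in> cls X"
  shows "X' \<in> CS" "cls X' = cls X"
proof -
  have *: "(X, X') \<in> cauchy_rel G R" using assms by (simp add: univ_class_def)
  then show "X' \<in> CS" by (simp add: rel_iff)
  show "cls X' = cls X"
    using equiv_class_eq[OF equiv_rel *] by (simp add: univ_class_def)
qed

text \<open>The operations of \<open>univ_cstar\<close> are unions over all representatives. A value
  independent of the representative makes the union collapse, so only well-definedness remains to be
  checked for each operation.\<close>

lemma cls_UN:
  assumes "X \<in> CS" "\<And>X'. X' \<in> CS \<Longrightarrow> cls X' = cls X \<Longrightarrow> F X' = F X"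
  shows "(\<Union>X'\<in>cls X. F X') = F X"
proof -
  have "(\<Union>X'\<in>cls X. F X') = (\<Union>X'\<in>cls X. F X)"
    by (intro SUP_cong refl assms(2) cls_member)
  then show ?thesis using cls_self[OF assms(1)] by auto
qed

lemma cls_UN2:
  assumes "X \<in> CS" "Y \<in> CS"
    and "\<And>X' Y'. X' \<in> CS \<Longrightarrow> Y' \<in> CS \<Longrightarrow> cls X' = cls X \<Longrightarrow> cls Y' = cls Y \<Longrightarrow> F X' Y' = F X Y"
  shows "(\<Union>X'\<in>cls X. \<Union>Y'\<in>cls Y. F X' Y') = F X Y"
proof -
  have "(\<Union>X'\<in>cls X. \<Union>Y'\<in>cls Y. F X' Y') = (\<Union>X'\<in>cls X. \<Union>Y'\<in>cls Y. F X Y)"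
    by (intro SUP_cong refl assms(3) cls_member)
  then show ?thesis using cls_self[OF assms(1)] cls_self[OF assms(2)] by auto
qed

lemma U_zero: "czero U = cls (\<lambda>n. 0)"
  by (simp add: univ_cstar_def)

lemma U_add:
  assumes X: "X \<in> CS" and Y: "Y \<in> CS"
  shows "cadd U (cls X) (cls Y) = cls (\<lambda>n. X n + Y n)"
proof -
  have "cls (\<lambda>n. X' n + Y' n) = cls (\<lambda>n. X n + Y n)"
    if "X' \<in> CS" "Y' \<in> CS" "cls X' = cls X" "cls Y' = cls Y" for X' Y'
  proof -
    have *: "(\<lambda>n. N (X' n - X n)) \<longlonglongrightarrow> 0" "(\<lambda>n. N (Y' n - Y n)) \<longlonglongrightarrow> 0"
      using that X Y cls_eq_iff by auto
    have "(\<lambda>n. N (X' n + Y' n - (X n + Y n))) \<longlonglongrightarrow> 0"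
    proof (rule tendsto_sandwich[OF _ _ tendsto_const])
      show "(\<lambda>n. N (X' n - X n) + N (Y' n - Y n)) \<longlonglongrightarrow> 0"
        using tendsto_add[OF *] by simp
      show "\<forall>\<^sub>F n in sequentially. N (X' n + Y' n - (X n + Y n)) \<le> N (X' n - X n) + N (Y' n - Y n)"
        using triangle[of "X' n - X n" "Y' n - Y n" for n] by (simp add: algebra_simps)
    qed (simp add: nonneg)
    then show ?thesis using that X Y by (simp add: cls_eq_iff CS_add)
  qed
  then show ?thesis
    using cls_UN2[OF X Y, of "\<lambda>X Y. cls (\<lambda>n. X n + Y n)"] by (simp add: univ_cstar_def)
qed

lemma U_mult:
  assumes X: "X \<in> CS" and Y: "Y \<in> CS"
  shows "cmult U (cls X) (cls Y) = cls (\<lambda>n. X n * Y n)"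
proof -
  have "cls (\<lambda>n. X' n * Y' n) = cls (\<lambda>n. X n * Y n)"
    if X': "X' \<in> CS" and Y': "Y' \<in> CS" and eq: "cls X' = cls X" "cls Y' = cls Y" for X' Y'
  proof -
    note that = X' Y' eq
    obtain B where B: "0 < B" "\<And>n. N (X n) \<le> B" using CS_bounded[OF X] by blast
    obtain C where C: "0 < C" "\<And>n. N (Y' n) \<le> C" using CS_bounded[OF Y'] by blast
    have *: "(\<lambda>n. N (X' n - X n)) \<longlonglongrightarrow> 0" "(\<lambda>n. N (Y' n - Y n)) \<longlonglongrightarrow> 0"
      using that X Y cls_eq_iff by auto
    have "(\<lambda>n. N (X' n * Y' n - X n * Y n)) \<longlonglongrightarrow> 0"
    proof (rule tendsto_sandwich[OF _ _ tendsto_const])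
      show "(\<lambda>n. N (X' n - X n) * C + B * N (Y' n - Y n)) \<longlonglongrightarrow> 0"
        using tendsto_add[OF tendsto_mult_left_zero[OF *(1)] tendsto_mult_right_zero[OF *(2)]] by simp
      have "N (X' n * Y' n - X n * Y n) \<le> N (X' n - X n) * C + B * N (Y' n - Y n)" for n
      proof -
        have "N (X' n * Y' n - X n * Y n) \<le> N ((X' n - X n) * Y' n) + N (X n * (Y' n - Y n))"
          using triangle[of "(X' n - X n) * Y' n" "X n * (Y' n - Y n)"] by (simp add: algebra_simps)
        also have "\<dots> \<le> N (X' n - X n) * C + B * N (Y' n - Y n)"
          by (intro add_mono p_mult_le B C order_refl)
        finally show ?thesis .
      qed
      then show "\<forall>\<^sub>F n in sequentially. N (X' n * Y' n - X n * Y n) \<le> N (X' n - X n) * C + B * N (Y' n - Y n)"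
        by simp
    qed (simp add: nonneg)
    then show ?thesis using that X Y by (simp add: cls_eq_iff CS_mult)
  qed
  then show ?thesis
    using cls_UN2[OF X Y, of "\<lambda>X Y. cls (\<lambda>n. X n * Y n)"] by (simp add: univ_cstar_def)
qed

lemma U_scale:
  assumes X: "X \<in> CS"
  shows "cscale U c (cls X) = cls (\<lambda>n. cst c * X n)"
proof -
  have "cls (\<lambda>n. cst c * X' n) = cls (\<lambda>n. cst c * X n)"
    if "X' \<in> CS" "cls X' = cls X" for X'
  proof -
    have "(\<lambda>n. cmod c * N (X' n - X n)) \<longlonglongrightarrow> 0"
      using that X cls_eq_iff by (auto intro: tendsto_mult_right_zero)
    then show ?thesis using that X
      by (simp add: cls_eq_iff CS_scale scale flip: right_diff_distrib)
  qed
  then show ?thesis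
    using cls_UN[OF X, of "\<lambda>X. cls (\<lambda>n. cst c * X n)"] by (simp add: univ_cstar_def scale_poly_cst)
qed

lemma U_star:
  assumes X: "X \<in> CS"
  shows "cstar U (cls X) = cls (\<lambda>n. star_poly (X n))"
proof -
  have "cls (\<lambda>n. star_poly (X' n)) = cls (\<lambda>n. star_poly (X n))"
    if "X' \<in> CS" "cls X' = cls X" for X'
    using that X cls_eq_iff by (simp add: cls_eq_iff CS_star flip: star_poly_diff)
  then show ?thesis
    using cls_UN[OF X, of "\<lambda>X. cls (\<lambda>n. star_poly (X n))"] by (simp add: univ_cstar_def)
qed

lemma lim_N_cong:
  assumes "X \<in> CS" "Y \<in> CS" "cls X = cls Y"
  shows "lim (\<lambda>n. N (X n)) = lim (\<lambda>n. N (Y n))"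
proof -
  have "(\<lambda>n. N (X n) - N (Y n)) \<longlonglongrightarrow> 0"
  proof (rule Lim_null_comparison)
    show "(\<lambda>n. N (X n - Y n)) \<longlonglongrightarrow> 0" using assms cls_eq_iff by blast
  qed (simp add: N_diff_abs)
  moreover have "(\<lambda>n. N (X n) - N (Y n)) \<longlonglongrightarrow> lim (\<lambda>n. N (X n)) - lim (\<lambda>n. N (Y n))"
    by (intro tendsto_diff CS_tendsto assms)
  ultimately show ?thesis using LIMSEQ_unique by fastforce
qed

lemma U_norm:
  assumes X: "X \<in> CS"
  shows "cnorm U (cls X) = lim (\<lambda>n. N (X n))"
proof -
  have eq: "univ_norm G R (Y n) = N (Y n)" if "Y \<in> CS" for Y n
    using that by (simp add: univ_norm_eq CS_free)
  have "lim (\<lambda>n. univ_norm G R (Y n)) = lim (\<lambda>n. N (X n))" if "Y \<in> cls X" for Y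
    using cls_member[OF that] lim_N_cong[of Y X] X eq by simp
  then have "(\<lambda>X. lim (\<lambda>n. univ_norm G R (X n))) ` cls X = {lim (\<lambda>n. N (X n))}"
    using cls_self[OF X] by auto
  then show ?thesis by (simp add: univ_cstar_def)
qed

lemma U_norm_tendsto: "X \<in> CS \<Longrightarrow> (\<lambda>n. N (X n)) \<longlonglongrightarrow> cnorm U (cls X)"
  by (simp add: U_norm CS_tendsto)

lemma U_norm_const: "x \<in> free_star_alg G \<Longrightarrow> cnorm U (cls (\<lambda>n. x)) = N x"
  using LIMSEQ_unique[OF U_norm_tendsto[OF CS_const] tendsto_const] by blast

lemmas CS_closed = CS_add CS_mult CS_scale CS_star CS_minus CS_diff CS_const
lemmas U_ops = U_zero U_add U_mult U_scale U_star

lemma U_dist: "X \<in> CS \<Longrightarrow> Y \<in> CS \<Longrightarrow> cdist U (cls X) (cls Y) = cnorm U (cls (\<lambda>n. X n - Y n))"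
  by (simp add: cdist_def U_ops CS_closed cst_minus)

lemma U_norm_le: "X \<in> CS \<Longrightarrow> (\<forall>\<^sub>F n in sequentially. N (X n) \<le> B) \<Longrightarrow> cnorm U (cls X) \<le> B"
  by (rule tendsto_upperbound[OF U_norm_tendsto]) auto

text \<open>A diagonal choice: from the n-th representative take a term beyond which it moves by
  less than \<open>1 / Suc n\<close>. These polynomials form a Cauchy sequence whose class is the
  limit.\<close>

lemma U_complete:
  assumes X: "\<And>n. X n \<in> elems U"
    and C: "\<forall>\<epsilon>>0. \<exists>M. \<forall>m\<ge>M. \<forall>n\<ge>M. cdist U (X m) (X n) < \<epsilon>"
  shows "\<exists>a\<in>elems U. (\<lambda>n. cdist U (X n) a) \<longlonglongrightarrow> 0"
proof -
  have "\<forall>n. \<exists>Y. Y \<in> CS \<and> X n = cls Y" using X elems_E by metis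
  then obtain Y where Y: "\<And>n. Y n \<in> CS" "\<And>n. X n = cls (Y n)" by metis
  have "\<forall>n. \<exists>k. \<forall>m\<ge>k. \<forall>l\<ge>k. N (Y n m - Y n l) < 1 / Suc n"
  proof
    fix n
    obtain M where "\<And>m l. m \<ge> M \<Longrightarrow> l \<ge> M \<Longrightarrow> N (Y n m - Y n l) < 1 / Suc n"
      using CS_D[OF Y(1), of "1 / Suc n" n] by auto
    then show "\<exists>k. \<forall>m\<ge>k. \<forall>l\<ge>k. N (Y n m - Y n l) < 1 / Suc n" by blast
  qed
  then obtain k where k: "\<And>n m l. m \<ge> k n \<Longrightarrow> l \<ge> k n \<Longrightarrow> N (Y n m - Y n l) < 1 / Suc n" by metis
  define Z where "Z n = Y n (k n)" for n
  have Zf: "Z n \<in> free_star_alg G" for n by (simp add: Z_def CS_free Y)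
  have XZ: "cdist U (X n) (cls (\<lambda>i. Z n)) \<le> 1 / Suc n" for n
  proof -
    have "cnorm U (cls (\<lambda>i. Y n i - Z n)) \<le> 1 / Suc n"
    proof (rule U_norm_le)
      show "\<forall>\<^sub>F i in sequentially. N (Y n i - Z n) \<le> 1 / Suc n"
        unfolding eventually_sequentially Z_def using k[of n] by (meson less_imp_le order_refl)
    qed (intro CS_closed Y Zf)
    then show ?thesis by (simp add: Y U_dist CS_closed Zf)
  qed
  \<comment> \<open>The distance of two classes is a limit of distances of their i-th terms; the
    triangle inequality is written at a common index \<open>i\<close>, which then tends to
    infinity.\<close>
  have Ztri: "N (Z m - Z n) \<le> 1 / Suc m + cdist U (X m) (X n) + 1 / Suc n" for m n
  proof -
    have "N (Z m - Z n) \<le> 1 / Suc m + N (Y m i - Y n i) + 1 / Suc n" if "i \<ge> max (k m) (k n)" for i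
    proof -
      have "N (Z m - Z n) \<le> N (Z m - Y m i) + N (Y m i - Y n i) + N (Y n i - Z n)"
        using triangle[of "Z m - Y m i" "Y m i - Y n i"] triangle[of "Z m - Y n i" "Y n i - Z n"] by simp
      moreover have "N (Z m - Y m i) < 1 / Suc m" "N (Y n i - Z n) < 1 / Suc n"
        unfolding Z_def using that by (intro k; simp)+
      ultimately show ?thesis by simp
    qed
    then have "\<forall>\<^sub>F i in sequentially. N (Z m - Z n) \<le> 1 / Suc m + N (Y m i - Y n i) + 1 / Suc n"
      unfolding eventually_sequentially by blast
    moreover have "(\<lambda>i. 1 / Suc m + N (Y m i - Y n i) + 1 / Suc n) \<longlonglongrightarrow>
        1 / Suc m + cdist U (X m) (X n) + 1 / Suc n"
      using U_norm_tendsto[of "\<lambda>i. Y m i - Y n i"] Y by (intro tendsto_intros) (simp add: U_dist CS_closed)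
    ultimately show ?thesis
      by (intro tendsto_lowerbound[OF _ _ sequentially_bot]) auto
  qed
  have Z: "Z \<in> CS"
  proof (rule CS_I)
    fix e :: real assume e: "0 < e"
    then obtain M where M: "\<And>m n. m \<ge> M \<Longrightarrow> n \<ge> M \<Longrightarrow> cdist U (X m) (X n) < e/3"
      using C by (metis divide_pos_pos zero_less_numeral)
    obtain L where L: "1 / Suc L < e/3" using nat_approx_posE[of "e/3"] e by auto
    have "1 / Suc m < e/3" if "m \<ge> L" for m
      using that by (intro le_less_trans[OF _ L]) (simp add: frac_le)
    then have "N (Z m - Z n) < e" if "m \<ge> max M L" "n \<ge> max M L" for m n
    proof -
      have "1 / Suc m < e/3" "1 / Suc n < e/3" "cdist U (X m) (X n) < e/3"
        using that \<open>\<And>m. m \<ge> L \<Longrightarrow> 1 / Suc m < e/3\<close> M by auto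
      then show ?thesis using Ztri[of m n] by linarith
    qed
    then show "\<exists>M. \<forall>m\<ge>M. \<forall>n\<ge>M. N (Z m - Z n) < e" by blast
  qed (rule Zf)
  have "(\<lambda>n. cdist U (X n) (cls Z)) \<longlonglongrightarrow> 0"
  proof (rule LIMSEQ_I)
    fix e :: real assume e: "0 < e"
    obtain M where M: "\<And>m n. m \<ge> M \<Longrightarrow> n \<ge> M \<Longrightarrow> N (Z m - Z n) < e/4"
      using CS_D[OF Z, of "e/4"] e by auto
    obtain L where L: "1 / Suc L < e/4" using nat_approx_posE[of "e/4"] e by auto
    have "norm (cdist U (X n) (cls Z) - 0) < e" if n: "n \<ge> max M L" for n
    proof -
      have "1 / Suc n < e/4"
        using n by (intro le_less_trans[OF _ L]) (simp add: frac_le)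
      have "cdist U (X n) (cls Z) \<le> e/2"
        unfolding Y U_dist[OF Y(1) Z]
      proof (rule U_norm_le)
        have "N (Y n i - Z i) \<le> e/2" if "i \<ge> max (k n) M" for i
          using triangle[of "Y n i - Z n" "Z n - Z i"] k[of n i "k n"] M[of n i] that n \<open>1 / Suc n < e/4\<close>
          by (simp add: Z_def)
        then show "\<forall>\<^sub>F i in sequentially. N (Y n i - Z i) \<le> e/2"
          unfolding eventually_sequentially by blast
      qed (intro CS_closed Y Z)
      moreover have "0 \<le> cdist U (X n) (cls Z)"
        unfolding Y U_dist[OF Y(1) Z]
        by (rule tendsto_lowerbound[OF U_norm_tendsto]) (auto simp: nonneg CS_closed Y Z)
      ultimately show ?thesis using e by simp
    qed
    then show "\<exists>no. \<forall>n\<ge>no. norm (cdist U (X n) (cls Z) - 0) < e" by blast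
  qed
  then show ?thesis using Z by auto
qed

theorem cstar_algebra_U: "cstar_algebra U"
proof
  fix a b d :: "'g univ_elem" and c k :: complex
  show "czero U \<in> elems U" by (simp add: U_zero CS_const)
  show "\<lbrakk>a \<in> elems U; b \<in> elems U\<rbrakk> \<Longrightarrow> cadd U a b \<in> elems U"
    by (elim elems_E) (simp add: U_ops CS_closed)
  show "a \<in> elems U \<Longrightarrow> cscale U c a \<in> elems U"
    by (elim elems_E) (simp add: U_ops CS_closed)
  show "\<lbrakk>a \<in> elems U; b \<in> elems U\<rbrakk> \<Longrightarrow> cmult U a b \<in> elems U"
    by (elim elems_E) (simp add: U_ops CS_closed)
  show "a \<in> elems U \<Longrightarrow> cstar U a \<in> elems U"
    by (elim elems_E) (simp add: U_ops CS_closed)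
  show "\<lbrakk>a \<in> elems U; b \<in> elems U; d \<in> elems U\<rbrakk> \<Longrightarrow> cadd U (cadd U a b) d = cadd U a (cadd U b d)"
    by (elim elems_E) (simp add: U_ops CS_closed add.assoc)
  show "\<lbrakk>a \<in> elems U; b \<in> elems U\<rbrakk> \<Longrightarrow> cadd U a b = cadd U b a"
    by (elim elems_E) (simp add: U_ops CS_closed add.commute)
  show "a \<in> elems U \<Longrightarrow> cadd U a (czero U) = a"
    by (elim elems_E) (simp add: U_ops CS_closed)
  show "a \<in> elems U \<Longrightarrow> cadd U a (cscale U (- 1) a) = czero U"
    by (elim elems_E) (simp add: U_ops CS_closed cst_minus)
  show "\<lbrakk>a \<in> elems U; b \<in> elems U\<rbrakk>
      \<Longrightarrow> cscale U c (cadd U a b) = cadd U (cscale U c a) (cscale U c b)"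
    by (elim elems_E) (simp add: U_ops CS_closed distrib_left)
  show "a \<in> elems U \<Longrightarrow> cscale U (c + k) a = cadd U (cscale U c a) (cscale U k a)"
    by (elim elems_E) (simp add: U_ops CS_closed cst_add distrib_right)
  show "a \<in> elems U \<Longrightarrow> cscale U c (cscale U k a) = cscale U (c * k) a"
    by (elim elems_E) (simp add: U_ops CS_closed cst_mult mult.assoc)
  show "a \<in> elems U \<Longrightarrow> cscale U 1 a = a"
    by (elim elems_E) (simp add: U_ops CS_closed)
  show "\<lbrakk>a \<in> elems U; b \<in> elems U; d \<in> elems U\<rbrakk>
      \<Longrightarrow> cmult U (cmult U a b) d = cmult U a (cmult U b d)"
    by (elim elems_E) (simp add: U_ops CS_closed mult.assoc)
  show "\<lbrakk>a \<in> elems U; b \<in> elems U; d \<in> elems U\<rbrakk>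
      \<Longrightarrow> cmult U a (cadd U b d) = cadd U (cmult U a b) (cmult U a d)"
    by (elim elems_E) (simp add: U_ops CS_closed distrib_left)
  show "\<lbrakk>a \<in> elems U; b \<in> elems U; d \<in> elems U\<rbrakk>
      \<Longrightarrow> cmult U (cadd U a b) d = cadd U (cmult U a d) (cmult U b d)"
    by (elim elems_E) (simp add: U_ops CS_closed distrib_right)
  show "\<lbrakk>a \<in> elems U; b \<in> elems U\<rbrakk> \<Longrightarrow> cmult U (cscale U c a) b = cscale U c (cmult U a b)"
    by (elim elems_E) (simp add: U_ops CS_closed mult.assoc)
  show "\<lbrakk>a \<in> elems U; b \<in> elems U\<rbrakk> \<Longrightarrow> cmult U a (cscale U c b) = cscale U c (cmult U a b)"
  proof (elim elems_E)
    fix X Y assume XY: "X \<in> CS" "a = cls X" "Y \<in> CS" "b = cls Y"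
    have "X n * (cst c * Y n) = cst c * (X n * Y n)" for n by (rule cst_left_comm)
    then show ?thesis using XY by (simp add: U_ops CS_closed)
  qed
  show "a \<in> elems U \<Longrightarrow> cstar U (cstar U a) = a"
    by (elim elems_E) (simp add: U_ops CS_closed)
  show "\<lbrakk>a \<in> elems U; b \<in> elems U\<rbrakk> \<Longrightarrow> cstar U (cadd U a b) = cadd U (cstar U a) (cstar U b)"
    by (elim elems_E) (simp add: U_ops CS_closed star_poly_add)
  show "a \<in> elems U \<Longrightarrow> cstar U (cscale U c a) = cscale U (cnj c) (cstar U a)"
    by (elim elems_E) (simp add: U_ops CS_closed star_poly_cst_mult)
  show "\<lbrakk>a \<in> elems U; b \<in> elems U\<rbrakk> \<Longrightarrow> cstar U (cmult U a b) = cmult U (cstar U b) (cstar U a)"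
    by (elim elems_E) (simp add: U_ops CS_closed star_poly_mult)
  show "a \<in> elems U \<Longrightarrow> 0 \<le> cnorm U a"
    by (elim elems_E) (auto intro!: tendsto_lowerbound[OF U_norm_tendsto] simp: nonneg)
  show "a \<in> elems U \<Longrightarrow> cnorm U a = 0 \<longleftrightarrow> a = czero U"
  proof (elim elems_E)
    fix X assume X: "X \<in> CS" "a = cls X"
    have "a = czero U \<longleftrightarrow> (\<lambda>n. N (X n)) \<longlonglongrightarrow> 0"
      using X by (simp add: U_zero cls_eq_iff CS_const)
    then show "cnorm U a = 0 \<longleftrightarrow> a = czero U"
      using U_norm_tendsto[OF X(1)] X(2) LIMSEQ_unique by auto
  qed
  show "\<lbrakk>a \<in> elems U; b \<in> elems U\<rbrakk> \<Longrightarrow> cnorm U (cadd U a b) \<le> cnorm U a + cnorm U b"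
  proof (elim elems_E)
    fix X Y assume XY: "X \<in> CS" "a = cls X" "Y \<in> CS" "b = cls Y"
    show ?thesis unfolding XY U_add[OF XY(1,3)]
      by (rule LIMSEQ_le[OF U_norm_tendsto tendsto_add[OF U_norm_tendsto U_norm_tendsto]])
        (auto simp: XY CS_closed triangle)
  qed
  show "a \<in> elems U \<Longrightarrow> cnorm U (cscale U c a) = cmod c * cnorm U a"
  proof (elim elems_E)
    fix X assume X: "X \<in> CS" "a = cls X"
    have "(\<lambda>n. N (cst c * X n)) \<longlonglongrightarrow> cmod c * cnorm U a"
      unfolding scale X by (intro tendsto_intros U_norm_tendsto X)
    then show ?thesis
      using X U_norm_tendsto[OF CS_scale[OF X(1)], of c] LIMSEQ_unique by (auto simp: U_scale)
  qed
  show "\<lbrakk>a \<in> elems U; b \<in> elems U\<rbrakk> \<Longrightarrow> cnorm U (cmult U a b) \<le> cnorm U a * cnorm U b"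
  proof (elim elems_E)
    fix X Y assume XY: "X \<in> CS" "a = cls X" "Y \<in> CS" "b = cls Y"
    show ?thesis unfolding XY U_mult[OF XY(1,3)]
      by (rule LIMSEQ_le[OF U_norm_tendsto tendsto_mult[OF U_norm_tendsto U_norm_tendsto]])
        (auto simp: XY CS_closed mult)
  qed
  show "a \<in> elems U \<Longrightarrow> cnorm U (cmult U (cstar U a) a) = (cnorm U a)\<^sup>2"
  proof (elim elems_E)
    fix X assume X: "X \<in> CS" "a = cls X"
    have "(\<lambda>n. N (star_poly (X n) * X n)) \<longlonglongrightarrow> (cnorm U a)\<^sup>2"
      unfolding cstar X by (intro tendsto_intros U_norm_tendsto X)
    then show ?thesis
      using X U_norm_tendsto[of "\<lambda>n. star_poly (X n) * X n"] LIMSEQ_unique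
      by (auto simp: U_ops CS_closed)
  qed
next
  fix X :: "nat \<Rightarrow> 'g univ_elem"
  assume "\<And>n. X n \<in> elems U" "\<forall>\<epsilon>>0. \<exists>M. \<forall>m\<ge>M. \<forall>n\<ge>M. cdist U (X m) (X n) < \<epsilon>"
  then show "\<exists>a\<in>elems U. (\<lambda>n. cdist U (X n) a) \<longlonglongrightarrow> 0" by (rule U_complete)
qed

end

section \<open>C*-algebras with explicit carriers\<close>

context cstar_algebra begin

abbreviation add_A (infixl \<open>\<oplus>\<close> 65) where "a \<oplus> b \<equiv> cadd A a b"
abbreviation mult_A (infixl \<open>\<otimes>\<close> 70) where "a \<otimes> b \<equiv> cmult A a b"
abbreviation scale_A (infixr \<open>\<cdot>\<close> 75) where "c \<cdot> a \<equiv> cscale A c a"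
abbreviation zero_A (\<open>\<zero>\<close>) where "\<zero> \<equiv> czero A"
abbreviation minus_A (infixl \<open>\<ominus>\<close> 65) where "a \<ominus> b \<equiv> a \<oplus> (- 1) \<cdot> b"

lemmas closed [simp] = zero_closed add_closed scale_closed mult_closed star_closed

lemma add_left_commute: "\<lbrakk>a \<in> elems A; b \<in> elems A; d \<in> elems A\<rbrakk> \<Longrightarrow> a \<oplus> (b \<oplus> d) = b \<oplus> (a \<oplus> d)"
  by (metis add_assoc add_commute)

lemma zero_add [simp]: "a \<in> elems A \<Longrightarrow> \<zero> \<oplus> a = a"
  using add_commute[of \<zero> a] add_zero by simp

lemma scale_zero_left [simp]: "a \<in> elems A \<Longrightarrow> 0 \<cdot> a = \<zero>"
  using scale_add_left[of a 1 "- 1"] by (simp add: scale_one add_minus)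

lemma scale_zero_right [simp]: "c \<cdot> \<zero> = \<zero>"
  using scale_scale[of \<zero> c 0] by simp

lemma mult_zero [simp]: "a \<in> elems A \<Longrightarrow> \<zero> \<otimes> a = \<zero>" "a \<in> elems A \<Longrightarrow> a \<otimes> \<zero> = \<zero>"
  using mult_scale_left[of \<zero> a 0] mult_scale_right[of a \<zero> 0] by auto

lemma star_zero [simp]: "cstar A \<zero> = \<zero>"
  using star_scale[of \<zero> 0] by simp

lemma norm_zero_A [simp]: "cnorm A \<zero> = 0"
  using norm_eq_zero by simp

lemma add_minus_cancel: "a \<in> elems A \<Longrightarrow> b \<in> elems A \<Longrightarrow> (a \<ominus> b) \<oplus> b = a"
  by (simp add: add_assoc add_commute[of "(- 1) \<cdot> b" b] add_minus add_zero)

lemma minus_telescope: "\<lbrakk>a \<in> elems A; b \<in> elems A; d \<in> elems A\<rbrakk> \<Longrightarrow> (a \<ominus> b) \<oplus> (b \<ominus> d) = a \<ominus> d"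
  using add_assoc[of "a \<ominus> b" b "(- 1) \<cdot> d"] by (simp add: add_minus_cancel)

lemma minus_minus: "a \<in> elems A \<Longrightarrow> b \<in> elems A \<Longrightarrow> (- 1) \<cdot> (a \<ominus> b) = b \<ominus> a"
  by (simp add: scale_add_right scale_scale scale_one add_commute)

lemma diff_eq_zero: "a \<in> elems A \<Longrightarrow> b \<in> elems A \<Longrightarrow> a \<ominus> b = \<zero> \<longleftrightarrow> a = b"
  by (metis add_minus add_minus_cancel closed(1) zero_add)

lemma norm_uminus: "a \<in> elems A \<Longrightarrow> cnorm A ((- 1) \<cdot> a) = cnorm A a"
  by (simp add: norm_scale)

lemma norm_star: "a \<in> elems A \<Longrightarrow> cnorm A (cstar A a) = cnorm A a"
proof -
  have "cnorm A a \<le> cnorm A (cstar A a)" if a: "a \<in> elems A" for a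
  proof (cases "cnorm A a = 0")
    case False
    have "cnorm A a * cnorm A a \<le> cnorm A (cstar A a) * cnorm A a"
      using norm_mult[of "cstar A a" a] cstar_identity[OF a] a by (simp add: power2_eq_square)
    then show ?thesis using False norm_nonneg[OF a] by (simp add: mult_le_cancel_right)
  qed (simp add: norm_nonneg a)
  from this[of a] this[of "cstar A a"] show "a \<in> elems A \<Longrightarrow> ?thesis" by (simp add: star_star)
qed

abbreviation dist_A (\<open>\<d>\<close>) where "\<d> \<equiv> cdist A"

lemma dist_nonneg: "a \<in> elems A \<Longrightarrow> b \<in> elems A \<Longrightarrow> 0 \<le> \<d> a b"
  by (simp add: cdist_def norm_nonneg)

lemma dist_sym: "a \<in> elems A \<Longrightarrow> b \<in> elems A \<Longrightarrow> \<d> a b = \<d> b a"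
  unfolding cdist_def by (metis closed(2,3) minus_minus norm_uminus)

lemma dist_tri: "\<lbrakk>a \<in> elems A; b \<in> elems A; d \<in> elems A\<rbrakk> \<Longrightarrow> \<d> a d \<le> \<d> a b + \<d> b d"
  using norm_triangle[of "a \<ominus> b" "b \<ominus> d"] by (simp add: cdist_def minus_telescope)

lemma dist_eq_0: "a \<in> elems A \<Longrightarrow> b \<in> elems A \<Longrightarrow> \<d> a b = 0 \<longleftrightarrow> a = b"
  by (simp add: cdist_def norm_eq_zero diff_eq_zero)

lemma dist_self [simp]: "a \<in> elems A \<Longrightarrow> \<d> a a = 0"
  by (simp add: dist_eq_0)

lemma dist_zero: "a \<in> elems A \<Longrightarrow> \<d> a \<zero> = cnorm A a"
  by (simp add: cdist_def add_zero)

lemma dist_star: "a \<in> elems A \<Longrightarrow> b \<in> elems A \<Longrightarrow> \<d> (cstar A a) (cstar A b) = \<d> a b"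
  using norm_star[of "a \<ominus> b"] by (simp add: cdist_def star_add star_scale)

lemma dist_scale: "a \<in> elems A \<Longrightarrow> b \<in> elems A \<Longrightarrow> \<d> (c \<cdot> a) (c \<cdot> b) = cmod c * \<d> a b"
  using norm_scale[of "a \<ominus> b" c] by (simp add: cdist_def scale_add_right scale_scale mult.commute)

lemma minus_add_minus:
  "\<lbrakk>a \<in> elems A; b \<in> elems A; a' \<in> elems A; b' \<in> elems A\<rbrakk> \<Longrightarrow>
    (a \<oplus> b) \<ominus> (a' \<oplus> b') = (a \<ominus> a') \<oplus> (b \<ominus> b')"
  by (simp add: scale_add_right add_assoc add_left_commute)

lemma dist_add: "\<lbrakk>a \<in> elems A; b \<in> elems A; a' \<in> elems A; b' \<in> elems A\<rbrakk> \<Longrightarrow>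
    \<d> (a \<oplus> b) (a' \<oplus> b') \<le> \<d> a a' + \<d> b b'"
  using norm_triangle[of "a \<ominus> a'" "b \<ominus> b'"] by (simp add: cdist_def minus_add_minus)

lemma dist_mult_left: "\<lbrakk>a \<in> elems A; b \<in> elems A; b' \<in> elems A\<rbrakk> \<Longrightarrow> \<d> (a \<otimes> b) (a \<otimes> b') \<le> cnorm A a * \<d> b b'"
  using norm_mult[of a "b \<ominus> b'"] by (simp add: cdist_def mult_add_right mult_scale_right)

lemma dist_mult_right: "\<lbrakk>a \<in> elems A; a' \<in> elems A; b \<in> elems A\<rbrakk> \<Longrightarrow> \<d> (a \<otimes> b) (a' \<otimes> b) \<le> \<d> a a' * cnorm A b"
  using norm_mult[of "a \<ominus> a'" b] by (simp add: cdist_def mult_add_left mult_scale_left)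

lemma dist_mult: "\<lbrakk>a \<in> elems A; a' \<in> elems A; b \<in> elems A; b' \<in> elems A\<rbrakk> \<Longrightarrow>
    \<d> (a \<otimes> b) (a' \<otimes> b') \<le> cnorm A a * \<d> b b' + \<d> a a' * cnorm A b'"
  using dist_tri[of "a \<otimes> b" "a \<otimes> b'" "a' \<otimes> b'"] dist_mult_left[of a b b'] dist_mult_right[of a a' b']
  by simp

lemma norm_le_dist: "a \<in> elems A \<Longrightarrow> b \<in> elems A \<Longrightarrow> cnorm A a \<le> \<d> a b + cnorm A b"
  using dist_tri[of a b \<zero>] by (simp add: dist_zero)

lemma eq_if_dist_le:
  assumes "a \<in> elems A" "b \<in> elems A" "e \<longlonglongrightarrow> 0" "\<And>n. \<d> a b \<le> e n"
  shows "a = b"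
proof -
  have "\<d> a b \<le> 0"
    using assms by (intro tendsto_lowerbound[OF assms(3)]) auto
  then show ?thesis using dist_nonneg[of a b] dist_eq_0[of a b] assms by simp
qed

lemma lim_unique:
  assumes "a \<in> elems A" "b \<in> elems A" "\<And>n. X n \<in> elems A"
    "(\<lambda>n. \<d> (X n) a) \<longlonglongrightarrow> 0" "(\<lambda>n. \<d> (X n) b) \<longlonglongrightarrow> 0"
  shows "a = b"
proof (rule eq_if_dist_le[OF assms(1,2)])
  show "(\<lambda>n. \<d> (X n) a + \<d> (X n) b) \<longlonglongrightarrow> 0" using tendsto_add[OF assms(4,5)] by simp
  show "\<d> a b \<le> \<d> (X n) a + \<d> (X n) b" for n
    using dist_tri[of a "X n" b] dist_sym[of a "X n"] assms by simp
qed

text \<open>\<open>b = 1 - (1 - h\<^sup>2)\<^sup>1\<^sup>/\<^sup>2\<close> is the fixed point of the contraction \<open>b \<mapsto> (h\<^sup>2 + b\<^sup>2)/2\<close>.\<close>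

lemma sqrt_complement:
  assumes h: "h \<in> elems A" "cstar A h = h" "cnorm A h < 1"
  obtains b where "b \<in> elems A" "cstar A b = b" "h \<otimes> b = b \<otimes> h" "b \<oplus> b = h \<otimes> h \<oplus> b \<otimes> b"
proof -
  define s where "s = cnorm A h"
  have s: "0 \<le> s" "s < 1" using h norm_nonneg by (auto simp: s_def)
  define T where "T b = (1/2) \<cdot> (h \<otimes> h \<oplus> b \<otimes> b)" for b
  define b where "b n = (T ^^ n) \<zero>" for n
  have b_simps: "b 0 = \<zero>" "b (Suc n) = T (b n)" for n by (simp_all add: b_def)
  have T_closed [simp]: "T a \<in> elems A" if "a \<in> elems A" for a using that h by (simp add: T_def)
  have b_closed [simp]: "b n \<in> elems A" for n by (induction n) (simp_all add: b_simps)
  \<comment> \<open>On the ball of radius \<open>s = cnorm A h\<close> the map \<open>T\<close>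
    stays inside, because \<open>(s * s + s * s) / 2 \<le> s\<close>, and contracts distances by the
    factor \<open>s < 1\<close>. The iterates start at zero and remain in this ball.\<close>
  have T_norm: "cnorm A (T a) \<le> s" if a: "a \<in> elems A" "cnorm A a \<le> s" for a
  proof -
    have "cnorm A (h \<otimes> h \<oplus> a \<otimes> a) \<le> cnorm A (h \<otimes> h) + cnorm A (a \<otimes> a)"
      using a h by (simp add: norm_triangle)
    also have "\<dots> \<le> s * s + s * s"
      using norm_mult[OF h(1) h(1)] norm_mult[OF a(1) a(1)] mult_mono[OF a(2) a(2)] s norm_nonneg[OF a(1)]
      unfolding s_def by linarith
    also have "\<dots> \<le> 2 * s" using s mult_left_le[of s s] by simp
    finally show ?thesis using a h by (simp add: T_def norm_scale)
  qed
  have b_norm: "cnorm A (b n) \<le> s" for n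
    by (induction n) (simp_all add: b_simps T_norm s)
  have T_contr: "\<d> (T a) (T a') \<le> s * \<d> a a'"
    if a: "a \<in> elems A" "a' \<in> elems A" "cnorm A a \<le> s" "cnorm A a' \<le> s" for a a'
  proof -
    have "\<d> (h \<otimes> h \<oplus> a \<otimes> a) (h \<otimes> h \<oplus> a' \<otimes> a') \<le> \<d> (h \<otimes> h) (h \<otimes> h) + \<d> (a \<otimes> a) (a' \<otimes> a')"
      using a h by (intro dist_add) auto
    also have "\<dots> \<le> cnorm A a * \<d> a a' + \<d> a a' * cnorm A a'"
      using a h dist_mult by simp
    also have "\<dots> \<le> s * \<d> a a' + \<d> a a' * s"
      using a dist_nonneg by (intro add_mono mult_right_mono mult_left_mono) auto
    finally show ?thesis using a h by (simp add: T_def dist_scale)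
  qed
  have b_dist: "\<d> (b (n + k)) (b n) \<le> s ^ n" for n k
  proof (induction n)
    case 0
    show ?case using b_norm[of k] s by (simp add: b_simps dist_zero)
  next
    case (Suc n)
    have "\<d> (b (Suc n + k)) (b (Suc n)) \<le> s * \<d> (b (n + k)) (b n)"
      by (simp add: b_simps T_contr b_norm)
    also have "\<dots> \<le> s * s ^ n" using Suc s by (intro mult_left_mono) auto
    finally show ?case by simp
  qed
  have s_pow: "(\<lambda>n. s ^ n) \<longlonglongrightarrow> 0" using s by (simp add: LIMSEQ_power_zero)
  have "\<forall>\<epsilon>>0. \<exists>M. \<forall>m\<ge>M. \<forall>n\<ge>M. \<d> (b m) (b n) < \<epsilon>"
  proof (intro allI impI)
    fix e :: real assume "0 < e"
    then obtain M where M: "s ^ M < e/2"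
      using order_tendstoD(2)[OF s_pow, of "e/2"] by (auto simp: eventually_sequentially)
    have "\<d> (b m) (b n) < e" if "m \<ge> M" "n \<ge> M" for m n
      using b_dist[of M "m - M"] b_dist[of M "n - M"] M that dist_tri[of "b m" "b M" "b n"]
        dist_sym[of "b M" "b n"] by simp
    then show "\<exists>M. \<forall>m\<ge>M. \<forall>n\<ge>M. \<d> (b m) (b n) < e" by blast
  qed
  then obtain d where d: "d \<in> elems A" "(\<lambda>n. \<d> (b n) d) \<longlonglongrightarrow> 0"
    using complete[of b] by auto
  have b_star: "cstar A (b n) = b n" for n
    by (induction n) (simp_all add: b_simps T_def star_scale star_add star_mult h)
  have b_comm: "h \<otimes> b n = b n \<otimes> h" for n
  proof (induction n)
    case (Suc n)
    have "h \<otimes> (b n \<otimes> b n) = b n \<otimes> b n \<otimes> h"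
      using Suc h mult_assoc[of h "b n" "b n"] mult_assoc[of "b n" h "b n"] mult_assoc[of "b n" "b n" h] by simp
    then show ?case
      using h by (simp add: b_simps T_def mult_scale_left mult_scale_right mult_add_left mult_add_right mult_assoc)
  qed (simp add: b_simps h)
  have d_norm: "cnorm A d \<le> s"
  proof (rule tendsto_lowerbound[OF _ _ sequentially_bot])
    show "(\<lambda>n. \<d> (b n) d + s) \<longlonglongrightarrow> s" using tendsto_add[OF d(2) tendsto_const] by simp
    show "\<forall>\<^sub>F n in sequentially. cnorm A d \<le> \<d> (b n) d + s"
      using norm_le_dist[OF d(1), of "b n" for n] b_norm dist_sym[OF d(1)]
      by (intro always_eventually allI) (metis add_left_mono b_closed order_trans)
  qed
  have lim1: "(\<lambda>n. C * \<d> (b n) d) \<longlonglongrightarrow> 0" for C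
    using d(2) by (rule tendsto_mult_right_zero)
  have "cstar A d = d"
  proof (rule eq_if_dist_le[OF _ _ lim1[of 2]])
    show "\<d> (cstar A d) d \<le> 2 * \<d> (b n) d" for n
      using dist_tri[of "cstar A d" "b n" d] dist_star[of "b n" d] d(1) dist_sym[of "cstar A d" "b n"]
      by (simp add: b_star)
  qed (simp_all add: d)
  moreover have "h \<otimes> d = d \<otimes> h"
  proof (rule eq_if_dist_le[OF _ _ lim1[of "2 * s"]])
    fix n
    have "\<d> (h \<otimes> d) (h \<otimes> b n) \<le> s * \<d> (b n) d" "\<d> (b n \<otimes> h) (d \<otimes> h) \<le> \<d> (b n) d * s"
      unfolding s_def using dist_mult_left[of h d "b n"] dist_mult_right[of "b n" d h] d h dist_sym[of d "b n"]
      by simp_all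
    then show "\<d> (h \<otimes> d) (d \<otimes> h) \<le> 2 * s * \<d> (b n) d"
      using dist_tri[of "h \<otimes> d" "h \<otimes> b n" "d \<otimes> h"] d h by (simp add: b_comm algebra_simps)
  qed (simp_all add: d h)
  moreover have "T d = d"
  proof (rule eq_if_dist_le)
    show "(\<lambda>n. s * \<d> (b n) d + \<d> (b (Suc n)) d) \<longlonglongrightarrow> 0"
      using tendsto_add[OF lim1[of s] LIMSEQ_Suc[OF d(2)]] by simp
    show "\<d> (T d) d \<le> s * \<d> (b n) d + \<d> (b (Suc n)) d" for n
      using dist_tri[of "T d" "b (Suc n)" d] T_contr[of d "b n"] d d_norm b_norm dist_sym[of d "b n"]
      by (simp add: b_simps)
  qed (simp_all add: d)
  moreover have "d \<oplus> d = h \<otimes> h \<oplus> d \<otimes> d" if "T d = d"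
  proof -
    have "d \<oplus> d = 2 \<cdot> T d"
      using scale_add_left[OF d(1), of 1 1] that by (simp add: scale_one d)
    then show ?thesis using d h by (simp add: T_def scale_scale scale_one)
  qed
  ultimately show ?thesis using that d by blast
qed

text \<open>With \<open>1 - b\<close> as square root of \<open>1 - x^2\<close>, the element
  \<open>x + j (1 - b)\<close> is unitary: \<open>b + b = x^2 + b^2\<close> says
  \<open>(1 - b)^2 = 1 - x^2\<close>, and the cross terms cancel as \<open>x\<close> and
  \<open>b\<close> commute. Since \<open>A\<close> may lack a unit, the unitary appears only through
  its action on an element \<open>c\<close>.\<close>

lemma unitary_isometry:
  assumes x: "x \<in> elems A" "cstar A x = x" and b: "b \<in> elems A" "cstar A b = b"
    and xb: "x \<otimes> b = b \<otimes> x" "b \<oplus> b = x \<otimes> x \<oplus> b \<otimes> b"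
    and c: "c \<in> elems A" and j: "j\<^sup>2 = - 1" "cnj j = - j"
  shows "cnorm A (x \<otimes> c \<oplus> j \<cdot> (c \<ominus> b \<otimes> c)) = cnorm A c"
proof -
  define w where "w = cstar A c"
  define y where "y = c \<ominus> b \<otimes> c"
  define v where "v = w \<ominus> w \<otimes> b"
  have [simp]: "w \<in> elems A" "y \<in> elems A" "v \<in> elems A" using x b c by (simp_all add: w_def y_def v_def)
  note [simp] = x(1) b(1) c
  have v: "cstar A y = v" by (simp add: y_def v_def w_def star_add star_scale star_mult b)
  have "cstar A (x \<otimes> c \<oplus> j \<cdot> y) = w \<otimes> x \<oplus> (- j) \<cdot> v"
    by (simp add: star_add star_scale star_mult x v j w_def)
  then have "cstar A (x \<otimes> c \<oplus> j \<cdot> y) \<otimes> (x \<otimes> c \<oplus> j \<cdot> y)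
      = ((w \<otimes> x) \<otimes> (x \<otimes> c) \<oplus> j \<cdot> ((w \<otimes> x) \<otimes> y)) \<oplus> ((- j) \<cdot> (v \<otimes> (x \<otimes> c)) \<oplus> v \<otimes> y)"
    using j by (simp add: mult_add_left mult_add_right mult_scale_left mult_scale_right scale_scale
        scale_one scale_add_right add_assoc add_left_commute power2_eq_square)
  also have "(w \<otimes> x) \<otimes> y = v \<otimes> (x \<otimes> c)"
  proof -
    have "x \<otimes> (b \<otimes> c) = b \<otimes> (x \<otimes> c)" using mult_assoc[of x b c] mult_assoc[of b x c] xb by simp
    then show ?thesis
      by (simp add: y_def v_def mult_add_left mult_add_right mult_scale_left mult_scale_right mult_assoc)
  qed
  also have "((w \<otimes> x) \<otimes> (x \<otimes> c) \<oplus> j \<cdot> (v \<otimes> (x \<otimes> c))) \<oplus> ((- j) \<cdot> (v \<otimes> (x \<otimes> c)) \<oplus> v \<otimes> y)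
     = (w \<otimes> x) \<otimes> (x \<otimes> c) \<oplus> ((j \<cdot> (v \<otimes> (x \<otimes> c)) \<oplus> (- j) \<cdot> (v \<otimes> (x \<otimes> c))) \<oplus> v \<otimes> y)"
    by (simp add: add_assoc)
  also have "j \<cdot> (v \<otimes> (x \<otimes> c)) \<oplus> (- j) \<cdot> (v \<otimes> (x \<otimes> c)) = \<zero>"
    using scale_add_left[of "v \<otimes> (x \<otimes> c)" j "- j"] by simp
  also have "(w \<otimes> x) \<otimes> (x \<otimes> c) \<oplus> (\<zero> \<oplus> v \<otimes> y) = w \<otimes> c"
  proof -
    define p where "p = w \<otimes> (x \<otimes> x) \<otimes> c"
    define q where "q = w \<otimes> b \<otimes> c"
    define r where "r = w \<otimes> (b \<otimes> b) \<otimes> c"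
    have [simp]: "p \<in> elems A" "q \<in> elems A" "r \<in> elems A" by (simp_all add: p_def q_def r_def)
    have pr: "p \<oplus> r = q \<oplus> q"
    proof -
      have "p \<oplus> r = w \<otimes> (x \<otimes> x \<oplus> b \<otimes> b) \<otimes> c"
        by (simp add: p_def r_def mult_add_left mult_add_right)
      also have "\<dots> = w \<otimes> (b \<oplus> b) \<otimes> c" using xb by simp
      finally show ?thesis by (simp add: q_def mult_add_left mult_add_right)
    qed
    have "v \<otimes> y = w \<otimes> c \<oplus> (((- 1) \<cdot> q \<oplus> (- 1) \<cdot> q) \<oplus> r)"
      by (simp add: y_def v_def mult_add_left mult_add_right mult_scale_left mult_scale_right
          scale_add_right scale_scale scale_one q_def r_def mult_assoc add_assoc)
    moreover have "(w \<otimes> x) \<otimes> (x \<otimes> c) = p" by (simp add: p_def mult_assoc)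
    moreover have "p \<oplus> (w \<otimes> c \<oplus> (((- 1) \<cdot> q \<oplus> (- 1) \<cdot> q) \<oplus> r)) = w \<otimes> c \<oplus> ((p \<oplus> r) \<oplus> (- 1) \<cdot> (q \<oplus> q))"
      by (simp add: scale_add_right add_assoc add_commute add_left_commute)
    ultimately show ?thesis by (simp add: pr add_minus add_zero)
  qed
  finally have "(cnorm A (x \<otimes> c \<oplus> j \<cdot> y))\<^sup>2 = (cnorm A c)\<^sup>2"
    using cstar_identity[of "x \<otimes> c \<oplus> j \<cdot> y"] cstar_identity[of c] by (simp add: w_def)
  then show ?thesis
    unfolding y_def by (rule power2_eq_imp_eq) (auto intro!: norm_nonneg)
qed

text \<open>\<open>x\<close> is the mean of the unitaries \<open>x + i (1 - b)\<close> and
  \<open>x - i (1 - b)\<close>. Applied to \<open>x\<close> itself this bounds the norm of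
  \<open>x \<otimes> x\<close> by that of \<open>x\<close>, which by the C*-identity reads
  \<open>t^2 \<le> t\<close> for \<open>t = cnorm A x\<close>.\<close>

lemma norm_le_1_if_sqrt_complement:
  assumes x: "x \<in> elems A" "cstar A x = x" and b: "b \<in> elems A" "cstar A b = b"
    and xb: "x \<otimes> b = b \<otimes> x" "b \<oplus> b = x \<otimes> x \<oplus> b \<otimes> b"
  shows "cnorm A x \<le> 1"
proof -
  let ?y = "x \<ominus> b \<otimes> x"
  let ?u = "x \<otimes> x \<oplus> \<i> \<cdot> ?y" and ?v = "x \<otimes> x \<oplus> (- \<i>) \<cdot> ?y"
  have y: "?y \<in> elems A" using x b by simp
  have "?u \<oplus> ?v = (x \<otimes> x \<oplus> x \<otimes> x) \<oplus> (\<i> \<cdot> ?y \<oplus> (- \<i>) \<cdot> ?y)"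
    using x y by (simp add: add_assoc add_left_commute)
  also have "\<i> \<cdot> ?y \<oplus> (- \<i>) \<cdot> ?y = \<zero>"
    using scale_add_left[OF y, of \<i> "- \<i>"] y by simp
  also have "(x \<otimes> x \<oplus> x \<otimes> x) \<oplus> \<zero> = 2 \<cdot> (x \<otimes> x)"
    using scale_add_left[of "x \<otimes> x" 1 1] x by (simp add: add_zero scale_one)
  finally have "2 * cnorm A (x \<otimes> x) = cnorm A (?u \<oplus> ?v)" using x by (simp add: norm_scale)
  also have "\<dots> \<le> cnorm A ?u + cnorm A ?v" using x y by (intro norm_triangle) auto
  also have "\<dots> = 2 * cnorm A x"
    using unitary_isometry[OF x b xb x(1), of \<i>] unitary_isometry[OF x b xb x(1), of "- \<i>"] by simp
  finally have "cnorm A x * cnorm A x \<le> cnorm A x"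
    using cstar_identity[OF x(1)] x(2) by (simp add: power2_eq_square)
  then show ?thesis
    using mult_strict_right_mono[of 1 "cnorm A x" "cnorm A x"] by (cases "1 < cnorm A x") auto
qed

end

lemma star_homD:
  assumes "star_hom A B \<phi>" "a \<in> elems A" "b \<in> elems A"
  shows "\<phi> a \<in> elems B" "\<phi> (cadd A a b) = cadd B (\<phi> a) (\<phi> b)" "\<phi> (cscale A c a) = cscale B c (\<phi> a)"
    "\<phi> (cmult A a b) = cmult B (\<phi> a) (\<phi> b)" "\<phi> (cstar A a) = cstar B (\<phi> a)"
  using assms by (auto simp: star_hom_def)

text \<open>The complement \<open>b\<close> of \<open>h\<close> is carried to one of
  \<open>\<phi> h\<close>, so self-adjoint elements of norm below 1 go into the unit ball. Scaling
  and the C*-identity extend this to all elements. Contractivity is what lets *-homomorphisms pass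
  to limits.\<close>

theorem star_hom_contractive:
  assumes A: "cstar_algebra A" and B: "cstar_algebra B" and \<phi>: "star_hom A B \<phi>" and a: "a \<in> elems A"
  shows "cnorm B (\<phi> a) \<le> cnorm A a"
proof -
  interpret A: cstar_algebra A by fact
  interpret B: cstar_algebra B by fact
  note hom = star_homD[OF \<phi>]
  have unit: "cnorm B (\<phi> h) \<le> 1" if h: "h \<in> elems A" "cstar A h = h" "cnorm A h < 1" for h
  proof -
    obtain b where b: "b \<in> elems A" "cstar A b = b" "cmult A h b = cmult A b h"
      "cadd A b b = cadd A (cmult A h h) (cmult A b b)"
      using A.sqrt_complement[OF h] by blast
    show ?thesis
    proof (rule B.norm_le_1_if_sqrt_complement)
      show "\<phi> h \<in> elems B" "\<phi> b \<in> elems B" using hom(1) h b by auto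
      show "cstar B (\<phi> h) = \<phi> h" "cstar B (\<phi> b) = \<phi> b"
        using hom(5)[of h h] hom(5)[of b b] h b by auto
      show "cmult B (\<phi> h) (\<phi> b) = cmult B (\<phi> b) (\<phi> h)"
        using hom(4)[of h b] hom(4)[of b h] h b by simp
      show "cadd B (\<phi> b) (\<phi> b) = cadd B (cmult B (\<phi> h) (\<phi> h)) (cmult B (\<phi> b) (\<phi> b))"
        using hom(2)[of b b] hom(2)[of "cmult A h h" "cmult A b b"] hom(4)[of h h] hom(4)[of b b] h b by simp
    qed
  qed
  have self: "cnorm B (\<phi> h) \<le> cnorm A h" if h: "h \<in> elems A" "cstar A h = h" for h
  proof (rule dense_ge)
    fix t assume t: "cnorm A h < t"
    have t0: "0 < t" using t A.norm_nonneg[OF h(1)] by simp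
    let ?h = "cscale A (of_real (1/t)) h"
    have "cnorm B (\<phi> ?h) \<le> 1"
      using h t t0 by (intro unit) (simp_all add: A.star_scale A.norm_scale norm_divide)
    then show "cnorm B (\<phi> h) \<le> t"
      using hom(3)[of h h] hom(1)[of h h] h t0 by (simp add: B.norm_scale norm_divide divide_le_eq)
  qed
  have "(cnorm B (\<phi> a))\<^sup>2 = cnorm B (\<phi> (cmult A (cstar A a) a))"
    using hom(4)[of "cstar A a" a] hom(5)[OF a a] hom(1)[OF a a] a by (simp add: B.cstar_identity)
  also have "\<dots> \<le> (cnorm A a)\<^sup>2"
    using self[of "cmult A (cstar A a) a"] a by (simp add: A.star_mult A.star_star A.cstar_identity)
  finally show ?thesis by (rule power2_le_imp_le) (simp add: A.norm_nonneg a)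
qed

lemma star_hom_diff:
  assumes "cstar_algebra A" "star_hom A B \<phi>" "a \<in> elems A" "b \<in> elems A"
  shows "\<phi> (cadd A a (cscale A (- 1) b)) = cadd B (\<phi> a) (cscale B (- 1) (\<phi> b))"
  using star_homD[OF assms(2)] assms cstar_algebra.scale_closed by metis

lemma star_hom_dist_le:
  assumes "cstar_algebra A" "cstar_algebra B" "star_hom A B \<phi>" "a \<in> elems A" "b \<in> elems A"
  shows "cdist B (\<phi> a) (\<phi> b) \<le> cdist A a b"
  using star_hom_contractive[OF assms(1-3), of "cadd A a (cscale A (- 1) b)"] star_hom_diff[OF assms(1,3-5)] assms
  by (simp add: cdist_def cstar_algebra.add_closed cstar_algebra.scale_closed)

subsection \<open>The tensor product with \<open>C(S\<^sup>1)\<close>\<close>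

lemma one_in_circle [simp]: "1 \<in> circle"
  by simp

lemma circle_mult: "\<mu> \<in> circle \<Longrightarrow> z \<in> circle \<Longrightarrow> \<mu> * z \<in> circle"
  by (simp add: norm_mult)

declare mem_sphere [simp del] mem_sphere_0 [simp del]

context cstar_algebra begin

abbreviation T where "T \<equiv> tensor_C A"

lemma alg_tensor_PiE: "F \<in> alg_tensor_C A \<Longrightarrow> F \<in> circle \<rightarrow>\<^sub>E elems A"
  by (induction rule: alg_tensor_C.induct)
    (auto simp: elem_tensor_def intro!: add_closed scale_closed dest: PiE_mem)

lemma alg_tensor_closed [simp]: "F \<in> alg_tensor_C A \<Longrightarrow> z \<in> circle \<Longrightarrow> F z \<in> elems A"
  using alg_tensor_PiE by blast

lemma alg_tensor_restrict: "F \<in> alg_tensor_C A \<Longrightarrow> (\<lambda>z\<in>circle. F z) = F"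
  using alg_tensor_PiE[of F] by (auto simp: PiE_iff extensional_restrict)

lemma alg_tensor_add:
  assumes F: "F \<in> alg_tensor_C A" and G: "G \<in> alg_tensor_C A"
  shows "(\<lambda>z\<in>circle. F z \<oplus> G z) \<in> alg_tensor_C A"
  using G
proof (induction rule: alg_tensor_C.induct)
  case zero
  have "(\<lambda>z\<in>circle. F z \<oplus> (\<lambda>z\<in>circle. \<zero>) z) = (\<lambda>z\<in>circle. F z)"
    using F by (intro restrict_ext) (simp add: add_zero)
  then show ?case using F alg_tensor_restrict by simp
next
  case (add G a g)
  have "(\<lambda>z\<in>circle. F z \<oplus> (\<lambda>z\<in>circle. G z \<oplus> elem_tensor A a g z) z)
      = (\<lambda>z\<in>circle. (\<lambda>z\<in>circle. F z \<oplus> G z) z \<oplus> elem_tensor A a g z)"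
    using F add by (intro restrict_ext) (simp add: add_assoc elem_tensor_def)
  then show ?case using alg_tensor_C.add[OF add.IH add.hyps(2,3)] by (simp only:)
qed

lemma alg_tensor_elem:
  assumes "a \<in> elems A" "continuous_on circle g"
  shows "elem_tensor A a g \<in> alg_tensor_C A"
proof -
  have "(\<lambda>z\<in>circle. (\<lambda>z\<in>circle. \<zero>) z \<oplus> elem_tensor A a g z) = elem_tensor A a g"
    using assms by (auto simp: elem_tensor_def fun_eq_iff)
  then show ?thesis using alg_tensor_C.add[OF alg_tensor_C.zero assms] by simp
qed

text \<open>The map \<open>h\<close> depends on the point \<open>z\<close>: for products it is
  multiplication by \<open>F z\<close>, one factor being held fixed while the other runs through
  elementary tensors.\<close>

lemma alg_tensor_map:
  assumes F: "F \<in> alg_tensor_C A" and h: "\<And>z. z \<in> circle \<Longrightarrow> h z \<zero> = czero B"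
    and add: "\<And>z a b. z \<in> circle \<Longrightarrow> a \<in> elems A \<Longrightarrow> b \<in> elems A \<Longrightarrow> h z (a \<oplus> b) = cadd B (h z a) (h z b)"
    and B: "cstar_algebra B"
    and elem: "\<And>a g. a \<in> elems A \<Longrightarrow> continuous_on circle g \<Longrightarrow>
      (\<lambda>z\<in>circle. h z (g z \<cdot> a)) \<in> alg_tensor_C B"
  shows "(\<lambda>z\<in>circle. h z (F z)) \<in> alg_tensor_C B"
  using F
proof (induction rule: alg_tensor_C.induct)
  case zero
  have "(\<lambda>z\<in>circle. h z ((\<lambda>z\<in>circle. \<zero>) z)) = (\<lambda>z\<in>circle. czero B)"
    by (intro restrict_ext) (simp add: h)
  then show ?case using alg_tensor_C.zero[of B] by (simp only:)
next
  case (add F a g)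
  have "(\<lambda>z\<in>circle. h z ((\<lambda>z\<in>circle. F z \<oplus> elem_tensor A a g z) z)) =
      (\<lambda>z\<in>circle. cadd B ((\<lambda>z\<in>circle. h z (F z)) z) ((\<lambda>z\<in>circle. h z (g z \<cdot> a)) z))"
    using add by (intro restrict_ext) (simp add: assms(3) elem_tensor_def)
  then show ?case
    using cstar_algebra.alg_tensor_add[OF B add.IH elem[OF add.hyps(2,3)]] by (simp only:)
qed

lemma alg_tensor_scale:
  assumes "F \<in> alg_tensor_C A"
  shows "(\<lambda>z\<in>circle. c \<cdot> F z) \<in> alg_tensor_C A"
proof (rule alg_tensor_map[OF assms])
  fix a g assume ag: "a \<in> elems A" "continuous_on circle (g :: complex \<Rightarrow> complex)"
  have "(\<lambda>z\<in>circle. c \<cdot> g z \<cdot> a) = elem_tensor A a (\<lambda>z. c * g z)"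
    using ag by (auto simp: elem_tensor_def fun_eq_iff scale_scale)
  then show "(\<lambda>z\<in>circle. c \<cdot> g z \<cdot> a) \<in> alg_tensor_C A"
    using alg_tensor_elem[OF ag(1), of "\<lambda>z. c * g z"] ag(2) by (simp add: continuous_on_mult_left)
qed (auto simp: scale_add_right cstar_algebra_axioms)

lemma alg_tensor_star:
  assumes "F \<in> alg_tensor_C A"
  shows "(\<lambda>z\<in>circle. cstar A (F z)) \<in> alg_tensor_C A"
proof (rule alg_tensor_map[OF assms])
  fix a g assume ag: "a \<in> elems A" "continuous_on circle (g :: complex \<Rightarrow> complex)"
  have "(\<lambda>z\<in>circle. cstar A (g z \<cdot> a)) = elem_tensor A (cstar A a) (\<lambda>z. cnj (g z))"
    using ag by (auto simp: elem_tensor_def fun_eq_iff star_scale)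
  then show "(\<lambda>z\<in>circle. cstar A (g z \<cdot> a)) \<in> alg_tensor_C A"
    using alg_tensor_elem[of "cstar A a" "\<lambda>z. cnj (g z)"] ag by (auto intro: continuous_intros)
qed (auto simp: star_add cstar_algebra_axioms)

lemma alg_tensor_mult:
  assumes F: "F \<in> alg_tensor_C A" and G: "G \<in> alg_tensor_C A"
  shows "(\<lambda>z\<in>circle. F z \<otimes> G z) \<in> alg_tensor_C A"
proof (rule alg_tensor_map[OF G])
  fix b k assume bk: "b \<in> elems A" "continuous_on circle (k :: complex \<Rightarrow> complex)"
  show "(\<lambda>z\<in>circle. F z \<otimes> k z \<cdot> b) \<in> alg_tensor_C A"
  proof (rule alg_tensor_map[OF F])
    fix a g assume ag: "a \<in> elems A" "continuous_on circle (g :: complex \<Rightarrow> complex)"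
    have "(\<lambda>z\<in>circle. g z \<cdot> a \<otimes> k z \<cdot> b) = elem_tensor A (a \<otimes> b) (\<lambda>z. k z * g z)"
      using ag bk by (auto simp: elem_tensor_def fun_eq_iff mult_scale_left mult_scale_right scale_scale)
    then show "(\<lambda>z\<in>circle. g z \<cdot> a \<otimes> k z \<cdot> b) \<in> alg_tensor_C A"
      using alg_tensor_elem[of "a \<otimes> b" "\<lambda>z. k z * g z"] ag bk by (auto intro: continuous_intros)
  qed (auto simp: mult_add_left bk cstar_algebra_axioms)
qed (auto simp: mult_add_right F cstar_algebra_axioms)

lemma alg_tensor_rotation:
  assumes F: "F \<in> alg_tensor_C A" and \<mu>: "\<mu> \<in> circle"
  shows "rotation \<mu> F \<in> alg_tensor_C A"
  using F
proof (induction rule: alg_tensor_C.induct)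
  case zero
  have "rotation \<mu> (\<lambda>z\<in>circle. \<zero>) = (\<lambda>z\<in>circle. \<zero>)"
    using circle_mult[OF \<mu>] by (auto simp: rotation_def fun_eq_iff)
  then show ?case using alg_tensor_C.zero[of A] by (simp only:)
next
  case (add F a g)
  have "rotation \<mu> (\<lambda>z\<in>circle. F z \<oplus> elem_tensor A a g z)
      = (\<lambda>z\<in>circle. rotation \<mu> F z \<oplus> elem_tensor A a (\<lambda>z. g (\<mu> * z)) z)"
    using circle_mult[OF \<mu>] by (auto simp: rotation_def elem_tensor_def fun_eq_iff)
  moreover have "continuous_on circle (\<lambda>z. g (\<mu> * z))"
    using circle_mult[OF \<mu>] by (intro continuous_on_compose2[OF add.hyps(3)] continuous_intros) blast
  ultimately show ?case
    using alg_tensor_C.add[OF add.IH add.hyps(2), of "\<lambda>z. g (\<mu> * z)"] by (simp only:)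
qed

lemma alg_tensor_bounded:
  "F \<in> alg_tensor_C A \<Longrightarrow> \<exists>B. \<forall>z\<in>circle. cnorm A (F z) \<le> B"
proof (induction rule: alg_tensor_C.induct)
  case (add F a g)
  then obtain B where B: "\<And>z. z \<in> circle \<Longrightarrow> cnorm A (F z) \<le> B" by blast
  have "bounded (g ` circle)"
    using compact_continuous_image[OF add.hyps(3) compact_sphere] by (rule compact_imp_bounded)
  then obtain C where C: "\<And>z. z \<in> circle \<Longrightarrow> cmod (g z) \<le> C" by (auto simp: bounded_iff)
  have "cnorm A (F z \<oplus> elem_tensor A a g z) \<le> B + C * cnorm A a" if z: "z \<in> circle" for z
  proof -
    have "cnorm A (F z \<oplus> g z \<cdot> a) \<le> cnorm A (F z) + cmod (g z) * cnorm A a"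
      using norm_triangle[of "F z" "g z \<cdot> a"] add z by (simp add: norm_scale)
    also have "\<dots> \<le> B + C * cnorm A a"
      using B[OF z] C[OF z] norm_nonneg[OF add.hyps(2)] by (intro add_mono mult_right_mono) auto
    finally show ?thesis using z by (simp add: elem_tensor_def)
  qed
  then show ?case by (intro exI[of _ "B + C * cnorm A a"]) simp
qed (auto intro!: exI[of _ 0])

text \<open>Uniform continuity survives uniform limits. It gives the continuity of the rotation
  action and later lets finitely many points of the circle control all of it.\<close>

lemma alg_tensor_uniformly_continuous:
  "F \<in> alg_tensor_C A \<Longrightarrow> 0 < \<epsilon> \<Longrightarrow>
    \<exists>\<delta>>0. \<forall>z\<in>circle. \<forall>w\<in>circle. dist z w < \<delta> \<longrightarrow> \<d> (F z) (F w) < \<epsilon>"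
proof (induction arbitrary: \<epsilon> rule: alg_tensor_C.induct)
  case zero
  then show ?case by (intro exI[of _ 1]) simp
next
  case (add F a g)
  \<comment> \<open>Adding 1 keeps the divisor positive when \<open>a\<close> is zero.\<close>
  define K where "K = cnorm A a + 1"
  have K: "0 < K" "cnorm A a \<le> K" using norm_nonneg[OF add.hyps(2)] by (auto simp: K_def)
  obtain \<delta>1 where \<delta>1: "\<delta>1 > 0" "\<And>z w. z \<in> circle \<Longrightarrow> w \<in> circle \<Longrightarrow> dist z w < \<delta>1 \<Longrightarrow> \<d> (F z) (F w) < \<epsilon>/2"
    using add.IH[of "\<epsilon>/2"] add.prems by auto
  have "uniformly_continuous_on circle g"
    using add.hyps(3) by (intro compact_uniformly_continuous) auto
  moreover have "0 < \<epsilon> / (2 * K)" using add.prems K by simp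
  ultimately obtain \<delta>2 where \<delta>2: "\<delta>2 > 0"
    "\<And>z w. z \<in> circle \<Longrightarrow> w \<in> circle \<Longrightarrow> dist z w < \<delta>2 \<Longrightarrow> dist (g z) (g w) < \<epsilon>/(2*K)"
    unfolding uniformly_continuous_on_def by (metis dist_commute)
  show ?case
  proof (intro exI[of _ "min \<delta>1 \<delta>2"] conjI ballI impI)
    fix z w assume zw: "z \<in> circle" "w \<in> circle" "dist z w < min \<delta>1 \<delta>2"
    have "\<d> (g z \<cdot> a) (g w \<cdot> a) = cmod (g z - g w) * cnorm A a"
      using scale_add_left[OF add.hyps(2), of "g z" "- g w"] norm_scale[OF add.hyps(2), of "g z - g w"]
      by (simp add: cdist_def scale_scale add.hyps)
    also have "\<dots> \<le> \<epsilon>/(2*K) * K"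
      using \<delta>2(2)[OF zw(1,2)] zw(3) K norm_nonneg[OF add.hyps(2)] add.prems
      by (intro mult_mono) (auto simp: dist_norm)
    finally have "\<d> (g z \<cdot> a) (g w \<cdot> a) \<le> \<epsilon>/2" using K by simp
    moreover have "\<d> (F z) (F w) < \<epsilon>/2" using \<delta>1(2)[OF zw(1,2)] zw(3) by simp
    moreover have "\<d> (F z \<oplus> g z \<cdot> a) (F w \<oplus> g w \<cdot> a) \<le> \<d> (F z) (F w) + \<d> (g z \<cdot> a) (g w \<cdot> a)"
      using zw add.hyps by (intro dist_add) auto
    ultimately show "\<d> ((\<lambda>z\<in>circle. F z \<oplus> elem_tensor A a g z) z) ((\<lambda>z\<in>circle. F z \<oplus> elem_tensor A a g z) w) < \<epsilon>"
      using zw by (simp add: elem_tensor_def)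
  qed (use \<delta>1 \<delta>2 in auto)
qed

lemma T_elems: "F \<in> elems T \<longleftrightarrow> F \<in> circle \<rightarrow>\<^sub>E elems A \<and>
    (\<forall>\<epsilon>>0. \<exists>G\<in>alg_tensor_C A. \<forall>z\<in>circle. \<d> (F z) (G z) < \<epsilon>)"
  by (simp add: tensor_C_def)

lemma T_closed [simp]: "F \<in> elems T \<Longrightarrow> z \<in> circle \<Longrightarrow> F z \<in> elems A"
  using T_elems by blast

lemma T_approx:
  assumes "F \<in> elems T" "0 < \<epsilon>"
  obtains G where "G \<in> alg_tensor_C A" "\<And>z. z \<in> circle \<Longrightarrow> \<d> (F z) (G z) < \<epsilon>"
  using assms T_elems by blast

lemma T_I:
  assumes "F \<in> circle \<rightarrow>\<^sub>E elems A"
    "\<And>\<epsilon>. \<epsilon> > 0 \<Longrightarrow> \<exists>G\<in>alg_tensor_C A. \<forall>z\<in>circle. \<d> (F z) (G z) < \<epsilon>"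
  shows "F \<in> elems T"
  using assms T_elems by blast

lemma T_restrict: "F \<in> elems T \<Longrightarrow> (\<lambda>z\<in>circle. F z) = F"
  by (auto simp: T_elems PiE_iff extensional_restrict)

lemma T_eqI:
  assumes "F \<in> elems T" "G \<in> elems T" "\<And>z. z \<in> circle \<Longrightarrow> F z = G z"
  shows "F = G"
proof -
  have "(\<lambda>z\<in>circle. F z) = (\<lambda>z\<in>circle. G z)" using assms(3) by (rule restrict_ext)
  then show ?thesis using assms T_restrict by simp
qed

lemma alg_tensor_T: "F \<in> alg_tensor_C A \<Longrightarrow> F \<in> elems T"
  by (rule T_I[OF alg_tensor_PiE]) (auto intro!: bexI[of _ F])

lemma T_bounded:
  assumes "F \<in> elems T"
  obtains B where "0 < B" "\<And>z. z \<in> circle \<Longrightarrow> cnorm A (F z) \<le> B"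
proof -
  obtain G where G: "G \<in> alg_tensor_C A" "\<And>z. z \<in> circle \<Longrightarrow> \<d> (F z) (G z) < 1"
    using T_approx[OF assms, of 1] by auto
  obtain B where B: "\<And>z. z \<in> circle \<Longrightarrow> cnorm A (G z) \<le> B" using alg_tensor_bounded[OF G(1)] by blast
  have "cnorm A (F z) \<le> \<bar>B\<bar> + 1" if "z \<in> circle" for z
    using norm_le_dist[of "F z" "G z"] G(2)[OF that] B[OF that] assms G(1) that by simp
  then show ?thesis using that[of "\<bar>B\<bar> + 1"] by simp
qed

lemma T_ops:
  "czero T = (\<lambda>z\<in>circle. \<zero>)" "cadd T F G = (\<lambda>z\<in>circle. F z \<oplus> G z)"
  "cscale T c F = (\<lambda>z\<in>circle. c \<cdot> F z)" "cmult T F G = (\<lambda>z\<in>circle. F z \<otimes> G z)"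
  "cstar T F = (\<lambda>z\<in>circle. cstar A (F z))" "cnorm T F = (SUP z\<in>circle. cnorm A (F z))"
  by (simp_all add: tensor_C_def)

lemma T_norm_upper:
  assumes "F \<in> elems T" "z \<in> circle"
  shows "cnorm A (F z) \<le> cnorm T F"
proof -
  obtain B where "\<And>z. z \<in> circle \<Longrightarrow> cnorm A (F z) \<le> B" using T_bounded[OF assms(1)] by blast
  then have "bdd_above ((\<lambda>z. cnorm A (F z)) ` circle)" by (intro bdd_aboveI2) blast
  then show ?thesis unfolding T_ops using assms(2) by (rule cSUP_upper2) simp
qed

lemma T_norm_least: "(\<And>z. z \<in> circle \<Longrightarrow> cnorm A (F z) \<le> B) \<Longrightarrow> cnorm T F \<le> B"
  unfolding T_ops using one_in_circle by (intro cSUP_least) blast+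

lemma T_add_closed:
  assumes F: "F \<in> elems T" and G: "G \<in> elems T"
  shows "cadd T F G \<in> elems T"
proof (rule T_I)
  fix e :: real assume "0 < e"
  then obtain F' G' where F': "F' \<in> alg_tensor_C A" "\<And>z. z \<in> circle \<Longrightarrow> \<d> (F z) (F' z) < e/2"
    and G': "G' \<in> alg_tensor_C A" "\<And>z. z \<in> circle \<Longrightarrow> \<d> (G z) (G' z) < e/2"
    using T_approx[OF F, of "e/2"] T_approx[OF G, of "e/2"] by (metis half_gt_zero)
  show "\<exists>H\<in>alg_tensor_C A. \<forall>z\<in>circle. \<d> (cadd T F G z) (H z) < e"
  proof (intro bexI[OF _ alg_tensor_add[OF F'(1) G'(1)]] ballI)
    fix z assume z: "z \<in> circle"
    have "\<d> (F z \<oplus> G z) (F' z \<oplus> G' z) \<le> \<d> (F z) (F' z) + \<d> (G z) (G' z)"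
      using z F G F' G' by (intro dist_add) auto
    then show "\<d> (cadd T F G z) ((\<lambda>z\<in>circle. F' z \<oplus> G' z) z) < e"
      using F'(2)[OF z] G'(2)[OF z] z by (simp add: T_ops)
  qed
qed (use assms in \<open>auto simp: T_ops\<close>)

lemma T_scale_closed:
  assumes F: "F \<in> elems T"
  shows "cscale T c F \<in> elems T"
proof (rule T_I)
  fix e :: real assume "0 < e"
  then have "0 < e / (cmod c + 1)" by (simp add: add_nonneg_pos)
  then obtain G where G: "G \<in> alg_tensor_C A" "\<And>z. z \<in> circle \<Longrightarrow> \<d> (F z) (G z) < e / (cmod c + 1)"
    using T_approx[OF F] by blast
  show "\<exists>H\<in>alg_tensor_C A. \<forall>z\<in>circle. \<d> (cscale T c F z) (H z) < e"
  proof (intro bexI[OF _ alg_tensor_scale[OF G(1)]] ballI)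
    fix z assume z: "z \<in> circle"
    have "cmod c * \<d> (F z) (G z) \<le> (cmod c + 1) * \<d> (F z) (G z)"
      using z F G dist_nonneg by (intro mult_right_mono) auto
    also have "\<dots> < e" using G(2)[OF z] by (simp add: pos_less_divide_eq add_nonneg_pos mult.commute)
    finally show "\<d> (cscale T c F z) ((\<lambda>z\<in>circle. c \<cdot> G z) z) < e"
      using z F G by (simp add: T_ops dist_scale)
  qed
qed (use assms in \<open>auto simp: T_ops\<close>)

lemma T_star_closed:
  assumes F: "F \<in> elems T"
  shows "cstar T F \<in> elems T"
proof (rule T_I)
  fix e :: real assume "0 < e"
  then obtain G where G: "G \<in> alg_tensor_C A" "\<And>z. z \<in> circle \<Longrightarrow> \<d> (F z) (G z) < e"
    using T_approx[OF F] by blast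
  show "\<exists>H\<in>alg_tensor_C A. \<forall>z\<in>circle. \<d> (cstar T F z) (H z) < e"
    using G F by (intro bexI[OF _ alg_tensor_star[OF G(1)]] ballI) (simp add: T_ops dist_star)
qed (use assms in \<open>auto simp: T_ops\<close>)

lemma T_mult_closed:
  assumes F: "F \<in> elems T" and G: "G \<in> elems T"
  shows "cmult T F G \<in> elems T"
proof (rule T_I)
  fix e :: real assume e: "0 < e"
  obtain B where B: "0 < B" "\<And>z. z \<in> circle \<Longrightarrow> cnorm A (F z) \<le> B" using T_bounded[OF F] by blast
  obtain C where C: "0 < C" "\<And>z. z \<in> circle \<Longrightarrow> cnorm A (G z) \<le> C" using T_bounded[OF G] by blast
  \<comment> \<open>Besides being close to \<open>G\<close>, the approximant \<open>G'\<close> must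
    stay bounded: distance below 1 gives it the bound \<open>C + 1\<close>.\<close>
  have "0 < e / (2 * (C + 1))" "0 < min 1 (e / (2 * B))" using e B C by auto
  then obtain F' G' where F': "F' \<in> alg_tensor_C A" "\<And>z. z \<in> circle \<Longrightarrow> \<d> (F z) (F' z) < e / (2 * (C + 1))"
    and G': "G' \<in> alg_tensor_C A" "\<And>z. z \<in> circle \<Longrightarrow> \<d> (G z) (G' z) < min 1 (e / (2 * B))"
    using T_approx[OF F] T_approx[OF G] by metis
  show "\<exists>H\<in>alg_tensor_C A. \<forall>z\<in>circle. \<d> (cmult T F G z) (H z) < e"
  proof (intro bexI[OF _ alg_tensor_mult[OF F'(1) G'(1)]] ballI)
    fix z assume z: "z \<in> circle"
    have "cnorm A (G' z) \<le> C + 1"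
      using norm_le_dist[of "G' z" "G z"] dist_sym[of "G' z" "G z"] C(2)[OF z] G'(2)[OF z] G(1) G'(1) z
      by auto
    then have "cnorm A (F z) * \<d> (G z) (G' z) + \<d> (F z) (F' z) * cnorm A (G' z)
      \<le> B * \<d> (G z) (G' z) + \<d> (F z) (F' z) * (C + 1)"
      using B(2)[OF z] z F G F' G' dist_nonneg by (intro add_mono mult_right_mono mult_left_mono) auto
    also have "\<dots> < B * (e / (2 * B)) + e / (2 * (C + 1)) * (C + 1)"
      using B C F'(2)[OF z] G'(2)[OF z] by (intro add_strict_mono mult_strict_left_mono mult_strict_right_mono) auto
    also have "\<dots> = e"
    proof -
      have "C + 1 \<noteq> 0" using C by simp
      then show ?thesis using B by (simp add: field_simps)
    qed
    finally show "\<d> (cmult T F G z) ((\<lambda>z\<in>circle. F' z \<otimes> G' z) z) < e"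
      using dist_mult[of "F z" "F' z" "G z" "G' z"] z F G F' G' by (simp add: T_ops)
  qed
qed (use assms in \<open>auto simp: T_ops\<close>)

lemma T_zero_closed: "czero T \<in> elems T"
  using alg_tensor_T[OF alg_tensor_C.zero] by (simp add: T_ops)

lemma T_dist: "cdist T F G = (SUP z\<in>circle. \<d> (F z) (G z))"
  by (simp add: cdist_def T_ops)

lemma T_dist_upper: "F \<in> elems T \<Longrightarrow> G \<in> elems T \<Longrightarrow> z \<in> circle \<Longrightarrow> \<d> (F z) (G z) \<le> cdist T F G"
  using T_norm_upper[OF T_add_closed[OF _ T_scale_closed], of F G z "- 1"]
  by (simp add: cdist_def T_ops)

lemma T_dist_least: "(\<And>z. z \<in> circle \<Longrightarrow> \<d> (F z) (G z) \<le> B) \<Longrightarrow> cdist T F G \<le> B"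
  unfolding T_dist using one_in_circle by (intro cSUP_least) blast+

text \<open>Limits exist pointwise by completeness of \<open>A\<close>. The Cauchy condition is
  uniform in \<open>z\<close>, so convergence is uniform, and approximability by sums of elementary
  tensors is inherited.\<close>

lemma T_complete:
  assumes X: "\<And>n. X n \<in> elems T"
    and C: "\<forall>\<epsilon>>0. \<exists>M. \<forall>m\<ge>M. \<forall>n\<ge>M. cdist T (X m) (X n) < \<epsilon>"
  shows "\<exists>F\<in>elems T. (\<lambda>n. cdist T (X n) F) \<longlonglongrightarrow> 0"
proof -
  have le: "\<d> (X m z) (X n z) \<le> cdist T (X m) (X n)" if "z \<in> circle" for m n z
    using T_dist_upper X that by blast
  have "\<exists>a\<in>elems A. (\<lambda>n. \<d> (X n z) a) \<longlonglongrightarrow> 0" if z: "z \<in> circle" for z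
  proof (rule complete)
    show "X n z \<in> elems A" for n using X z by simp
    show "\<forall>\<epsilon>>0. \<exists>M. \<forall>m\<ge>M. \<forall>n\<ge>M. \<d> (X m z) (X n z) < \<epsilon>"
      using C le[OF z] by (meson le_less_trans)
  qed
  then obtain F where F: "\<And>z. z \<in> circle \<Longrightarrow> F z \<in> elems A"
    "\<And>z. z \<in> circle \<Longrightarrow> (\<lambda>n. \<d> (X n z) (F z)) \<longlonglongrightarrow> 0" by metis
  define H where "H = (\<lambda>z\<in>circle. F z)"
  have unif: "\<exists>M. \<forall>n\<ge>M. \<forall>z\<in>circle. \<d> (X n z) (H z) \<le> e" if e: "0 < e" for e :: real
  proof -
    obtain M where M: "\<And>m n. m \<ge> M \<Longrightarrow> n \<ge> M \<Longrightarrow> cdist T (X m) (X n) < e" using C e by blast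
    have "\<d> (X n z) (H z) \<le> e" if n: "n \<ge> M" and z: "z \<in> circle" for n z
    proof (rule tendsto_lowerbound[OF _ _ sequentially_bot])
      show "(\<lambda>m. e + \<d> (X m z) (F z)) \<longlonglongrightarrow> e" using tendsto_add[OF tendsto_const F(2)[OF z]] by simp
      have "\<d> (X n z) (H z) \<le> e + \<d> (X m z) (F z)" if m: "m \<ge> M" for m
        using dist_tri[of "X n z" "X m z" "F z"] le[OF z, of n m] M[OF n m] X z F by (simp add: H_def)
      then show "\<forall>\<^sub>F m in sequentially. \<d> (X n z) (H z) \<le> e + \<d> (X m z) (F z)"
        unfolding eventually_sequentially by blast
    qed
    then show ?thesis by blast
  qed
  have H: "H \<in> elems T"
  proof (rule T_I)
    show "H \<in> circle \<rightarrow>\<^sub>E elems A" using F by (auto simp: H_def)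
    fix e :: real assume e: "0 < e"
    obtain M where M: "\<And>z. z \<in> circle \<Longrightarrow> \<d> (X M z) (H z) \<le> e/2"
      using unif[OF half_gt_zero[OF e]] by blast
    obtain G where G: "G \<in> alg_tensor_C A" "\<And>z. z \<in> circle \<Longrightarrow> \<d> (X M z) (G z) < e/2"
      using T_approx[OF X, of "e/2" M] e by auto
    have "\<d> (H z) (G z) < e" if z: "z \<in> circle" for z
      using dist_tri[of "H z" "X M z" "G z"] M[OF z] G(2)[OF z] dist_sym[of "H z" "X M z"] X G(1) z F
      by (simp add: H_def)
    then show "\<exists>G\<in>alg_tensor_C A. \<forall>z\<in>circle. \<d> (H z) (G z) < e" using G(1) by blast
  qed
  have "(\<lambda>n. cdist T (X n) H) \<longlonglongrightarrow> 0"
  proof (rule LIMSEQ_I)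
    fix e :: real assume e: "0 < e"
    obtain M where M: "\<And>n z. n \<ge> M \<Longrightarrow> z \<in> circle \<Longrightarrow> \<d> (X n z) (H z) \<le> e/2"
      using unif[OF half_gt_zero[OF e]] by blast
    have "norm (cdist T (X n) H - 0) < e" if n: "n \<ge> M" for n
    proof -
      have "cdist T (X n) H \<le> e/2" using M[OF n] by (rule T_dist_least)
      moreover have "0 \<le> \<d> (X n 1) (H 1)" using X H by (intro dist_nonneg) auto
      then have "0 \<le> cdist T (X n) H" using T_dist_upper[OF X H one_in_circle, of n] by simp
      ultimately show ?thesis using e by simp
    qed
    then show "\<exists>no. \<forall>n\<ge>no. norm (cdist T (X n) H - 0) < e" by blast
  qed
  then show ?thesis using H by blast
qed

lemma T_norm_nonneg: "F \<in> elems T \<Longrightarrow> 0 \<le> cnorm T F"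
  using T_norm_upper[OF _ one_in_circle, of F] norm_nonneg[of "F 1"] by (auto intro: order_trans)

theorem cstar_algebra_tensor: "cstar_algebra T"
proof
  fix F G H :: "complex \<Rightarrow> 'a" and c k :: complex
  show "czero T \<in> elems T" by (rule T_zero_closed)
  show "\<lbrakk>F \<in> elems T; G \<in> elems T\<rbrakk> \<Longrightarrow> cadd T F G \<in> elems T" by (rule T_add_closed)
  show "F \<in> elems T \<Longrightarrow> cscale T c F \<in> elems T" by (rule T_scale_closed)
  show "\<lbrakk>F \<in> elems T; G \<in> elems T\<rbrakk> \<Longrightarrow> cmult T F G \<in> elems T" by (rule T_mult_closed)
  show "F \<in> elems T \<Longrightarrow> cstar T F \<in> elems T" by (rule T_star_closed)
  show "\<lbrakk>F \<in> elems T; G \<in> elems T; H \<in> elems T\<rbrakk> \<Longrightarrow> cadd T (cadd T F G) H = cadd T F (cadd T G H)"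
    unfolding T_ops by (intro restrict_ext) (simp add: add_assoc)
  show "\<lbrakk>F \<in> elems T; G \<in> elems T\<rbrakk> \<Longrightarrow> cadd T F G = cadd T G F"
    unfolding T_ops by (intro restrict_ext) (simp add: add_commute)
  show "F \<in> elems T \<Longrightarrow> cadd T F (czero T) = F"
    by (rule T_eqI[OF T_add_closed]) (simp_all add: T_zero_closed, simp add: T_ops add_zero)
  show "F \<in> elems T \<Longrightarrow> cadd T F (cscale T (- 1) F) = czero T"
    unfolding T_ops by (intro restrict_ext) (simp add: add_minus)
  show "\<lbrakk>F \<in> elems T; G \<in> elems T\<rbrakk> \<Longrightarrow> cscale T c (cadd T F G) = cadd T (cscale T c F) (cscale T c G)"
    unfolding T_ops by (intro restrict_ext) (simp add: scale_add_right)
  show "F \<in> elems T \<Longrightarrow> cscale T (c + k) F = cadd T (cscale T c F) (cscale T k F)"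
    unfolding T_ops by (intro restrict_ext) (simp add: scale_add_left)
  show "F \<in> elems T \<Longrightarrow> cscale T c (cscale T k F) = cscale T (c * k) F"
    unfolding T_ops by (intro restrict_ext) (simp add: scale_scale)
  show "F \<in> elems T \<Longrightarrow> cscale T 1 F = F"
    by (rule T_eqI[OF T_scale_closed]) (simp_all, simp add: T_ops scale_one)
  show "\<lbrakk>F \<in> elems T; G \<in> elems T; H \<in> elems T\<rbrakk> \<Longrightarrow> cmult T (cmult T F G) H = cmult T F (cmult T G H)"
    unfolding T_ops by (intro restrict_ext) (simp add: mult_assoc)
  show "\<lbrakk>F \<in> elems T; G \<in> elems T; H \<in> elems T\<rbrakk> \<Longrightarrow> cmult T F (cadd T G H) = cadd T (cmult T F G) (cmult T F H)"
    unfolding T_ops by (intro restrict_ext) (simp add: mult_add_right)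
  show "\<lbrakk>F \<in> elems T; G \<in> elems T; H \<in> elems T\<rbrakk> \<Longrightarrow> cmult T (cadd T F G) H = cadd T (cmult T F H) (cmult T G H)"
    unfolding T_ops by (intro restrict_ext) (simp add: mult_add_left)
  show "\<lbrakk>F \<in> elems T; G \<in> elems T\<rbrakk> \<Longrightarrow> cmult T (cscale T c F) G = cscale T c (cmult T F G)"
    unfolding T_ops by (intro restrict_ext) (simp add: mult_scale_left)
  show "\<lbrakk>F \<in> elems T; G \<in> elems T\<rbrakk> \<Longrightarrow> cmult T F (cscale T c G) = cscale T c (cmult T F G)"
    unfolding T_ops by (intro restrict_ext) (simp add: mult_scale_right)
  show "F \<in> elems T \<Longrightarrow> cstar T (cstar T F) = F"
    by (rule T_eqI[OF T_star_closed[OF T_star_closed]]) (simp_all, simp add: T_ops star_star)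
  show "\<lbrakk>F \<in> elems T; G \<in> elems T\<rbrakk> \<Longrightarrow> cstar T (cadd T F G) = cadd T (cstar T F) (cstar T G)"
    unfolding T_ops by (intro restrict_ext) (simp add: star_add)
  show "F \<in> elems T \<Longrightarrow> cstar T (cscale T c F) = cscale T (cnj c) (cstar T F)"
    unfolding T_ops by (intro restrict_ext) (simp add: star_scale)
  show "\<lbrakk>F \<in> elems T; G \<in> elems T\<rbrakk> \<Longrightarrow> cstar T (cmult T F G) = cmult T (cstar T G) (cstar T F)"
    unfolding T_ops by (intro restrict_ext) (simp add: star_mult)
  show "F \<in> elems T \<Longrightarrow> 0 \<le> cnorm T F" by (rule T_norm_nonneg)
  show "F \<in> elems T \<Longrightarrow> cnorm T F = 0 \<longleftrightarrow> F = czero T"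
  proof
    assume F: "F \<in> elems T" "cnorm T F = 0"
    have "F z = \<zero>" if z: "z \<in> circle" for z
      using T_norm_upper[OF F(1) z] norm_nonneg[of "F z"] norm_eq_zero[of "F z"] F z by simp
    then show "F = czero T" using F by (intro T_eqI T_zero_closed) (simp_all add: T_ops)
  next
    assume "F \<in> elems T" "F = czero T"
    then show "cnorm T F = 0" using one_in_circle by (simp add: T_ops cSUP_const)
  qed
  show "cnorm T (cadd T F G) \<le> cnorm T F + cnorm T G" if FG: "F \<in> elems T" "G \<in> elems T"
  proof (rule T_norm_least)
    fix z assume z: "z \<in> circle"
    show "cnorm A (cadd T F G z) \<le> cnorm T F + cnorm T G"
      using norm_triangle[of "F z" "G z"] T_norm_upper[OF FG(1) z] T_norm_upper[OF FG(2) z] FG z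
      by (simp add: T_ops(2))
  qed
  have sc: "cnorm T (cscale T c F) \<le> cmod c * cnorm T F" if F: "F \<in> elems T" for c F
  proof (rule T_norm_least)
    fix z assume z: "z \<in> circle"
    show "cnorm A (cscale T c F z) \<le> cmod c * cnorm T F"
      using mult_left_mono[OF T_norm_upper[OF F z], of "cmod c"] F z by (simp add: T_ops(3) norm_scale)
  qed
  show "cnorm T (cscale T c F) = cmod c * cnorm T F" if F: "F \<in> elems T"
  proof (cases "c = 0")
    case True
    then show ?thesis using sc[OF F, of 0] T_norm_nonneg[OF T_scale_closed[OF F], of 0] by simp
  next
    case False
    have "cscale T (inverse c) (cscale T c F) = F"
      using F False by (intro T_eqI T_scale_closed) (auto simp: T_ops(3) scale_scale scale_one)
    then have "cnorm T F \<le> cmod (inverse c) * cnorm T (cscale T c F)"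
      using sc[OF T_scale_closed[OF F], of "inverse c" c] by simp
    then have "cmod c * cnorm T F \<le> cnorm T (cscale T c F)"
      using False by (simp add: norm_inverse norm_divide field_simps)
    then show ?thesis using sc[OF F, of c] by simp
  qed
  show "cnorm T (cmult T F G) \<le> cnorm T F * cnorm T G" if FG: "F \<in> elems T" "G \<in> elems T"
  proof (rule T_norm_least)
    fix z assume z: "z \<in> circle"
    have "cnorm A (F z) * cnorm A (G z) \<le> cnorm T F * cnorm T G"
      using FG z by (intro mult_mono T_norm_upper norm_nonneg T_norm_nonneg) auto
    then show "cnorm A (cmult T F G z) \<le> cnorm T F * cnorm T G"
      using norm_mult[of "F z" "G z"] FG z by (simp add: T_ops(4))
  qed
  show "cnorm T (cmult T (cstar T F) F) = (cnorm T F)\<^sup>2" if F: "F \<in> elems T"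
  proof -
    have FF: "cmult T (cstar T F) F \<in> elems T" using F by (intro T_mult_closed T_star_closed)
    have z: "cnorm A (cmult T (cstar T F) F z) = (cnorm A (F z))\<^sup>2" if "z \<in> circle" for z
      using that F by (simp add: T_ops(4,5) cstar_identity)
    have "cnorm T (cmult T (cstar T F) F) \<le> (cnorm T F)\<^sup>2"
      using F by (intro T_norm_least) (simp add: z power_mono T_norm_upper norm_nonneg)
    moreover have "cnorm T F \<le> sqrt (cnorm T (cmult T (cstar T F) F))"
    proof (rule T_norm_least)
      fix w assume w: "w \<in> circle"
      show "cnorm A (F w) \<le> sqrt (cnorm T (cmult T (cstar T F) F))"
        using T_norm_upper[OF FF w] z[OF w] by (simp add: real_le_rsqrt)
    qed
    then have "(cnorm T F)\<^sup>2 \<le> cnorm T (cmult T (cstar T F) F)"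
      using T_norm_nonneg[OF F] T_norm_nonneg[OF FF]
      by (metis power_mono real_sqrt_pow2)
    ultimately show ?thesis by simp
  qed
next
  fix X :: "nat \<Rightarrow> complex \<Rightarrow> 'a"
  assume "\<And>n. X n \<in> elems T" "\<forall>\<epsilon>>0. \<exists>M. \<forall>m\<ge>M. \<forall>n\<ge>M. cdist T (X m) (X n) < \<epsilon>"
  then show "\<exists>F\<in>elems T. (\<lambda>n. cdist T (X n) F) \<longlonglongrightarrow> 0" by (rule T_complete)
qed

lemma T_uniformly_continuous:
  assumes F: "F \<in> elems T" and e: "0 < \<epsilon>"
  shows "\<exists>\<delta>>0. \<forall>z\<in>circle. \<forall>w\<in>circle. dist z w < \<delta> \<longrightarrow> \<d> (F z) (F w) < \<epsilon>"
proof -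
  obtain G where G: "G \<in> alg_tensor_C A" "\<And>z. z \<in> circle \<Longrightarrow> \<d> (F z) (G z) < \<epsilon>/3"
    using T_approx[OF F, of "\<epsilon>/3"] e by auto
  obtain \<delta> where \<delta>: "\<delta> > 0" "\<And>z w. z \<in> circle \<Longrightarrow> w \<in> circle \<Longrightarrow> dist z w < \<delta> \<Longrightarrow> \<d> (G z) (G w) < \<epsilon>/3"
    using alg_tensor_uniformly_continuous[OF G(1), of "\<epsilon>/3"] e by auto
  have "\<d> (F z) (F w) < \<epsilon>" if zw: "z \<in> circle" "w \<in> circle" "dist z w < \<delta>" for z w
    using dist_tri[of "F z" "G z" "F w"] dist_tri[of "G z" "G w" "F w"] dist_sym[of "G w" "F w"]
      G(2)[OF zw(1)] G(2)[OF zw(2)] \<delta>(2)[OF zw] F G(1) zw by simp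
  then show ?thesis using \<delta>(1) by blast
qed

lemma rotation_apply: "z \<in> circle \<Longrightarrow> rotation \<mu> F z = F (\<mu> * z)"
  by (simp add: rotation_def)

lemma T_rotation_closed:
  assumes F: "F \<in> elems T" and \<mu>: "\<mu> \<in> circle"
  shows "rotation \<mu> F \<in> elems T"
proof (rule T_I)
  show "rotation \<mu> F \<in> circle \<rightarrow>\<^sub>E elems A"
    using F circle_mult[OF \<mu>] by (auto simp: rotation_def)
  fix e :: real assume "0 < e"
  then obtain G where G: "G \<in> alg_tensor_C A" "\<And>z. z \<in> circle \<Longrightarrow> \<d> (F z) (G z) < e"
    using T_approx[OF F] by blast
  show "\<exists>H\<in>alg_tensor_C A. \<forall>z\<in>circle. \<d> (rotation \<mu> F z) (H z) < e"
    using G circle_mult[OF \<mu>] alg_tensor_rotation[OF G(1) \<mu>]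
    by (intro bexI[of _ "rotation \<mu> G"] ballI) (simp_all add: rotation_apply)
qed

theorem U1_cstar_algebra_tensor: "U1_cstar_algebra T rotation"
  unfolding U1_cstar_algebra_def
proof (intro conjI ballI)
  show "cstar_algebra T" by (rule cstar_algebra_tensor)
  show "star_hom T T (rotation \<mu>)" if \<mu>: "\<mu> \<in> circle" for \<mu>
    unfolding star_hom_def using T_rotation_closed[OF _ \<mu>] circle_mult[OF \<mu>]
    by (auto simp: rotation_def T_ops fun_eq_iff)
  show "rotation 1 F = F" if "F \<in> elems T" for F
    using T_restrict[OF that] by (simp add: rotation_def)
  show "rotation (\<mu> * \<nu>) F = rotation \<mu> (rotation \<nu> F)"
    if "\<mu> \<in> circle" "\<nu> \<in> circle" "F \<in> elems T" for \<mu> \<nu> F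
    using circle_mult[OF that(1)] by (auto simp: rotation_def fun_eq_iff mult_ac)
  show "((\<lambda>\<nu>. cdist T (rotation \<nu> F) (rotation \<mu> F)) \<longlongrightarrow> 0) (at \<mu> within circle)"
    if F: "F \<in> elems T" and \<mu>: "\<mu> \<in> circle" for F \<mu>
  proof (rule tendstoI)
    fix e :: real assume e: "0 < e"
    obtain \<delta> where \<delta>: "\<delta> > 0" "\<And>z w. z \<in> circle \<Longrightarrow> w \<in> circle \<Longrightarrow> dist z w < \<delta> \<Longrightarrow> \<d> (F z) (F w) < e/2"
      using T_uniformly_continuous[OF F, of "e/2"] e by auto
    have "dist (cdist T (rotation \<nu> F) (rotation \<mu> F)) 0 < e" if \<nu>: "\<nu> \<in> circle" "dist \<nu> \<mu> < \<delta>" for \<nu>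
    proof -
      have "cdist T (rotation \<nu> F) (rotation \<mu> F) \<le> e/2"
      proof (rule T_dist_least)
        fix z assume z: "z \<in> circle"
        \<comment> \<open>Multiplication by a point of the circle is isometric, so one
          \<open>\<delta>\<close> serves all \<open>z\<close>.\<close>
        have "dist (\<nu> * z) (\<mu> * z) < \<delta>"
          using \<nu> z Real_Vector_Spaces.norm_mult[of "\<nu> - \<mu>" z]
          by (simp add: dist_norm mem_sphere_0 left_diff_distrib)
        then show "\<d> (rotation \<nu> F z) (rotation \<mu> F z) \<le> e/2"
          using \<delta>(2)[OF circle_mult[OF \<nu>(1) z] circle_mult[OF \<mu> z]] z by (simp add: rotation_apply)
      qed
      moreover have "0 \<le> cdist T (rotation \<nu> F) (rotation \<mu> F)"
        using F \<mu> \<nu> by (intro cstar_algebra.dist_nonneg[OF cstar_algebra_tensor] T_rotation_closed)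
      ultimately show ?thesis using e by simp
    qed
    then show "\<forall>\<^sub>F \<nu> in at \<mu> within circle. dist (cdist T (rotation \<nu> F) (rotation \<mu> F)) 0 < e"
      unfolding eventually_at using \<delta>(1) by blast
  qed
qed

end

lemma star_hom_zero:
  assumes "cstar_algebra A" "cstar_algebra B" "star_hom A B \<phi>"
  shows "\<phi> (czero A) = czero B"
proof -
  interpret A: cstar_algebra A by fact
  interpret B: cstar_algebra B by fact
  have "\<phi> (cscale A 0 (czero A)) = cscale B 0 (\<phi> (czero A))"
    by (rule star_homD(3)[OF assms(3) A.zero_closed A.zero_closed])
  then show ?thesis
    using star_homD(1)[OF assms(3), of "czero A" "czero A"] by simp
qed

theorem star_hom_map_tensor:
  assumes A: "cstar_algebra A" and B: "cstar_algebra B" and \<phi>: "star_hom A B \<phi>"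
  shows "star_hom (tensor_C A) (tensor_C B) (map_tensor_C \<phi>)"
proof -
  interpret A: cstar_algebra A by fact
  interpret B: cstar_algebra B by fact
  note hom = star_homD[OF \<phi>]
  have "map_tensor_C \<phi> F \<in> elems (tensor_C B)" if F: "F \<in> elems (tensor_C A)" for F
  proof (rule B.T_I)
    show "map_tensor_C \<phi> F \<in> circle \<rightarrow>\<^sub>E elems B"
      using F \<phi> by (auto simp: map_tensor_C_def star_hom_def)
    fix e :: real assume "0 < e"
    then obtain G where G: "G \<in> alg_tensor_C A" "\<And>z. z \<in> circle \<Longrightarrow> cdist A (F z) (G z) < e"
      using A.T_approx[OF F] by blast
    have "map_tensor_C \<phi> G \<in> alg_tensor_C B"
      unfolding map_tensor_C_def
    proof (rule A.alg_tensor_map[OF G(1) _ _ B])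
      fix a g assume ag: "a \<in> elems A" "continuous_on circle (g :: complex \<Rightarrow> complex)"
      have "(\<lambda>z\<in>circle. \<phi> (cscale A (g z) a)) = elem_tensor B (\<phi> a) g"
        using hom(3)[OF ag(1) ag(1)] by (simp add: elem_tensor_def)
      then show "(\<lambda>z\<in>circle. \<phi> (cscale A (g z) a)) \<in> alg_tensor_C B"
        using B.alg_tensor_elem[OF hom(1)[OF ag(1) ag(1)] ag(2)] by simp
    qed (use hom(2) star_hom_zero[OF A B \<phi>] in auto)
    moreover have "cdist B (map_tensor_C \<phi> F z) (map_tensor_C \<phi> G z) < e" if z: "z \<in> circle" for z
      using star_hom_dist_le[OF A B \<phi>, of "F z" "G z"] G F z
      by (auto simp: map_tensor_C_def intro: le_less_trans)
    ultimately show "\<exists>H\<in>alg_tensor_C B. \<forall>z\<in>circle. cdist B (map_tensor_C \<phi> F z) (H z) < e" by blast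
  qed
  then show ?thesis
    using \<phi> unfolding star_hom_def
    by (auto simp: map_tensor_C_def A.T_ops B.T_ops fun_eq_iff)
qed

lemma U1_equivariant_map_tensor: "U1_equivariant (tensor_C A) rotation rotation (map_tensor_C \<phi>)"
  unfolding U1_equivariant_def using circle_mult
  by (auto simp: map_tensor_C_def rotation_def fun_eq_iff)

subsection \<open>Homomorphisms out of a universal C*-algebra\<close>

lemma star_hom_cong:
  assumes "cstar_algebra A" "\<And>a. a \<in> elems A \<Longrightarrow> \<phi> a = \<psi> a" "star_hom A B \<psi>"
  shows "star_hom A B \<phi>"
proof -
  interpret cstar_algebra A by fact
  show ?thesis using assms(2,3) by (simp add: star_hom_def)
qed

context bounded_relations begin

lemma univ_gen_cls: "univ_gen G R g = cls (\<lambda>n. gen g)"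
  by (simp add: univ_gen_def)

lemma U_dist_approx:
  assumes X: "X \<in> CS"
  shows "(\<lambda>n. cdist U (cls X) (cls (\<lambda>i. X n))) \<longlonglongrightarrow> 0"
proof (rule LIMSEQ_I)
  interpret U: cstar_algebra U by (rule cstar_algebra_U)
  fix e :: real assume e: "0 < e"
  obtain M where M: "\<And>m n. m \<ge> M \<Longrightarrow> n \<ge> M \<Longrightarrow> N (X m - X n) < e/2"
    using CS_D[OF X half_gt_zero[OF e]] by blast
  have "norm (cdist U (cls X) (cls (\<lambda>i. X n)) - 0) < e" if n: "n \<ge> M" for n
  proof -
    have Xn: "(\<lambda>i. X n) \<in> CS" by (intro CS_const CS_free X)
    have "cdist U (cls X) (cls (\<lambda>i. X n)) \<le> e/2"
      unfolding U_dist[OF X Xn]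
    proof (rule U_norm_le[OF CS_diff[OF X Xn]])
      show "\<forall>\<^sub>F i in sequentially. N (X i - X n) \<le> e/2"
        unfolding eventually_sequentially using M n less_imp_le by blast
    qed
    moreover have "0 \<le> cdist U (cls X) (cls (\<lambda>i. X n))"
      using X Xn by (intro U.dist_nonneg) auto
    ultimately show ?thesis using e by simp
  qed
  then show "\<exists>no. \<forall>n\<ge>no. norm (cdist U (cls X) (cls (\<lambda>i. X n)) - 0) < e" by blast
qed

lemma U_dense:
  assumes "a \<in> elems U" "0 < e"
  obtains x where "x \<in> free_star_alg G" "cdist U a (cls (\<lambda>i. x)) < e"
proof -
  obtain X where X: "X \<in> CS" "a = cls X" using elems_E[OF assms(1)] by blast
  obtain n where "cdist U (cls X) (cls (\<lambda>i. X n)) < e"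
    using order_tendstoD(2)[OF U_dist_approx[OF X(1)] assms(2)] by (auto simp: eventually_sequentially)
  then show ?thesis using that[of "X n"] X CS_free by simp
qed

text \<open>Maps that agree on generators agree on polynomials and, being contractive, on the
  completion. This is the uniqueness by which the description with \<open>THE\<close> in
  \<open>graph_hom\<close> is resolved.\<close>

lemma star_hom_eqI:
  assumes B: "cstar_algebra B" and \<phi>: "star_hom U B \<phi>" and \<psi>: "star_hom U B \<psi>"
    and gen: "\<And>g. g \<in> G \<Longrightarrow> \<phi> (univ_gen G R g) = \<psi> (univ_gen G R g)" and a: "a \<in> elems U"
  shows "\<phi> a = \<psi> a"
proof -
  interpret B: cstar_algebra B by fact
  obtain X where X: "X \<in> CS" "a = cls X" using elems_E[OF a] by blast
  have poly: "\<phi> (cls (\<lambda>i. x)) = \<psi> (cls (\<lambda>i. x))" if "x \<in> free_star_alg G" for x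
    using that
  proof (induction x rule: free_induct)
    case zero
    show ?case
      using star_hom_zero[OF cstar_algebra_U B \<phi>] star_hom_zero[OF cstar_algebra_U B \<psi>] by (simp add: U_zero)
  next
    case (gen g)
    then show ?case using assms(4) by (simp add: univ_gen_cls)
  next
    case (add x y)
    then show ?case
      using star_homD(2)[OF \<phi>, of "cls (\<lambda>i. x)" "cls (\<lambda>i. y)"] star_homD(2)[OF \<psi>, of "cls (\<lambda>i. x)" "cls (\<lambda>i. y)"]
      by (simp add: U_add CS_const)
  next
    case (mult x y)
    then show ?case
      using star_homD(4)[OF \<phi>, of "cls (\<lambda>i. x)" "cls (\<lambda>i. y)"] star_homD(4)[OF \<psi>, of "cls (\<lambda>i. x)" "cls (\<lambda>i. y)"]
      by (simp add: U_mult CS_const)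
  next
    case (scale c x)
    then show ?case
      using star_homD(3)[OF \<phi>, of "cls (\<lambda>i. x)" "cls (\<lambda>i. x)"] star_homD(3)[OF \<psi>, of "cls (\<lambda>i. x)" "cls (\<lambda>i. x)"]
      by (simp add: U_scale CS_const)
  next
    case (star x)
    then show ?case
      using star_homD(5)[OF \<phi>, of "cls (\<lambda>i. x)" "cls (\<lambda>i. x)"] star_homD(5)[OF \<psi>, of "cls (\<lambda>i. x)" "cls (\<lambda>i. x)"]
      by (simp add: U_star CS_const)
  qed
  show ?thesis
  proof (rule B.eq_if_dist_le)
    show "\<phi> a \<in> elems B" "\<psi> a \<in> elems B" using star_homD(1) \<phi> \<psi> a by metis+
    show "(\<lambda>n. 2 * cdist U a (cls (\<lambda>i. X n))) \<longlonglongrightarrow> 0"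
      using U_dist_approx[OF X(1)] X(2) by (auto intro: tendsto_mult_right_zero)
    fix n
    have Xn: "cls (\<lambda>i. X n) \<in> elems U" by (intro cls_elems CS_const CS_free X)
    have "cdist B (\<phi> a) (\<phi> (cls (\<lambda>i. X n))) \<le> cdist U a (cls (\<lambda>i. X n))"
      "cdist B (\<psi> a) (\<psi> (cls (\<lambda>i. X n))) \<le> cdist U a (cls (\<lambda>i. X n))"
      using star_hom_dist_le[OF cstar_algebra_U B _ a Xn] \<phi> \<psi> by auto
    moreover have "\<phi> (cls (\<lambda>i. X n)) = \<psi> (cls (\<lambda>i. X n))" by (intro poly CS_free X)
    moreover have mem: "\<phi> a \<in> elems B" "\<psi> a \<in> elems B" "\<psi> (cls (\<lambda>i. X n)) \<in> elems B"
      using star_homD(1) \<phi> \<psi> a Xn by metis+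
    ultimately show "cdist B (\<phi> a) (\<psi> a) \<le> 2 * cdist U a (cls (\<lambda>i. X n))"
      using B.dist_tri[of "\<phi> a" "\<psi> (cls (\<lambda>i. X n))" "\<psi> a"] B.dist_sym[OF mem(2,3)] by simp
  qed
qed

end

text \<open>Substitution applied term by term to representatives. The gauge automorphisms, the
  quotient maps and the values of \<open>f\<close> at single points of the circle are all realised
  in this form.\<close>

definition univ_map ::
    "'h set \<Rightarrow> 'h star_poly set \<Rightarrow> ('g \<Rightarrow> 'h star_poly) \<Rightarrow> 'g univ_elem \<Rightarrow> 'h univ_elem" where
  "univ_map H S t a = (\<Union>X\<in>a. univ_class H S (\<lambda>n. subst t (X n)))"

text \<open>The pullback of the universal seminorm of the codomain has to be admissible for the
  domain, so that the universal seminorm there dominates it. As seminorms live on all letters,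
  \<open>t_out\<close> makes the letters outside \<open>G\<close> null.\<close>

locale relation_map = dom: bounded_relations G R + cod: bounded_relations H S
  for G :: "'g set" and R and H :: "'h set" and S +
  fixes t :: "'g \<Rightarrow> 'h star_poly"
  assumes t_free: "g \<in> G \<Longrightarrow> t g \<in> free_star_alg H"
    and t_out: "g \<notin> G \<Longrightarrow> cod.N (t g) = 0"
    and t_rel: "r \<in> R \<Longrightarrow> cod.N (subst t r) = 0"
begin

lemma subst_admissible: "(\<lambda>x. cod.N (subst t x)) \<in> admissible G R"
  using total_seminorm_subst[OF cod.total_seminorm_axioms, of t] t_out t_rel by (simp add: admissible_def)

lemma subst_le: "cod.N (subst t x) \<le> dom.N x"
  using dom.N_upper[OF subst_admissible] .

lemma subst_in_free: "x \<in> free_star_alg G \<Longrightarrow> subst t x \<in> free_star_alg H"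
  by (rule subst_free[OF _ t_free])

lemma subst_CS: "X \<in> dom.CS \<Longrightarrow> (\<lambda>n. subst t (X n)) \<in> cod.CS"
  unfolding dom.CS_iff cod.CS_iff
  using subst_in_free subst_le le_less_trans by (metis subst_diff)

abbreviation map_class :: "'g univ_elem \<Rightarrow> 'h univ_elem" where
  "map_class \<equiv> univ_map H S t"

lemma map_cls:
  assumes X: "X \<in> dom.CS"
  shows "map_class (dom.cls X) = cod.cls (\<lambda>n. subst t (X n))"
  unfolding univ_map_def
proof (rule dom.cls_UN[OF X])
  fix X' assume X': "X' \<in> dom.CS" "dom.cls X' = dom.cls X"
  then have *: "(\<lambda>n. dom.N (X' n - X n)) \<longlonglongrightarrow> 0" using dom.cls_eq_iff X by blast
  have "(\<lambda>n. cod.N (subst t (X' n) - subst t (X n))) \<longlonglongrightarrow> 0"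
    by (rule Lim_null_comparison[OF _ *]) (simp add: cod.nonneg subst_le flip: subst_diff)
  then show "cod.cls (\<lambda>n. subst t (X' n)) = cod.cls (\<lambda>n. subst t (X n))"
    using X X' by (simp add: cod.cls_eq_iff subst_CS)
qed

lemma map_gen: "g \<in> G \<Longrightarrow> map_class (univ_gen G R g) = cod.cls (\<lambda>n. t g)"
  by (simp add: dom.univ_gen_cls map_cls dom.CS_const free_gen)

lemma star_hom_map_class: "star_hom dom.U cod.U map_class"
  unfolding star_hom_def
proof (intro conjI ballI allI)
  fix a assume "a \<in> elems dom.U"
  then obtain X where X: "X \<in> dom.CS" "a = dom.cls X" by (rule dom.elems_E)
  show "map_class a \<in> elems cod.U" using X by (simp add: map_cls subst_CS)
  show "map_class (cscale dom.U c a) = cscale cod.U c (map_class a)" for c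
    using X by (simp add: map_cls subst_CS dom.U_scale cod.U_scale dom.CS_scale subst_mult)
  show "map_class (cstar dom.U a) = cstar cod.U (map_class a)"
    using X by (simp add: map_cls subst_CS dom.U_star cod.U_star dom.CS_star subst_star)
  fix b assume "b \<in> elems dom.U"
  then obtain Y where Y: "Y \<in> dom.CS" "b = dom.cls Y" by (rule dom.elems_E)
  show "map_class (cadd dom.U a b) = cadd cod.U (map_class a) (map_class b)"
    using X Y by (simp add: map_cls subst_CS dom.U_add cod.U_add dom.CS_add subst_add)
  show "map_class (cmult dom.U a b) = cmult cod.U (map_class a) (map_class b)"
    using X Y by (simp add: map_cls subst_CS dom.U_mult cod.U_mult dom.CS_mult subst_mult)
qed

end

section \<open>Graph C*-algebras\<close>

abbreviation V :: "'v \<Rightarrow> ('v, 'e) graph_gen star_poly" where "V v \<equiv> gen (Vx v)"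
abbreviation S :: "'e \<Rightarrow> ('v, 'e) graph_gen star_poly" where "S e \<equiv> gen (Ed e)"

lemma graph_relsI:
  "v \<in> verts E \<Longrightarrow> V v * V v - V v \<in> graph_rels E"
  "v \<in> verts E \<Longrightarrow> star_poly (V v) - V v \<in> graph_rels E"
  "v \<in> verts E \<Longrightarrow> w \<in> verts E \<Longrightarrow> v \<noteq> w \<Longrightarrow> V v * V w \<in> graph_rels E"
  "e \<in> arcs E \<Longrightarrow> S e * star_poly (S e) * S e - S e \<in> graph_rels E"
  "e \<in> arcs E \<Longrightarrow> star_poly (S e) * S e - V (head E e) \<in> graph_rels E"
  "v \<in> verts E \<Longrightarrow> out_arcs E v \<noteq> {} \<Longrightarrow>
    (\<Sum>e\<in>out_arcs E v. S e * star_poly (S e)) - V v \<in> graph_rels E"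
  unfolding graph_rels_def by blast+

lemma graph_rels_cases [consumes 1, case_names proj selfadj orth piso range CK]:
  assumes "r \<in> graph_rels E"
  obtains (proj) v where "v \<in> verts E" "r = V v * V v - V v"
  | (selfadj) v where "v \<in> verts E" "r = star_poly (V v) - V v"
  | (orth) v w where "v \<in> verts E" "w \<in> verts E" "v \<noteq> w" "r = V v * V w"
  | (piso) e where "e \<in> arcs E" "r = S e * star_poly (S e) * S e - S e"
  | (range) e where "e \<in> arcs E" "r = star_poly (S e) * S e - V (head E e)"
  | (CK) v where "v \<in> verts E" "out_arcs E v \<noteq> {}"
      "r = (\<Sum>e\<in>out_arcs E v. S e * star_poly (S e)) - V v"
  using assms unfolding graph_rels_def
  by (elim UnE CollectE exE conjE) (rule proj selfadj orth piso range CK; assumption)+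

lemma Vx_graph_gens [simp]: "Vx v \<in> graph_gens E \<longleftrightarrow> v \<in> verts E"
  and Ed_graph_gens [simp]: "Ed e \<in> graph_gens E \<longleftrightarrow> e \<in> arcs E"
  by (auto simp: graph_gens_def)

lemma V_free: "v \<in> verts E \<Longrightarrow> V v \<in> free_star_alg (graph_gens E)"
  and S_free: "e \<in> arcs E \<Longrightarrow> S e \<in> free_star_alg (graph_gens E)"
  by (auto simp: graph_gens_def intro: free_gen)

text \<open>A representation of the graph relations, seen only through its seminorm. Besides the
  universal one, quotient seminorms and pullbacks along substitutions are of this kind, and the
  universal one dominates them all; every comparison of the three algebras rests on this.\<close>

locale graph_seminorm = fin_digraph E + total_seminorm p
  for E :: "('v, 'e) pre_digraph" and p :: "('v, 'e) graph_gen star_poly \<Rightarrow> real" +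
  assumes outside: "g \<notin> graph_gens E \<Longrightarrow> p (gen g) = 0"
    and rel: "r \<in> graph_rels E \<Longrightarrow> p r = 0"
begin

lemma V_outside: "v \<notin> verts E \<Longrightarrow> V v \<simeq> 0" and S_outside: "e \<notin> arcs E \<Longrightarrow> S e \<simeq> 0"
  unfolding eqv_0 by (rule outside; auto simp: graph_gens_def)+

lemma V_proj: "is_proj (V v)"
proof (cases "v \<in> verts E")
  case True
  then show ?thesis using rel graph_relsI(1,2)[of v E] by (auto simp: is_proj_def eqv_def)
next
  case False
  then have "V v \<simeq> 0" by (rule V_outside)
  then show ?thesis unfolding is_proj_def
    using eqv_star[of "V v" 0] eqv_0_mult(1)[of "V v" "V v"] eqv_sym eqv_trans by (metis star_poly_0)
qed

lemma V_orth: "v \<noteq> w \<Longrightarrow> V v * V w \<simeq> 0"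
proof (cases "v \<in> verts E \<and> w \<in> verts E")
  case True
  then show "v \<noteq> w \<Longrightarrow> ?thesis" using rel graph_relsI(3)[of v E w] by (simp add: eqv_0)
qed (use V_outside eqv_0_mult in blast)

lemma S_range: "e \<in> arcs E \<Longrightarrow> star_poly (S e) * S e \<simeq> V (head E e)"
  using rel graph_relsI(5)[of e E] by (simp add: eqv_def)

lemma S_piso: "S e * star_poly (S e) * S e \<simeq> S e"
proof (cases "e \<in> arcs E")
  case True
  then show ?thesis using rel graph_relsI(4)[of e E] by (simp add: eqv_def)
next
  case False
  then show ?thesis using S_outside eqv_0_mult(2) eqv_sym eqv_trans by meson
qed

lemma CK: "v \<in> verts E \<Longrightarrow> out_arcs E v \<noteq> {} \<Longrightarrow> (\<Sum>e\<in>out_arcs E v. S e * star_poly (S e)) \<simeq> V v"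
  using rel graph_relsI(6)[of v E] by (simp add: eqv_def)

lemma SS_proj: "is_proj (S e * star_poly (S e))"
  using eqv_multL[OF S_piso[of e], of "star_poly (S e)"]
  by (simp add: is_proj_def star_poly_mult mult.assoc)

lemma V_le_1: "p (V v) \<le> 1"
  by (rule proj_le_1[OF V_proj])

lemma S_le_1: "p (S e) \<le> 1"
proof -
  have "(p (S e))\<^sup>2 = p (S e * star_poly (S e))" by (simp add: cstar')
  also have "\<dots> \<le> 1" by (rule proj_le_1[OF SS_proj])
  finally show ?thesis using power2_le_imp_le[of "p (S e)" 1] by simp
qed

lemma S_head: "e \<in> arcs E \<Longrightarrow> S e * V (head E e) \<simeq> S e"
  using eqv_trans[OF eqv_multR[OF eqv_sym[OF S_range], of e "S e"]] S_piso[of e] by (simp add: mult.assoc)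

lemma V_SS: "e \<in> arcs E \<Longrightarrow> V (tail E e) * (S e * star_poly (S e)) \<simeq> S e * star_poly (S e)"
  by (rule proj_sum_absorb[OF _ _ V_proj CK, where j = e]) (auto simp: SS_proj)

text \<open>Not among the relations: the Cuntz-Krieger relation makes the range projection of
  \<open>S e\<close> a summand of the vertex projection, which therefore absorbs it.\<close>

lemma S_tail: 
  assumes "e \<in> arcs E"
  shows "V (tail E e) * S e \<simeq> S e"
proof -
  have "V (tail E e) * S e \<simeq> V (tail E e) * (S e * star_poly (S e) * S e)"
    by (intro eqv_multR eqv_sym[OF S_piso])
  also have "\<dots> = V (tail E e) * (S e * star_poly (S e)) * S e" by (simp add: mult.assoc)
  also have "\<dots> \<simeq> (S e * star_poly (S e)) * S e" by (intro eqv_multL V_SS assms)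
  also have "\<dots> \<simeq> S e" by (rule S_piso)
  finally show ?thesis .
qed

lemma V_S_zero:
  assumes "e \<in> arcs E" "v \<noteq> tail E e"
  shows "V v * S e \<simeq> 0"
proof -
  have "V v * S e \<simeq> V v * (V (tail E e) * S e)" by (intro eqv_multR eqv_sym[OF S_tail] assms)
  also have "\<dots> = (V v * V (tail E e)) * S e" by (simp add: mult.assoc)
  also have "\<dots> \<simeq> 0" by (intro eqv_0_mult(1) V_orth assms)
  finally show ?thesis .
qed

text \<open>Insert the range projections between the factors. For a common source they are
  orthogonal as summands of one vertex projection; for different sources the vertex projections
  separate them.\<close>

lemma S_orth:
  assumes "e \<noteq> f"
  shows "star_poly (S e) * S f \<simeq> 0"
proof (cases "e \<in> arcs E \<and> f \<in> arcs E")
  case True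
  have "star_poly (S e) * S f \<simeq> star_poly (S e * star_poly (S e) * S e) * (S f * star_poly (S f) * S f)"
    by (intro eqv_mult eqv_star eqv_sym[OF S_piso])
  also have "\<dots> = star_poly (S e) * ((S e * star_poly (S e)) * (S f * star_poly (S f))) * S f"
    by (simp add: star_poly_mult mult.assoc)
  also have "\<dots> \<simeq> 0"
  proof (rule eqv_0_mult(1)[OF eqv_0_mult(2)])
    show "(S e * star_poly (S e)) * (S f * star_poly (S f)) \<simeq> 0"
    proof (cases "tail E e = tail E f")
      case eq: True
      show ?thesis
        using True eq assms
        by (intro proj_sum_orthogonal[OF _ _ V_proj CK[of "tail E e"], where i = e and j = f])
          (auto simp: SS_proj)
    next
      case False
      have "star_poly (S e) \<simeq> star_poly (S e) * V (tail E e)"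
        using eqv_star[OF S_tail[of e]] True projD(1)[OF V_proj]
        by (metis (no_types, lifting) eqv_multR eqv_sym eqv_trans star_poly_mult)
      then have "star_poly (S e) * S f \<simeq> star_poly (S e) * V (tail E e) * S f" by (rule eqv_multL)
      also have "\<dots> = star_poly (S e) * (V (tail E e) * S f)" by (simp add: mult.assoc)
      also have "\<dots> \<simeq> 0" using True False by (intro eqv_0_mult(2) V_S_zero) auto
      finally have "S e * (star_poly (S e) * S f) * star_poly (S f) \<simeq> 0"
        by (intro eqv_0_mult(1)[OF eqv_0_mult(2)])
      then show ?thesis by (simp add: mult.assoc)
    qed
  qed
  finally show ?thesis .
next
  case False
  then show ?thesis
    using eqv_0_mult(1)[of "star_poly (S e)" "S f"] eqv_0_mult(2)[of "S f" "star_poly (S e)"]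
      S_outside[of e] S_outside[of f] eqv_star[of "S e" 0] by auto
qed

end

section \<open>Universal norms and homomorphisms of graph algebras\<close>

lemma graph_rels_free:
  assumes "wf_digraph E"
  shows "graph_rels E \<subseteq> free_star_alg (graph_gens E)"
proof
  interpret wf_digraph E by fact
  fix r assume "r \<in> graph_rels E"
  then show "r \<in> free_star_alg (graph_gens E)"
    by (cases rule: graph_rels_cases)
      (auto intro!: free_diff free_mult free_star V_free S_free free_sum)
qed

lemma graph_seminormI:
  assumes "fin_digraph E" "p \<in> admissible (graph_gens E) (graph_rels E)"
  shows "graph_seminorm E p"
  using assms by (auto simp: graph_seminorm_def graph_seminorm_axioms_def admissible_def)

lemma bounded_relations_graph:
  assumes E: "fin_digraph E"
  shows "bounded_relations (graph_gens E) (graph_rels E)"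
proof
  interpret fin_digraph E by fact
  show "graph_rels E \<subseteq> free_star_alg (graph_gens E)" by (rule graph_rels_free) unfold_locales
  show "\<exists>B. \<forall>p\<in>admissible (graph_gens E) (graph_rels E). p (gen g) \<le> B" for g
  proof (intro exI ballI)
    fix p assume "p \<in> admissible (graph_gens E) (graph_rels E)"
    then interpret graph_seminorm E p by (rule graph_seminormI[OF E])
    show "p (gen g) \<le> 1" by (cases g) (simp_all add: V_le_1 S_le_1)
  qed
qed

definition graph_norm :: "('v, 'e) pre_digraph \<Rightarrow> ('v, 'e) graph_gen star_poly \<Rightarrow> real" where
  "graph_norm E = total_norm (graph_gens E) (graph_rels E)"

lemma graph_seminorm_graph_norm:
  assumes "fin_digraph E"
  shows "graph_seminorm E (graph_norm E)"
  unfolding graph_norm_def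
  by (intro graph_seminormI assms bounded_relations.N_admissible bounded_relations_graph)

lemma graph_seminorm_le:
  assumes "graph_seminorm E p"
  shows "p x \<le> graph_norm E x"
proof -
  interpret graph_seminorm E p by fact
  have "p \<in> admissible (graph_gens E) (graph_rels E)"
    using outside rel total_seminorm_axioms by (simp add: admissible_def)
  then show ?thesis
    unfolding graph_norm_def
    by (rule bounded_relations.N_upper[OF bounded_relations_graph[OF fin_digraph]])
qed

lemma cstar_algebra_graph: "fin_digraph E \<Longrightarrow> cstar_algebra (graph_cstar E)"
  unfolding graph_cstar_def by (intro bounded_relations.cstar_algebra_U bounded_relations_graph)

text \<open>Uniqueness on generators identifies \<open>\<phi>\<close> with the function chosen by
  \<open>THE\<close>, and restricting \<open>\<phi>\<close> to the carrier matches the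
  extensionality demanded there. All concrete maps of the square enter through this lemma.\<close>

lemma graph_hom_apply:
  assumes E: "fin_digraph E" and B: "cstar_algebra B" and \<phi>: "star_hom (graph_cstar E) B \<phi>"
    and p: "\<And>v. v \<in> verts E \<Longrightarrow> \<phi> (vproj E v) = p v" and s: "\<And>e. e \<in> arcs E \<Longrightarrow> \<phi> (eiso E e) = s e"
    and a: "a \<in> elems (graph_cstar E)"
  shows "graph_hom E B p s a = \<phi> a"
proof -
  interpret bounded_relations "graph_gens E" "graph_rels E" by (rule bounded_relations_graph[OF E])
  interpret A: cstar_algebra "graph_cstar E" by (rule cstar_algebra_graph[OF E])
  have mem: "vproj E v \<in> elems (graph_cstar E)" if "v \<in> verts E" for v
    using that by (simp add: vproj_def graph_cstar_def univ_gen_cls CS_const V_free)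
  have mem': "eiso E e \<in> elems (graph_cstar E)" if "e \<in> arcs E" for e
    using that by (simp add: eiso_def graph_cstar_def univ_gen_cls CS_const S_free)
  let ?\<phi> = "restrict \<phi> (elems (graph_cstar E))"
  have "graph_hom E B p s = ?\<phi>"
    unfolding graph_hom_def
  proof (rule the_equality)
    show "?\<phi> \<in> extensional (elems (graph_cstar E)) \<and> star_hom (graph_cstar E) B ?\<phi> \<and>
      (\<forall>v\<in>verts E. ?\<phi> (vproj E v) = p v) \<and> (\<forall>e\<in>arcs E. ?\<phi> (eiso E e) = s e)"
      using p s mem mem' by (auto intro: star_hom_cong[OF A.cstar_algebra_axioms _ \<phi>])
    fix \<psi> assume \<psi>: "\<psi> \<in> extensional (elems (graph_cstar E)) \<and> star_hom (graph_cstar E) B \<psi> \<and>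
      (\<forall>v\<in>verts E. \<psi> (vproj E v) = p v) \<and> (\<forall>e\<in>arcs E. \<psi> (eiso E e) = s e)"
    have "\<psi> a = \<phi> a" if "a \<in> elems (graph_cstar E)" for a
    proof (rule star_hom_eqI[OF B])
      show "star_hom U B \<psi>" "star_hom U B \<phi>" using \<psi> \<phi> by (simp_all add: graph_cstar_def)
      show "a \<in> elems U" using that by (simp add: graph_cstar_def)
      fix g assume "g \<in> graph_gens E"
      then show "\<psi> (univ_gen (graph_gens E) (graph_rels E) g) = \<phi> (univ_gen (graph_gens E) (graph_rels E) g)"
        using \<psi> p s by (auto simp: graph_gens_def vproj_def eiso_def)
    qed
    then show "\<psi> = ?\<phi>" using \<psi> by (auto intro: extensionalityI[of _ "elems (graph_cstar E)"])
  qed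
  then show ?thesis using a by simp
qed

section \<open>The quotient by the ideal of a vertex\<close>

text \<open>The algebraic two-sided ideal, without closure; the closed ideal enters only through
  distances to this set.\<close>

inductive_set gen_ideal :: "'g star_poly \<Rightarrow> 'g star_poly set" for P where
  base: "P \<in> gen_ideal P"
| add: "x \<in> gen_ideal P \<Longrightarrow> y \<in> gen_ideal P \<Longrightarrow> x + y \<in> gen_ideal P"
| left: "x \<in> gen_ideal P \<Longrightarrow> a * x \<in> gen_ideal P"
| right: "x \<in> gen_ideal P \<Longrightarrow> x * a \<in> gen_ideal P"

lemma gen_ideal_0: "0 \<in> gen_ideal P"
  using gen_ideal.left[OF gen_ideal.base, of 0 P] by simp

lemma gen_ideal_sum: "(\<And>a. a \<in> A \<Longrightarrow> f a \<in> gen_ideal P) \<Longrightarrow> sum f A \<in> gen_ideal P"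
  by (induction A rule: infinite_finite_induct) (auto simp: gen_ideal_0 gen_ideal.add)

text \<open>Shared by \<open>E\<close> and \<open>E'\<close>: only the loop leaves \<open>vb\<close>
  in the one graph and no edge in the other, so a single treatment of the quotient gives both
  quotient maps. \<open>other_exit\<close> is the form in which (T2) is used.\<close>

locale isolated_vertex = fin_digraph E for E :: "('v, 'e) pre_digraph" +
  fixes vb :: 'v
  assumes vb: "vb \<in> verts E"
    and loops: "e \<in> arcs E \<Longrightarrow> tail E e = vb \<Longrightarrow> head E e = vb"
    and other_exit: "v \<in> verts E \<Longrightarrow> v \<noteq> vb \<Longrightarrow> out_arcs E v \<noteq> {} \<Longrightarrow> \<exists>e\<in>out_arcs E v. head E e \<noteq> vb"
begin

definition proper_arcs :: "'e set" where
  "proper_arcs = {e \<in> arcs E. tail E e \<noteq> vb}"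

text \<open>\<open>approx_unit n\<close> is \<open>\<Sum> S\<^sub>\<mu> S\<^sub>\<mu>\<^sup>*\<close> over the paths \<open>\<mu>\<close> of length at most \<open>n\<close> that end at \<open>vb\<close> and
  do not pass through a loop at \<open>vb\<close>.\<close>

primrec approx_unit :: "nat \<Rightarrow> ('v, 'e) graph_gen star_poly" where
  "approx_unit 0 = V vb"
| "approx_unit (Suc n) = V vb + (\<Sum>e\<in>proper_arcs. S e * approx_unit n * star_poly (S e))"

abbreviation J :: "('v, 'e) graph_gen star_poly set" where "J \<equiv> gen_ideal (V vb)"

lemma finite_proper_arcs [simp]: "finite proper_arcs"
  by (simp add: proper_arcs_def)

lemma approx_unit_ideal: "approx_unit n \<in> J"
proof (induction n)
  case (Suc n)
  then show ?case
    unfolding approx_unit.simps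
    by (intro gen_ideal.add gen_ideal.base gen_ideal_sum gen_ideal.right[OF gen_ideal.left])
qed (simp add: gen_ideal.base)

abbreviation E_del :: "('v, 'e) pre_digraph" where "E_del \<equiv> del_vert vb"

lemma fin_digraph_del: "fin_digraph E_del"
  by (rule fin_digraph_del_vert)

text \<open>Deleting a vertex removes the edges touching it at either end. By \<open>loops\<close>
  an edge that starts at \<open>vb\<close> also ends there, so testing the range is enough.\<close>

lemma arcs_del: "e \<in> arcs E_del \<longleftrightarrow> e \<in> arcs E \<and> head E e \<noteq> vb"
  using loops by (auto simp: del_vert_simps)

lemma out_arcs_del: "v \<noteq> vb \<Longrightarrow> out_arcs E_del v = {e \<in> out_arcs E v. head E e \<noteq> vb}"
  by (auto simp: out_arcs_def del_vert_simps)

lemma sum_out_arcs: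
  assumes "v \<noteq> vb"
  shows "sum f (out_arcs E v) = sum f (out_arcs E_del v) + sum f {e \<in> out_arcs E v. head E e = vb}"
proof -
  have "sum f (out_arcs E v) = sum f ({e \<in> out_arcs E v. head E e \<noteq> vb} \<union> {e \<in> out_arcs E v. head E e = vb})"
    by (rule arg_cong[where f = "sum f"]) blast
  also have "\<dots> = sum f {e \<in> out_arcs E v. head E e \<noteq> vb} + sum f {e \<in> out_arcs E v. head E e = vb}"
    by (rule sum.union_disjoint) (auto simp: out_arcs_def)
  finally show ?thesis unfolding out_arcs_del[OF assms] .
qed

lemma graph_gens_del: "graph_gens E_del \<subseteq> graph_gens E"
  by (auto simp: graph_gens_def del_vert_simps)

end

section \<open>The approximate unit of the ideal at \<open>vb\<close>\<close>

locale isolated_vertex_seminorm = isolated_vertex E vb + graph_seminorm E p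
  for E :: "('v, 'e) pre_digraph" and vb and p
begin

abbreviation (input) a where "a \<equiv> approx_unit"

lemma proper_arcsD: "e \<in> proper_arcs \<Longrightarrow> e \<in> arcs E" "e \<in> proper_arcs \<Longrightarrow> tail E e \<noteq> vb"
  by (auto simp: proper_arcs_def)

lemma approx_unit_star: "star_poly (approx_unit n) \<simeq> approx_unit n"
proof (induction n)
  case (Suc n)
  have "S e * (star_poly (a n) * star_poly (S e)) \<simeq> S e * (a n * star_poly (S e))" for e
    by (intro eqv_multR eqv_multL Suc)
  then show ?case
    using projD(1)[OF V_proj] by (simp add: star_poly_simps mult.assoc eqv_add eqv_sum)
qed (simp add: projD V_proj)

lemma V_S_eqv: "e \<in> arcs E \<Longrightarrow> V v * S e \<simeq> (if v = tail E e then S e else 0)"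
  using S_tail V_S_zero by auto

lemma S_star_V_eqv: "e \<in> arcs E \<Longrightarrow> star_poly (S e) * V v \<simeq> (if v = tail E e then star_poly (S e) else 0)"
proof -
  assume e: "e \<in> arcs E"
  have "star_poly (S e) * V v \<simeq> star_poly (S e) * star_poly (V v)"
    by (intro eqv_multR eqv_sym[OF projD(1)] V_proj)
  also have "\<dots> = star_poly (V v * S e)" by (simp add: star_poly_mult)
  also have "\<dots> \<simeq> star_poly (if v = tail E e then S e else 0)" by (intro eqv_star V_S_eqv e)
  finally show ?thesis by (simp split: if_splits)
qed

lemma V_comm: "V v * V w \<simeq> V w * V v"
  using eqv_trans[OF V_orth eqv_sym[OF V_orth], of v w w v] by (cases "v = w") auto

text \<open>Every summand coming from an edge \<open>e\<close> lies under the vertex projection at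
  the source of \<open>e\<close> from both sides, so each \<open>V v\<close> either fixes it on both
  sides or annihilates it on both sides.\<close>

lemma V_approx_unit_comm: "V v * approx_unit n \<simeq> approx_unit n * V v"
proof (cases n)
  case 0
  then show ?thesis by (simp add: V_comm)
next
  case (Suc m)
  have "V v * (S e * a m * star_poly (S e)) \<simeq> S e * a m * star_poly (S e) * V v" if "e \<in> proper_arcs" for e
  proof -
    note e = proper_arcsD(1)[OF that]
    have "V v * (S e * a m * star_poly (S e)) = (V v * S e) * (a m * star_poly (S e))"
      by (simp add: mult.assoc)
    also have "\<dots> \<simeq> (if v = tail E e then S e else 0) * (a m * star_poly (S e))"
      by (intro eqv_multL V_S_eqv e)
    also have "\<dots> = (S e * a m) * (if v = tail E e then star_poly (S e) else 0)"
      by (simp add: mult.assoc)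
    also have "\<dots> \<simeq> (S e * a m) * (star_poly (S e) * V v)"
      by (intro eqv_multR eqv_sym[OF S_star_V_eqv] e)
    finally show ?thesis by (simp add: mult.assoc)
  qed
  then have "(\<Sum>e\<in>proper_arcs. V v * (S e * a m * star_poly (S e)))
      \<simeq> (\<Sum>e\<in>proper_arcs. S e * a m * star_poly (S e) * V v)" by (rule eqv_sum)
  then show ?thesis
    using eqv_add[OF V_comm[of v vb]]
    by (simp add: Suc distrib_left distrib_right sum_distrib_left sum_distrib_right)
qed

lemma vb_approx_unit: "V vb * approx_unit n \<simeq> V vb"
proof (cases n)
  case (Suc m)
  have "V vb * (S e * a m * star_poly (S e)) \<simeq> 0" if "e \<in> proper_arcs" for e
    using eqv_0_mult(1)[OF V_S_zero[of e vb], of "a m * star_poly (S e)"] proper_arcsD[OF that]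
    by (simp add: mult.assoc)
  then have "(\<Sum>e\<in>proper_arcs. V vb * (S e * a m * star_poly (S e))) \<simeq> (\<Sum>e\<in>proper_arcs. 0)"
    by (intro eqv_sum)
  then show ?thesis
    using eqv_add[OF projD(2)[OF V_proj[of vb]]] by (fastforce simp: Suc distrib_left sum_distrib_left)
qed (simp add: projD V_proj)

lemma approx_unit_vb: "approx_unit n * V vb \<simeq> V vb"
  using V_approx_unit_comm vb_approx_unit eqv_sym eqv_trans by meson

lemma S_approx_unit_head:
  assumes "e \<in> arcs E"
  shows "S e * approx_unit n * V (head E e) \<simeq> S e * approx_unit n"
proof -
  have "S e * a n * V (head E e) = S e * (a n * V (head E e))" by (simp add: mult.assoc)
  also have "\<dots> \<simeq> S e * (V (head E e) * a n)" by (intro eqv_multR eqv_sym[OF V_approx_unit_comm])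
  also have "\<dots> = S e * V (head E e) * a n" by (simp add: mult.assoc)
  also have "\<dots> \<simeq> S e * a n" by (intro eqv_multL S_head assms)
  finally show ?thesis .
qed

text \<open>Of the summands of \<open>approx_unit (Suc n)\<close> only the one for \<open>e\<close>
  survives, by orthogonality of the edges. Moving the unit past an edge thus costs one step of path
  length, and the index drops by one.\<close>

lemma approx_unit_S:
  assumes e: "e \<in> proper_arcs"
  shows "approx_unit (Suc n) * S e \<simeq> S e * approx_unit n"
proof -
  have "(S f * a n * star_poly (S f)) * S e \<simeq> (if f = e then S e * a n else 0)" if "f \<in> proper_arcs" for f
  proof (cases "f = e")
    case True
    have "(S e * a n * star_poly (S e)) * S e = S e * a n * (star_poly (S e) * S e)" by (simp add: mult.assoc)
    also have "\<dots> \<simeq> S e * a n * V (head E e)" by (intro eqv_multR S_range proper_arcsD e)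
    also have "\<dots> \<simeq> S e * a n" by (intro S_approx_unit_head proper_arcsD e)
    finally show ?thesis using True by simp
  next
    case False
    then show ?thesis using eqv_0_mult(2)[OF S_orth[of f e], of "S f * a n"] by (simp add: mult.assoc)
  qed
  then have "(\<Sum>f\<in>proper_arcs. (S f * a n * star_poly (S f)) * S e) \<simeq> (\<Sum>f\<in>proper_arcs. if f = e then S e * a n else 0)"
    by (rule eqv_sum)
  then have "(\<Sum>f\<in>proper_arcs. (S f * a n * star_poly (S f)) * S e) \<simeq> S e * a n"
    using e by simp
  then have "V vb * S e + (\<Sum>f\<in>proper_arcs. (S f * a n * star_poly (S f)) * S e) \<simeq> 0 + S e * a n"
    using e proper_arcsD by (intro eqv_add V_S_zero) auto
  then show ?thesis by (simp add: distrib_right sum_distrib_right)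
qed

lemma S_star_approx_unit:
  assumes e: "e \<in> proper_arcs"
  shows "star_poly (S e) * approx_unit (Suc n) \<simeq> approx_unit n * star_poly (S e)"
proof -
  have "star_poly (S e) * a (Suc n) \<simeq> star_poly (S e) * star_poly (a (Suc n))"
    by (intro eqv_multR eqv_sym[OF approx_unit_star])
  also have "\<dots> = star_poly (a (Suc n) * S e)" by (simp add: star_poly_mult)
  also have "\<dots> \<simeq> star_poly (S e * a n)" by (intro eqv_star approx_unit_S e)
  also have "\<dots> = star_poly (a n) * star_poly (S e)" by (simp add: star_poly_mult)
  also have "\<dots> \<simeq> a n * star_poly (S e)" by (intro eqv_multL approx_unit_star)
  finally show ?thesis .
qed

lemma approx_unit_proj: "is_proj (approx_unit n)"
proof (induction n)
  case 0
  show ?case by (simp add: V_proj)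
next
  case (Suc n)
  have "a (Suc n) * (S e * a n * star_poly (S e)) \<simeq> S e * a n * star_poly (S e)" if e: "e \<in> proper_arcs" for e
  proof -
    have "a (Suc n) * (S e * a n * star_poly (S e)) = (a (Suc n) * S e) * (a n * star_poly (S e))"
      by (simp add: mult.assoc)
    also have "\<dots> \<simeq> (S e * a n) * (a n * star_poly (S e))" by (intro eqv_multL approx_unit_S e)
    also have "\<dots> = S e * (a n * a n) * star_poly (S e)" by (simp add: mult.assoc)
    also have "\<dots> \<simeq> S e * a n * star_poly (S e)" using Suc by (intro eqv_multL eqv_multR projD)
    finally show ?thesis .
  qed
  then have "(\<Sum>e\<in>proper_arcs. a (Suc n) * (S e * a n * star_poly (S e)))
      \<simeq> (\<Sum>e\<in>proper_arcs. S e * a n * star_poly (S e))" by (rule eqv_sum)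
  then have "a (Suc n) * V vb + (\<Sum>e\<in>proper_arcs. a (Suc n) * (S e * a n * star_poly (S e))) \<simeq> a (Suc n)"
    using eqv_add[OF approx_unit_vb[of "Suc n"]] by simp
  then have "a (Suc n) * a (Suc n) \<simeq> a (Suc n)"
    unfolding approx_unit.simps(2)[of n, THEN arg_cong, of "\<lambda>x. a (Suc n) * x"]
    by (simp only: distrib_left sum_distrib_left)
  then show ?case using approx_unit_star[of "Suc n"] unfolding is_proj_def by blast
qed

lemma loop_approx_unit:
  assumes e: "e \<in> arcs E" "tail E e = vb"
  shows "S e * approx_unit n \<simeq> S e" "star_poly (S e) * approx_unit n \<simeq> star_poly (S e)"
proof -
  have h: "S e * V vb \<simeq> S e" using S_head[OF e(1)] loops[OF e] by simp
  have "S e * a n \<simeq> S e * V vb * a n" by (intro eqv_multL eqv_sym[OF h])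
  also have "\<dots> = S e * (V vb * a n)" by (simp add: mult.assoc)
  also have "\<dots> \<simeq> S e * V vb" by (intro eqv_multR vb_approx_unit)
  also have "\<dots> \<simeq> S e" by (rule h)
  finally show "S e * a n \<simeq> S e" .
  have h': "star_poly (S e) * V vb \<simeq> star_poly (S e)" using S_star_V_eqv[OF e(1), of vb] e by simp
  have "star_poly (S e) * a n \<simeq> star_poly (S e) * V vb * a n" by (intro eqv_multL eqv_sym[OF h'])
  also have "\<dots> = star_poly (S e) * (V vb * a n)" by (simp add: mult.assoc)
  also have "\<dots> \<simeq> star_poly (S e) * V vb" by (intro eqv_multR vb_approx_unit)
  also have "\<dots> \<simeq> star_poly (S e)" by (rule h')
  finally show "star_poly (S e) * a n \<simeq> star_poly (S e)" .
qed

text \<open>Absorption is exact from some index on, not merely in the limit. For the algebraic ideal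
  this can be reached because each letter shifts the index by at most one.\<close>

definition absorbed :: "('v, 'e) graph_gen star_poly \<Rightarrow> bool" where
  "absorbed y \<longleftrightarrow> (\<exists>n0. \<forall>n\<ge>n0. y * approx_unit n \<simeq> y)"

lemma absorbed_add: "absorbed x \<Longrightarrow> absorbed y \<Longrightarrow> absorbed (x + y)"
proof -
  assume "absorbed x" "absorbed y"
  then obtain m n where "\<forall>k\<ge>m. x * a k \<simeq> x" "\<forall>k\<ge>n. y * a k \<simeq> y" by (auto simp: absorbed_def)
  then have "\<forall>k\<ge>max m n. (x + y) * a k \<simeq> x + y" by (simp add: distrib_right eqv_add)
  then show ?thesis unfolding absorbed_def by blast
qed

lemma absorbed_left: "absorbed y \<Longrightarrow> absorbed (x * y)"
  unfolding absorbed_def by (metis eqv_multR mult.assoc)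

lemma absorbed_trivial: "(\<And>n. x * approx_unit n \<simeq> x) \<Longrightarrow> absorbed (y * x)"
  by (rule absorbed_left) (simp add: absorbed_def)

lemma absorbed_letter:
  assumes y: "absorbed y"
  shows "absorbed (y * letter l)"
proof -
  obtain n0 where n0: "\<And>n. n \<ge> n0 \<Longrightarrow> y * a n \<simeq> y" using y by (auto simp: absorbed_def)
  \<comment> \<open>It suffices that \<open>x\<close> passes the unit with a bounded loss of index.
    For \<open>S e\<close> the index rises by one; for its adjoint it falls by one, which
    \<open>k = 1\<close> compensates.\<close>
  have comm: "absorbed (y * x)" if c: "\<And>n. \<exists>m\<ge>n. x * a (n + k) \<simeq> a m * x" for x k
    unfolding absorbed_def
  proof (intro exI allI impI)
    fix n assume n: "n \<ge> n0 + k"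
    obtain m where m: "m \<ge> n - k" "x * a (n - k + k) \<simeq> a m * x" using c by blast
    have "y * x * a n = y * (x * a (n - k + k))" using n by (simp add: mult.assoc)
    also have "\<dots> \<simeq> y * (a m * x)" by (intro eqv_multR m)
    also have "\<dots> = (y * a m) * x" by (simp add: mult.assoc)
    also have "\<dots> \<simeq> y * x" using m n by (intro eqv_multL n0) auto
    finally show "y * x * a n \<simeq> y * x" .
  qed
  have null: "absorbed (y * x)" if "x \<simeq> 0" for x
    by (rule absorbed_trivial) (rule eqv_trans[OF eqv_0_mult(1)[OF that] eqv_sym[OF that]])
  obtain g b where l: "l = (g, b)" by (cases l)
  show ?thesis
  proof (cases g)
    case (Vx v)
    have 1: "absorbed (y * V v)"
      using V_approx_unit_comm eqv_sym by (intro comm[of _ 0]) (metis add_0_right order_refl eqv_sym)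
    have "y * letter l \<simeq> y * V v"
      using projD(1)[OF V_proj, of v] by (auto simp: l Vx letter_eq intro: eqv_multR)
    then show ?thesis using 1 unfolding absorbed_def
      by (meson eqv_multL eqv_sym eqv_trans)
  next
    case (Ed e)
    consider (out) "e \<notin> arcs E" | (loop) "e \<in> arcs E" "tail E e = vb" | (proper) "e \<in> proper_arcs"
      by (auto simp: proper_arcs_def)
    then show ?thesis
    proof cases
      case out
      then show ?thesis
        using null[of "S e"] null[of "star_poly (S e)"] S_outside[of e] eqv_star[of "S e" 0]
        by (simp add: l Ed letter_eq)
    next
      case loop
      then show ?thesis
        using absorbed_trivial[of "S e" y] absorbed_trivial[of "star_poly (S e)" y] loop_approx_unit
        by (simp add: l Ed letter_eq)
    next
      case proper
      have "absorbed (y * S e)"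
        by (rule comm[of _ 0]) (metis add_0_right approx_unit_S[OF proper] eqv_sym le_SucI order_refl)
      moreover have "absorbed (y * star_poly (S e))"
        by (rule comm[of _ 1]) (metis Suc_eq_plus1 S_star_approx_unit[OF proper] order_refl)
      ultimately show ?thesis by (simp add: l Ed letter_eq)
    qed
  qed
qed

lemma absorbed_right: "absorbed y \<Longrightarrow> absorbed (y * x)"
proof (induction x arbitrary: y rule: star_poly_word_induct)
  case (letter l x)
  then show ?case using letter.IH[OF absorbed_letter[of y l]] by (simp add: mult.assoc)
next
  case (scale c x)
  then show ?case using absorbed_left[of "y * x" "cst c"] by (simp add: cst_left_comm[of y])
next
  case (add x z)
  then show ?case by (simp add: distrib_left absorbed_add)
qed (auto simp: absorbed_def)

lemma ideal_absorbed: "y \<in> J \<Longrightarrow> absorbed y"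
proof (induction rule: gen_ideal.induct)
  case base
  show ?case using vb_approx_unit by (auto simp: absorbed_def)
qed (auto intro: absorbed_add absorbed_left absorbed_right)

text \<open>As polynomials \<open>star_poly (V vb)\<close> and \<open>V vb\<close> are different
  words, and \<open>J\<close> is generated by the latter alone; the ideal is self-adjoint only up to
  null elements.\<close>

lemma ideal_star: "y \<in> J \<Longrightarrow> \<exists>z\<in>J. star_poly y \<simeq> z"
proof (induction rule: gen_ideal.induct)
  case base
  show ?case using projD(1)[OF V_proj] gen_ideal.base by blast
next
  case (add x y)
  then show ?case using gen_ideal.add eqv_add by (metis star_poly_add)
next
  case (left x b)
  then show ?case using gen_ideal.right eqv_multL by (metis star_poly_mult)
next
  case (right x b)
  then show ?case using gen_ideal.left eqv_multR by (metis star_poly_mult)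
qed

section \<open>The quotient seminorm\<close>

definition quot :: "('v, 'e) graph_gen star_poly \<Rightarrow> real" where
  "quot x = (INF y\<in>J. p (x - y))"

lemma quot_le: "y \<in> J \<Longrightarrow> quot x \<le> p (x - y)"
  unfolding quot_def by (rule cINF_lower) (auto intro: bdd_belowI2 nonneg)

lemma quot_greatest: "(\<And>y. y \<in> J \<Longrightarrow> b \<le> p (x - y)) \<Longrightarrow> b \<le> quot x"
  unfolding quot_def by (rule cINF_greatest) (use gen_ideal.base in auto)

lemma quot_nonneg: "0 \<le> quot x"
  by (intro quot_greatest nonneg)

lemma quot_le_p: "quot x \<le> p x"
  using quot_le[OF gen_ideal_0, of x] by simp

lemma quot_approx:
  assumes "quot x < b"
  obtains y where "y \<in> J" "p (x - y) < b"
  using quot_greatest[of b x] assms by (meson not_le)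

lemma quot_cong: "x \<simeq> y \<Longrightarrow> quot x = quot y"
proof -
  assume xy: "x \<simeq> y"
  have "p (x - z) = p (y - z)" for z by (intro p_cong eqv_diff xy eqv_refl)
  then show ?thesis by (simp add: quot_def)
qed

lemma quot_greatest_mult:
  assumes "0 \<le> c" "\<And>y. y \<in> J \<Longrightarrow> b \<le> p (x - y) * c"
  shows "b \<le> quot x * c"
proof (cases "c = 0")
  case True
  then show ?thesis using assms(2)[OF gen_ideal_0] by simp
next
  case False
  then have c: "0 < c" using assms(1) by simp
  have "b / c \<le> quot x" using assms(2) c by (intro quot_greatest) (simp add: divide_le_eq)
  then show ?thesis using c by (simp add: divide_le_eq)
qed

lemma quot_ideal: "y \<in> J \<Longrightarrow> quot y = 0"
  using quot_le[of y y] quot_nonneg[of y] by simp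

lemma approx_unit_compl_le: "p (x * (1 - approx_unit n)) \<le> p x"
  by (intro p_mult_right proj_le_1 proj_compl approx_unit_proj)

text \<open>The C*-identity rests on the approximate unit. If \<open>a n\<close> absorbs the ideal
  element \<open>y\<close>, cutting by \<open>1 - a n\<close> annihilates \<open>y\<close>. The
  seminorm of \<open>x * (1 - a n)\<close> bounds \<open>quot x\<close>, and its square is at most
  the distance of \<open>star_poly x * x\<close> from \<open>y\<close>.\<close>

lemma total_seminorm_quot: "total_seminorm quot"
proof
  fix x y :: "('v, 'e) graph_gen star_poly" and c
  show "0 \<le> quot x" by (rule quot_nonneg)
  show "quot (x + y) \<le> quot x + quot y"
  proof (rule field_le_epsilon)
    fix e :: real assume e: "0 < e"
    obtain u where u: "u \<in> J" "p (x - u) < quot x + e/2" using quot_approx[of x "quot x + e/2"] e by auto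
    obtain w where w: "w \<in> J" "p (y - w) < quot y + e/2" using quot_approx[of y "quot y + e/2"] e by auto
    have "quot (x + y) \<le> p (x + y - (u + w))" by (intro quot_le gen_ideal.add u w)
    also have "\<dots> \<le> p (x - u) + p (y - w)" using triangle[of "x - u" "y - w"] by (simp add: algebra_simps)
    finally show "quot (x + y) \<le> quot x + quot y + e" using u w by simp
  qed
  have sc: "quot (cst c * x) \<le> quot x * cmod c" for c x
  proof (rule quot_greatest_mult)
    fix y assume "y \<in> J"
    then have "quot (cst c * x) \<le> p (cst c * x - cst c * y)" by (intro quot_le gen_ideal.left)
    then show "quot (cst c * x) \<le> p (x - y) * cmod c" by (simp add: scale mult.commute flip: right_diff_distrib)
  qed simp
  show "quot (cst c * x) = cmod c * quot x"
  proof (cases "c = 0")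
    case True
    then show ?thesis using sc[of 0 x] quot_nonneg[of 0] by simp
  next
    case False
    have "quot x \<le> quot (cst c * x) * cmod (inverse c)"
      using sc[of "inverse c" "cst c * x"] False by (simp flip: mult.assoc cst_mult)
    then have "cmod c * quot x \<le> quot (cst c * x)"
      using False by (simp add: norm_inverse norm_divide field_simps)
    then show ?thesis using sc[of c x] by (simp add: mult.commute)
  qed
  have mu: "quot (x * y) \<le> quot x * quot y" for x y
  proof (rule quot_greatest_mult[OF quot_nonneg])
    fix u assume u: "u \<in> J"
    have "quot (x * y) \<le> quot y * p (x - u)"
    proof (rule quot_greatest_mult[OF nonneg])
      fix w assume w: "w \<in> J"
      have "quot (x * y) \<le> p (x * y - (u * y + (x - u) * w))"
        by (intro quot_le gen_ideal.intros u w)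
      also have "x * y - (u * y + (x - u) * w) = (x - u) * (y - w)" by (simp add: algebra_simps)
      finally show "quot (x * y) \<le> p (y - w) * p (x - u)"
        using mult[of "x - u" "y - w"] by (simp add: mult.commute)
    qed
    then show "quot (x * y) \<le> p (x - u) * quot y" by (simp add: mult.commute)
  qed
  then show "quot (x * y) \<le> quot x * quot y" .
  have st: "quot (star_poly x) \<le> quot x" for x
  proof (rule quot_greatest)
    fix y assume "y \<in> J"
    then obtain z where z: "z \<in> J" "star_poly y \<simeq> z" using ideal_star by blast
    have "quot (star_poly x) \<le> p (star_poly x - z)" by (rule quot_le[OF z(1)])
    also have "\<dots> = p (star_poly x - star_poly y)" by (intro p_cong eqv_diff eqv_refl eqv_sym[OF z(2)])
    finally show "quot (star_poly x) \<le> p (x - y)" by (simp flip: star_poly_diff)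
  qed
  have "(quot x)\<^sup>2 \<le> quot (star_poly x * x)"
  proof (rule quot_greatest)
    fix y assume "y \<in> J"
    then obtain n where n: "y * a n \<simeq> y" using ideal_absorbed unfolding absorbed_def by blast
    define u where "u = 1 - a n"
    have u: "p u \<le> 1" "star_poly u \<simeq> u"
      using proj_le_1[OF proj_compl[OF approx_unit_proj]] projD(1)[OF proj_compl[OF approx_unit_proj]]
      by (simp_all add: u_def)
    have yu: "p (y * u) = 0"
      using n p_diff_comm[of "y * a n" y] by (simp add: u_def eqv_def algebra_simps)
    have "quot x \<le> p (x * u)"
      using quot_le[OF gen_ideal.left[OF approx_unit_ideal], of x x n] by (simp add: u_def algebra_simps)
    then have "(quot x)\<^sup>2 \<le> (p (x * u))\<^sup>2" by (intro power_mono quot_nonneg)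
    also have "\<dots> = p (star_poly u * (star_poly x * x * u))"
      by (simp add: star_poly_mult mult.assoc flip: cstar)
    also have "\<dots> \<le> p (star_poly x * x * u)" using u by (intro p_mult_left) simp
    also have "\<dots> \<le> p ((star_poly x * x - y) * u) + p (y * u)"
      using triangle[of "(star_poly x * x - y) * u" "y * u"] by (simp add: algebra_simps)
    also have "\<dots> \<le> p (star_poly x * x - y)" using p_mult_right[OF u(1)] yu by simp
    finally show "(quot x)\<^sup>2 \<le> p (star_poly x * x - y)" .
  qed
  moreover have "quot (star_poly x * x) \<le> (quot x)\<^sup>2"
    using order_trans[OF mu mult_right_mono[OF st quot_nonneg]] by (simp add: power2_eq_square)
  ultimately show "quot (star_poly x * x) = (quot x)\<^sup>2" by simp
qed

lemma quot_S: "e \<in> arcs E \<Longrightarrow> head E e = vb \<Longrightarrow> quot (S e) = 0"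
  using quot_cong[OF S_head[of e]] quot_ideal[OF gen_ideal.left[OF gen_ideal.base]] by simp

text \<open>The edges missing from a Cuntz-Krieger sum in \<open>E_del\<close> end at
  \<open>vb\<close>; they satisfy \<open>S_e = S_e P\<close> and are null in the quotient. Hence
  \<open>quot\<close> is dominated by the universal seminorm of \<open>E_del\<close>.\<close>

lemma graph_seminorm_quot: "graph_seminorm E_del quot"
proof -
  interpret q: total_seminorm quot by (rule total_seminorm_quot)
  have zero: "quot x = 0" if "p x = 0" for x
    using quot_le_p[of x] quot_nonneg[of x] that by simp
  have "quot (gen g) = 0" if g: "g \<notin> graph_gens E_del" for g
  proof (cases g)
    case (Vx v)
    then have "v \<notin> verts E \<or> v = vb" using g by (auto simp: graph_gens_def del_vert_simps)
    then show ?thesis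
      using zero V_outside[of v] quot_ideal[OF gen_ideal.base] by (auto simp: Vx eqv_0)
  next
    case (Ed e)
    then have "e \<notin> arcs E \<or> e \<in> arcs E \<and> head E e = vb"
      using g by (auto simp: graph_gens_def arcs_del)
    then show ?thesis using zero S_outside[of e] quot_S[of e] by (auto simp: Ed eqv_0)
  qed
  moreover have "quot r = 0" if "r \<in> graph_rels E_del" for r
    using that
  proof (cases rule: graph_rels_cases)
    case (CK v)
    then have v: "v \<in> verts E" "v \<noteq> vb" by (auto simp: del_vert_simps)
    let ?f = "\<lambda>e. S e * star_poly (S e)"
    define D where "D = {e \<in> out_arcs E v. head E e = vb}"
    have r: "r = (sum ?f (out_arcs E v) - V v) - sum ?f D"
      unfolding CK(3) sum_out_arcs[OF v(2), of ?f] D_def by simp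
    have "out_arcs E v \<noteq> {}" using CK(2) unfolding out_arcs_del[OF v(2)] by blast
    then have "quot (sum ?f (out_arcs E v) - V v) = 0"
      by (intro zero rel graph_relsI v)
    moreover have "quot (?f e) = 0" if "e \<in> D" for e
      using q.mult[of "S e" "star_poly (S e)"] q.nonneg[of "?f e"] quot_S[of e] that by (auto simp: D_def)
    then have "quot (sum ?f D) \<le> 0" using q.p_sum[of ?f D] by simp
    ultimately show ?thesis
      using q.triangle_diff[of "sum ?f (out_arcs E v) - V v" "sum ?f D"] q.nonneg[of r] unfolding r by simp
  qed (auto intro!: zero rel graph_relsI simp: del_vert_simps)
  ultimately show ?thesis
    by (intro graph_seminorm.intro fin_digraph_del total_seminorm_quot) (simp add: graph_seminorm_axioms_def)
qed

text \<open>A bound on the universal seminorm of \<open>E_del\<close> yields a nearby element of the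
  algebraic ideal, where absorption is exact. This is the form in which the identification of the
  quotient is used later.\<close>

lemma ideal_approximation:
  assumes "graph_norm E_del x < b"
  obtains y where "y \<in> J" "p (x - y) < b"
  using quot_approx[OF le_less_trans[OF graph_seminorm_le[OF graph_seminorm_quot] assms]] that by blast

end

context isolated_vertex begin

text \<open>Here (T2) enters: a vertex other than \<open>vb\<close> that emits edges in
  \<open>E\<close> still emits one in \<open>E_del\<close>, so its Cuntz-Krieger relation persists,
  the lost summands being null. At \<open>vb\<close> the projection and all edges leaving it are
  null.\<close>

lemma graph_seminorm_del: "graph_seminorm E (graph_norm E_del)"
proof -
  interpret d: graph_seminorm E_del "graph_norm E_del"
    by (rule graph_seminorm_graph_norm[OF fin_digraph_del])
  have vb0: "d.eqv (V vb) 0" by (rule d.V_outside) (simp add: del_vert_simps)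
  have S0: "d.eqv (S e) 0" if "head E e = vb" for e
    by (rule d.S_outside) (simp add: arcs_del that)
  have "graph_norm E_del r = 0" if "r \<in> graph_rels E" for r
    using that
  proof (cases rule: graph_rels_cases)
    case (proj v)
    then show ?thesis using d.projD(2)[OF d.V_proj] by (simp add: d.eqv_def)
  next
    case (selfadj v)
    then show ?thesis using d.projD(1)[OF d.V_proj] by (simp add: d.eqv_def)
  next
    case (orth v w)
    then show ?thesis using d.V_orth by (simp add: d.eqv_def)
  next
    case (piso e)
    then show ?thesis using d.S_piso by (simp add: d.eqv_def)
  next
    case (range e)
    have "d.eqv (star_poly (S e) * S e) (V (head E e))"
    proof (cases "head E e = vb")
      case True
      then show ?thesis
        using d.eqv_0_mult(2)[OF S0[OF True]] vb0 d.eqv_sym d.eqv_trans by metis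
    next
      case False
      then have "e \<in> arcs E_del" using range by (simp only: arcs_del simp_thms)
      from d.S_range[OF this] show ?thesis by (simp add: head_del_vert)
    qed
    then show ?thesis using range by (simp add: d.eqv_def)
  next
    case (CK v)
    let ?f = "\<lambda>e. S e * star_poly (S e)"
    have "d.eqv (sum ?f (out_arcs E v)) (V v)"
    proof (cases "v = vb")
      case True
      have "d.eqv (sum ?f (out_arcs E v)) (\<Sum>e\<in>out_arcs E v. 0)"
        using loops True by (intro d.eqv_sum d.eqv_0_mult(1) S0) auto
      then have "d.eqv (sum ?f (out_arcs E v)) 0" by simp
      from d.eqv_trans[OF this d.eqv_sym[OF vb0]] show ?thesis using True by simp
    next
      case False
      define D where "D = {e \<in> out_arcs E v. head E e = vb}"
      have "out_arcs E_del v \<noteq> {}" using other_exit[OF CK(1) False CK(2)] unfolding out_arcs_del[OF False] by blast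
      then have 1: "d.eqv (sum ?f (out_arcs E_del v)) (V v)"
        using CK False by (intro d.CK) (auto simp: del_vert_simps)
      have 2: "d.eqv (sum ?f D) (\<Sum>e\<in>D. 0)"
        by (intro d.eqv_sum d.eqv_0_mult(1) S0) (simp add: D_def)
      show ?thesis
        using d.eqv_add[OF 1 2] unfolding sum_out_arcs[OF False, of ?f] D_def by simp
    qed
    then show ?thesis using CK by (simp add: d.eqv_def)
  qed
  moreover have "graph_norm E_del (gen g) = 0" if "g \<notin> graph_gens E" for g
    using that graph_gens_del d.outside by blast
  ultimately show ?thesis
    by (intro graph_seminorm.intro d.total_seminorm_axioms fin_digraph_axioms)
      (simp add: graph_seminorm_axioms_def)
qed

lemma graph_norm_del_le: "graph_norm E_del x \<le> graph_norm E x"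
  by (rule graph_seminorm_le[OF graph_seminorm_del])

end

section \<open>Trimmable graphs\<close>

lemma circle_norm: "z \<in> circle \<Longrightarrow> cmod z = 1"
  by (simp add: mem_sphere_0)

lemma circle_cnj: "z \<in> circle \<Longrightarrow> z * cnj z = 1" "z \<in> circle \<Longrightarrow> cnj z * z = 1"
  by (simp_all add: complex_norm_square[symmetric] circle_norm mult.commute[of "cnj z"])

lemma circle_nonzero: "z \<in> circle \<Longrightarrow> z \<noteq> 0"
  using circle_norm by fastforce

lemma cst_cancel:
  assumes "z \<in> circle"
  shows "(cst z * x) * (cst (cnj z) * y) = x * y" "(cst (cnj z) * x) * (cst z * y) = x * y"
proof -
  have "(cst c * x) * (cst d * y) = cst (c * d) * (x * y)" for c d
    by (simp add: cst_mult mult.assoc cst_left_comm[of x])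
  then show "(cst z * x) * (cst (cnj z) * y) = x * y" "(cst (cnj z) * x) * (cst z * y) = x * y"
    by (simp_all add: circle_cnj[OF assms])
qed

section \<open>Gauge action and \<open>f\<close> as families of substitutions\<close>

definition gauge_gen :: "complex \<Rightarrow> ('v, 'e) graph_gen \<Rightarrow> ('v, 'e) graph_gen star_poly" where
  "gauge_gen z g = (case g of Vx v \<Rightarrow> V v | Ed e \<Rightarrow> cst z * S e)"

text \<open>The value at the point z of the image of a generator under \<open>f\<close>. The loop
  goes to P tensor u, whose value is \<open>z P\<close>.\<close>

definition trim_gen :: "'v \<Rightarrow> 'e \<Rightarrow> complex \<Rightarrow> ('v, 'e) graph_gen \<Rightarrow> ('v, 'e) graph_gen star_poly" where
  "trim_gen vb eb z g = (case g of Vx v \<Rightarrow> V v | Ed e \<Rightarrow> cst z * (if e = eb then V vb else S e))"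

lemma gauge_gen_simps [simp]: "gauge_gen z (Vx v) = V v" "gauge_gen z (Ed e) = cst z * S e"
  by (simp_all add: gauge_gen_def)

lemma trim_gen_simps [simp]: "trim_gen vb eb z (Vx v) = V v"
  "trim_gen vb eb z (Ed e) = cst z * (if e = eb then V vb else S e)"
  by (simp_all add: trim_gen_def)

lemma graph_seminormI':
  assumes "fin_digraph E" "total_seminorm p" "\<And>g. g \<notin> graph_gens E \<Longrightarrow> p (gen g) = 0"
    "\<And>r. r \<in> graph_rels E \<Longrightarrow> p r = 0"
  shows "graph_seminorm E p"
  using assms by (auto simp: graph_seminorm_def graph_seminorm_axioms_def)

context graph_seminorm begin

lemma graph_seminorm_gauge:
  assumes z: "z \<in> circle"
  shows "graph_seminorm E (\<lambda>x. p (subst (gauge_gen z) x))"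
proof (rule graph_seminormI')
  show "fin_digraph E" by unfold_locales
  show "total_seminorm (\<lambda>x. p (subst (gauge_gen z) x))"
    by (rule total_seminorm_subst) unfold_locales
  show "p (subst (gauge_gen z) (gen g)) = 0" if "g \<notin> graph_gens E" for g
    using outside[OF that] by (cases g) (simp_all add: scale)
  fix r assume r: "r \<in> graph_rels E"
  note r0 = rel[OF r]
  from r show "p (subst (gauge_gen z) r) = 0"
  proof (cases rule: graph_rels_cases)
    case (piso e)
    have "subst (gauge_gen z) r = cst z * r"
      by (simp add: piso subst_simps star_poly_cst_mult cst_cancel[OF z] mult.assoc cst_left_comm[of "S e"]
          right_diff_distrib) (simp add: cst_left_comm[of "star_poly (S e)"] cst_left_comm[of "S e"]
          flip: cst_mult mult.assoc[of "cst z" "cst (cnj z)"], simp add: circle_cnj[OF z])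
    then show ?thesis using r0 by (simp add: scale)
  qed (use r0 in \<open>simp_all add: subst_simps star_poly_cst_mult cst_cancel[OF z]\<close>)
qed

end

locale trimmable_graph =
  fixes E :: "('v, 'e) pre_digraph" and vb :: 'v and eb :: 'e
  assumes trimmable: "trimmable E vb eb"
begin

abbreviation E1 :: "('v, 'e) pre_digraph" where "E1 \<equiv> pre_digraph.del_arc E eb"
abbreviation E2 :: "('v, 'e) pre_digraph" where "E2 \<equiv> pre_digraph.del_vert E1 vb"

sublocale fin_digraph E
  using trimmable by (simp add: trimmable_def)

lemma vb: "vb \<in> verts E" and eb: "eb \<in> arcs E" "tail E eb = vb" "head E eb = vb"
  and out_vb: "out_arcs E vb = {eb}"
  using trimmable by (simp_all add: trimmable_def)

lemma tail_vb: "e \<in> arcs E \<Longrightarrow> tail E e = vb \<longleftrightarrow> e = eb"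
  using out_vb eb by (auto simp: out_arcs_def)

text \<open>(T2) speaks of the vertices with an edge into \<open>vb\<close>; at any other vertex an
  outgoing edge already ends elsewhere.\<close>

lemma exit: "v \<in> verts E \<Longrightarrow> v \<noteq> vb \<Longrightarrow> out_arcs E v \<noteq> {} \<Longrightarrow> \<exists>e\<in>out_arcs E v. head E e \<noteq> vb"
proof -
  assume v: "v \<in> verts E" "v \<noteq> vb" "out_arcs E v \<noteq> {}"
  then obtain e where e: "e \<in> arcs E" "tail E e = v" by (auto simp: out_arcs_def)
  show ?thesis
  proof (cases "head E e = vb")
    case True
    then have "v \<in> tail E ` (in_arcs E vb - {eb})" using e v tail_vb[OF e(1)] by (auto simp: in_arcs_def)
    then have "out_arcs E v - in_arcs E vb \<noteq> {}" using trimmable unfolding trimmable_def by blast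
    then show ?thesis by (auto simp: in_arcs_def out_arcs_def)
  next
    case False
    then show ?thesis using e by auto
  qed
qed

sublocale E: isolated_vertex E vb
  using vb exit tail_vb eb by unfold_locales auto

lemma fin_digraph_E1: "fin_digraph E1"
  by (rule fin_digraph_del_arc)

lemma out_arcs_E1: "v \<noteq> vb \<Longrightarrow> out_arcs E1 v = out_arcs E v"
  using eb by (auto simp: out_arcs_del_arc_iff)

sublocale E1: isolated_vertex E1 vb
proof -
  interpret E1: fin_digraph E1 by (rule fin_digraph_E1)
  show "isolated_vertex E1 vb"
  proof
    show "vb \<in> verts E1" by (simp add: vb)
    show "head E1 e = vb" if "e \<in> arcs E1" "tail E1 e = vb" for e
      using that tail_vb by auto
    show "\<exists>e\<in>out_arcs E1 v. head E1 e \<noteq> vb" if "v \<in> verts E1" "v \<noteq> vb" "out_arcs E1 v \<noteq> {}" for v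
      using exit[of v] that out_arcs_E1 by simp
  qed
qed

text \<open>The loop disappears together with its vertex, so \<open>E\<close> and \<open>E1\<close>
  have the same quotient graph and both quotient maps end in one algebra.\<close>

lemma E2_eq: "del_vert vb = E2"
  using eb by (auto simp: pre_digraph.del_vert_def)

abbreviation N :: "('v, 'e) graph_gen star_poly \<Rightarrow> real" where "N \<equiv> graph_norm E"
abbreviation N1 :: "('v, 'e) graph_gen star_poly \<Rightarrow> real" where "N1 \<equiv> graph_norm E1"
abbreviation N2 :: "('v, 'e) graph_gen star_poly \<Rightarrow> real" where "N2 \<equiv> graph_norm E2"

sublocale N: isolated_vertex_seminorm E vb N
  by (intro isolated_vertex_seminorm.intro E.isolated_vertex_axioms graph_seminorm_graph_norm) unfold_locales

sublocale N1: isolated_vertex_seminorm E1 vb N1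
  by (intro isolated_vertex_seminorm.intro E1.isolated_vertex_axioms graph_seminorm_graph_norm fin_digraph_E1)

lemma fin_digraph_E2: "fin_digraph E2"
  by (rule E1.fin_digraph_del)

sublocale N2: graph_seminorm E2 N2
  by (rule graph_seminorm_graph_norm[OF fin_digraph_E2])

lemma N2_le_N1: "N2 x \<le> N1 x"
  by (rule E1.graph_norm_del_le)

abbreviation f :: "complex \<Rightarrow> ('v, 'e) graph_gen star_poly \<Rightarrow> ('v, 'e) graph_gen star_poly" where
  "f z \<equiv> subst (trim_gen vb eb z)"

text \<open>A scalar of modulus one times \<open>P\<close> satisfies the relations of the loop: it
  is a unitary of the corner of \<open>P\<close>, and the Cuntz-Krieger relation at
  \<open>vb\<close> has the loop as its sole term. At the other vertices \<open>E\<close> and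
  \<open>E1\<close> emit the same edges.\<close>

lemma graph_seminorm_trim:
  assumes z: "z \<in> circle"
  shows "graph_seminorm E (\<lambda>x. N1 (f z x))"
proof (rule graph_seminormI')
  show "fin_digraph E" by unfold_locales
  show "total_seminorm (\<lambda>x. N1 (f z x))"
    by (rule total_seminorm_subst) unfold_locales
  show "N1 (f z (gen g)) = 0" if g: "g \<notin> graph_gens E" for g
  proof (cases g)
    case (Vx v)
    then show ?thesis using g N1.V_outside[of v] by (auto simp: graph_gens_def N1.eqv_0)
  next
    case (Ed e)
    then have "e \<notin> arcs E" using g by (auto simp: graph_gens_def)
    then show ?thesis using N1.S_outside[of e] eb by (auto simp: Ed N1.eqv_0 N1.scale)
  qed
  fix r assume r: "r \<in> graph_rels E"
  have VV: "N1.eqv (star_poly (V vb) * V vb) (V vb)" "N1.eqv (V vb * star_poly (V vb)) (V vb)"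
    using N1.projD[OF N1.V_proj[of vb]] N1.eqv_trans N1.eqv_multL N1.eqv_multR by meson+
  from r show "N1 (f z r) = 0"
  proof (cases rule: graph_rels_cases)
    case (proj v)
    then show ?thesis using N1.projD(2)[OF N1.V_proj] by (simp add: N1.eqv_def subst_simps)
  next
    case (selfadj v)
    then show ?thesis using N1.projD(1)[OF N1.V_proj] by (simp add: N1.eqv_def subst_simps)
  next
    case (orth v w)
    then show ?thesis using N1.V_orth by (simp add: N1.eqv_def subst_simps)
  next
    case (piso e)
    let ?s = "if e = eb then V vb else S e"
    have "f z r = cst z * (?s * star_poly ?s * ?s - ?s)"
      using cst_cancel[OF z, of ?s "star_poly ?s"] cst_left_comm[of "?s * star_poly ?s" z ?s]
      by (simp add: piso subst_simps star_poly_cst_mult right_diff_distrib del: if_distrib)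
    moreover have "N1.eqv (?s * star_poly ?s * ?s) ?s"
      using N1.eqv_trans[OF N1.eqv_multL[OF VV(2)] N1.projD(2)[OF N1.V_proj]] N1.S_piso[of e] by simp
    ultimately show ?thesis by (simp only: N1.scale N1.eqv_def)
  next
    case (range e)
    let ?s = "if e = eb then V vb else S e"
    have "f z r = star_poly ?s * ?s - V (head E e)"
      by (simp add: range subst_simps star_poly_cst_mult cst_cancel[OF z])
    moreover have "N1.eqv (star_poly ?s * ?s) (V (head E e))"
      using VV(1) N1.S_range[of e] range eb by auto
    ultimately show ?thesis by (simp only: N1.eqv_def)
  next
    case (CK v)
    have "N1.eqv (\<Sum>e\<in>out_arcs E v. (if e = eb then V vb else S e) * star_poly (if e = eb then V vb else S e)) (V v)"
    proof (cases "v = vb")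
      case True
      then show ?thesis using VV(2) by (simp add: out_vb)
    next
      case False
      have "(\<Sum>e\<in>out_arcs E v. (if e = eb then V vb else S e) * star_poly (if e = eb then V vb else S e))
          = (\<Sum>e\<in>out_arcs E1 v. S e * star_poly (S e))"
        using False eb by (intro sum.cong) (auto simp: out_arcs_E1)
      then show ?thesis using N1.CK[of v] CK out_arcs_E1[OF False] by simp
    qed
    moreover have "f z r = (\<Sum>e\<in>out_arcs E v. (if e = eb then V vb else S e) * star_poly (if e = eb then V vb else S e)) - V v"
      by (simp add: CK(3) subst_simps star_poly_cst_mult cst_cancel[OF z])
    ultimately show ?thesis by (simp only: N1.eqv_def)
  qed
qed

lemma f_le: "z \<in> circle \<Longrightarrow> N1 (f z x) \<le> N x"
  by (rule graph_seminorm_le[OF graph_seminorm_trim])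

lemma f_eqv: "z \<in> circle \<Longrightarrow> N.eqv x y \<Longrightarrow> N1.eqv (f z x) (f z y)"
  using f_le[of z "x - y"] N1.nonneg[of "f z (x - y)"] by (simp add: N.eqv_def N1.eqv_def subst_diff)

text \<open>Forgetting the unitary \<open>S\<^bsub>eb\<^esub>\<close> turns a representation of \<open>E\<close> into one of \<open>E'\<close>.\<close>

lemma V_le: "N (V vb) \<le> N1 (V vb)"
proof -
  let ?t = "\<lambda>g. if g = Ed eb then 0 else gen g"
  have "graph_seminorm E1 (\<lambda>x. N (subst ?t x))"
  proof (rule graph_seminormI'[OF fin_digraph_E1])
    show "total_seminorm (\<lambda>x. N (subst ?t x))" by (rule total_seminorm_subst) unfold_locales
    show "N (subst ?t (gen g)) = 0" if "g \<notin> graph_gens E1" for g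
      using that N.outside[of g] by (auto simp: graph_gens_def)
    fix r assume "r \<in> graph_rels E1"
    then show "N (subst ?t r) = 0"
    proof (cases rule: graph_rels_cases)
      \<comment> \<open>In \<open>E1\<close> the vertex \<open>vb\<close> is a sink and carries no
        Cuntz-Krieger relation; this is why the loop may be sent to zero while \<open>V vb\<close>
        is kept.\<close>
      case (CK v)
      then have v: "v \<noteq> vb" using out_vb eb by (auto simp: out_arcs_del_arc_iff)
      have "subst ?t r = r"
        using CK(3) v eb by (auto simp: subst_simps out_arcs_E1 intro!: sum.cong)
      moreover have "r \<in> graph_rels E"
        using CK v graph_relsI(6)[of v E] by (simp add: out_arcs_E1)
      ultimately show ?thesis using N.rel by simp
    qed (auto simp: subst_simps intro!: N.rel graph_relsI)
  qed
  from graph_seminorm_le[OF this, of "V vb"] show ?thesis by simp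
qed

definition rho :: "('v, 'e) graph_gen star_poly \<Rightarrow> real" where
  "rho x = (SUP z\<in>circle. N1 (f z x))"

lemma bdd_rho: "bdd_above ((\<lambda>z. N1 (f z x)) ` circle)"
  by (rule bdd_aboveI2) (rule f_le)

lemma rho_upper: "z \<in> circle \<Longrightarrow> N1 (f z x) \<le> rho x"
  unfolding rho_def by (rule cSUP_upper[OF _ bdd_rho])

lemma rho_least: "(\<And>z. z \<in> circle \<Longrightarrow> N1 (f z x) \<le> b) \<Longrightarrow> rho x \<le> b"
  unfolding rho_def using one_in_circle by (intro cSUP_least) blast+

lemma rho_le_N: "rho x \<le> N x"
  by (intro rho_least f_le)

sublocale rho: total_seminorm rho
  unfolding rho_def
proof (rule total_seminorm_SUP)
  show "circle \<noteq> {}" using one_in_circle by blast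
  show "total_seminorm (\<lambda>x. N1 (f z x))" for z by (rule total_seminorm_subst) unfold_locales
  show "bdd_above ((\<lambda>z. N1 (f z x)) ` circle)" for x by (rule bdd_rho)
qed

lemma rho_cong: "N.eqv x y \<Longrightarrow> rho x = rho y"
  unfolding rho_def using f_eqv N1.p_cong by (intro SUP_cong) auto

text \<open>At z = 1 the substitution only replaces the loop by \<open>V vb\<close>, and both lie
  outside \<open>E2\<close>, hence are null there. In this way \<open>rho\<close> controls the norm
  modulo the ideal.\<close>

lemma N2_f_1: "N2.eqv (f 1 x) x"
proof (induction x rule: star_poly_gen_induct)
  case (gen g)
  show ?case
  proof (cases "g = Ed eb")
    case True
    have "N2.eqv (V vb) 0" by (rule N2.V_outside) (simp add: E1.del_vert_simps)
    moreover have "N2.eqv (S eb) 0" by (rule N2.S_outside) (simp add: E1.del_vert_simps)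
    ultimately have "N2.eqv (V vb) (S eb)" by (rule N2.eqv_trans[OF _ N2.eqv_sym])
    then show ?thesis using True by simp
  qed (cases g; simp)
qed (auto simp: subst_simps intro: N2.eqv_add N2.eqv_mult N2.eqv_star)

lemma N2_le_rho: "N2 x \<le> rho x"
  using N2.p_cong[OF N2_f_1, of x] N2_le_N1[of "f 1 x"] rho_upper[OF one_in_circle, of x] by simp

end

subsection \<open>Laurent polynomials in the unitary at the loop\<close>

lemma sum_roots_of_unity:
  fixes j :: int and M :: nat
  assumes "0 < \<bar>j\<bar>" "\<bar>j\<bar> < M"
  shows "(\<Sum>m<M. cis (2 * pi / M) powi (j * int m)) = 0"
proof -
  define w where "w = cis (2 * pi / M) powi j"
  have M: "0 < M" using assms by simp
  have w: "w = cis (2 * pi * j / M)"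
    by (simp add: w_def cis_power_int mult.commute)
  have "w ^ M = 1"
  proof -
    have "w ^ M = cis (real M * (2 * pi * j / M))" unfolding w by (rule Complex.DeMoivre)
    also have "real M * (2 * pi * j / M) = 2 * pi * j" using M by simp
    finally show ?thesis by (simp add: cis_multiple_2pi)
  qed
  moreover have "w \<noteq> 1"
  proof
    assume "w = 1"
    then have "cos (2 * pi * j / M) = 1" using w by (metis cis.sel(1) one_complex.sel(1))
    then obtain n :: int where "2 * pi * j / M = of_int n * 2 * pi"
      using cos_one_2pi_int by blast
    then have "real_of_int j = n * M" using M by (simp add: field_simps)
    then have "j = n * int M" by (metis of_int_eq_iff of_int_mult of_int_of_nat_eq)
    then show False using assms M by (cases "n = 0") (auto simp: abs_mult)
  qed
  moreover have "(\<Sum>m<M. cis (2 * pi / M) powi (j * int m)) = (\<Sum>m<M. w ^ m)"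
    by (simp add: w_def power_int_mult)
  ultimately show ?thesis by (simp add: geometric_sum)
qed

text \<open>The coefficient is recovered by averaging over the M-th roots of unity, a discrete
  substitute for the Fourier integral.\<close>

lemma laurent_coeff_le:
  fixes c :: "int \<Rightarrow> complex"
  assumes le: "\<And>z. z \<in> circle \<Longrightarrow> cmod (\<Sum>k\<in>{- int d..int d}. c k * z powi k) \<le> B"
    and j: "j \<in> {- int d..int d}"
  shows "cmod (c j) \<le> B"
proof -
  \<comment> \<open>\<open>M\<close> exceeds the difference of any two exponents, so distinct
    exponents stay distinct modulo \<open>M\<close>.\<close>
  define M where "M = 2 * d + 1"
  define w where "w m = cis (2 * pi / M) powi int m" for m
  have w: "w m \<in> circle" for m by (simp add: w_def mem_sphere_0 norm_power)
  have w0: "w m \<noteq> 0" for m using circle_nonzero[OF w] .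
  have "(\<Sum>m<M. w m powi (- j) * (\<Sum>k\<in>{- int d..int d}. c k * w m powi k))
      = (\<Sum>k\<in>{- int d..int d}. c k * (\<Sum>m<M. cis (2 * pi / M) powi ((k - j) * int m)))"
    unfolding sum_distrib_left
  proof (subst sum.swap, intro sum.cong refl)
    fix k m
    have "w m powi (- j) * (c k * w m powi k) = c k * (w m powi (- j) * w m powi k)" by simp
    also have "w m powi (- j) * w m powi k = w m powi (k - j)"
      using w0 by (simp flip: power_int_add)
    finally show "w m powi (- j) * (c k * w m powi k) = c k * cis (2 * pi / M) powi ((k - j) * int m)"
      by (simp add: w_def mult.commute[of "k - j"] power_int_mult)
  qed
  also have "\<dots> = (\<Sum>k\<in>{- int d..int d}. if k = j then c j * M else 0)"
  proof (intro sum.cong refl)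
    fix k assume k: "k \<in> {- int d..int d}"
    show "c k * (\<Sum>m<M. cis (2 * pi / M) powi ((k - j) * int m)) = (if k = j then c j * M else 0)"
    proof (cases "k = j")
      case False
      then have "(\<Sum>m<M. cis (2 * pi / M) powi ((k - j) * int m)) = 0"
        using j k by (intro sum_roots_of_unity) (auto simp: M_def)
      then show ?thesis using False by simp
    qed simp
  qed
  also have "\<dots> = c j * M" using j by simp
  finally have "cmod (c j) * M = cmod (\<Sum>m<M. w m powi (- j) * (\<Sum>k\<in>{- int d..int d}. c k * w m powi k))"
    by (simp add: norm_mult)
  also have "\<dots> \<le> (\<Sum>m<M. B)"
    by (rule order_trans[OF norm_sum], rule sum_mono)
      (simp add: norm_mult norm_power_int circle_norm[OF w] le[OF w])
  finally show ?thesis by (simp add: M_def)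
qed

context trimmable_graph begin

text \<open>Integer powers of the loop as a unitary of the corner of \<open>P\<close>; the factor
  \<open>V vb\<close> in front makes the zeroth power the unit of that corner.\<close>

definition U :: "int \<Rightarrow> ('v, 'e) graph_gen star_poly" where
  "U k = (if 0 \<le> k then V vb * S eb ^ nat k else V vb * star_poly (S eb) ^ nat (- k))"

lemma U_nat: "U (int n) = V vb * S eb ^ n" and U_neg: "U (- int n) = V vb * star_poly (S eb) ^ n"
  by (auto simp: U_def)

lemma U_0: "U 0 = V vb"
  by (simp add: U_def)

lemma S_eb: "N.eqv (S eb * V vb) (S eb)" "N.eqv (star_poly (S eb) * V vb) (star_poly (S eb))"
    "N.eqv (star_poly (S eb) * S eb) (V vb)" "N.eqv (S eb * star_poly (S eb)) (V vb)"
  using N.S_head[of eb] N.S_star_V_eqv[of eb vb] N.S_range[of eb] N.CK[of vb] eb out_vb vb by auto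

lemma U_V: "N.eqv (U k * V vb) (U k)"
proof -
  have "N.eqv (V vb * x ^ n * V vb) (V vb * x ^ n)" if "N.eqv (x * V vb) x" for x n
  proof (cases n)
    case (Suc m)
    have "V vb * x ^ n * V vb = V vb * x ^ m * (x * V vb)"
      unfolding Suc power_Suc2 by (simp add: mult.assoc)
    then show ?thesis
      using N.eqv_multR[OF that, of "V vb * x ^ m"] unfolding Suc power_Suc2 by (simp add: mult.assoc)
  qed (simp add: N.projD N.V_proj)
  then show ?thesis using S_eb(1,2) by (auto simp: U_def)
qed

lemma U_absorb:
  assumes "N.eqv (x * V vb) x" "N.eqv (x * y) (V vb)"
  shows "N.eqv (V vb * x ^ Suc n * y) (V vb * x ^ n)"
proof -
  have "V vb * x ^ Suc n * y = V vb * x ^ n * (x * y)" unfolding power_Suc2 by (simp add: mult.assoc)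
  also have "N.eqv \<dots> (V vb * x ^ n * V vb)" by (intro N.eqv_multR assms)
  also have "N.eqv \<dots> (V vb * x ^ n)"
  proof (cases n)
    case (Suc m)
    show ?thesis
      using N.eqv_multR[OF assms(1), of "V vb * x ^ m"] unfolding Suc power_Suc2 by (simp add: mult.assoc)
  qed (simp add: N.projD N.V_proj)
  finally show ?thesis .
qed

lemma int_sign_cases [case_names nonneg neg]:
  obtains n where "k = int n" | n where "k = - int (Suc n)"
  using that by (cases k) auto

lemma U_S: "N.eqv (U k * S eb) (U (k + 1))"
proof (cases k rule: int_sign_cases)
  case (nonneg n)
  have "U k * S eb = V vb * S eb ^ Suc n" by (simp only: nonneg U_nat power_Suc2 mult.assoc)
  also have "\<dots> = U (k + 1)" using U_nat[of "Suc n"] by (simp add: nonneg add.commute)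
  finally show ?thesis by simp
next
  case (neg n)
  have "k + 1 = - int n" by (simp add: neg)
  then show ?thesis
    using U_absorb[OF S_eb(2,3), of n] by (simp only: neg U_neg)
qed

lemma U_S_star: "N.eqv (U k * star_poly (S eb)) (U (k - 1))"
proof (cases "- k" rule: int_sign_cases)
  case (nonneg n)
  then have k: "k = - int n" by simp
  have "U k * star_poly (S eb) = V vb * star_poly (S eb) ^ Suc n" by (simp only: k U_neg power_Suc2 mult.assoc)
  also have "\<dots> = U (k - 1)"
  proof -
    have "k - 1 = - int (Suc n)" by (simp add: k)
    then show ?thesis by (simp only: U_neg)
  qed
  finally show ?thesis by simp
next
  case (neg n)
  then have k: "k = int (Suc n)" "k - 1 = int n" by simp_all
  then show ?thesis
    using U_absorb[OF S_eb(1,4), of n] by (simp only: U_nat)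
qed

lemma U_mult: "N.eqv (U k * U l) (U (k + l))"
proof -
  have pos: "N.eqv (U k * (V vb * S eb ^ n)) (U (k + int n))" for n
  proof (induction n)
    case (Suc n)
    have "U k * (V vb * S eb ^ Suc n) = U k * (V vb * S eb ^ n) * S eb"
      by (simp only: power_Suc2 mult.assoc)
    also have "N.eqv \<dots> (U (k + int n) * S eb)" by (intro N.eqv_multL Suc)
    also have "N.eqv \<dots> (U (k + int n + 1))" by (rule U_S)
    finally show ?case by (simp add: add_ac)
  qed (simp add: U_V)
  have neg: "N.eqv (U k * (V vb * star_poly (S eb) ^ n)) (U (k - int n))" for n
  proof (induction n)
    case (Suc n)
    have "U k * (V vb * star_poly (S eb) ^ Suc n) = U k * (V vb * star_poly (S eb) ^ n) * star_poly (S eb)"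
      by (simp only: power_Suc2 mult.assoc)
    also have "N.eqv \<dots> (U (k - int n) * star_poly (S eb))" by (intro N.eqv_multL Suc)
    also have "N.eqv \<dots> (U (k - int n - 1))" by (rule U_S_star)
    finally show ?case by (simp add: algebra_simps)
  qed (simp add: U_V)
  show ?thesis
    using pos[of "nat l"] neg[of "nat (- l)"] by (cases "0 \<le> l") (simp_all add: U_def)
qed

lemma U_le: "N (U k) \<le> N (V vb)"
proof -
  have "N (x ^ n) \<le> 1" if "N x \<le> 1" for x n
    using that by (induction n) (auto intro: N.p_1 N.p_mult_le_1)
  then show ?thesis
    using N.S_le_1[of eb] by (auto simp: U_def intro!: N.p_mult_right)
qed

lemma U_free: "U k \<in> free_star_alg (graph_gens E)"
proof -
  have "V vb * x ^ n \<in> free_star_alg (graph_gens E)" if "x \<in> free_star_alg (graph_gens E)" for x n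
  proof (induction n)
    case (Suc n)
    then show ?case using free_mult[OF Suc that] by (simp only: power_Suc2 mult.assoc)
  qed (simp add: V_free vb)
  then show ?thesis by (simp add: U_def S_free free_star eb)
qed

lemma f_U:
  assumes z: "z \<in> circle"
  shows "N1.eqv (f z (U k)) (cst (z powi k) * V vb)"
proof -
  note V2 = N1.projD[OF N1.V_proj[of vb]]
  have *: "N1.eqv (f z (V vb * x ^ n)) (cst (c ^ n) * V vb)" if x: "N1.eqv (V vb * f z x) (cst c * V vb)" for x c n
  proof (induction n)
    case (Suc n)
    have "f z (V vb * x ^ Suc n) = f z (V vb * x ^ n) * f z x"
      by (simp only: power_Suc2 subst_mult mult.assoc)
    also have "N1.eqv \<dots> (cst (c ^ n) * V vb * f z x)" by (intro N1.eqv_multL Suc)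
    also have "\<dots> = cst (c ^ n) * (V vb * f z x)" by (simp add: mult.assoc)
    also have "N1.eqv \<dots> (cst (c ^ n) * (cst c * V vb))" by (intro N1.eqv_multR x)
    finally show ?case by (simp only: power_Suc2 cst_mult mult.assoc)
  qed simp
  show ?thesis
  proof (cases "0 \<le> k")
    case True
    have "N1.eqv (V vb * f z (S eb)) (cst z * V vb)"
      using N1.eqv_cst[OF V2(2), of z] by (simp add: cst_left_comm[of "V vb"])
    from *[OF this, of "nat k"] show ?thesis using True by (simp add: U_def power_int_def)
  next
    case False
    have "V vb * f z (star_poly (S eb)) = cst (cnj z) * (V vb * star_poly (V vb))"
      by (simp add: subst_star star_poly_cst_mult cst_left_comm[of "V vb"])
    also have "N1.eqv \<dots> (cst (cnj z) * (V vb * V vb))" by (intro N1.eqv_multR V2)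
    also have "N1.eqv \<dots> (cst (cnj z) * V vb)" by (intro N1.eqv_multR V2)
    finally have "N1.eqv (f z (U k)) (cst (cnj z ^ nat (- k)) * V vb)"
      using *[of "star_poly (S eb)" "cnj z" "nat (- k)"] False by (simp add: U_def)
    moreover have "cnj z = inverse z" using circle_cnj[OF z] circle_nonzero[OF z] by (simp add: field_simps)
    ultimately show ?thesis using False by (simp add: power_int_def)
  qed
qed

definition laurent :: "nat \<Rightarrow> ('v, 'e) graph_gen star_poly \<Rightarrow> bool" where
  "laurent d x \<longleftrightarrow> (\<exists>c. N.eqv x (\<Sum>k\<in>{- int d..int d}. cst (c k) * U k))"

lemma laurent_cong: "N.eqv x y \<Longrightarrow> laurent d y \<Longrightarrow> laurent d x"
  unfolding laurent_def using N.eqv_trans by blast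

lemma laurent_monomial:
  assumes "\<bar>k\<bar> \<le> int d"
  shows "laurent d (cst a * U k)"
proof -
  have k: "k \<in> {- int d..int d}" using assms by auto
  have "(\<Sum>j\<in>{- int d..int d}. cst (if j = k then a else 0) * U j) = (\<Sum>j\<in>{- int d..int d}. if j = k then cst a * U k else 0)"
    by (intro sum.cong) auto
  also have "\<dots> = cst a * U k" using k by (simp only: sum.delta finite_atLeastAtMost_int if_True)
  finally have "N.eqv (cst a * U k) (\<Sum>j\<in>{- int d..int d}. cst (if j = k then a else 0) * U j)"
    by (simp only: N.eqv_refl)
  then show ?thesis unfolding laurent_def by (rule exI[of _ "\<lambda>j. if j = k then a else 0"])
qed

lemma laurent_scale: "laurent d x \<Longrightarrow> laurent d (cst a * x)"
proof -
  assume "laurent d x"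
  then obtain c where "N.eqv x (\<Sum>k\<in>{- int d..int d}. cst (c k) * U k)" by (auto simp: laurent_def)
  from N.eqv_cst[OF this, of a] show ?thesis
    unfolding laurent_def
    by (intro exI[of _ "\<lambda>k. a * c k"]) (simp add: sum_distrib_left cst_mult mult.assoc)
qed

lemma laurent_0: "laurent d 0"
  using laurent_monomial[of 0 d 0] by simp

lemma laurent_add: "laurent d x \<Longrightarrow> laurent d y \<Longrightarrow> laurent d (x + y)"
proof -
  assume "laurent d x" "laurent d y"
  then obtain b c where "N.eqv x (\<Sum>k\<in>{- int d..int d}. cst (b k) * U k)"
    "N.eqv y (\<Sum>k\<in>{- int d..int d}. cst (c k) * U k)" by (auto simp: laurent_def)
  from N.eqv_add[OF this] show ?thesis
    unfolding laurent_def
    by (intro exI[of _ "\<lambda>k. b k + c k"]) (simp add: cst_add distrib_right sum.distrib)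
qed

lemma laurent_sum: "(\<And>a. a \<in> A \<Longrightarrow> laurent d (g a)) \<Longrightarrow> laurent d (sum g A)"
  by (induction A rule: infinite_finite_induct) (auto intro: laurent_add laurent_0)

lemma laurent_mult:
  assumes "laurent d x" "laurent e y"
  shows "laurent (d + e) (x * y)"
proof -
  obtain b c where b: "N.eqv x (\<Sum>k\<in>{- int d..int d}. cst (b k) * U k)"
    and c: "N.eqv y (\<Sum>k\<in>{- int e..int e}. cst (c k) * U k)" using assms by (auto simp: laurent_def)
  have "laurent (d + e) ((cst (b k) * U k) * (cst (c l) * U l))"
    if "k \<in> {- int d..int d}" "l \<in> {- int e..int e}" for k l
  proof (rule laurent_cong)
    have "(cst (b k) * U k) * (cst (c l) * U l) = cst (b k * c l) * (U k * U l)"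
      by (simp add: cst_mult mult.assoc cst_left_comm[of "U k"])
    then show "N.eqv ((cst (b k) * U k) * (cst (c l) * U l)) (cst (b k * c l) * U (k + l))"
      using N.eqv_cst[OF U_mult] by simp
    show "laurent (d + e) (cst (b k * c l) * U (k + l))"
      using that by (intro laurent_monomial) auto
  qed
  then have "laurent (d + e) ((\<Sum>k\<in>{- int d..int d}. cst (b k) * U k) * (\<Sum>k\<in>{- int e..int e}. cst (c k) * U k))"
    unfolding sum_product by (intro laurent_sum)
  then show ?thesis using N.eqv_mult[OF b c] laurent_cong by blast
qed

lemma laurent_mono: "laurent d x \<Longrightarrow> d \<le> e \<Longrightarrow> laurent e x"
proof -
  assume "laurent d x" "d \<le> e"
  then obtain c where "N.eqv x (\<Sum>k\<in>{- int d..int d}. cst (c k) * U k)" by (auto simp: laurent_def)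
  then show ?thesis
    by (rule laurent_cong) (use \<open>d \<le> e\<close> in \<open>auto intro!: laurent_sum laurent_monomial\<close>)
qed

text \<open>The substitution at z turns \<open>U k\<close> into \<open>z^k P\<close>, so
  \<open>rho x\<close> bounds a scalar Laurent polynomial on the circle times
  \<open>N1 (V vb)\<close>, and with it each coefficient. \<open>V_le\<close> carries this over to
  \<open>N (V vb)\<close>, and the triangle inequality over \<open>2 d + 1\<close> terms gives the
  factor.\<close>

lemma laurent_bound:
  assumes "laurent d x"
  shows "N x \<le> (2 * real d + 1) * rho x"
proof -
  obtain c where c: "N.eqv x (\<Sum>k\<in>{- int d..int d}. cst (c k) * U k)" using assms by (auto simp: laurent_def)
  have coeff: "cmod (c k) * N (V vb) \<le> rho x" if k: "k \<in> {- int d..int d}" for k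
  proof (cases "N1 (V vb) = 0")
    case True
    then show ?thesis using V_le N.nonneg[of "V vb"] rho.nonneg[of x] by simp
  next
    case False
    then have pos: "0 < N1 (V vb)" using N1.nonneg[of "V vb"] by simp
    have "cmod (c k) \<le> rho x / N1 (V vb)"
    proof (rule laurent_coeff_le[OF _ k])
      fix z assume z: "z \<in> circle"
      have "N1.eqv (f z x) (f z (\<Sum>k\<in>{- int d..int d}. cst (c k) * U k))" by (rule f_eqv[OF z c])
      also have "f z (\<Sum>k\<in>{- int d..int d}. cst (c k) * U k) = (\<Sum>k\<in>{- int d..int d}. cst (c k) * f z (U k))"
        by (simp add: subst_simps)
      also have "N1.eqv \<dots> (\<Sum>k\<in>{- int d..int d}. cst (c k) * (cst (z powi k) * V vb))"
        by (intro N1.eqv_sum N1.eqv_cst f_U z)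
      also have "\<dots> = cst (\<Sum>k\<in>{- int d..int d}. c k * z powi k) * V vb"
      proof -
        have "cst (sum g A) = (\<Sum>a\<in>A. cst (g a) :: ('v, 'e) graph_gen star_poly)" for g and A :: "int set"
          by (induction A rule: infinite_finite_induct) (auto simp: cst_add)
        then show ?thesis by (simp add: sum_distrib_right cst_mult mult.assoc)
      qed
      finally have "N1 (f z x) = cmod (\<Sum>k\<in>{- int d..int d}. c k * z powi k) * N1 (V vb)"
        using N1.p_cong N1.scale by metis
      then show "cmod (\<Sum>k\<in>{- int d..int d}. c k * z powi k) \<le> rho x / N1 (V vb)"
        using rho_upper[OF z, of x] pos by (simp add: le_divide_eq)
    qed
    then have "cmod (c k) * N1 (V vb) \<le> rho x" using pos by (simp add: le_divide_eq)
    then show ?thesis using mult_left_mono[OF V_le, of "cmod (c k)"] by simp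
  qed
  have "N x = N (\<Sum>k\<in>{- int d..int d}. cst (c k) * U k)" by (rule N.p_cong[OF c])
  also have "\<dots> \<le> (\<Sum>k\<in>{- int d..int d}. N (cst (c k) * U k))" by (rule N.p_sum)
  also have "\<dots> \<le> (\<Sum>k\<in>{- int d..int d}. rho x)"
  proof (rule sum_mono)
    fix k assume k: "k \<in> {- int d..int d}"
    have "N (cst (c k) * U k) \<le> cmod (c k) * N (V vb)"
      using U_le[of k] by (simp add: N.scale mult_left_mono)
    then show "N (cst (c k) * U k) \<le> rho x" using coeff[OF k] by simp
  qed
  also have "\<dots> = (2 * real d + 1) * rho x" by simp
  finally show ?thesis .
qed

text \<open>The vectors \<open>U k * S\<^sub>\<mu>\<^sup>*\<close> span \<open>P C\<^sup>*(E)\<close>, where \<open>P\<close> is the projection at \<open>vb\<close>.\<close>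

inductive_set fock :: "('v, 'e) graph_gen star_poly set" where
  U: "U k \<in> fock"
| step: "t \<in> fock \<Longrightarrow> e \<in> E.proper_arcs \<Longrightarrow> t * star_poly (S e) \<in> fock"

inductive fock_span :: "('v, 'e) graph_gen star_poly \<Rightarrow> bool" where
  base: "t \<in> fock \<Longrightarrow> N.eqv x t \<Longrightarrow> fock_span x"
| zero: "N.eqv x 0 \<Longrightarrow> fock_span x"
| add: "fock_span x \<Longrightarrow> fock_span y \<Longrightarrow> fock_span (x + y)"
| scale: "fock_span x \<Longrightarrow> fock_span (cst c * x)"

lemma proper_or_loop: "e \<in> arcs E \<Longrightarrow> e = eb \<or> e \<in> E.proper_arcs"
  using tail_vb by (auto simp: E.proper_arcs_def)

lemma U_V_eqv: "N.eqv (U k * V v) (if v = vb then U k else 0)"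
proof (cases "v = vb")
  case False
  have "N.eqv (U k * V v) (U k * V vb * V v)" by (intro N.eqv_multL N.eqv_sym[OF U_V])
  also have "\<dots> = U k * (V vb * V v)" by (simp add: mult.assoc)
  also have "N.eqv \<dots> 0" using False by (intro N.eqv_0_mult(2) N.V_orth) auto
  finally show ?thesis using False by simp
qed (simp add: U_V)

lemma fock_V:
  assumes "t \<in> fock"
  shows "N.eqv (t * V v) t \<or> N.eqv (t * V v) 0"
  using assms
proof (cases rule: fock.cases)
  case (U k)
  then show ?thesis using U_V_eqv[of k v] by (auto split: if_splits)
next
  case (step t' e)
  then have "N.eqv (t * V v) (t' * (if v = tail E e then star_poly (S e) else 0))"
    using N.eqv_multR[OF N.S_star_V_eqv[of e v], of t'] by (simp add: N.proper_arcsD mult.assoc)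
  then show ?thesis using step by (auto split: if_splits)
qed

lemma U_S_zero: "e \<in> E.proper_arcs \<Longrightarrow> N.eqv (U k * S e) 0"
proof -
  assume e: "e \<in> E.proper_arcs"
  have "N.eqv (U k * S e) (U k * V vb * S e)" by (intro N.eqv_multL N.eqv_sym[OF U_V])
  also have "\<dots> = U k * (V vb * S e)" by (simp add: mult.assoc)
  also have "N.eqv \<dots> 0" using N.proper_arcsD[OF e] by (intro N.eqv_0_mult(2) N.V_S_zero) auto
  finally show ?thesis .
qed

text \<open>The last adjoint edge of \<open>t\<close> either cancels against \<open>S e\<close>,
  leaving a vertex projection that keeps or kills the shorter vector, or is orthogonal to it. On a
  bare \<open>U k\<close> only the loop survives.\<close>

lemma fock_S:
  assumes "t \<in> fock" "e \<in> arcs E"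
  shows "(\<exists>t'\<in>fock. N.eqv (t * S e) t') \<or> N.eqv (t * S e) 0"
  using assms(1)
proof (cases rule: fock.cases)
  case (U k)
  then show ?thesis using U_S[of k] U_S_zero[of e k] proper_or_loop[OF assms(2)] fock.U by auto
next
  case (step t' g)
  show ?thesis
  proof (cases "g = e")
    case True
    have "t * S e = t' * (star_poly (S e) * S e)" by (simp add: step True mult.assoc)
    then have "N.eqv (t * S e) (t' * V (head E e))" using N.eqv_multR[OF N.S_range[OF assms(2)]] by simp
    then show ?thesis using fock_V[OF step(2), of "head E e"] step(2) N.eqv_trans by blast
  next
    case False
    then have "N.eqv (t * S e) 0"
      using N.eqv_0_mult(2)[OF N.S_orth[OF False], of t'] by (simp add: step mult.assoc)
    then show ?thesis by blast
  qed
qed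

text \<open>Proper edges just lengthen the vector. The adjoint of the loop shifts the power on a
  bare \<open>U k\<close> and annihilates every longer vector: a proper edge \<open>g\<close> does
  not start at \<open>vb\<close>, so \<open>S_eb S_g = 0\<close>.\<close>

lemma fock_S_star:
  assumes "t \<in> fock" "e \<in> arcs E"
  shows "(\<exists>t'\<in>fock. N.eqv (t * star_poly (S e)) t') \<or> N.eqv (t * star_poly (S e)) 0"
proof (cases "e \<in> E.proper_arcs")
  case True
  then show ?thesis using fock.step[OF assms(1)] by blast
next
  case False
  then have e: "e = eb" using proper_or_loop assms(2) by blast
  show ?thesis using assms(1)
  proof (cases rule: fock.cases)
    case (U k)
    then show ?thesis using U_S_star[of k] e fock.U by auto
  next
    case (step t' g)
    have "star_poly (S g) * star_poly (S eb) = star_poly (S eb * S g)" by (simp add: star_poly_mult)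
    moreover have "N.eqv (S eb * S g) 0"
    proof -
      have "N.eqv (S eb * S g) (S eb * V vb * S g)" by (intro N.eqv_multL N.eqv_sym[OF S_eb(1)])
      also have "\<dots> = S eb * (V vb * S g)" by (simp add: mult.assoc)
      also have "N.eqv \<dots> 0" using N.proper_arcsD[OF step(3)] by (intro N.eqv_0_mult(2) N.V_S_zero) auto
      finally show ?thesis .
    qed
    ultimately have "N.eqv (star_poly (S g) * star_poly (S eb)) 0"
      using N.eqv_star[of "S eb * S g" 0] by (simp only: star_poly_mult star_poly_0)
    then show ?thesis using N.eqv_0_mult(2)[of _ t'] by (simp add: step e mult.assoc)
  qed
qed

lemma fock_span_cong: "N.eqv x y \<Longrightarrow> fock_span y \<Longrightarrow> fock_span x"
proof -
  assume xy: "N.eqv x y" "fock_span y"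
  have "fock_span (x - y)" using xy by (intro fock_span.zero) (simp add: N.eqv_def)
  from fock_span.add[OF this xy(2)] show ?thesis by simp
qed

lemma fock_span_letter: "fock_span x \<Longrightarrow> fock_span (x * letter l)"
proof (induction rule: fock_span.induct)
  case (base t x)
  have "fock_span (t * letter l)"
  proof (cases l)
    case (Pair g b)
    show ?thesis
    proof (cases g)
      case (Vx v)
      have "N.eqv (t * letter l) (t * V v)"
        using N.projD(1)[OF N.V_proj, of v] by (auto simp: Pair Vx letter_eq intro: N.eqv_multR)
      moreover have "fock_span (t * V v)"
        using fock_V[OF base(1), of v] base(1) by (auto intro: fock_span.base fock_span.zero)
      ultimately show ?thesis by (rule fock_span_cong)
    next
      case (Ed e)
      show ?thesis
      proof (cases "e \<in> arcs E")
        case True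
        then show ?thesis
          using fock_S[OF base(1) True] fock_S_star[OF base(1) True]
          by (cases b) (auto simp: Pair Ed letter_eq intro: fock_span.base fock_span.zero)
      next
        case False
        then have "N.eqv (letter l) 0"
          using N.S_outside[of e] N.eqv_star[of "S e" 0] by (auto simp: Pair Ed letter_eq)
        then show ?thesis by (intro fock_span.zero N.eqv_0_mult(2))
      qed
    qed
  qed
  then show ?case using N.eqv_multL[OF base(2)] fock_span_cong by blast
next
  case (zero x)
  then show ?case by (intro fock_span.zero N.eqv_0_mult(1))
next
  case (add x y)
  then show ?case by (simp add: distrib_right fock_span.add)
next
  case (scale x c)
  then show ?case by (simp add: mult.assoc fock_span.scale)
qed

lemma fock_span_mult: "fock_span x \<Longrightarrow> fock_span (x * y)"
proof (induction y arbitrary: x rule: star_poly_word_induct)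
  case (letter l y)
  then show ?case using letter.IH[OF fock_span_letter[of x l]] by (simp add: mult.assoc)
next
  case (scale c y)
  then show ?case using fock_span.scale[of "x * y" c] by (simp add: cst_left_comm[of x])
next
  case (add y z)
  then show ?case by (simp add: distrib_left fock_span.add)
qed (auto intro: fock_span.zero)

text \<open>Right multiplication by \<open>V vb\<close> removes every vector ending in the adjoint
  of a proper edge, since such an edge does not start at \<open>vb\<close>; only powers of the loop
  remain.\<close>

lemma fock_span_laurent: "fock_span x \<Longrightarrow> \<exists>d. laurent d (x * V vb)"
proof (induction rule: fock_span.induct)
  case (base t x)
  have "\<exists>d. laurent d (t * V vb)"
    using base(1)
  proof (cases rule: fock.cases)
    case (U k)
    have "laurent (nat \<bar>k\<bar>) (cst 1 * U k)" by (rule laurent_monomial) simp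
    then have "laurent (nat \<bar>k\<bar>) (t * V vb)" using U_V[of k] U laurent_cong by simp
    then show ?thesis by blast
  next
    case (step t' e)
    have "N.eqv (t * V vb) 0"
      using N.eqv_0_mult(2)[of "star_poly (S e) * V vb" t'] N.S_star_V_eqv[of e vb] N.proper_arcsD[OF step(3)]
      by (simp add: step mult.assoc)
    then show ?thesis using laurent_cong laurent_0 by blast
  qed
  then show ?case using N.eqv_multL[OF base(2)] laurent_cong by blast
next
  case (zero x)
  then show ?case using N.eqv_0_mult(1) laurent_cong laurent_0 by blast
next
  case (add x y)
  then obtain d e where "laurent d (x * V vb)" "laurent e (y * V vb)" by blast
  then have "laurent (max d e) (x * V vb)" "laurent (max d e) (y * V vb)"
    by (auto elim: laurent_mono)
  then show ?case using laurent_add by (metis distrib_right)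
next
  case (scale x c)
  then obtain d where "laurent d (x * V vb)" by blast
  then show ?case using laurent_scale by (metis mult.assoc)
qed

subsection \<open>The map \<open>f\<close> is isometric\<close>

lemma corner_laurent: "\<exists>d. laurent d (V vb * x * V vb)"
  using fock_span_laurent[OF fock_span_mult[OF fock_span.base[OF fock.U N.eqv_refl, of 0]]] by (simp add: U_0)

text \<open>Squaring doubles the degree, so \<open>sq_iter k\<close> of a corner element has degree
  at most \<open>d * 2^k\<close>. The factor in \<open>laurent_bound\<close> then grows linearly in
  \<open>2^k\<close>, which the growth criterion tolerates.\<close>

lemma rho_eq_vb: "N (V vb * x * V vb) \<le> rho (V vb * x * V vb)"
proof -
  let ?y = "V vb * x * V vb"
  have "N.eqv (star_poly ?y * ?y) (V vb * (star_poly x * V vb * V vb * x) * V vb)"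
  proof -
    have "N.eqv (star_poly (V vb) * star_poly x * star_poly (V vb) * ?y) (V vb * star_poly x * V vb * ?y)"
      by (intro N.eqv_mult N.projD N.V_proj N.eqv_refl)
    then show ?thesis by (simp add: star_poly_mult mult.assoc)
  qed
  then obtain d where d: "laurent d (star_poly ?y * ?y)" using corner_laurent laurent_cong by blast
  have "laurent (d * 2 ^ k) (sq_iter k ?y)" for k
  proof (induction k)
    case (Suc k)
    have "d * 2 ^ Suc k = d * 2 ^ k + d * 2 ^ k" by simp
    then show ?case using laurent_mult[OF Suc Suc] by (simp only: sq_iter.simps)
  qed (use d in simp)
  then have "N (sq_iter k ?y) \<le> (2 * real d * 2 ^ k + 1) * rho (sq_iter k ?y)" for k
    using laurent_bound[of "d * 2 ^ k" "sq_iter k ?y"] by (simp add: mult.assoc)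
  then show ?thesis
    by (intro seminorm_le_of_growth[OF N.total_seminorm_axioms rho.total_seminorm_axioms, of "2 * real d" 1]) auto
qed

text \<open>The unit at level \<open>Suc n\<close> is a sum of \<open>t i * star_poly (t i)\<close>
  with \<open>t i\<close> equal to \<open>V vb\<close> or to \<open>S e * approx_unit n\<close>. An
  element \<open>y\<close> of its corner is therefore a finite matrix with entries
  \<open>star_poly (t i) * y * t j\<close> in the corner at level \<open>n\<close>, where the
  induction hypothesis applies. The matrix size enters as a constant factor, which is dropped
  because the corner is closed under products and adjoints.\<close>

lemma rho_eq_corner: "N (E.approx_unit n * x * E.approx_unit n) \<le> rho (E.approx_unit n * x * E.approx_unit n)"
proof (induction n arbitrary: x)
  case 0
  show ?case by (simp add: rho_eq_vb)
next
  case (Suc n)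
  let ?a = "E.approx_unit"
  define I where "I = insert None (Some ` E.proper_arcs)"
  define t where "t i = (case i of None \<Rightarrow> V vb | Some e \<Rightarrow> S e * ?a n)" for i
  have aa: "N.eqv (?a n * star_poly (?a n)) (?a n)"
    using N.eqv_trans[OF N.eqv_multR[OF N.approx_unit_star] N.projD(2)[OF N.approx_unit_proj]] .
  have unit: "N.eqv (?a (Suc n)) (\<Sum>i\<in>I. t i * star_poly (t i))"
  proof -
    have "N.eqv (V vb) (V vb * star_poly (V vb))"
      using N.eqv_trans[OF N.eqv_multR[OF N.projD(1)] N.projD(2)] N.V_proj N.eqv_sym by blast
    moreover have "N.eqv (\<Sum>e\<in>E.proper_arcs. S e * ?a n * star_poly (S e)) (\<Sum>e\<in>E.proper_arcs. t (Some e) * star_poly (t (Some e)))"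
    proof (rule N.eqv_sum)
      fix e
      have "t (Some e) * star_poly (t (Some e)) = S e * (?a n * star_poly (?a n)) * star_poly (S e)"
        by (simp add: t_def star_poly_mult mult.assoc)
      then show "N.eqv (S e * ?a n * star_poly (S e)) (t (Some e) * star_poly (t (Some e)))"
        using N.eqv_multL[OF N.eqv_multR[OF N.eqv_sym[OF aa]]] by simp
    qed
    moreover have "(\<Sum>i\<in>I. t i * star_poly (t i)) = V vb * star_poly (V vb)
        + (\<Sum>e\<in>E.proper_arcs. t (Some e) * star_poly (t (Some e)))"
      unfolding I_def by (subst sum.insert) (auto simp: sum.reindex t_def)
    ultimately show ?thesis using N.eqv_add by simp
  qed
  have t_le: "N (t i) \<le> 1" for i
    using N.V_le_1 N.S_le_1 N.proj_le_1[OF N.approx_unit_proj]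
    by (auto simp: t_def split: option.split intro: N.p_mult_le_1)
  have t_a: "N.eqv (t i * ?a n) (t i)" for i
    using N.vb_approx_unit N.eqv_multR[OF N.projD(2)[OF N.approx_unit_proj]]
    by (auto simp: t_def mult.assoc split: option.split)
  have a_t: "N.eqv (?a n * star_poly (t i)) (star_poly (t i))" for i
  proof -
    have "N.eqv (?a n * star_poly (t i)) (star_poly (?a n) * star_poly (t i))"
      by (intro N.eqv_multL N.eqv_sym[OF N.approx_unit_star])
    also have "\<dots> = star_poly (t i * ?a n)" by (simp add: star_poly_mult)
    also have "N.eqv \<dots> (star_poly (t i))" by (intro N.eqv_star t_a)
    finally show ?thesis .
  qed
  \<comment> \<open>The corner is described by absorption up to null elements, since the adjoint of
    a literal product with \<open>a\<close> on both sides has the adjoint of \<open>a\<close> there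
    instead.\<close>
  define C where "C = {y. N.eqv (?a (Suc n) * y) y \<and> N.eqv (y * ?a (Suc n)) y}"
  show ?case
  proof (rule seminorm_le_of_bound[OF N.total_seminorm_axioms rho.total_seminorm_axioms])
    show "0 \<le> real (card I) * real (card I)" by simp
    show "?a (Suc n) * x * ?a (Suc n) \<in> C"
      using N.eqv_multL[OF N.projD(2)[OF N.approx_unit_proj[of "Suc n"]], of "x * ?a (Suc n)"]
        N.eqv_multR[OF N.projD(2)[OF N.approx_unit_proj[of "Suc n"]], of "?a (Suc n) * x"]
      by (simp only: C_def mem_Collect_eq mult.assoc)
    show "star_poly y \<in> C" if "y \<in> C" for y
    proof -
      have "N.eqv (star_poly (?a (Suc n)) * star_poly y) (star_poly y)"
        "N.eqv (star_poly y * star_poly (?a (Suc n))) (star_poly y)"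
        using that N.eqv_star[of "y * ?a (Suc n)" y] N.eqv_star[of "?a (Suc n) * y" y]
        by (simp_all only: C_def mem_Collect_eq star_poly_mult)
      then show ?thesis
        using N.eqv_trans[OF N.eqv_multL[OF N.eqv_sym[OF N.approx_unit_star]]]
          N.eqv_trans[OF N.eqv_multR[OF N.eqv_sym[OF N.approx_unit_star]]]
        unfolding C_def by blast
    qed
    show "y * w \<in> C" if "y \<in> C" "w \<in> C" for y w
      using that N.eqv_multL[of "?a (Suc n) * y" y w] N.eqv_multR[of "w * ?a (Suc n)" w y]
      by (simp only: C_def mem_Collect_eq mult.assoc simp_thms)
    show "N y \<le> real (card I) * real (card I) * rho y" if y: "y \<in> C" for y
    proof -
      have "N.eqv y (?a (Suc n) * y * ?a (Suc n))"
        using y N.eqv_multL[of "?a (Suc n) * y" y "?a (Suc n)"] N.eqv_trans N.eqv_sym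
        unfolding C_def by blast
      also have "N.eqv \<dots> ((\<Sum>i\<in>I. t i * star_poly (t i)) * y * (\<Sum>i\<in>I. t i * star_poly (t i)))"
        by (intro N.eqv_mult unit N.eqv_refl)
      also have "\<dots> = (\<Sum>i\<in>I. \<Sum>j\<in>I. t i * (star_poly (t i) * y * t j) * star_poly (t j))"
        by (simp only: sum_distrib_left sum_distrib_right mult.assoc) (rule sum.swap)
      finally have "N y = N (\<Sum>i\<in>I. \<Sum>j\<in>I. t i * (star_poly (t i) * y * t j) * star_poly (t j))"
        by (rule N.p_cong)
      also have "\<dots> \<le> (\<Sum>i\<in>I. \<Sum>j\<in>I. N (t i * (star_poly (t i) * y * t j) * star_poly (t j)))"
        by (rule order_trans[OF N.p_sum]) (intro sum_mono N.p_sum)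
      also have "\<dots> \<le> (\<Sum>i\<in>I. \<Sum>j\<in>I. rho y)"
      proof (intro sum_mono)
        fix i j
        let ?x = "star_poly (t i) * y * t j"
        have le: "rho (t i) \<le> 1" "rho (?a n) \<le> 1" for i
          using order_trans[OF rho_le_N t_le] order_trans[OF rho_le_N N.proj_le_1[OF N.approx_unit_proj]] by auto
        have eq: "N.eqv ?x (?a n * ?x * ?a n)"
        proof -
          have "N.eqv (?a n * star_poly (t i) * y * (t j * ?a n)) (star_poly (t i) * y * t j)"
            by (intro N.eqv_mult a_t t_a N.eqv_refl)
          then show ?thesis by (simp add: mult.assoc N.eqv_sym)
        qed
        have "N (t i * ?x * star_poly (t j)) \<le> N ?x"
          by (rule order_trans[OF N.p_mult_right N.p_mult_left]) (simp_all add: t_le)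
        also have "\<dots> = N (?a n * ?x * ?a n)" by (rule N.p_cong[OF eq])
        also have "\<dots> \<le> rho (?a n * ?x * ?a n)" by (rule Suc.IH)
        also have "\<dots> = rho ?x" by (rule rho_cong[OF eq, symmetric])
        also have "\<dots> \<le> rho y"
          by (rule order_trans[OF rho.p_mult_right rho.p_mult_left]) (simp_all add: le)
        finally show "N (t i * ?x * star_poly (t j)) \<le> rho y" .
      qed
      finally show ?thesis by (simp add: mult.assoc)
    qed
  qed
qed

text \<open>Split \<open>x\<close> by a unit \<open>a n\<close> that absorbs an ideal element
  \<open>y\<close> bringing \<open>x\<close> within \<open>rho x\<close>, up to an arbitrary error.
  The part \<open>x * (1 - a n)\<close> is bounded by that distance, and the part
  \<open>x * a n\<close> by the C*-identity, which moves it into the corner.\<close>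

theorem f_isometric: "N x \<le> rho x"
proof (rule seminorm_le_of_bound[OF N.total_seminorm_axioms rho.total_seminorm_axioms, where S = UNIV and C = 2])
  fix x :: "('v, 'e) graph_gen star_poly"
  let ?a = "E.approx_unit"
  show "N x \<le> 2 * rho x"
  proof (rule field_le_epsilon)
    fix e :: real assume e: "0 < e"
    have "N2 x < rho x + e" using N2_le_rho[of x] e by simp
    then obtain y where y: "y \<in> E.J" "N (x - y) < rho x + e"
      using N.ideal_approximation[of x "rho x + e"] by (auto simp: E2_eq)
    then obtain n where n: "N.eqv (y * ?a n) y" using N.ideal_absorbed unfolding N.absorbed_def by blast
    have "N (x * (1 - ?a n)) \<le> N ((x - y) * (1 - ?a n)) + N (y * (1 - ?a n))"
      using N.triangle[of "(x - y) * (1 - ?a n)" "y * (1 - ?a n)"] by (simp add: algebra_simps)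
    also have "N (y * (1 - ?a n)) = 0"
      using n N.p_diff_comm[of "y * ?a n" y] by (simp add: N.eqv_def algebra_simps)
    finally have 1: "N (x * (1 - ?a n)) < rho x + e"
      using N.approx_unit_compl_le[of "x - y" n] y by simp
    have "(N (x * ?a n))\<^sup>2 = N (star_poly (?a n) * (star_poly x * x) * ?a n)"
      by (simp add: star_poly_mult mult.assoc flip: N.cstar)
    also have "\<dots> = N (?a n * (star_poly x * x) * ?a n)"
      by (intro N.p_cong N.eqv_multL N.approx_unit_star)
    also have "\<dots> \<le> rho (?a n * (star_poly x * x) * ?a n)" by (rule rho_eq_corner)
    also have "\<dots> \<le> rho (star_poly x * x)"
      using order_trans[OF rho_le_N N.proj_le_1[OF N.approx_unit_proj[of n]]]
      by (intro order_trans[OF rho.p_mult_right rho.p_mult_left])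
    also have "\<dots> = (rho x)\<^sup>2" by (rule rho.cstar)
    finally have 2: "N (x * ?a n) \<le> rho x" by (rule power2_le_imp_le) (rule rho.nonneg)
    have "N x \<le> N (x * ?a n) + N (x * (1 - ?a n))"
      using N.triangle[of "x * ?a n" "x * (1 - ?a n)"] by (simp add: algebra_simps)
    then show "N x \<le> 2 * rho x + e" using 1 2 by simp
  qed
qed auto

end

subsection \<open>Trigonometric polynomials\<close>

text \<open>Laurent polynomials as functions on the circle. The rule \<open>cong\<close> leaves the
  values off the circle arbitrary, since the addition rule for exponents can fail at 0.\<close>

inductive trig_scalar :: "(complex \<Rightarrow> complex) \<Rightarrow> bool" where
  mono: "trig_scalar (\<lambda>z. c * z powi k)"
| add: "trig_scalar g \<Longrightarrow> trig_scalar h \<Longrightarrow> trig_scalar (\<lambda>z. g z + h z)"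
| cong: "trig_scalar g \<Longrightarrow> (\<And>z. z \<in> circle \<Longrightarrow> h z = g z) \<Longrightarrow> trig_scalar h"

lemma powi_add_circle: "z \<in> circle \<Longrightarrow> z powi (k + l) = z powi k * z powi l"
  by (simp add: power_int_add circle_nonzero)

lemma trig_scalar_mult:
  assumes "trig_scalar g" "trig_scalar h"
  shows "trig_scalar (\<lambda>z. g z * h z)"
  using assms(1)
proof (induction rule: trig_scalar.induct)
  case (mono c k)
  show ?case using assms(2)
  proof (induction rule: trig_scalar.induct)
    case (mono d l)
    show ?case
      by (rule trig_scalar.cong[OF trig_scalar.mono[of "c * d" "k + l"]]) (simp add: powi_add_circle mult_ac)
  next
    case (add g h)
    from trig_scalar.add[OF add.IH] show ?case by (simp add: distrib_left)
  next
    case (cong g h)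
    show ?case by (rule trig_scalar.cong[OF cong.IH]) (simp add: cong.hyps)
  qed
next
  case (add g h)
  from trig_scalar.add[OF add.IH] show ?case by (simp add: distrib_right)
next
  case (cong g h)
  show ?case by (rule trig_scalar.cong[OF cong.IH]) (simp add: cong.hyps)
qed

lemma trig_scalar_const: "trig_scalar (\<lambda>z. c)"
  using trig_scalar.mono[of c 0] by simp

text \<open>On the circle \<open>cnj z\<close> is the inverse of \<open>z\<close>. Real and
  imaginary part, and hence every real linear functional, are therefore combinations of
  \<open>z\<close> and \<open>z powi - 1\<close>; the constants are obtained from the values at 1
  and at the imaginary unit.\<close>

lemma trig_scalar_real_polynomial:
  assumes "real_polynomial_function p"
  shows "trig_scalar (\<lambda>z. of_real (p z))"
  using assms
proof (induction rule: real_polynomial_function.induct)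
  case (linear p)
  then interpret bounded_linear p .
  let ?c = "(of_real (p 1) - \<i> * of_real (p \<i>)) / 2 :: complex"
    and ?d = "(of_real (p 1) + \<i> * of_real (p \<i>)) / 2 :: complex"
  show ?case
  proof (rule trig_scalar.cong[OF trig_scalar.add[OF trig_scalar.mono[of ?c 1] trig_scalar.mono[of ?d "- 1"]]])
    fix z assume z: "z \<in> circle"
    have inv: "inverse z = cnj z" using circle_cnj[OF z] circle_nonzero[OF z] by (simp add: field_simps)
    have "z = Re z *\<^sub>R 1 + Im z *\<^sub>R \<i>" by (simp add: complex_eq_iff)
    then have "p z = Re z * p 1 + Im z * p \<i>" by (metis add scaleR real_scaleR_def)
    then show "of_real (p z) = ?c * z powi 1 + ?d * z powi - 1"
      by (auto simp: power_int_minus inv complex_eq_iff add_divide_distrib diff_divide_distrib algebra_simps)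
  qed
next
  case (const c)
  show ?case by (rule trig_scalar_const)
next
  case (add p q)
  from trig_scalar.add[OF add.IH] show ?case by simp
next
  case (mult p q)
  from trig_scalar_mult[OF mult.IH] show ?case by simp
qed

lemma trig_scalar_dense:
  assumes "continuous_on circle g" "0 < e"
  obtains h where "trig_scalar h" "\<And>z. z \<in> circle \<Longrightarrow> cmod (g z - h z) < e"
proof -
  obtain q where q: "polynomial_function q" "\<And>z. z \<in> circle \<Longrightarrow> cmod (g z - q z) < e"
    using Stone_Weierstrass_polynomial_function[OF compact_sphere assms] by blast
  have "real_polynomial_function (Re \<circ> q)" "real_polynomial_function (Im \<circ> q)"
    using q(1) bounded_linear_Re bounded_linear_Im by (auto simp: polynomial_function_def)
  then have "trig_scalar (\<lambda>z. of_real (Re (q z)) + \<i> * of_real (Im (q z)))"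
    by (intro trig_scalar.add trig_scalar_mult trig_scalar_const)
      (auto dest: trig_scalar_real_polynomial)
  then have "trig_scalar q" by (simp flip: complex_eq)
  then show ?thesis using that q(2) by blast
qed

text \<open>Finite sums of polynomials tensored with powers of u: a dense part of the tensor product
  on which seminorms of the free algebra can still be evaluated. It contains the functions
  \<open>z \<mapsto> f z x\<close>.\<close>

inductive trig :: "'g set \<Rightarrow> (complex \<Rightarrow> 'g star_poly) \<Rightarrow> bool" for G where
  mono: "y \<in> free_star_alg G \<Longrightarrow> trig G (\<lambda>z. cst (z powi k) * y)"
| add: "trig G g \<Longrightarrow> trig G h \<Longrightarrow> trig G (\<lambda>z. g z + h z)"
| cong: "trig G g \<Longrightarrow> (\<And>z. z \<in> circle \<Longrightarrow> h z = g z) \<Longrightarrow> trig G h"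

lemma trig_const: "y \<in> free_star_alg G \<Longrightarrow> trig G (\<lambda>z. y)"
  using trig.mono[of y G 0] by simp

lemma trig_scale:
  assumes "trig G h"
  shows "trig G (\<lambda>z. cst c * h z)"
  using assms
proof (induction rule: trig.induct)
  case (mono y k)
  from trig.mono[OF free_cst_mult[OF mono, of c], of k] show ?case by (simp add: cst_left_comm[of "cst _"])
next
  case (add g h)
  from trig.add[OF add.IH] show ?case by (simp add: distrib_left)
next
  case (cong g h)
  show ?case by (rule trig.cong[OF cong.IH]) (simp add: cong.hyps)
qed

lemma trig_diff: "trig G g \<Longrightarrow> trig G h \<Longrightarrow> trig G (\<lambda>z. g z - h z)"
  using trig.add[of G g "\<lambda>z. cst (- 1) * h z"] trig_scale[of G h "- 1"] by (simp add: cst_minus)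

lemma trig_mult:
  assumes "trig G g" "trig G h"
  shows "trig G (\<lambda>z. g z * h z)"
  using assms(1)
proof (induction rule: trig.induct)
  case (mono y k)
  note y = mono
  show ?case using assms(2)
  proof (induction rule: trig.induct)
    case (mono x l)
    have *: "cst (z powi (k + l)) * (y * x) = cst (z powi k) * y * (cst (z powi l) * x)" if "z \<in> circle" for z
      by (simp add: powi_add_circle[OF that] cst_mult mult.assoc cst_left_comm[of y])
    show ?case by (rule trig.cong[OF trig.mono[OF free_mult[OF y mono], of "k + l"]]) (simp add: *)
  next
    case (add g h)
    from trig.add[OF add.IH] show ?case by (simp add: distrib_left)
  next
    case (cong g h)
    show ?case by (rule trig.cong[OF cong.IH]) (simp add: cong.hyps)
  qed
next
  case (add g h)
  from trig.add[OF add.IH] show ?case by (simp add: distrib_right)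
next
  case (cong g h)
  show ?case by (rule trig.cong[OF cong.IH]) (simp add: cong.hyps)
qed

lemma cnj_powi_circle: "z \<in> circle \<Longrightarrow> cnj (z powi k) = z powi (- k)"
proof -
  assume z: "z \<in> circle"
  have "cnj z = inverse z" using circle_cnj[OF z] circle_nonzero[OF z] by (simp add: field_simps)
  then show ?thesis by (simp add: power_int_minus power_int_inverse)
qed

lemma trig_star:
  assumes "trig G h"
  shows "trig G (\<lambda>z. star_poly (h z))"
  using assms
proof (induction rule: trig.induct)
  case (mono y k)
  show ?case
    by (rule trig.cong[OF trig.mono[OF free_star[OF mono], of "- k"]])
      (simp add: star_poly_cst_mult cnj_powi_circle del: complex_cnj_power_int)
next
  case (add g h)
  from trig.add[OF add.IH] show ?case by (simp add: star_poly_add)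
next
  case (cong g h)
  show ?case by (rule trig.cong[OF cong.IH]) (simp add: cong.hyps)
qed

lemma trig_subst:
  assumes "x \<in> free_star_alg G" "\<And>g. g \<in> G \<Longrightarrow> trig H (\<lambda>z. t z g)"
  shows "trig H (\<lambda>z. subst (t z) x)"
  using assms(1)
  by (induction x rule: free_induct)
    (auto simp: subst_simps assms(2) intro: trig_const trig.add trig_mult trig_scale trig_star)

lemma trig_free: "trig G h \<Longrightarrow> z \<in> circle \<Longrightarrow> h z \<in> free_star_alg G"
  by (induction rule: trig.induct) (auto intro: free_cst_mult free_add)

lemma trig_scalar_mult_poly:
  assumes "trig_scalar p" "y \<in> free_star_alg G"
  shows "trig G (\<lambda>z. cst (p z) * y)"
  using assms(1)
proof (induction rule: trig_scalar.induct)
  case (mono c k)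
  from trig_scale[OF trig.mono[OF assms(2)], of c k] show ?case by (simp add: cst_mult mult.assoc)
next
  case (add g h)
  from trig.add[OF add.IH] show ?case by (simp add: cst_add distrib_right)
next
  case (cong g h)
  show ?case by (rule trig.cong[OF cong.IH]) (simp add: cong.hyps)
qed

context bounded_relations begin

abbreviation const_cls :: "'g star_poly \<Rightarrow> 'g univ_elem" where "const_cls x \<equiv> cls (\<lambda>n. x)"

lemma const_cls_elems: "x \<in> free_star_alg G \<Longrightarrow> const_cls x \<in> elems U"
  by (simp add: CS_const)

lemma const_cls_dist: "x \<in> free_star_alg G \<Longrightarrow> y \<in> free_star_alg G \<Longrightarrow> cdist U (const_cls x) (const_cls y) = N (x - y)"
  by (simp add: U_dist CS_const U_norm_const free_diff)

lemma trig_alg_tensor: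
  assumes "trig G h"
  shows "(\<lambda>z\<in>circle. const_cls (h z)) \<in> alg_tensor_C U"
  using assms
proof (induction rule: trig.induct)
  interpret U: cstar_algebra U by (rule cstar_algebra_U)
  {
    case (mono y k)
    have "(\<lambda>z\<in>circle. const_cls (cst (z powi k) * y)) = elem_tensor U (const_cls y) (\<lambda>z. z powi k)"
      using mono by (auto simp: elem_tensor_def fun_eq_iff U_scale CS_const)
    moreover have "continuous_on circle (\<lambda>z. z powi k)"
      using circle_nonzero by (intro continuous_intros) auto
    ultimately show ?case using U.alg_tensor_elem[OF const_cls_elems[OF mono]] by simp
  next
    case (add g h)
    have "(\<lambda>z\<in>circle. const_cls (g z + h z)) =
        (\<lambda>z\<in>circle. cadd U ((\<lambda>z\<in>circle. const_cls (g z)) z) ((\<lambda>z\<in>circle. const_cls (h z)) z))"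
      using add.hyps by (intro restrict_ext) (simp add: U_add CS_const trig_free)
    then show ?case using U.alg_tensor_add[OF add.IH] by (simp only:)
  next
    case (cong g h)
    have "(\<lambda>z\<in>circle. const_cls (h z)) = (\<lambda>z\<in>circle. const_cls (g z))"
      by (intro restrict_ext) (simp add: cong.hyps)
    then show ?case using cong.IH by (simp only:)
  }
qed

lemma trig_uniformly_continuous:
  assumes h: "trig G h" and e: "0 < \<epsilon>"
  shows "\<exists>\<delta>>0. \<forall>z\<in>circle. \<forall>w\<in>circle. dist z w < \<delta> \<longrightarrow> N (h z - h w) < \<epsilon>"
proof -
  interpret U: cstar_algebra U by (rule cstar_algebra_U)
  show ?thesis
    using U.alg_tensor_uniformly_continuous[OF trig_alg_tensor[OF h] e]
    by (auto simp: const_cls_dist trig_free[OF h])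
qed

lemma trig_dense:
  assumes "F \<in> alg_tensor_C U" "0 < \<epsilon>"
  shows "\<exists>h. trig G h \<and> (\<forall>z\<in>circle. cdist U (F z) (const_cls (h z)) < \<epsilon>)"
  using assms
proof (induction arbitrary: \<epsilon> rule: alg_tensor_C.induct)
  interpret U: cstar_algebra U by (rule cstar_algebra_U)
  {
    case zero
    then show ?case
      by (intro exI[of _ "\<lambda>z. 0"]) (simp add: trig_const flip: U_zero)
  next
    case (add F a g)
    note e = add.prems
    have "bounded (g ` circle)"
      using compact_continuous_image[OF add.hyps(3) compact_sphere] by (rule compact_imp_bounded)
    then obtain K where K: "0 < K" "\<And>z. z \<in> circle \<Longrightarrow> cmod (g z) \<le> K" by (auto simp: bounded_pos)
    obtain h1 where h1: "trig G h1" "\<And>z. z \<in> circle \<Longrightarrow> cdist U (F z) (const_cls (h1 z)) < \<epsilon>/3"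
      using add.IH[of "\<epsilon>/3"] e by auto
    obtain y where y: "y \<in> free_star_alg G" "cdist U a (const_cls y) < \<epsilon> / (3 * K)"
      using U_dense[OF add.hyps(2), of "\<epsilon> / (3 * K)"] e K by auto
    \<comment> \<open>Adding 1 keeps the divisor positive when \<open>y\<close> is null. The three
      errors \<open>\<epsilon>/3\<close> come from the earlier summands, from the coefficient and
      from the scalar function.\<close>
    have L: "0 < N y + 1" using nonneg[of y] by simp
    then obtain p where p: "trig_scalar p" "\<And>z. z \<in> circle \<Longrightarrow> cmod (g z - p z) < \<epsilon> / (3 * (N y + 1))"
      using trig_scalar_dense[OF add.hyps(3), of "\<epsilon> / (3 * (N y + 1))"] e by auto
    have y': "const_cls y \<in> elems U" by (rule const_cls_elems[OF y(1)])
    show ?case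
    proof (intro exI[of _ "\<lambda>z. h1 z + cst (p z) * y"] conjI ballI)
      show "trig G (\<lambda>z. h1 z + cst (p z) * y)"
        by (intro trig.add h1 trig_scalar_mult_poly p y)
      fix z assume z: "z \<in> circle"
      have "cdist U (cscale U (g z) a) (cscale U (g z) (const_cls y)) \<le> K * (\<epsilon> / (3 * K))"
        using K(2)[OF z] y K add.hyps(2) y' U.dist_nonneg
        unfolding U.dist_scale[OF add.hyps(2) y'] by (intro mult_mono) (auto simp: less_imp_le)
      then have 1: "cdist U (cscale U (g z) a) (cscale U (g z) (const_cls y)) \<le> \<epsilon>/3" using K by simp
      have "cdist U (cscale U (g z) (const_cls y)) (cscale U (p z) (const_cls y)) = N (cst (g z - p z) * y)"
        using y(1) by (simp add: U_scale CS_const const_cls_dist free_cst_mult cst_diff left_diff_distrib)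
      also have "\<dots> \<le> \<epsilon> / (3 * (N y + 1)) * (N y + 1)"
        unfolding scale using p(2)[OF z] nonneg[of y] L e by (intro mult_mono) auto
      also have "\<dots> = \<epsilon>/3" using L by (simp add: field_simps)
      finally have 2: "cdist U (cscale U (g z) (const_cls y)) (cscale U (p z) (const_cls y)) \<le> \<epsilon>/3" .
      have 3: "cdist U (cscale U (g z) a) (cscale U (p z) (const_cls y)) \<le> \<epsilon>/3 + \<epsilon>/3"
        using U.dist_tri[of "cscale U (g z) a" "cscale U (g z) (const_cls y)" "cscale U (p z) (const_cls y)"]
          1 2 add.hyps(2) y' by simp
      have h1z: "const_cls (h1 z) \<in> elems U" by (rule const_cls_elems[OF trig_free[OF h1(1) z]])
      have "const_cls (h1 z + cst (p z) * y) = cadd U (const_cls (h1 z)) (cscale U (p z) (const_cls y))"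
        using y(1) trig_free[OF h1(1) z] by (simp add: U_scale U_add CS_const free_cst_mult)
      moreover have "cdist U (cadd U (F z) (cscale U (g z) a)) (cadd U (const_cls (h1 z)) (cscale U (p z) (const_cls y)))
          \<le> cdist U (F z) (const_cls (h1 z)) + cdist U (cscale U (g z) a) (cscale U (p z) (const_cls y))"
        using add.hyps z h1z y' by (intro U.dist_add) auto
      ultimately show "cdist U ((\<lambda>z\<in>circle. cadd U (F z) (elem_tensor U a g z)) z) (const_cls (h1 z + cst (p z) * y)) < \<epsilon>"
        using 3 h1(2)[OF z] z by (simp add: elem_tensor_def)
    qed
  }
qed

end

subsection \<open>The range of \<open>f\<close>\<close>

context trimmable_graph begin

text \<open>All powers \<open>z^k\<close> are demanded at once, with a lift independent of z,
  because multiplication by an edge shifts the exponent. For \<open>V vb\<close> the powers of the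
  loop in \<open>E\<close> provide every exponent.\<close>

definition liftable :: "('v, 'e) graph_gen star_poly \<Rightarrow> bool" where
  "liftable x \<longleftrightarrow> (\<forall>k. \<exists>y\<in>free_star_alg (graph_gens E). \<forall>z\<in>circle. N1.eqv (cst (z powi k) * x) (f z y))"

lemma liftable_V: "liftable (V vb)"
  unfolding liftable_def using f_U N1.eqv_sym U_free by blast

lemma liftable_null: "N1.eqv x 0 \<Longrightarrow> liftable x"
  unfolding liftable_def using N1.eqv_0_mult(2) by (intro allI bexI[of _ 0]) auto

lemma liftable_add:
  assumes "liftable x" "liftable y"
  shows "liftable (x + y)"
  unfolding liftable_def
proof
  fix k
  obtain u where u: "u \<in> free_star_alg (graph_gens E)" "\<And>z. z \<in> circle \<Longrightarrow> N1.eqv (cst (z powi k) * x) (f z u)"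
    using assms(1) unfolding liftable_def by blast
  obtain w where w: "w \<in> free_star_alg (graph_gens E)" "\<And>z. z \<in> circle \<Longrightarrow> N1.eqv (cst (z powi k) * y) (f z w)"
    using assms(2) unfolding liftable_def by blast
  show "\<exists>y'\<in>free_star_alg (graph_gens E). \<forall>z\<in>circle. N1.eqv (cst (z powi k) * (x + y)) (f z y')"
    using N1.eqv_add[OF u(2) w(2)] by (intro bexI[of _ "u + w"] free_add u w) (simp add: distrib_left subst_add)
qed

lemma liftable_scale:
  assumes "liftable x"
  shows "liftable (cst c * x)"
  unfolding liftable_def
proof
  fix k
  obtain u where u: "u \<in> free_star_alg (graph_gens E)" "\<And>z. z \<in> circle \<Longrightarrow> N1.eqv (cst (z powi k) * x) (f z u)"
    using assms(1) unfolding liftable_def by blast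
  show "\<exists>y\<in>free_star_alg (graph_gens E). \<forall>z\<in>circle. N1.eqv (cst (z powi k) * (cst c * x)) (f z y)"
    using N1.eqv_cst[OF u(2), of _ c]
    by (intro bexI[of _ "cst c * u"] free_cst_mult u) (simp add: subst_mult cst_left_comm[of "cst _" c])
qed

text \<open>A letter of the graph \<open>E1\<close> lifts with its own gauge degree: 0 for a vertex,
  1 for an edge, -1 for the adjoint of an edge. The loop is missing from \<open>E1\<close> and is
  null there.\<close>

lemma letter_lift: "\<exists>j. \<exists>u\<in>free_star_alg (graph_gens E). \<forall>z\<in>circle. N1.eqv (cst (z powi j) * letter l) (f z u)"
proof -
  have null: ?thesis if "N1.eqv (letter l) 0"
    using liftable_null[OF that] unfolding liftable_def by blast
  obtain g b where l: "l = (g, b)" by (cases l)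
  show ?thesis
  proof (cases g)
    case (Vx v)
    show ?thesis
    proof (cases "v \<in> verts E")
      case True
      have "\<forall>z\<in>circle. N1.eqv (cst (z powi 0) * letter l) (f z (letter l))"
        by (auto simp: l Vx letter_eq subst_star)
      moreover have "letter l \<in> free_star_alg (graph_gens E)"
        using True by (auto simp: l Vx letter_eq intro: V_free free_star)
      ultimately show ?thesis by blast
    next
      case False
      then show ?thesis
        using N1.V_outside[of v] N1.eqv_star[of "V v" 0] by (intro null) (auto simp: l Vx letter_eq)
    qed
  next
    case (Ed e)
    show ?thesis
    proof (cases "e \<in> arcs E \<and> e \<noteq> eb")
      case True
      have "cst (z powi (if b then - 1 else 1)) * letter l = f z (letter l)" if z: "z \<in> circle" for z
        using True cnj_powi_circle[OF z, of 1]
        by (auto simp: l Ed letter_eq subst_star star_poly_cst_mult)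
      moreover have "letter l \<in> free_star_alg (graph_gens E)"
        using True by (auto simp: l Ed letter_eq intro: S_free free_star)
      ultimately show ?thesis by (metis N1.eqv_refl)
    next
      case False
      then show ?thesis
        using N1.S_outside[of e] N1.eqv_star[of "S e" 0] by (intro null) (auto simp: l Ed letter_eq)
    qed
  qed
qed

lemma liftable_letter:
  assumes x: "liftable x"
  shows "liftable (letter l * x)" "liftable (x * letter l)"
proof -
  obtain j u where u: "u \<in> free_star_alg (graph_gens E)"
    "\<And>z. z \<in> circle \<Longrightarrow> N1.eqv (cst (z powi j) * letter l) (f z u)" using letter_lift by blast
  have "\<exists>w\<in>free_star_alg (graph_gens E). \<forall>z\<in>circle. N1.eqv (cst (z powi (k - j)) * x) (f z w)" for k
    using x unfolding liftable_def by blast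
  then obtain w where w: "\<And>k. w k \<in> free_star_alg (graph_gens E)"
    "\<And>k z. z \<in> circle \<Longrightarrow> N1.eqv (cst (z powi (k - j)) * x) (f z (w k))" by metis
  \<comment> \<open>The factor \<open>z^k\<close> is distributed so that the letter receives its own
    degree and \<open>x\<close> the rest.\<close>
  have split: "cst (z powi k) * (r * s) = (cst (z powi i) * r) * (cst (z powi (k - i)) * s)"
    if "z \<in> circle" for z k i and r s :: "('v, 'e) graph_gen star_poly"
    using powi_add_circle[OF that, of i "k - i"] by (simp add: cst_mult mult.assoc cst_left_comm[of r])
  show "liftable (letter l * x)"
    unfolding liftable_def
  proof (intro allI bexI[of _ "u * w _"] ballI)
    fix k z assume z: "z \<in> circle"
    show "N1.eqv (cst (z powi k) * (letter l * x)) (f z (u * w k))"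
      unfolding split[OF z, of k "letter l" x j] subst_mult by (intro N1.eqv_mult u w z)
  qed (intro free_mult u w)
  show "liftable (x * letter l)"
    unfolding liftable_def
  proof (intro allI bexI[of _ "w _ * u"] ballI)
    fix k z assume z: "z \<in> circle"
    have "N1.eqv ((cst (z powi (k - j)) * x) * (cst (z powi j) * letter l)) (f z (w k) * f z u)"
      by (intro N1.eqv_mult u w z)
    then show "N1.eqv (cst (z powi k) * (x * letter l)) (f z (w k * u))"
      using split[OF z, of k x "letter l" "k - j"] by (simp add: subst_mult)
  qed (intro free_mult u w)
qed

lemma liftable_left: "liftable x \<Longrightarrow> liftable (a * x)"
proof (induction a rule: star_poly_word_induct)
  case (letter l a)
  then show ?case using liftable_letter(1)[of "a * x" l] by (simp add: mult.assoc)
next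
  case (scale c a)
  then show ?case using liftable_scale[of "a * x" c] by (simp add: mult.assoc)
next
  case (add a b)
  then show ?case by (simp add: distrib_right liftable_add)
qed (auto intro: liftable_null)

lemma liftable_right: "liftable x \<Longrightarrow> liftable (x * a)"
proof (induction a arbitrary: x rule: star_poly_word_induct)
  case (letter l a)
  then show ?case using letter.IH[OF liftable_letter(2)[of x l]] by (simp add: mult.assoc)
next
  case (scale c a)
  then show ?case using liftable_scale[of "x * a" c] by (simp add: cst_left_comm[of x])
next
  case (add a b)
  then show ?case by (simp add: distrib_left liftable_add)
qed (auto intro: liftable_null)

lemma ideal_liftable: "x \<in> E1.J \<Longrightarrow> liftable x"
  by (induction rule: gen_ideal.induct) (auto intro: liftable_V liftable_add liftable_left liftable_right)

text \<open>Multiplication by the approximate unit pushes each coefficient into the ideal, so the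
  function cut off in this way is hit, up to null elements, by a single polynomial for all
  z.\<close>

lemma trig_cut_liftable:
  assumes "trig G h"
  shows "\<exists>y\<in>free_star_alg (graph_gens E). \<forall>z\<in>circle. N1.eqv (h z * E1.approx_unit n) (f z y)"
  using assms
proof (induction rule: trig.induct)
  case (mono y k)
  have "y * E1.approx_unit n \<in> E1.J" by (intro gen_ideal.left E1.approx_unit_ideal)
  then show ?case using ideal_liftable unfolding liftable_def by (simp add: mult.assoc)
next
  case (add g h)
  then obtain u w where u: "u \<in> free_star_alg (graph_gens E)" "\<And>z. z \<in> circle \<Longrightarrow> N1.eqv (g z * E1.approx_unit n) (f z u)"
    and w: "w \<in> free_star_alg (graph_gens E)" "\<And>z. z \<in> circle \<Longrightarrow> N1.eqv (h z * E1.approx_unit n) (f z w)" by blast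
  show ?case
    using N1.eqv_add[OF u(2) w(2)] by (intro bexI[of _ "u + w"] free_add u w) (simp add: distrib_right subst_add)
next
  case (cong g h)
  then show ?case by auto
qed

lemma trim_gen_trig: "g \<in> graph_gens E \<Longrightarrow> trig (graph_gens E1) (\<lambda>z. trim_gen vb eb z g)"
proof -
  assume g: "g \<in> graph_gens E"
  have m: "trig (graph_gens E1) (\<lambda>z. cst z * y)" if "y \<in> free_star_alg (graph_gens E1)" for y
    using trig.mono[OF that, of 1] by simp
  show ?thesis
  proof (cases g)
    case (Vx v)
    then have "v \<in> verts E1" using g by (auto simp: graph_gens_def)
    from trig_const[OF V_free[OF this]] show ?thesis by (simp add: Vx)
  next
    case (Ed e)
    have "(if e = eb then V vb else S e) \<in> free_star_alg (graph_gens E1)"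
      using g Ed vb V_free[of vb E1] S_free[of e E1] by (auto simp: graph_gens_def)
    from m[OF this] show ?thesis by (simp add: Ed)
  qed
qed

text \<open>For each z the bound modulo the ideal holds after cutting by \<open>1 - a n\<close>, for
  n large depending on z. Continuity in z, at the cost \<open>e\<close>, and a finite net of the
  circle give one n for all z; the remaining part, multiplied by \<open>a n\<close>, lies in the
  range of \<open>f\<close>.\<close>

lemma f_dense:
  assumes h: "trig (graph_gens E1) h" and x: "x \<in> free_star_alg (graph_gens E)" and e: "0 < e"
    and le: "\<And>z. z \<in> circle \<Longrightarrow> N2 (h z - f z x) < b"
  obtains y where "y \<in> free_star_alg (graph_gens E)" "\<And>z. z \<in> circle \<Longrightarrow> N1 (h z - f z y) < b + e"
proof -
  interpret B1: bounded_relations "graph_gens E1" "graph_rels E1"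
    by (rule bounded_relations_graph[OF fin_digraph_E1])
  let ?a = "E1.approx_unit"
  define g where "g z = h z - f z x" for z
  have g: "trig (graph_gens E1) g"
    unfolding g_def by (intro trig_diff h trig_subst[OF x] trim_gen_trig)
  have "\<exists>n0. \<forall>n\<ge>n0. N1 (g z * (1 - ?a n)) < b" if z: "z \<in> circle" for z
  proof -
    have "N2 (g z) < b" using le[OF z] by (simp add: g_def)
    then obtain y where y: "y \<in> E1.J" "N1 (g z - y) < b" using N1.ideal_approximation by blast
    obtain n0 where n0: "\<And>n. n \<ge> n0 \<Longrightarrow> N1.eqv (y * ?a n) y"
      using N1.ideal_absorbed[OF y(1)] unfolding N1.absorbed_def by blast
    have "N1 (g z * (1 - ?a n)) < b" if "n \<ge> n0" for n
    proof -
      have "N1 (g z * (1 - ?a n)) \<le> N1 ((g z - y) * (1 - ?a n)) + N1 (y * (1 - ?a n))"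
        using N1.triangle[of "(g z - y) * (1 - ?a n)" "y * (1 - ?a n)"] by (simp add: algebra_simps)
      also have "N1 (y * (1 - ?a n)) = 0"
        using n0[OF that] N1.p_diff_comm[of "y * ?a n" y] by (simp add: N1.eqv_def algebra_simps)
      finally show ?thesis using N1.approx_unit_compl_le[of "g z - y" n] y by simp
    qed
    then show ?thesis by blast
  qed
  then obtain n0 where n0: "\<And>z n. z \<in> circle \<Longrightarrow> n \<ge> n0 z \<Longrightarrow> N1 (g z * (1 - ?a n)) < b" by metis
  obtain \<delta> where \<delta>: "\<delta> > 0" "\<And>z w. z \<in> circle \<Longrightarrow> w \<in> circle \<Longrightarrow> dist z w < \<delta> \<Longrightarrow> N1 (g z - g w) < e"
    using B1.trig_uniformly_continuous[OF g e] unfolding graph_norm_def by blast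
  obtain K where K: "finite K" "K \<subseteq> circle" "circle \<subseteq> (\<Union>z\<in>K. ball z \<delta>)"
    using compactE_image[OF compact_sphere, of "circle" "\<lambda>z. ball z \<delta>"] \<delta>(1)
    by (metis (no_types, lifting) UN_iff centre_in_ball open_ball subsetI)
  define n where "n = Max (insert 0 (n0 ` K))"
  have n: "n \<ge> n0 z" if "z \<in> K" for z
    using that K(1) by (auto simp: n_def)
  obtain y where y: "y \<in> free_star_alg (graph_gens E)" "\<And>z. z \<in> circle \<Longrightarrow> N1.eqv (g z * ?a n) (f z y)"
    using trig_cut_liftable[OF g, of n] by blast
  show ?thesis
  proof (rule that[of "x + y"])
    show "x + y \<in> free_star_alg (graph_gens E)" by (intro free_add x y)
    fix w assume w: "w \<in> circle"
    then obtain z where z: "z \<in> K" "dist z w < \<delta>" using K(3) by auto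
    then have zc: "z \<in> circle" using K(2) by blast
    have "N1 (h w - f w (x + y)) = N1 (g w - f w y)" by (simp add: g_def subst_add algebra_simps)
    also have "\<dots> = N1 (g w - g w * ?a n)" by (intro N1.p_cong N1.eqv_diff N1.eqv_refl N1.eqv_sym[OF y(2)] w)
    also have "\<dots> \<le> N1 ((g w - g z) * (1 - ?a n)) + N1 (g z * (1 - ?a n))"
      using N1.triangle[of "(g w - g z) * (1 - ?a n)" "g z * (1 - ?a n)"] by (simp add: algebra_simps)
    also have "\<dots> < e + b"
      using N1.approx_unit_compl_le[of "g w - g z" n] \<delta>(2)[OF zc w z(2)] N1.p_diff_comm[of "g w" "g z"]
        n0[OF zc n[OF z(1)]] by simp
    finally show "N1 (h w - f w (x + y)) < b + e" by simp
  qed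
qed

end

section \<open>The pullback square\<close>

text \<open>Trigonometric dependence on z puts the family in the tensor product and not merely among
  functions on the circle. It serves both the gauge coaction and \<open>f\<close>.\<close>

locale circle_map = dom: bounded_relations G R + cod: bounded_relations H S
  for G :: "'g set" and R and H :: "'h set" and S +
  fixes t :: "complex \<Rightarrow> 'g \<Rightarrow> 'h star_poly"
  assumes relation_map: "z \<in> circle \<Longrightarrow> relation_map G R H S (t z)"
    and trig_gen: "g \<in> G \<Longrightarrow> trig H (\<lambda>z. t z g)"
begin

abbreviation circle_hom :: "'g univ_elem \<Rightarrow> complex \<Rightarrow> 'h univ_elem" where
  "circle_hom a \<equiv> (\<lambda>z\<in>circle. univ_map H S (t z) a)"

lemma circle_hom_const:
  "x \<in> free_star_alg G \<Longrightarrow> circle_hom (dom.const_cls x) = (\<lambda>z\<in>circle. cod.const_cls (subst (t z) x))"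
  using relation_map.map_cls[OF relation_map dom.CS_const] by (intro restrict_ext) auto

lemma circle_hom_elems:
  assumes a: "a \<in> elems dom.U"
  shows "circle_hom a \<in> elems (tensor_C cod.U)"
proof -
  interpret U: cstar_algebra cod.U by (rule cod.cstar_algebra_U)
  show ?thesis
  proof (rule U.T_I)
    show "circle_hom a \<in> circle \<rightarrow>\<^sub>E elems cod.U"
      using star_homD(1)[OF relation_map.star_hom_map_class[OF relation_map] a a] by auto
    fix e :: real assume "0 < e"
    then obtain x where x: "x \<in> free_star_alg G" "cdist dom.U a (dom.const_cls x) < e"
      using dom.U_dense[OF a] by blast
    have "circle_hom (dom.const_cls x) \<in> alg_tensor_C cod.U"
      unfolding circle_hom_const[OF x(1)]
      by (intro cod.trig_alg_tensor trig_subst[OF x(1)] trig_gen)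
    moreover have "cdist cod.U (circle_hom a z) (circle_hom (dom.const_cls x) z) < e" if z: "z \<in> circle" for z
      using star_hom_dist_le[OF dom.cstar_algebra_U cod.cstar_algebra_U
          relation_map.star_hom_map_class[OF relation_map[OF z]] a dom.const_cls_elems[OF x(1)]] x(2) z
      by simp
    ultimately show "\<exists>F\<in>alg_tensor_C cod.U. \<forall>z\<in>circle. cdist cod.U (circle_hom a z) (F z) < e" by blast
  qed
qed

lemma star_hom_circle_hom: "star_hom dom.U (tensor_C cod.U) circle_hom"
proof -
  interpret U: cstar_algebra cod.U by (rule cod.cstar_algebra_U)
  have hom: "star_hom dom.U cod.U (univ_map H S (t z))" if "z \<in> circle" for z
    by (rule relation_map.star_hom_map_class[OF relation_map[OF that]])
  show ?thesis
    using circle_hom_elems hom unfolding star_hom_def U.T_ops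
    by (intro conjI ballI allI restrict_ext) auto
qed

lemma circle_hom_gen: "g \<in> G \<Longrightarrow> circle_hom (univ_gen G R g) = (\<lambda>z\<in>circle. cod.const_cls (t z g))"
  using relation_map.map_gen[OF relation_map] by (intro restrict_ext) auto

end

lemma relation_map_graphI:
  assumes E: "fin_digraph E" "fin_digraph F"
    and free: "\<And>g. g \<in> graph_gens E \<Longrightarrow> t g \<in> free_star_alg (graph_gens F)"
    and sem: "graph_seminorm E (\<lambda>x. graph_norm F (subst t x))"
  shows "relation_map (graph_gens E) (graph_rels E) (graph_gens F) (graph_rels F) t"
proof -
  interpret graph_seminorm E "\<lambda>x. graph_norm F (subst t x)" by fact
  show ?thesis
    using outside rel free bounded_relations_graph[OF E(1)] bounded_relations_graph[OF E(2)]
    by (intro relation_map.intro relation_map_axioms.intro) (simp_all flip: graph_norm_def)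
qed

lemma relation_map_gauge:
  assumes "fin_digraph E" "z \<in> circle"
  shows "relation_map (graph_gens E) (graph_rels E) (graph_gens E) (graph_rels E) (gauge_gen z)"
proof (rule relation_map_graphI[OF assms(1,1)])
  show "gauge_gen z g \<in> free_star_alg (graph_gens E)" if "g \<in> graph_gens E" for g
    using free_gen[OF that] by (cases g) (auto intro: free_cst_mult)
qed (intro graph_seminorm.graph_seminorm_gauge graph_seminorm_graph_norm assms)

lemma gauge_gen_trig: "g \<in> graph_gens E \<Longrightarrow> trig (graph_gens E) (\<lambda>z. gauge_gen z g)"
  using trig_const[OF free_gen, of g "graph_gens E"] trig.mono[OF free_gen, of g "graph_gens E" 1]
  by (cases g) auto

lemma circle_map_gauge:
  assumes "fin_digraph E"
  shows "circle_map (graph_gens E) (graph_rels E) (graph_gens E) (graph_rels E) gauge_gen"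
  using relation_map_gauge gauge_gen_trig bounded_relations_graph assms
  by (intro circle_map.intro circle_map_axioms.intro) auto

section \<open>Gauge action and gauge coaction\<close>

locale graph_algebra = fin_digraph E for E :: "('v, 'e) pre_digraph"
begin

sublocale B: bounded_relations "graph_gens E" "graph_rels E"
  by (rule bounded_relations_graph) unfold_locales

abbreviation cl :: "(nat \<Rightarrow> ('v, 'e) graph_gen star_poly) \<Rightarrow> ('v, 'e) graph_elem" where
  "cl \<equiv> univ_class (graph_gens E) (graph_rels E)"

sublocale A: cstar_algebra "graph_cstar E"
  by (rule cstar_algebra_graph) unfold_locales

lemma vproj_cl: "vproj E v = cl (\<lambda>n. V v)" and eiso_cl: "eiso E e = cl (\<lambda>n. S e)"
  by (simp_all add: vproj_def eiso_def B.univ_gen_cls)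

lemma gauge_action_eq:
  assumes z: "z \<in> circle" and a: "a \<in> elems (graph_cstar E)"
  shows "gauge_action E z a = univ_map (graph_gens E) (graph_rels E) (gauge_gen z) a"
proof -
  interpret r: relation_map "graph_gens E" "graph_rels E" "graph_gens E" "graph_rels E" "gauge_gen z"
    by (rule relation_map_gauge[OF fin_digraph z])
  show ?thesis
    unfolding gauge_action_def
  proof (rule graph_hom_apply[OF fin_digraph A.cstar_algebra_axioms _ _ _ a])
    show "star_hom (graph_cstar E) (graph_cstar E) r.map_class"
      using r.star_hom_map_class by (simp add: graph_cstar_def)
    show "r.map_class (vproj E v) = vproj E v" if "v \<in> verts E" for v
      using r.map_gen[of "Vx v"] that by (simp add: vproj_def B.univ_gen_cls)
    show "r.map_class (eiso E e) = cscale (graph_cstar E) z (eiso E e)" if "e \<in> arcs E" for e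
      using r.map_gen[of "Ed e"] that B.U_scale[OF B.CS_const[OF S_free[OF that]]]
      by (simp add: eiso_def B.univ_gen_cls graph_cstar_def)
  qed
qed

lemma gauge_coaction_eq:
  assumes a: "a \<in> elems (graph_cstar E)"
  shows "gauge_coaction E a = (\<lambda>z\<in>circle. gauge_action E z a)"
proof -
  interpret r: circle_map "graph_gens E" "graph_rels E" "graph_gens E" "graph_rels E" gauge_gen
    by (rule circle_map_gauge[OF fin_digraph])
  have "gauge_coaction E a = r.circle_hom a"
    unfolding gauge_coaction_def
  proof (rule graph_hom_apply[OF fin_digraph A.cstar_algebra_tensor _ _ _ a])
    show "star_hom (graph_cstar E) (tensor_C (graph_cstar E)) r.circle_hom"
      using r.star_hom_circle_hom by (simp add: graph_cstar_def)
    show "r.circle_hom (vproj E v) = elem_tensor (graph_cstar E) (vproj E v) (\<lambda>z. 1)" if v: "v \<in> verts E" for v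
    proof -
      have "Vx v \<in> graph_gens E" using v by simp
      moreover have "vproj E v \<in> elems (graph_cstar E)"
        using v by (simp add: vproj_cl graph_cstar_def B.CS_const V_free)
      ultimately show ?thesis
        unfolding elem_tensor_def vproj_def r.circle_hom_gen[OF \<open>Vx v \<in> graph_gens E\<close>]
        by (intro restrict_ext) (simp add: A.scale_one B.univ_gen_cls)
    qed
    show "r.circle_hom (eiso E e) = elem_tensor (graph_cstar E) (eiso E e) (\<lambda>z. z)" if e: "e \<in> arcs E" for e
    proof -
      have "Ed e \<in> graph_gens E" using e by simp
      then show ?thesis
        unfolding elem_tensor_def eiso_def r.circle_hom_gen[OF \<open>Ed e \<in> graph_gens E\<close>]
        using B.U_scale[OF B.CS_const[OF S_free[OF e]]]
        by (intro restrict_ext) (simp add: B.univ_gen_cls graph_cstar_def)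
    qed
  qed
  also have "\<dots> = (\<lambda>z\<in>circle. gauge_action E z a)"
    using gauge_action_eq[OF _ a] by (intro restrict_ext) simp
  finally show ?thesis .
qed

lemma gauge_coaction_tensor: "a \<in> elems (graph_cstar E) \<Longrightarrow> gauge_coaction E a \<in> elems (tensor_C (graph_cstar E))"
proof -
  assume a: "a \<in> elems (graph_cstar E)"
  interpret r: circle_map "graph_gens E" "graph_rels E" "graph_gens E" "graph_rels E" gauge_gen
    by (rule circle_map_gauge[OF fin_digraph])
  have "gauge_coaction E a = r.circle_hom a"
    unfolding gauge_coaction_eq[OF a] using gauge_action_eq[OF _ a] by (intro restrict_ext) simp
  then show ?thesis using r.circle_hom_elems a by (simp add: graph_cstar_def)
qed

lemma star_hom_gauge:
  assumes z: "z \<in> circle"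
  shows "star_hom (graph_cstar E) (graph_cstar E) (gauge_action E z)"
proof (rule star_hom_cong[OF A.cstar_algebra_axioms gauge_action_eq[OF z]])
  show "star_hom (graph_cstar E) (graph_cstar E) (univ_map (graph_gens E) (graph_rels E) (gauge_gen z))"
    using relation_map.star_hom_map_class[OF relation_map_gauge[OF fin_digraph z]] by (simp add: graph_cstar_def)
qed

lemma star_hom_gauge_coaction: "star_hom (graph_cstar E) (tensor_C (graph_cstar E)) (gauge_coaction E)"
proof -
  interpret r: circle_map "graph_gens E" "graph_rels E" "graph_gens E" "graph_rels E" gauge_gen
    by (rule circle_map_gauge[OF fin_digraph])
  have "gauge_coaction E a = r.circle_hom a" if "a \<in> elems (graph_cstar E)" for a
    unfolding gauge_coaction_eq[OF that] using gauge_action_eq[OF _ that] by (intro restrict_ext) simp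
  then show ?thesis
    by (rule star_hom_cong[OF A.cstar_algebra_axioms]) (use r.star_hom_circle_hom in \<open>simp_all add: graph_cstar_def\<close>)
qed

lemma elems_cl:
  assumes "a \<in> elems (graph_cstar E)"
  obtains X where "X \<in> B.CS" "a = cl X"
  using B.elems_E assms unfolding graph_cstar_def by blast

lemma gauge_cl:
  assumes "z \<in> circle" "X \<in> B.CS"
  shows "gauge_action E z (cl X) = cl (\<lambda>n. subst (gauge_gen z) (X n))"
  using gauge_action_eq[OF assms(1), of "cl X"] assms(2)
    relation_map.map_cls[OF relation_map_gauge[OF fin_digraph assms(1)] assms(2)]
  by (simp add: graph_cstar_def)

lemma gauge_gauge: "subst (gauge_gen z) (subst (gauge_gen w) x) = subst (gauge_gen (z * w)) x"
  for x :: "('v, 'e) graph_gen star_poly"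
proof -
  have "(\<lambda>g :: ('v, 'e) graph_gen. subst (gauge_gen z) (gauge_gen w g)) = gauge_gen (z * w)"
  proof
    fix g :: "('v, 'e) graph_gen"
    show "subst (gauge_gen z) (gauge_gen w g) = gauge_gen (z * w) g"
      by (cases g) (simp_all add: subst_mult cst_mult cst_left_comm[of "cst w"] mult.assoc)
  qed
  then show ?thesis by (simp add: subst_subst)
qed

lemma gauge_action_mult:
  assumes "z \<in> circle" "w \<in> circle" "a \<in> elems (graph_cstar E)"
  shows "gauge_action E (z * w) a = gauge_action E z (gauge_action E w a)"
proof -
  obtain X where X: "X \<in> B.CS" "a = cl X" using elems_cl[OF assms(3)] by blast
  have "(\<lambda>n. subst (gauge_gen w) (X n)) \<in> B.CS"
    by (rule relation_map.subst_CS[OF relation_map_gauge[OF fin_digraph assms(2)] X(1)])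
  then show ?thesis
    using X assms circle_mult[OF assms(1,2)] by (simp add: gauge_cl gauge_gauge)
qed

lemma gauge_action_1: "a \<in> elems (graph_cstar E) \<Longrightarrow> gauge_action E 1 a = a"
proof -
  assume "a \<in> elems (graph_cstar E)"
  then obtain X where X: "X \<in> B.CS" "a = cl X" using elems_cl by blast
  have "gauge_gen 1 = (gen :: ('v, 'e) graph_gen \<Rightarrow> _)"
  proof
    fix g :: "('v, 'e) graph_gen"
    show "gauge_gen 1 g = gen g" by (cases g) simp_all
  qed
  then show ?thesis using gauge_cl[OF one_in_circle X(1)] X(2) by simp
qed

text \<open>Continuity of the action: the orbit map of \<open>a\<close> is the element
  \<open>gauge_coaction E a\<close> of the tensor product, and such elements are uniformly
  continuous on the circle.\<close>

theorem U1_cstar_algebra_graph: "U1_cstar_algebra (graph_cstar E) (gauge_action E)"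
  unfolding U1_cstar_algebra_def
proof (intro conjI ballI)
  show "cstar_algebra (graph_cstar E)" by unfold_locales
  fix a \<mu> assume a: "a \<in> elems (graph_cstar E)" and \<mu>: "\<mu> \<in> circle"
  show "((\<lambda>\<nu>. cdist (graph_cstar E) (gauge_action E \<nu> a) (gauge_action E \<mu> a)) \<longlongrightarrow> 0) (at \<mu> within circle)"
  proof (rule tendstoI)
    fix e :: real assume "0 < e"
    then obtain \<delta> where \<delta>: "\<delta> > 0" "\<And>z w. z \<in> circle \<Longrightarrow> w \<in> circle \<Longrightarrow> dist z w < \<delta> \<Longrightarrow>
        cdist (graph_cstar E) (gauge_coaction E a z) (gauge_coaction E a w) < e"
      using A.T_uniformly_continuous[OF gauge_coaction_tensor[OF a], of e] by auto
    have "dist (cdist (graph_cstar E) (gauge_action E \<nu> a) (gauge_action E \<mu> a)) 0 < e"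
      if \<nu>: "\<nu> \<in> circle" "dist \<nu> \<mu> < \<delta>" for \<nu>
      using \<delta>(2)[OF \<nu>(1) \<mu> \<nu>(2)] \<nu>(1) \<mu> star_homD(1)[OF star_hom_gauge a a]
      by (simp add: gauge_coaction_eq[OF a] A.dist_nonneg)
    then show "\<forall>\<^sub>F \<nu> in at \<mu> within circle. dist (cdist (graph_cstar E) (gauge_action E \<nu> a) (gauge_action E \<mu> a)) 0 < e"
      unfolding eventually_at using \<delta>(1) by blast
  qed
qed (auto simp: star_hom_gauge gauge_action_1 gauge_action_mult)

lemma U1_equivariant_gauge_coaction: "U1_equivariant (graph_cstar E) (gauge_action E) rotation (gauge_coaction E)"
  unfolding U1_equivariant_def
proof (intro ballI)
  fix \<mu> a assume \<mu>: "\<mu> \<in> circle" and a: "a \<in> elems (graph_cstar E)"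
  have ga: "gauge_action E \<mu> a \<in> elems (graph_cstar E)" by (rule star_homD(1)[OF star_hom_gauge[OF \<mu>] a a])
  show "gauge_coaction E (gauge_action E \<mu> a) = rotation \<mu> (gauge_coaction E a)"
    unfolding gauge_coaction_eq[OF ga] rotation_def gauge_coaction_eq[OF a]
    using circle_mult[OF \<mu>] gauge_action_mult[OF _ \<mu> a] by (intro restrict_ext) (simp add: mult.commute)
qed

end

lemma (in graph_seminorm) eqv_cut: "cut (graph_gens E) x \<simeq> x"
proof (induction x rule: star_poly_gen_induct)
  case (gen g)
  then show ?case using outside[of g] eqv_sym[of "gen g" 0] by (simp add: eqv_0)
qed (auto intro: eqv_add eqv_mult eqv_star)

section \<open>The quotient maps\<close>

context isolated_vertex begin

abbreviation kill_gen :: "('v, 'e) graph_gen \<Rightarrow> ('v, 'e) graph_gen star_poly" where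
  "kill_gen \<equiv> \<lambda>g. if g \<in> graph_gens E_del then gen g else 0"

text \<open>Letters outside \<open>E_del\<close> are already null there, so erasing them leaves the
  seminorm unchanged, and the quotient map may be realised by erasing them literally.\<close>

lemma norm_kill: "graph_norm E_del (subst kill_gen x) = graph_norm E_del x"
proof -
  interpret d: graph_seminorm E_del "graph_norm E_del"
    by (rule graph_seminorm_graph_norm[OF fin_digraph_del])
  show ?thesis using d.p_cong[OF d.eqv_cut] by (simp add: cut_def)
qed

lemma relation_map_kill:
  "relation_map (graph_gens E) (graph_rels E) (graph_gens E_del) (graph_rels E_del) kill_gen"
  using graph_seminorm_del by (intro relation_map_graphI fin_digraph_axioms fin_digraph_del)
    (auto simp: norm_kill intro: free_gen)

abbreviation kill_class :: "('v, 'e) graph_elem \<Rightarrow> ('v, 'e) graph_elem" where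
  "kill_class \<equiv> univ_map (graph_gens E_del) (graph_rels E_del) kill_gen"

lemma star_hom_kill_class: "star_hom (graph_cstar E) (graph_cstar E_del) kill_class"
  using relation_map.star_hom_map_class[OF relation_map_kill] by (simp add: graph_cstar_def)

lemma kill_vertex_eq:
  assumes a: "a \<in> elems (graph_cstar E)"
  shows "kill_vertex E E_del vb a = kill_class a"
  unfolding kill_vertex_def
proof (rule graph_hom_apply[OF fin_digraph_axioms cstar_algebra_graph[OF fin_digraph_del] star_hom_kill_class _ _ a])
  interpret kill: relation_map "graph_gens E" "graph_rels E" "graph_gens E_del" "graph_rels E_del" kill_gen
    by (rule relation_map_kill)
  show "kill_class (vproj E v) = (if v = vb then czero (graph_cstar E_del) else vproj E_del v)"
    if "v \<in> verts E" for v
    using kill.map_gen[of "Vx v"] that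
    by (auto simp: vproj_def del_vert_simps graph_cstar_def kill.cod.U_zero kill.cod.univ_gen_cls)
  show "kill_class (eiso E e) = (if head E e = vb then czero (graph_cstar E_del) else eiso E_del e)"
    if "e \<in> arcs E" for e
  proof -
    have "Ed e \<in> graph_gens E_del \<longleftrightarrow> head E e \<noteq> vb" using arcs_del[of e] that by auto
    then show ?thesis using kill.map_gen[of "Ed e"] that
      by (auto simp: eiso_def graph_cstar_def kill.cod.U_zero kill.cod.univ_gen_cls)
  qed
qed

lemma star_hom_kill: "star_hom (graph_cstar E) (graph_cstar E_del) (kill_vertex E E_del vb)"
  by (rule star_hom_cong[OF cstar_algebra_graph[OF fin_digraph_axioms] kill_vertex_eq star_hom_kill_class])

lemma kill_cl:
  assumes "X \<in> cauchy_seqs (graph_gens E) (graph_rels E)"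
  shows "kill_vertex E E_del vb (univ_class (graph_gens E) (graph_rels E) X)
    = univ_class (graph_gens E_del) (graph_rels E_del) (\<lambda>n. subst kill_gen (X n))"
proof -
  interpret kill: relation_map "graph_gens E" "graph_rels E" "graph_gens E_del" "graph_rels E_del" kill_gen
    by (rule relation_map_kill)
  show ?thesis using kill_vertex_eq[of "kill.dom.cls X"] assms by (simp add: graph_cstar_def kill.map_cls)
qed

lemma U1_equivariant_kill:
  "U1_equivariant (graph_cstar E) (gauge_action E) (gauge_action E_del) (kill_vertex E E_del vb)"
  unfolding U1_equivariant_def
proof (intro ballI)
  interpret E: graph_algebra E by unfold_locales
  interpret D: graph_algebra E_del by (intro graph_algebra.intro fin_digraph_del)
  fix \<mu> a assume \<mu>: "\<mu> \<in> circle" and "a \<in> elems (graph_cstar E)"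
  then obtain X where X: "X \<in> E.B.CS" "a = E.cl X" using E.elems_cl by blast
  have "subst kill_gen (subst (gauge_gen \<mu>) x) = subst (gauge_gen \<mu>) (subst kill_gen x)" for x
  proof -
    have "(\<lambda>g. subst kill_gen (gauge_gen \<mu> g)) = (\<lambda>g. subst (gauge_gen \<mu>) (kill_gen g))"
    proof
      fix g :: "('v, 'e) graph_gen"
      show "subst kill_gen (gauge_gen \<mu> g) = subst (gauge_gen \<mu>) (kill_gen g)"
        by (cases g) (simp_all add: subst_mult)
    qed
    then show ?thesis by (simp only: subst_subst)
  qed
  then show "kill_vertex E E_del vb (gauge_action E \<mu> a) = gauge_action E_del \<mu> (kill_vertex E E_del vb a)"
    using X \<mu> relation_map.subst_CS[OF relation_map_gauge[OF fin_digraph_axioms \<mu>] X(1)]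
    by (simp add: E.gauge_cl D.gauge_cl kill_cl relation_map.subst_CS[OF relation_map_kill])
qed

end

section \<open>The maps of the square and their isomorphism with the pullback\<close>

context trimmable_graph begin

sublocale GA: graph_algebra E by unfold_locales
sublocale GA1: graph_algebra E1 by (intro graph_algebra.intro fin_digraph_E1)
sublocale GA2: graph_algebra E2 by (intro graph_algebra.intro fin_digraph_E2)

abbreviation "A \<equiv> graph_cstar E"
abbreviation "A1 \<equiv> graph_cstar E1"
abbreviation "A2 \<equiv> graph_cstar E2"
abbreviation "F \<equiv> trim_map E E1 vb eb"
abbreviation "p1 \<equiv> kill_vertex E E2 vb"
abbreviation "p2 \<equiv> kill_vertex E1 E2 vb"

lemma relation_map_trim:
  assumes "z \<in> circle"
  shows "relation_map (graph_gens E) (graph_rels E) (graph_gens E1) (graph_rels E1) (trim_gen vb eb z)"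
  using trig_free[OF trim_gen_trig assms]
  by (intro relation_map_graphI fin_digraph_E1 graph_seminorm_trim assms) (auto intro: fin_digraph_axioms)

sublocale c: circle_map "graph_gens E" "graph_rels E" "graph_gens E1" "graph_rels E1" "trim_gen vb eb"
  using relation_map_trim trim_gen_trig by (intro circle_map.intro circle_map_axioms.intro) (auto intro: bounded_relations_graph fin_digraph_axioms fin_digraph_E1)

lemma F_eq:
  assumes a: "a \<in> elems A"
  shows "F a = c.circle_hom a"
  unfolding trim_map_def
proof (rule graph_hom_apply[OF fin_digraph_axioms GA1.A.cstar_algebra_tensor _ _ _ a])
  show "star_hom A (tensor_C A1) c.circle_hom"
    using c.star_hom_circle_hom by (simp add: graph_cstar_def)
  have mem: "vproj E1 v \<in> elems A1" if "v \<in> verts E" for v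
    using that by (simp add: GA1.vproj_cl graph_cstar_def GA1.B.CS_const V_free)
  show "c.circle_hom (vproj E v) = elem_tensor A1 (vproj E1 v) (\<lambda>z. 1)" if v: "v \<in> verts E" for v
  proof -
    have g: "Vx v \<in> graph_gens E" using v by simp
    show ?thesis
      unfolding elem_tensor_def vproj_def[of E] c.circle_hom_gen[OF g]
      using mem[OF v] by (intro restrict_ext) (simp add: GA1.A.scale_one GA1.vproj_cl)
  qed
  show "c.circle_hom (eiso E e) = (if e = eb then elem_tensor A1 (vproj E1 vb) (\<lambda>z. z)
      else elem_tensor A1 (eiso E1 e) (\<lambda>z. z))" if e: "e \<in> arcs E" for e
  proof -
    have g: "Ed e \<in> graph_gens E" using e by simp
    have V: "cscale A1 z (vproj E1 vb) = GA1.cl (\<lambda>n. cst z * V vb)" for z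
      using GA1.B.U_scale[OF GA1.B.CS_const[OF V_free]] vb by (simp add: GA1.vproj_cl graph_cstar_def)
    have S: "cscale A1 z (eiso E1 e) = GA1.cl (\<lambda>n. cst z * S e)" if "e \<noteq> eb" for z
      using GA1.B.U_scale[OF GA1.B.CS_const[OF S_free]] e that by (simp add: GA1.eiso_cl graph_cstar_def)
    show ?thesis
      unfolding elem_tensor_def eiso_def[of E] c.circle_hom_gen[OF g] by (simp add: V S)
  qed
qed

lemma star_hom_F: "star_hom A (tensor_C A1) F"
  by (rule star_hom_cong[OF GA.A.cstar_algebra_axioms F_eq])
    (use c.star_hom_circle_hom in \<open>simp_all add: graph_cstar_def\<close>)

lemma F_cl: "X \<in> GA.B.CS \<Longrightarrow> z \<in> circle \<Longrightarrow> F (GA.cl X) z = GA1.cl (\<lambda>n. f z (X n))"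
  using F_eq[of "GA.cl X"] relation_map.map_cls[OF relation_map_trim] by (simp add: graph_cstar_def)

lemma U1_equivariant_F: "U1_equivariant A (gauge_action E) rotation F"
  unfolding U1_equivariant_def
proof (intro ballI)
  fix \<mu> a assume \<mu>: "\<mu> \<in> circle" and a: "a \<in> elems A"
  then obtain X where X: "X \<in> GA.B.CS" "a = GA.cl X" using GA.elems_cl by blast
  have X': "(\<lambda>n. subst (gauge_gen \<mu>) (X n)) \<in> GA.B.CS"
    by (rule relation_map.subst_CS[OF relation_map_gauge[OF fin_digraph_axioms \<mu>] X(1)])
  have eq: "f z (subst (gauge_gen \<mu>) x) = f (\<mu> * z) x" for z x
  proof -
    have "(\<lambda>g. f z (gauge_gen \<mu> g)) = trim_gen vb eb (\<mu> * z)"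
    proof
      fix g :: "('v, 'e) graph_gen"
      show "f z (gauge_gen \<mu> g) = trim_gen vb eb (\<mu> * z) g"
        by (cases g) (simp_all add: subst_mult cst_mult mult.assoc)
    qed
    then show ?thesis by (simp add: subst_subst)
  qed
  have ga: "gauge_action E \<mu> a \<in> elems A" by (rule star_homD(1)[OF GA.star_hom_gauge[OF \<mu>] a a])
  show "F (gauge_action E \<mu> a) = rotation \<mu> (F a)"
  proof (rule GA1.A.T_eqI)
    show "F (gauge_action E \<mu> a) \<in> elems (tensor_C A1)" by (rule star_homD(1)[OF star_hom_F ga ga])
    show "rotation \<mu> (F a) \<in> elems (tensor_C A1)"
      by (intro GA1.A.T_rotation_closed \<mu> star_homD(1)[OF star_hom_F a a])
    show "F (gauge_action E \<mu> a) z = rotation \<mu> (F a) z" if z: "z \<in> circle" for z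
      using X X' \<mu> z circle_mult[OF \<mu> z] by (simp add: GA.gauge_cl F_cl eq GA1.A.rotation_apply)
  qed
qed

lemma p1_cl: "X \<in> GA.B.CS \<Longrightarrow> p1 (GA.cl X) = GA2.cl (\<lambda>n. subst E1.kill_gen (X n))"
  using E.kill_cl by (simp add: E2_eq)

lemma p2_cl: "X \<in> GA1.B.CS \<Longrightarrow> p2 (GA1.cl X) = GA2.cl (\<lambda>n. subst E1.kill_gen (X n))"
  using E1.kill_cl by simp

lemma star_hom_p1: "star_hom A A2 p1"
  using E.star_hom_kill by (simp add: E2_eq)

lemma star_hom_p2: "star_hom A1 A2 p2"
  using E1.star_hom_kill by simp

lemma U1_equivariant_p1: "U1_equivariant A (gauge_action E) (gauge_action E2) p1"
  using E.U1_equivariant_kill by (simp add: E2_eq)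

lemma p1_elems: "a \<in> elems A \<Longrightarrow> p1 a \<in> elems A2"
  and F_elems: "a \<in> elems A \<Longrightarrow> F a \<in> elems (tensor_C A1)"
  and p2_elems: "b \<in> elems A1 \<Longrightarrow> p2 b \<in> elems A2"
  using star_homD(1)[OF star_hom_p1] star_homD(1)[OF star_hom_F] star_homD(1)[OF star_hom_p2] by blast+

text \<open>Both composites are substitutions at each z, so they are compared on generators. The
  loop is erased at once on one path; on the other it becomes \<open>z P\<close>, which is erased
  next.\<close>

lemma square_commutes:
  assumes a: "a \<in> elems A"
  shows "gauge_coaction E2 (p1 a) = map_tensor_C p2 (F a)"
proof -
  obtain X where X: "X \<in> GA.B.CS" "a = GA.cl X" using GA.elems_cl[OF a] by blast
  have eq: "subst (gauge_gen z) (subst E1.kill_gen x) = subst E1.kill_gen (f z x)" for z x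
  proof -
    have "(\<lambda>g. subst (gauge_gen z) (E1.kill_gen g)) = (\<lambda>g. subst E1.kill_gen (trim_gen vb eb z g))"
    proof
      fix g :: "('v, 'e) graph_gen"
      have "Vx vb \<notin> graph_gens E2" "Ed eb \<notin> graph_gens E2"
        by (auto simp: E1.del_vert_simps)
      then show "subst (gauge_gen z) (E1.kill_gen g) = subst E1.kill_gen (trim_gen vb eb z g)"
        by (cases g) (auto simp: subst_mult)
    qed
    then show ?thesis by (simp only: subst_subst)
  qed
  have "(\<lambda>n. subst E1.kill_gen (X n)) \<in> GA2.B.CS"
    using relation_map.subst_CS[OF E.relation_map_kill X(1)] by (simp add: E2_eq)
  then show ?thesis
    unfolding GA2.gauge_coaction_eq[OF p1_elems[OF a]] map_tensor_C_def
    using relation_map.subst_CS[OF relation_map_trim X(1)] X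
    by (intro restrict_ext) (simp add: p1_cl p2_cl F_cl GA2.gauge_cl eq)
qed

text \<open>The isometry passes from polynomials to the completion. Replacing \<open>a\<close> by a
  polynomial costs their distance once in \<open>A\<close> and once, \<open>F\<close> being
  contractive, in the image, whence the factor 2.\<close>

lemma F_norm:
  assumes a: "a \<in> elems A"
  shows "cnorm A a \<le> cnorm (tensor_C A1) (F a)"
proof -
  interpret T: cstar_algebra "tensor_C A1" by (rule GA1.A.cstar_algebra_tensor)
  obtain X where X: "X \<in> GA.B.CS" "a = GA.cl X" using GA.elems_cl[OF a] by blast
  let ?x = "\<lambda>n. GA.B.const_cls (X n)"
  have x: "?x n \<in> elems A" for n
    using GA.B.const_cls_elems[OF GA.B.CS_free[OF X(1)]] by (simp add: graph_cstar_def)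
  have le: "cnorm A a \<le> cnorm (tensor_C A1) (F a) + 2 * cdist A a (?x n)" for n
  proof -
    have Xn: "X n \<in> free_star_alg (graph_gens E)" by (rule GA.B.CS_free[OF X(1)])
    have "cnorm A (?x n) = N (X n)"
      using GA.B.U_norm_const[OF Xn] by (simp add: graph_cstar_def graph_norm_def)
    also have "\<dots> \<le> rho (X n)" by (rule f_isometric)
    also have "\<dots> \<le> cnorm (tensor_C A1) (F (?x n))"
    proof (rule rho_least)
      fix z assume z: "z \<in> circle"
      have "f z (X n) \<in> free_star_alg (graph_gens E1)"
        by (rule relation_map.subst_in_free[OF relation_map_trim[OF z] Xn])
      then have "N1 (f z (X n)) = cnorm A1 (F (?x n) z)"
        using GA1.B.U_norm_const F_cl[OF GA.B.CS_const[OF Xn] z] by (simp add: graph_cstar_def graph_norm_def)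
      also have "\<dots> \<le> cnorm (tensor_C A1) (F (?x n))" by (intro GA1.A.T_norm_upper F_elems x z)
      finally show "N1 (f z (X n)) \<le> cnorm (tensor_C A1) (F (?x n))" .
    qed
    also have "\<dots> \<le> cdist (tensor_C A1) (F (?x n)) (F a) + cnorm (tensor_C A1) (F a)"
      by (intro T.norm_le_dist F_elems x a)
    also have "cdist (tensor_C A1) (F (?x n)) (F a) \<le> cdist A (?x n) a"
      by (intro star_hom_dist_le[OF GA.A.cstar_algebra_axioms T.cstar_algebra_axioms star_hom_F] x a)
    finally show ?thesis
      using GA.A.norm_le_dist[OF a x, of n] GA.A.dist_sym[OF a x, of n] by simp
  qed
  show ?thesis
  proof (rule tendsto_lowerbound[OF _ _ sequentially_bot])
    have "(\<lambda>n. cdist A a (?x n)) \<longlonglongrightarrow> 0"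
      using GA.B.U_dist_approx[OF X(1)] X(2) by (simp add: graph_cstar_def)
    from tendsto_add[OF tendsto_const tendsto_mult_right_zero[OF this]]
    show "(\<lambda>n. cnorm (tensor_C A1) (F a) + 2 * cdist A a (?x n)) \<longlonglongrightarrow> cnorm (tensor_C A1) (F a)" by simp
  qed (use le in auto)
qed

lemma F_dist:
  assumes "a \<in> elems A" "b \<in> elems A"
  shows "cdist A a b \<le> cdist (tensor_C A1) (F a) (F b)"
  using F_norm[of "cadd A a (cscale A (- 1) b)"] star_hom_diff[OF GA.A.cstar_algebra_axioms star_hom_F assms] assms
  by (simp add: cdist_def)

lemma F_approx:
  assumes a: "a \<in> elems A2" and b: "b \<in> elems (tensor_C A1)"
    and ab: "gauge_coaction E2 a = map_tensor_C p2 b" and e: "0 < e"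
  obtains x where "x \<in> elems A" "cdist (tensor_C A1) (F x) b < e"
proof -
  \<comment> \<open>Error budget: \<open>b\<close> is within 2d of \<open>h\<close> and
    \<open>a\<close> within d of \<open>x\<close>, so \<open>h - f x\<close> is below 3d modulo the
    ideal. Lifting costs d and returning to \<open>b\<close> another 2d, in total 6d, which is below
    \<open>e\<close>.\<close>
  define d where "d = e / 8"
  have d: "0 < d" using e by (simp add: d_def)
  obtain G where G: "G \<in> alg_tensor_C A1" "\<And>z. z \<in> circle \<Longrightarrow> cdist A1 (b z) (G z) < d"
    using GA1.A.T_approx[OF b d] by blast
  obtain h where h: "trig (graph_gens E1) h" "\<And>z. z \<in> circle \<Longrightarrow> cdist A1 (G z) (GA1.B.const_cls (h z)) < d"
    using GA1.B.trig_dense[OF _ d, of G] G(1) by (auto simp: graph_cstar_def)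
  have hf: "h z \<in> free_star_alg (graph_gens E1)" if "z \<in> circle" for z by (rule trig_free[OF h(1) that])
  have hz: "GA1.B.const_cls (h z) \<in> elems A1" if "z \<in> circle" for z
    using GA1.B.const_cls_elems[OF hf[OF that]] by (simp add: graph_cstar_def)
  have bh: "cdist A1 (b z) (GA1.B.const_cls (h z)) < 2 * d" if z: "z \<in> circle" for z
    using GA1.A.dist_tri[of "b z" "G z" "GA1.B.const_cls (h z)"] G h z b hz[OF z] by fastforce
  \<comment> \<open>This polynomial uses generators of \<open>E2\<close> alone; read in
    \<open>E\<close>, it is a lift of itself under \<open>p1\<close>.\<close>
  obtain x where x: "x \<in> free_star_alg (graph_gens E2)" "cdist A2 a (GA2.B.const_cls x) < d"
    using GA2.B.U_dense[OF _ d] a by (auto simp: graph_cstar_def)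
  have gens: "graph_gens E2 \<subseteq> graph_gens E" using E.graph_gens_del by (simp add: E2_eq)
  have xE: "x \<in> free_star_alg (graph_gens E)" using x(1) free_mono[OF gens] by blast
  have x2: "GA2.B.const_cls x \<in> elems A2"
    using GA2.B.const_cls_elems[OF x(1)] by (simp add: graph_cstar_def)
  have xA: "GA.B.const_cls x \<in> elems A"
    using GA.B.const_cls_elems[OF xE] by (simp add: graph_cstar_def)
  have p1x: "p1 (GA.B.const_cls x) = GA2.B.const_cls x"
    using p1_cl[OF GA.B.CS_const[OF xE]] cut_free[OF x(1)] by (simp add: cut_def)
  have p2_dist: "cdist A2 (p2 (GA1.B.const_cls u)) (p2 (GA1.B.const_cls w)) = N2 (u - w)"
    if "u \<in> free_star_alg (graph_gens E1)" "w \<in> free_star_alg (graph_gens E1)" for u w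
  proof -
    have "cdist A2 (p2 (GA1.B.const_cls u)) (p2 (GA1.B.const_cls w)) = N2 (subst E1.kill_gen (u - w))"
      using that GA2.B.const_cls_dist[OF relation_map.subst_in_free[OF E1.relation_map_kill] relation_map.subst_in_free[OF E1.relation_map_kill]]
      by (simp add: p2_cl GA1.B.CS_const graph_cstar_def graph_norm_def subst_diff)
    then show ?thesis using E1.norm_kill by simp
  qed
  have "N2 (h z - f z x) < 3 * d" if z: "z \<in> circle" for z
  proof -
    have fz: "f z x \<in> free_star_alg (graph_gens E1)"
      by (rule relation_map.subst_in_free[OF relation_map_trim[OF z] xE])
    have Fx: "F (GA.B.const_cls x) z = GA1.B.const_cls (f z x)" by (rule F_cl[OF GA.B.CS_const[OF xE] z])
    have "p2 (GA1.B.const_cls (f z x)) = gauge_coaction E2 (GA2.B.const_cls x) z"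
      using square_commutes[OF xA] z by (simp add: p1x map_tensor_C_def Fx)
    then have 1: "p2 (GA1.B.const_cls (f z x)) = gauge_action E2 z (GA2.B.const_cls x)"
      using z by (simp add: GA2.gauge_coaction_eq[OF x2])
    have 2: "p2 (b z) = gauge_action E2 z a"
      using fun_cong[OF ab, of z] z by (simp add: GA2.gauge_coaction_eq[OF a] map_tensor_C_def)
    have bz: "b z \<in> elems A1" using b z by simp
    have mem: "p2 (GA1.B.const_cls (h z)) \<in> elems A2" "p2 (b z) \<in> elems A2"
      "gauge_action E2 z (GA2.B.const_cls x) \<in> elems A2"
      using p2_elems hz[OF z] bz star_homD(1)[OF GA2.star_hom_gauge[OF z] x2 x2] by auto
    have "N2 (h z - f z x) = cdist A2 (p2 (GA1.B.const_cls (h z))) (gauge_action E2 z (GA2.B.const_cls x))"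
      using p2_dist[OF hf[OF z] fz] 1 by simp
    also have "\<dots> \<le> cdist A2 (p2 (GA1.B.const_cls (h z))) (p2 (b z))
        + cdist A2 (p2 (b z)) (gauge_action E2 z (GA2.B.const_cls x))"
      by (rule GA2.A.dist_tri[OF mem])
    also have "\<dots> \<le> cdist A1 (GA1.B.const_cls (h z)) (b z) + cdist A2 a (GA2.B.const_cls x)"
      unfolding 2
      using star_hom_dist_le[OF GA1.A.cstar_algebra_axioms GA2.A.cstar_algebra_axioms star_hom_p2 hz[OF z] bz]
        star_hom_dist_le[OF GA2.A.cstar_algebra_axioms GA2.A.cstar_algebra_axioms GA2.star_hom_gauge[OF z] a x2]
      by (simp add: 2)
    finally show ?thesis using bh[OF z] x(2) GA1.A.dist_sym[OF hz[OF z] bz] by simp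
  qed
  then obtain y where y: "y \<in> free_star_alg (graph_gens E)" "\<And>z. z \<in> circle \<Longrightarrow> N1 (h z - f z y) < 3 * d + d"
    using f_dense[OF h(1) xE d] by blast
  have yA: "GA.B.const_cls y \<in> elems A"
    using GA.B.const_cls_elems[OF y(1)] by (simp add: graph_cstar_def)
  have "cdist (tensor_C A1) (F (GA.B.const_cls y)) b \<le> 6 * d"
  proof (rule GA1.A.T_dist_least)
    fix z assume z: "z \<in> circle"
    have fz: "f z y \<in> free_star_alg (graph_gens E1)"
      by (rule relation_map.subst_in_free[OF relation_map_trim[OF z] y(1)])
    have fzA: "GA1.B.const_cls (f z y) \<in> elems A1"
      using GA1.B.const_cls_elems[OF fz] by (simp add: graph_cstar_def)
    have bz: "b z \<in> elems A1" using b z by simp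
    have Fy: "F (GA.B.const_cls y) z = GA1.B.const_cls (f z y)" by (rule F_cl[OF GA.B.CS_const[OF y(1)] z])
    have "cdist A1 (GA1.B.const_cls (h z)) (GA1.B.const_cls (f z y)) < 4 * d"
      using GA1.B.const_cls_dist[OF hf[OF z] fz] y(2)[OF z] by (simp add: graph_cstar_def graph_norm_def)
    then show "cdist A1 (F (GA.B.const_cls y) z) (b z) \<le> 6 * d"
      using GA1.A.dist_tri[OF fzA hz[OF z] bz] bh[OF z] GA1.A.dist_sym[OF fzA hz[OF z]]
        GA1.A.dist_sym[OF hz[OF z] bz] by (simp add: Fy)
  qed
  then have "cdist (tensor_C A1) (F (GA.B.const_cls y)) b < e" using d by (simp add: d_def)
  then show ?thesis using that yA by blast
qed

text \<open>As \<open>F\<close> is isometric, approximate preimages of \<open>b\<close> form a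
  Cauchy sequence, whose limit is an exact preimage.\<close>

lemma F_surjective:
  assumes a: "a \<in> elems A2" and b: "b \<in> elems (tensor_C A1)"
    and ab: "gauge_coaction E2 a = map_tensor_C p2 b"
  obtains x where "x \<in> elems A" "p1 x = a" "F x = b"
proof -
  interpret T: cstar_algebra "tensor_C A1" by (rule GA1.A.cstar_algebra_tensor)
  have "\<forall>n. \<exists>x. x \<in> elems A \<and> cdist (tensor_C A1) (F x) b < 1 / Suc n"
    using F_approx[OF a b ab] by (metis of_nat_0_less_iff zero_less_Suc zero_less_divide_1_iff)
  then obtain X where X: "\<And>n. X n \<in> elems A" "\<And>n. cdist (tensor_C A1) (F (X n)) b < 1 / Suc n" by metis
  have "\<forall>\<epsilon>>0. \<exists>M. \<forall>m\<ge>M. \<forall>n\<ge>M. cdist A (X m) (X n) < \<epsilon>"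
  proof (intro allI impI)
    fix e :: real assume "0 < e"
    then obtain M where M: "1 / Suc M < e/2" using nat_approx_posE[of "e/2"] by auto
    have "cdist A (X m) (X n) < e" if "m \<ge> M" "n \<ge> M" for m n
    proof -
      have "1 / Suc k < e/2" if "k \<ge> M" for k
        using that by (intro le_less_trans[OF _ M]) (simp add: frac_le)
      then have "cdist (tensor_C A1) (F (X m)) b < e/2" "cdist (tensor_C A1) (F (X n)) b < e/2"
        using X(2)[of m] X(2)[of n] that by (meson less_trans)+
      then show ?thesis
        using F_dist[OF X(1) X(1), of m n] T.dist_tri[OF F_elems[OF X(1)] b F_elems[OF X(1)], of m n]
          T.dist_sym[OF b F_elems[OF X(1)], of n] by simp
    qed
    then show "\<exists>M. \<forall>m\<ge>M. \<forall>n\<ge>M. cdist A (X m) (X n) < e" by blast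
  qed
  from GA.A.complete[OF X(1) this] obtain x where x: "x \<in> elems A" "(\<lambda>n. cdist A (X n) x) \<longlonglongrightarrow> 0"
    by blast
  have "F x = b"
  proof (rule T.lim_unique[OF F_elems[OF x(1)] b, of "\<lambda>n. F (X n)"])
    show "(\<lambda>n. cdist (tensor_C A1) (F (X n)) (F x)) \<longlonglongrightarrow> 0"
    proof (rule Lim_null_comparison[OF _ x(2)], rule always_eventually, rule allI)
      show "norm (cdist (tensor_C A1) (F (X n)) (F x)) \<le> cdist A (X n) x" for n
        using star_hom_dist_le[OF GA.A.cstar_algebra_axioms T.cstar_algebra_axioms star_hom_F X(1) x(1), of n]
          T.dist_nonneg[OF F_elems[OF X(1)] F_elems[OF x(1)], of n] by simp
    qed
    show "(\<lambda>n. cdist (tensor_C A1) (F (X n)) b) \<longlonglongrightarrow> 0"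
    proof (rule Lim_null_comparison[OF _ LIMSEQ_Suc[OF lim_1_over_n]], rule always_eventually, rule allI)
      show "norm (cdist (tensor_C A1) (F (X n)) b) \<le> 1 / of_nat (Suc n)" for n
        using X(2)[of n] T.dist_nonneg[OF F_elems[OF X(1)] b, of n] by simp
    qed
  qed (use F_elems X in auto)
  moreover have "p1 x = a"
  proof -
    \<comment> \<open>Evaluation at z = 1 recovers an element from its coaction, so
      \<open>F x = b\<close> already determines \<open>p1 x\<close>.\<close>
    have "gauge_coaction E2 (p1 x) 1 = gauge_coaction E2 a 1"
      using square_commutes[OF x(1)] \<open>F x = b\<close> ab by simp
    then show ?thesis
      by (simp add: GA2.gauge_coaction_eq p1_elems x a GA2.gauge_action_1)
  qed
  ultimately show ?thesis using that x(1) by blast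
qed

theorem pullback_iso:
  "star_iso A (cstar_pullback A2 (tensor_C A1) (gauge_coaction E2) (map_tensor_C p2)) (\<lambda>x. (p1 x, F x))"
  unfolding star_iso_def
proof
  show "star_hom A (cstar_pullback A2 (tensor_C A1) (gauge_coaction E2) (map_tensor_C p2)) (\<lambda>x. (p1 x, F x))"
    using star_hom_p1 star_hom_F square_commutes by (simp add: star_hom_def cstar_pullback_def)
  show "bij_betw (\<lambda>x. (p1 x, F x)) (elems A)
      (elems (cstar_pullback A2 (tensor_C A1) (gauge_coaction E2) (map_tensor_C p2)))"
    unfolding bij_betw_def
  proof
    interpret T: cstar_algebra "tensor_C A1" by (rule GA1.A.cstar_algebra_tensor)
    show "inj_on (\<lambda>x. (p1 x, F x)) (elems A)"
    proof (rule inj_onI)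
      fix x y assume xy: "x \<in> elems A" "y \<in> elems A" "(p1 x, F x) = (p1 y, F y)"
      then have "cdist A x y \<le> 0" using F_dist[OF xy(1,2)] T.dist_self[OF F_elems[OF xy(2)]] by simp
      then show "x = y" using GA.A.dist_nonneg[OF xy(1,2)] GA.A.dist_eq_0[OF xy(1,2)] by simp
    qed
    show "(\<lambda>x. (p1 x, F x)) ` elems A = elems (cstar_pullback A2 (tensor_C A1) (gauge_coaction E2) (map_tensor_C p2))"
    proof (intro equalityI subsetI)
      fix c assume "c \<in> (\<lambda>x. (p1 x, F x)) ` elems A"
      then show "c \<in> elems (cstar_pullback A2 (tensor_C A1) (gauge_coaction E2) (map_tensor_C p2))"
        using p1_elems F_elems square_commutes by (auto simp: cstar_pullback_def)
    next
      fix c assume "c \<in> elems (cstar_pullback A2 (tensor_C A1) (gauge_coaction E2) (map_tensor_C p2))"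
      then obtain a b where c: "c = (a, b)" "a \<in> elems A2" "b \<in> elems (tensor_C A1)"
        "gauge_coaction E2 a = map_tensor_C p2 b" by (auto simp: cstar_pullback_def)
      from F_surjective[OF c(2-4)] obtain x where "x \<in> elems A" "p1 x = a" "F x = b" .
      then show "c \<in> (\<lambda>x. (p1 x, F x)) ` elems A" using c(1) by auto
    qed
  qed
qed

end

theorem theorem2p4:
  fixes E E' E'' :: "('v, 'e) pre_digraph" and vb :: 'v and eb :: 'e
  assumes "trimmable E vb eb"
    and "E' = pre_digraph.del_arc E eb"
    and "E'' = pre_digraph.del_vert E' vb"
    and "\<pi>\<^sub>1 = kill_vertex E E'' vb"
    and "\<pi>\<^sub>2 = kill_vertex E' E'' vb"
    and "\<delta> = gauge_coaction E''"
    and "f = trim_map E E' vb eb"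
  shows
    "U1_cstar_algebra (graph_cstar E) (gauge_action E)
     \<and> U1_cstar_algebra (graph_cstar E'') (gauge_action E'')
     \<and> U1_cstar_algebra (tensor_C (graph_cstar E')) rotation
     \<and> U1_cstar_algebra (tensor_C (graph_cstar E'')) rotation

     \<and> star_hom (graph_cstar E) (graph_cstar E'') \<pi>\<^sub>1
     \<and> U1_equivariant (graph_cstar E) (gauge_action E) (gauge_action E'') \<pi>\<^sub>1
     \<and> star_hom (graph_cstar E) (tensor_C (graph_cstar E')) f
     \<and> U1_equivariant (graph_cstar E) (gauge_action E) rotation f
     \<and> star_hom (graph_cstar E'') (tensor_C (graph_cstar E'')) \<delta>
     \<and> U1_equivariant (graph_cstar E'') (gauge_action E'') rotation \<delta>
     \<and> star_hom (tensor_C (graph_cstar E')) (tensor_C (graph_cstar E'')) (map_tensor_C \<pi>\<^sub>2)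
     \<and> U1_equivariant (tensor_C (graph_cstar E')) rotation rotation (map_tensor_C \<pi>\<^sub>2)

     \<and> (\<forall>x\<in>elems (graph_cstar E). \<delta> (\<pi>\<^sub>1 x) = map_tensor_C \<pi>\<^sub>2 (f x))

     \<and> star_iso (graph_cstar E)
         (cstar_pullback (graph_cstar E'') (tensor_C (graph_cstar E')) \<delta> (map_tensor_C \<pi>\<^sub>2))
         (\<lambda>x. (\<pi>\<^sub>1 x, f x))
     \<and> U1_equivariant (graph_cstar E) (gauge_action E) (diag_action (gauge_action E'') rotation)
         (\<lambda>x. (\<pi>\<^sub>1 x, f x))"
proof -
  interpret T: trimmable_graph E vb eb by unfold_locales fact
  have "U1_equivariant T.A (gauge_action E) (diag_action (gauge_action T.E2) rotation) (\<lambda>x. (T.p1 x, T.F x))"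
    using T.U1_equivariant_p1 T.U1_equivariant_F by (simp add: U1_equivariant_def diag_action_def)
  then show ?thesis
    unfolding assms(2-7)
    by (intro conjI ballI T.GA.U1_cstar_algebra_graph T.GA2.U1_cstar_algebra_graph
        T.GA1.A.U1_cstar_algebra_tensor T.GA2.A.U1_cstar_algebra_tensor T.star_hom_p1 T.U1_equivariant_p1
        T.star_hom_F T.U1_equivariant_F T.GA2.star_hom_gauge_coaction T.GA2.U1_equivariant_gauge_coaction
        star_hom_map_tensor T.GA1.A.cstar_algebra_axioms T.GA2.A.cstar_algebra_axioms T.star_hom_p2
        U1_equivariant_map_tensor T.square_commutes T.pullback_iso)
qed

end
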